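(* Let $\mathfrak m=\mathfrak m(V,W,\beta)$ be a real extended translation algebra with $\dim V=2$ and let $\mathfrak g$ be its maximal transitive prolongation. Then one of the following three cases occurs: - If $\mathrm{sign}\,V=(2,0)$, then $N$ is an arbitrary positive integer, $\mathfrak m=\mathfrak n_N(\mathbb C)_{\mathbb R}$, and $\mathfrak g=\mathfrak c_N(\mathbb C)_{\mathbb R}$. - If $\mathrm{sign}\,V=(0,2)$, then $N$ is even, $\mathfrak m=\mathfrak n_{N/2}(\mathbb C)_{\mathbb R}$, and $\mathfrak g=\mathfrak c_{N/2}(\mathbb C)_{\mathbb R}$. - If $\mathrm{sign}\,V=(1,1)$, then $N$ is even, $\mathfrak m=\mathfrak n_{N/2}(\mathbb R)\oplus\mathfrak n_{N/2}(\mathbb R)$, and $\mathfrak g=\mathfrak c_{N/2}(\mathbb R)\oplus\mathfrak c_{N/2}(\mathbb R)$.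
   Context: Let $V\neq0$ be a finite-dimensional real vector space with a nondegenerate, possibly indefinite, symmetric bilinear form $(\cdot,\cdot)$; its signature $(p,q)$ means $p$ positive and $q$ negative directions. The Clifford algebra $C\!\ell(V)$ has product satisfying $vu+uv=-2(v,u)\mathbf 1$ for $v,u\in V$. Let $W\ne0$ be a finite-dimensional $C\!\ell(V)$-module, with action written $c\cdot s$. $N\ge1$ denotes the number of irreducible $C\!\ell(V)$-components of $W$, counted with multiplicity. The Lie algebra $\mathfrak{so}(V)$ acts on $V$ in the defining way and on $W$ by the spin representation, i.e. the endomorphism $w\mapsto (v,w)u-(u,w)v$ acts on $W$ as $\frac14(vu-uv)\in C\!\ell(V)$. Let $\beta$ be a nondegenerate bilinear form on $W$ such that: (B1) $\beta$ is $\mathfrak{so}(V)$-invariant; (B2) $\beta$ is symmetric (put $\epsilon=-1$) or skew-symmetric (put $\epsilon=1$); (B3) $\beta(v\cdot s,t)=\epsilon\beta(s,v\cdot t)$ for all $v\in V$, $s,t\in W$. The (real) extended translation algebra $\mathfrak m=\mathfrak m(V,W,\beta)$ is the graded Lie algebra $\mathfrak m=\mathfrak m_{-2}+\mathfrak m_{-1}$, $\mathfrak m_{-2}=V$, $\mathfrak m_{-1}=W$, whose only nonzero bracket $W\times W\to V$ is given by $([s,t],v)=\beta(v\cdot s,t)$. The maximal transitive prolongation of $\mathfrak m$ is the (unique) graded Lie algebra $\mathfrak g=\sum_{p\in\mathbb Z}\mathfrak g_p$ such that (1) each $\mathfrak g_p$ is finite-dimensional; (2) the negatively graded part of $\mathfrak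 g$ is $\mathfrak m$ ($\mathfrak g_p=\mathfrak m_p$ for $p=-1,-2$ and $\mathfrak g_p=0$ for $p<-2$); (3) for all $p\ge0$, $X\in\mathfrak g_p$ with $[X,\mathfrak g_{-1}]=0$ implies $X=0$; (4) $\mathfrak g$ is maximal: any graded Lie algebra $\mathfrak g'$ satisfying (1)-(3) admits an injective graded Lie algebra homomorphism $\mathfrak g'\to\mathfrak g$. For $\mathbb K=\mathbb R,\mathbb C$, $\mathfrak c_\ell(\mathbb K)$ denotes the infinite-dimensional contact algebra in dimension $2\ell+1$ over $\mathbb K$: the graded Lie algebra of polynomial vector fields on $\mathbb K^{2\ell+1}$ (coordinates $x_i,y_i,z$, $1\le i\le\ell$) preserving the contact distribution $\ker(dz-\sum_i y_i\,dx_i)$, graded by giving $x_i,y_i$ weight $1$, $z$ weight $2$, $\partial_{x_i},\partial_{y_i}$ weight $-1$ and $\partial_z$ weight $-2$. $\mathfrak n_\ell(\mathbb K)$ denotes its negatively graded part (the Heisenberg algebra of dimension $2\ell+1$, with one-dimensional degree $-2$ part). The subscript $\mathbb R$ on a complex Lie algebra denotes restriction of scalars to $\mathbb R$. Direct sums are direct sums of ideals and equality means isomorphism of graded real Lie algebras. "$N$ is an arbitrary positive integer" means that every positive integer occurs as a value of $N$. *)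

theory Defs
  imports "HOL-Analysis.Analysis" "HOL-Library.Function_Algebras"
begin

section \<open>Linear algebra on subspaces\<close>

text \<open>Real vector spaces are subspaces of an ambient type of class \<open>real_vector\<close>.
  The function spaces below (with pointwise operations) serve as ambient types.\<close>

instantiation "fun" :: (type, real_vector) real_vector
begin

definition scaleR_fun :: "real \<Rightarrow> ('a \<Rightarrow> 'b) \<Rightarrow> 'a \<Rightarrow> 'b"
  where "scaleR_fun r f = (\<lambda>x. r *\<^sub>R f x)"

instance
  by standard (auto simp: scaleR_fun_def plus_fun_def fun_eq_iff scaleR_add_right scaleR_add_left)

end

definition finite_dimensional :: "'a::real_vector set \<Rightarrow> bool"
  where "finite_dimensional S \<longleftrightarrow> (\<exists>B. finite B \<and> S = span B)"

definition linear_on :: "'a::real_vector set \<Rightarrow> ('a \<Rightarrow> 'b::real_vector) \<Rightarrow> bool"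
  where "linear_on S f \<longleftrightarrow>
    (\<forall>x\<in>S. \<forall>y\<in>S. f (x + y) = f x + f y) \<and> (\<forall>r. \<forall>x\<in>S. f (r *\<^sub>R x) = r *\<^sub>R f x)"

definition bilinear_on ::
    "'a::real_vector set \<Rightarrow> 'b::real_vector set \<Rightarrow> ('a \<Rightarrow> 'b \<Rightarrow> 'c::real_vector) \<Rightarrow> bool"
  where "bilinear_on S T f \<longleftrightarrow>
    (\<forall>x\<in>S. linear_on T (f x)) \<and> (\<forall>y\<in>T. linear_on S (\<lambda>x. f x y))"

definition internal_direct_sum :: "'i set \<Rightarrow> ('i \<Rightarrow> 'a::real_vector set) \<Rightarrow> 'a set \<Rightarrow> bool"
  where "internal_direct_sum I F S \<longleftrightarrow>
    subspace S \<and> (\<forall>i\<in>I. subspace (F i) \<and> F i \<subseteq> S) \<and>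
    (\<forall>x\<in>S. \<exists>!f. (\<forall>i\<in>I. f i \<in> F i) \<and> (\<forall>i. i \<notin> I \<longrightarrow> f i = 0) \<and>
       finite {i. f i \<noteq> 0} \<and> x = (\<Sum>i | f i \<noteq> 0. f i))"


section \<open>Graded real Lie algebras\<close>

record 'a graded_lie =
  lie_space :: "'a set"
  lie_bracket :: "'a \<Rightarrow> 'a \<Rightarrow> 'a"
  lie_grade :: "int \<Rightarrow> 'a set"

definition graded_lie_algebra :: "'a::real_vector graded_lie \<Rightarrow> bool"
  where "graded_lie_algebra L \<longleftrightarrow>
    subspace (lie_space L) \<and>
    (\<forall>x\<in>lie_space L. \<forall>y\<in>lie_space L. lie_bracket L x y \<in> lie_space L) \<and>
    bilinear_on (lie_space L) (lie_space L) (lie_bracket L) \<and>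
    (\<forall>x\<in>lie_space L. lie_bracket L x x = 0) \<and>
    (\<forall>x\<in>lie_space L. \<forall>y\<in>lie_space L. \<forall>z\<in>lie_space L.
       lie_bracket L x (lie_bracket L y z) + lie_bracket L y (lie_bracket L z x) +
       lie_bracket L z (lie_bracket L x y) = 0) \<and>
    internal_direct_sum UNIV (lie_grade L) (lie_space L) \<and>
    (\<forall>p q. \<forall>x\<in>lie_grade L p. \<forall>y\<in>lie_grade L q. lie_bracket L x y \<in> lie_grade L (p + q))"

definition graded_lie_hom ::
    "'a::real_vector graded_lie \<Rightarrow> 'b::real_vector graded_lie \<Rightarrow> ('a \<Rightarrow> 'b) \<Rightarrow> bool"
  where "graded_lie_hom L M \<phi> \<longleftrightarrow>
    \<phi> ` lie_space L \<subseteq> lie_space M \<and> linear_on (lie_space L) \<phi> \<and>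
    (\<forall>x\<in>lie_space L. \<forall>y\<in>lie_space L. \<phi> (lie_bracket L x y) = lie_bracket M (\<phi> x) (\<phi> y)) \<and>
    (\<forall>p. \<phi> ` lie_grade L p \<subseteq> lie_grade M p)"

definition graded_lie_isomorphic :: "'a::real_vector graded_lie \<Rightarrow> 'b::real_vector graded_lie \<Rightarrow> bool"
    (infix "\<cong>\<^sub>g\<^sub>r" 50)
  where "L \<cong>\<^sub>g\<^sub>r M \<longleftrightarrow>
    (\<exists>\<phi>. graded_lie_hom L M \<phi> \<and> bij_betw \<phi> (lie_space L) (lie_space M) \<and>
         (\<forall>p. \<phi> ` lie_grade L p = lie_grade M p))"

definition lie_direct_sum ::
    "'a::real_vector graded_lie \<Rightarrow> 'b::real_vector graded_lie \<Rightarrow> ('a \<times> 'b) graded_lie"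
    (infixr "\<oplus>\<^sub>g\<^sub>r" 65)
  where "L \<oplus>\<^sub>g\<^sub>r M = \<lparr>
    lie_space = lie_space L \<times> lie_space M,
    lie_bracket = (\<lambda>(x, y) (x', y'). (lie_bracket L x x', lie_bracket M y y')),
    lie_grade = (\<lambda>p. lie_grade L p \<times> lie_grade M p)\<rparr>"

definition negative_part :: "'a::real_vector graded_lie \<Rightarrow> 'a graded_lie"
  where "negative_part L = \<lparr>
    lie_space = span (\<Union>p\<in>{p. p < 0}. lie_grade L p),
    lie_bracket = lie_bracket L,
    lie_grade = (\<lambda>p. if p < 0 then lie_grade L p else {0})\<rparr>"


section \<open>Maximal transitive prolongations\<close>

definition transitive_prolongation ::
    "'m::real_vector graded_lie \<Rightarrow> 'g::real_vector graded_lie \<Rightarrow> bool"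
  where "transitive_prolongation m g \<longleftrightarrow>
    graded_lie_algebra g \<and>
    (\<forall>p. finite_dimensional (lie_grade g p)) \<and>
    negative_part g \<cong>\<^sub>g\<^sub>r m \<and>
    (\<forall>p\<ge>0. \<forall>X\<in>lie_grade g p. (\<forall>s\<in>lie_grade g (-1). lie_bracket g X s = 0) \<longrightarrow> X = 0)"

text \<open>A graded Lie algebra with finite-dimensional components has countable dimension, hence is
  isomorphic to one whose space is a subspace of \<open>nat \<Rightarrow> real\<close>. Letting \<open>g'\<close> range
  over graded Lie algebras of that type therefore covers all competitors.\<close>

definition maximal_transitive_prolongation ::
    "'m::real_vector graded_lie \<Rightarrow> 'g::real_vector graded_lie \<Rightarrow> bool"
  where "maximal_transitive_prolongation m g \<longleftrightarrow>
    transitive_prolongation m g \<and>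
    (\<forall>g' :: (nat \<Rightarrow> real) graded_lie. transitive_prolongation m g' \<longrightarrow>
       (\<exists>\<phi>. graded_lie_hom g' g \<phi> \<and> inj_on \<phi> (lie_space g')))"


section \<open>Quadratic spaces and Clifford modules\<close>

definition quadratic_space :: "'v::real_vector set \<Rightarrow> ('v \<Rightarrow> 'v \<Rightarrow> real) \<Rightarrow> bool"
  where "quadratic_space V b \<longleftrightarrow>
    subspace V \<and> finite_dimensional V \<and> V \<noteq> {0} \<and> bilinear_on V V b \<and>
    (\<forall>v\<in>V. \<forall>u\<in>V. b v u = b u v) \<and> (\<forall>v\<in>V. (\<forall>u\<in>V. b v u = 0) \<longrightarrow> v = 0)"

definition has_signature ::
    "'v::real_vector set \<Rightarrow> ('v \<Rightarrow> 'v \<Rightarrow> real) \<Rightarrow> nat \<Rightarrow> nat \<Rightarrow> bool"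
  where "has_signature V b p q \<longleftrightarrow>
    (\<exists>B. finite B \<and> independent B \<and> span B = V \<and>
         (\<forall>e\<in>B. \<forall>f\<in>B. e \<noteq> f \<longrightarrow> b e f = 0) \<and> (\<forall>e\<in>B. b e e \<noteq> 0) \<and>
         card {e \<in> B. b e e > 0} = p \<and> card {e \<in> B. b e e < 0} = q)"

text \<open>The Clifford algebra is the unital associative algebra generated by \<open>V\<close>, linearly in
  \<open>v \<in> V\<close>, subject to \<open>v u + u v = - 2 (v, u) 1\<close>. A module over it is thus given by
  the action \<open>c v\<close> of the generators, and its submodules are the subspaces stable under these.\<close>

definition clifford_module ::
    "'v::real_vector set \<Rightarrow> ('v \<Rightarrow> 'v \<Rightarrow> real) \<Rightarrow> 'w::real_vector set \<Rightarrow> ('v \<Rightarrow> 'w \<Rightarrow> 'w) \<Rightarrow> bool"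
  where "clifford_module V b W c \<longleftrightarrow>
    subspace W \<and> (\<forall>v\<in>V. \<forall>s\<in>W. c v s \<in> W) \<and> bilinear_on V W c \<and>
    (\<forall>v\<in>V. \<forall>u\<in>V. \<forall>s\<in>W. c v (c u s) + c u (c v s) = (- 2 * b v u) *\<^sub>R s)"

definition clifford_submodule ::
    "'v::real_vector set \<Rightarrow> ('v \<Rightarrow> 'w \<Rightarrow> 'w) \<Rightarrow> 'w set \<Rightarrow> 'w::real_vector set \<Rightarrow> bool"
  where "clifford_submodule V c W S \<longleftrightarrow>
    subspace S \<and> S \<subseteq> W \<and> (\<forall>v\<in>V. \<forall>s\<in>S. c v s \<in> S)"

definition irreducible_submodule ::
    "'v::real_vector set \<Rightarrow> ('v \<Rightarrow> 'w \<Rightarrow> 'w) \<Rightarrow> 'w set \<Rightarrow> 'w::real_vector set \<Rightarrow> bool"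
  where "irreducible_submodule V c W S \<longleftrightarrow>
    clifford_submodule V c W S \<and> S \<noteq> {0} \<and>
    (\<forall>T. clifford_submodule V c S T \<longrightarrow> T = {0} \<or> T = S)"

definition num_irreducible_components ::
    "'v::real_vector set \<Rightarrow> 'w::real_vector set \<Rightarrow> ('v \<Rightarrow> 'w \<Rightarrow> 'w) \<Rightarrow> nat"
  where "num_irreducible_components V W c =
    (THE n. \<exists>F. (\<forall>i<n. irreducible_submodule V c W (F i)) \<and> internal_direct_sum {..<n} F W)"

text \<open>The graph of the spin representation, as a set of pairs of an element of \<open>so(V)\<close> and
  the endomorphism by which it acts on \<open>W\<close>: the endomorphisms
  \<open>w \<mapsto> (v, w) u - (u, w) v\<close> span \<open>so(V)\<close>, so the graph is the span of the
  pairs given for them.\<close>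

definition spin_representation ::
    "'v::real_vector set \<Rightarrow> ('v \<Rightarrow> 'v \<Rightarrow> real) \<Rightarrow> ('v \<Rightarrow> 'w \<Rightarrow> 'w::real_vector)
      \<Rightarrow> (('v \<Rightarrow> 'v) \<times> ('w \<Rightarrow> 'w)) set"
  where "spin_representation V b c =
    span {(\<lambda>w. b v w *\<^sub>R u - b u w *\<^sub>R v, \<lambda>s. (1/4) *\<^sub>R (c v (c u s) - c u (c v s))) | v u.
      v \<in> V \<and> u \<in> V}"

definition admissible_form ::
    "'v::real_vector set \<Rightarrow> ('v \<Rightarrow> 'v \<Rightarrow> real) \<Rightarrow> 'w::real_vector set \<Rightarrow> ('v \<Rightarrow> 'w \<Rightarrow> 'w)
      \<Rightarrow> ('w \<Rightarrow> 'w \<Rightarrow> real) \<Rightarrow> bool"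
  where "admissible_form V b W c \<beta> \<longleftrightarrow>
    bilinear_on W W \<beta> \<and>
    (\<forall>s\<in>W. (\<forall>t\<in>W. \<beta> s t = 0) \<longrightarrow> s = 0) \<and>
    (\<forall>(A, T)\<in>spin_representation V b c. \<forall>s\<in>W. \<forall>t\<in>W. \<beta> (T s) t + \<beta> s (T t) = 0) \<and>
    (\<exists>\<epsilon>::real.
       ((\<forall>s\<in>W. \<forall>t\<in>W. \<beta> s t = \<beta> t s) \<and> \<epsilon> = -1 \<or>
        (\<forall>s\<in>W. \<forall>t\<in>W. \<beta> s t = - \<beta> t s) \<and> \<epsilon> = 1) \<and>
       (\<forall>v\<in>V. \<forall>s\<in>W. \<forall>t\<in>W. \<beta> (c v s) t = \<epsilon> * \<beta> s (c v t)))"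

definition extended_translation_data ::
    "'v::real_vector set \<Rightarrow> ('v \<Rightarrow> 'v \<Rightarrow> real) \<Rightarrow> 'w::real_vector set \<Rightarrow> ('v \<Rightarrow> 'w \<Rightarrow> 'w)
      \<Rightarrow> ('w \<Rightarrow> 'w \<Rightarrow> real) \<Rightarrow> bool"
  where "extended_translation_data V b W c \<beta> \<longleftrightarrow>
    quadratic_space V b \<and> clifford_module V b W c \<and> finite_dimensional W \<and> W \<noteq> {0} \<and>
    admissible_form V b W c \<beta>"

definition extended_translation_algebra ::
    "'v::real_vector set \<Rightarrow> ('v \<Rightarrow> 'v \<Rightarrow> real) \<Rightarrow> 'w::real_vector set \<Rightarrow> ('v \<Rightarrow> 'w \<Rightarrow> 'w)
      \<Rightarrow> ('w \<Rightarrow> 'w \<Rightarrow> real) \<Rightarrow> ('v \<times> 'w) graded_lie"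
  where "extended_translation_algebra V b W c \<beta> = \<lparr>
    lie_space = V \<times> W,
    lie_bracket = (\<lambda>(x, s) (y, t). (THE z. z \<in> V \<and> (\<forall>v\<in>V. b z v = \<beta> (c v s) t), 0)),
    lie_grade = (\<lambda>p. if p = -2 then V \<times> {0} else if p = -1 then {0} \<times> W else {0})\<rparr>"


section \<open>Contact algebras\<close>

text \<open>Points of the \<open>(2 l + 1)\<close>-dimensional space over \<open>'k\<close> have coordinates indexed by
  \<open>coords l\<close>. They are represented by functions on all of \<open>contact_coord\<close>; polynomials
  are polynomial functions depending only on the coordinates in \<open>coords l\<close>. For
  \<open>'k = complex\<close>, partial derivatives are complex derivatives, and the vector fields
  are regarded as a real vector space, i.e. the definitions below yield the restriction of scalars
  of the complex contact algebra.\<close>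

datatype contact_coord = CX nat | CY nat | CZ

definition coords :: "nat \<Rightarrow> contact_coord set"
  where "coords l = CX ` {1..l} \<union> CY ` {1..l} \<union> {CZ}"

fun weight :: "contact_coord \<Rightarrow> int"
  where "weight (CX i) = 1" | "weight (CY i) = 1" | "weight CZ = 2"

type_synonym 'k vfield = "contact_coord \<Rightarrow> (contact_coord \<Rightarrow> 'k) \<Rightarrow> 'k"
  \<comment> \<open>\<open>X a\<close> is the coefficient of \<open>X\<close> at the partial derivative along \<open>a\<close>\<close>

definition polynomials :: "nat \<Rightarrow> ((contact_coord \<Rightarrow> 'k::real_normed_field) \<Rightarrow> 'k) set"
  where "polynomials l = span {\<lambda>x. k * (\<Prod>a\<in>coords l. x a ^ e a) | k e. True}"

definition homogeneous_polynomials ::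
    "nat \<Rightarrow> int \<Rightarrow> ((contact_coord \<Rightarrow> 'k::real_normed_field) \<Rightarrow> 'k) set"
  where "homogeneous_polynomials l w =
    span {\<lambda>x. k * (\<Prod>a\<in>coords l. x a ^ e a) | k e. (\<Sum>a\<in>coords l. weight a * int (e a)) = w}"

definition partial_deriv ::
    "contact_coord \<Rightarrow> ((contact_coord \<Rightarrow> 'k::real_normed_field) \<Rightarrow> 'k) \<Rightarrow> (contact_coord \<Rightarrow> 'k) \<Rightarrow> 'k"
  where "partial_deriv a f x = deriv (\<lambda>t. f (x(a := t))) (x a)"

definition polynomial_vfields :: "nat \<Rightarrow> 'k::real_normed_field vfield set"
  where "polynomial_vfields l =
    {X. (\<forall>a\<in>coords l. X a \<in> polynomials l) \<and> (\<forall>a. a \<notin> coords l \<longrightarrow> X a = 0)}"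

definition vfield_bracket ::
    "nat \<Rightarrow> 'k::real_normed_field vfield \<Rightarrow> 'k vfield \<Rightarrow> 'k vfield"
  where "vfield_bracket l X Y = (\<lambda>a x.
    \<Sum>c\<in>coords l. X c x * partial_deriv c (Y a) x - Y c x * partial_deriv c (X a) x)"

text \<open>The contraction of a vector field with the form \<open>dz - (\<Sum>i. y_i dx_i)\<close>.\<close>

definition contact_form :: "nat \<Rightarrow> 'k::real_normed_field vfield \<Rightarrow> (contact_coord \<Rightarrow> 'k) \<Rightarrow> 'k"
  where "contact_form l X = (\<lambda>x. X CZ x - (\<Sum>i=1..l. x (CY i) * X (CX i) x))"

text \<open>A vector field preserves the contact distribution if its bracket with every section of the
  distribution is again a section; polynomial sections suffice, as the distribution is spanned by
  polynomial ones.\<close>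

definition contact_vfields :: "nat \<Rightarrow> 'k::real_normed_field vfield set"
  where "contact_vfields l = {X \<in> polynomial_vfields l.
    \<forall>Y\<in>polynomial_vfields l. contact_form l Y = 0 \<longrightarrow> contact_form l (vfield_bracket l X Y) = 0}"

definition contact_algebra :: "nat \<Rightarrow> 'k::real_normed_field vfield graded_lie"
  where "contact_algebra l = \<lparr>
    lie_space = contact_vfields l,
    lie_bracket = vfield_bracket l,
    lie_grade = (\<lambda>p. {X \<in> contact_vfields l.
      \<forall>a\<in>coords l. X a \<in> homogeneous_polynomials l (p + weight a)})\<rparr>"

definition heisenberg_algebra :: "nat \<Rightarrow> 'k::real_normed_field vfield graded_lie"
  where "heisenberg_algebra l = negative_part (contact_algebra l)"

end

theory Submission
  imports Defs
begin

text \<open>What singles out planes is that the even part of their Clifford algebra is commutative. It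
  is spanned by \<open>1\<close> and the volume element \<open>J = e1 e2\<close>, whose square is \<open>-1\<close> if \<open>V\<close> is definite and
  \<open>1\<close> if it is Lorentzian, so \<open>W\<close> is a module over \<open>K = \<complex>\<close> or \<open>K = \<real> + \<real>\<close>. Moreover
  \<open>\<beta> (J s) t = - \<beta> s (J t)\<close> and \<open>J\<close> anticommutes with \<open>V\<close>; hence, for a suitable identification of
  \<open>V\<close> with \<open>K\<close>, the bracket \<open>W \<times> W \<rightarrow> V\<close> is a nondegenerate skew-symmetric \<open>K\<close>-bilinear form
  (\<open>m_definite\<close>, \<open>m_lorentzian\<close>). A symplectic basis identifies the translation algebra with the
  Heisenberg algebra over \<open>K\<close> (\<open>heisenberg_model_isomorphic\<close>). In the Lorentzian case this is a sum
  of two real Heisenberg algebras, one for each eigenspace of \<open>J\<close>, and they have the same dimension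
  because \<open>e1\<close> interchanges the eigenspaces.

  The prolongation is found by a characterization of the contact algebras among all transitive
  algebras with the same negative part. Call a graded Lie algebra full if it is transitive from
  degree \<open>-1\<close> on and every derivation of degree \<open>p \<ge> 0\<close> from its negative part into it is inner. A
  transitive algebra \<open>g\<close> embeds into any full \<open>L\<close> with the same negative part, degree by degree: the
  image of \<open>X\<close> has to act on degree \<open>-1\<close> in the way dictated by the brackets of \<open>X\<close>, and this
  prescription is a derivation of the negative part of \<open>L\<close>, hence induced by exactly one element. If
  \<open>g\<close> is maximal then \<open>L\<close> embeds into \<open>g\<close> as well, and comparing dimensions in each degree gives
  \<open>g \<cong> L\<close> (\<open>full_prolongation_unique\<close>).

  That the contact algebra is full is a statement about polynomials. A contact field \<open>X\<close> is
  determined by its generating function \<open>f = \<theta>(X)\<close>, where \<open>\<theta>\<close> is the contact form, and \<open>f\<close> is an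
  arbitrary polynomial. The negative part is spanned over the scalars by fields \<open>Z\<close> that preserve
  \<open>\<theta>\<close> itself, so \<open>\<theta>([X, Z]) = - Z f\<close>: to find an inner derivation is to find a polynomial with
  prescribed partial derivatives. The derivation property makes the prescribed one-form closed, and
  Euler's formula for weighted homogeneous polynomials integrates it (\<open>homogeneous_poincare\<close>). For
  this the derivation has to be linear over the scalars. Over \<open>\<complex>\<close> this is automatic: the defect
  \<open>E s = D (\<i> s) - \<i> D s\<close> satisfies \<open>[E s, t] = [s, E t]\<close> and \<open>E (\<i> s) = - \<i> E s\<close>, and these are
  compatible only if \<open>E = 0\<close>. Likewise a derivation of a direct sum has no mixed components
  (\<open>full_prolongation_direct_sum\<close>).

  The number \<open>N\<close> enters through dimensions. In signature \<open>(2, 0)\<close> the Clifford algebra is the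
  algebra of quaternions and irreducible modules have dimension \<open>4\<close>; in the other signatures it is
  the algebra of real \<open>2 \<times> 2\<close> matrices and they have dimension \<open>2\<close>. Comparing \<open>dim W = 4 N\<close> or
  \<open>dim W = 2 N\<close> with the dimension of a Heisenberg algebra over \<open>K\<close> gives its rank, and the parity
  of \<open>N\<close>. Sums of \<open>n\<close> copies of the quaternions with the standard inner product realize every \<open>n\<close>.\<close>

section \<open>Linear maps and dimensions of subspaces\<close>

lemma linear_onD:
  assumes "linear_on S f"
  shows linear_on_add: "\<And>x y. x \<in> S \<Longrightarrow> y \<in> S \<Longrightarrow> f (x + y) = f x + f y"
    and linear_on_scale: "\<And>r x. x \<in> S \<Longrightarrow> f (r *\<^sub>R x) = r *\<^sub>R f x"
  using assms by (auto simp: linear_on_def)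

lemma linear_on_0: "linear_on S f \<Longrightarrow> subspace S \<Longrightarrow> f 0 = 0"
  using linear_on_scale[of S f 0 0] by (simp add: subspace_0)

lemma linear_on_neg: "linear_on S f \<Longrightarrow> x \<in> S \<Longrightarrow> f (- x) = - f x"
  using linear_on_scale[of S f x "-1"] by simp

lemma linear_on_diff:
  "linear_on S f \<Longrightarrow> subspace S \<Longrightarrow> x \<in> S \<Longrightarrow> y \<in> S \<Longrightarrow> f (x - y) = f x - f y"
  using linear_on_add[of S f x "- y"] linear_on_neg[of S f y] by (simp add: subspace_neg)

lemma linear_on_sum:
  assumes "linear_on S f" "subspace S" "\<And>i. i \<in> A \<Longrightarrow> g i \<in> S"
  shows "f (\<Sum>i\<in>A. g i) = (\<Sum>i\<in>A. f (g i))"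
proof (cases "finite A")
  case True
  then show ?thesis using assms(3)
  proof (induction rule: finite_induct)
    case empty then show ?case using assms by (simp add: linear_on_0)
  next
    case (insert a A)
    then show ?case using assms(1,2) by (simp add: linear_on_add subspace_sum)
  qed
qed (use assms in \<open>simp add: linear_on_0\<close>)

lemma linear_on_subset: "linear_on S f \<Longrightarrow> T \<subseteq> S \<Longrightarrow> linear_on T f"
  unfolding linear_on_def by blast

lemma subspace_linear_on_image:
  assumes "subspace S" "linear_on S f" shows "subspace (f ` S)"
  unfolding subspace_def
proof (intro conjI ballI allI)
  show "0 \<in> f ` S" using assms by (metis imageI linear_on_0 subspace_0)
  fix x assume "x \<in> f ` S"
  then show "y \<in> f ` S \<Longrightarrow> x + y \<in> f ` S" and "r *\<^sub>R x \<in> f ` S" for y r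
    using assms by (auto simp flip: linear_on_add linear_on_scale
        intro!: imageI simp: subspace_add subspace_scale)
qed

lemma subspace_linear_on_eq:
  assumes "subspace S" "linear_on S f" "linear_on S g"
  shows "subspace {x \<in> S. f x = g x}"
  using assms by (auto simp: subspace_def linear_on_0 linear_on_add linear_on_scale)

lemma linear_on_eq_on_span:
  assumes "subspace S" "linear_on S f" "linear_on S g" "B \<subseteq> S"
    "\<And>x. x \<in> B \<Longrightarrow> f x = g x" "x \<in> span B"
  shows "f x = g x"
proof -
  have "span B \<subseteq> {x \<in> S. f x = g x}"
    using assms by (intro span_minimal subspace_linear_on_eq) auto
  then show ?thesis using assms(6) by auto
qed

lemma linear_on_inj_onI:
  assumes "linear_on S f" "subspace S" "\<And>x. x \<in> S \<Longrightarrow> f x = 0 \<Longrightarrow> x = 0"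
  shows "inj_on f S"
proof (rule inj_onI)
  fix x y assume "x \<in> S" "y \<in> S" "f x = f y"
  then have "f (x - y) = 0" "x - y \<in> S"
    using assms(1,2) by (simp_all add: linear_on_diff subspace_diff)
  then have "x - y = 0" by (rule assms(3)[rotated])
  then show "x = y" by simp
qed

text \<open>Reduces maps that are linear only on a subspace to linear maps on the whole type, for which
  images of spans and of independent sets are understood.\<close>

lemma linear_on_extend:
  assumes "subspace S" "linear_on S f"
  obtains h where "linear h" "\<And>x. x \<in> S \<Longrightarrow> h x = f x"
proof -
  obtain B where B: "B \<subseteq> S" "independent B" "S \<subseteq> span B"
    using maximal_independent_subset by blast
  obtain h where h: "linear h" "\<And>x. x \<in> B \<Longrightarrow> h x = f x"
    using linear_independent_extend[OF B(2), of f] by blast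
  have "h x = f x" if "x \<in> S" for x
  proof (rule linear_on_eq_on_span[OF assms(1) _ assms(2) B(1) h(2)])
    show "linear_on S h" using h(1) by (auto simp: linear_on_def linear_add linear_scale)
  qed (use that B in auto)
  with h(1) show ?thesis using that by blast
qed

lemma linear_on_comp:
  "linear_on S f \<Longrightarrow> f ` S \<subseteq> T \<Longrightarrow> linear_on T g \<Longrightarrow> linear_on S (\<lambda>x. g (f x))"
  by (auto simp: linear_on_def image_subset_iff)

lemma linear_on_inv_into:
  assumes "subspace S" "linear_on S f" "inj_on f S"
  shows "linear_on (f ` S) (inv_into S f)"
  unfolding linear_on_def
proof (intro conjI ballI allI)
  fix x assume x: "x \<in> f ` S"
  then obtain a where a: "a \<in> S" "x = f a" by blast
  {
    fix y assume "y \<in> f ` S"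
    then obtain b where b: "b \<in> S" "y = f b" by blast
    have "inv_into S f (f (a + b)) = a + b"
      using a b assms by (intro inv_into_f_f) (auto simp: subspace_add)
    then show "inv_into S f (x + y) = inv_into S f x + inv_into S f y"
      using a b assms by (simp add: linear_on_add)
  }
  fix r
  have "inv_into S f (f (r *\<^sub>R a)) = r *\<^sub>R a"
    using a assms by (intro inv_into_f_f) (auto simp: subspace_scale)
  then show "inv_into S f (r *\<^sub>R x) = r *\<^sub>R inv_into S f x"
    using a assms by (simp add: linear_on_scale)
qed

lemma finite_dimensional_basis:
  assumes "finite_dimensional S"
  obtains B where "finite B" "independent B" "span B = S" "card B = dim S"
proof -
  obtain A where A: "finite A" "S = span A" using assms by (auto simp: finite_dimensional_def)
  obtain B where B: "B \<subseteq> A" "independent B" "A \<subseteq> span B"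
    using maximal_independent_subset by blast
  have "span B = S" using A B by (metis span_mono span_span subset_antisym)
  moreover have "finite B" using A B finite_subset by blast
  ultimately show ?thesis using that B dim_eq_card_independent by (metis dim_span)
qed

lemma finite_dimensional_subspace: "finite_dimensional S \<Longrightarrow> subspace S"
  by (auto simp: finite_dimensional_def)

text \<open>The ambient types are infinite-dimensional, so the dimension theory of Euclidean spaces does
  not apply; the exchange lemma does.\<close>

lemma finite_dimensional_subset:
  assumes "finite_dimensional T" "subspace S" "S \<subseteq> T"
  shows finite_dimensional_mono: "finite_dimensional S"
    and dim_mono_on: "dim S \<le> dim T"
    and subspace_dim_eq: "dim S = dim T \<Longrightarrow> S = T"
proof -
  obtain A where A: "finite A" "independent A" "span A = T" "card A = dim T"
    using finite_dimensional_basis assms(1) by blast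
  obtain B where B: "B \<subseteq> S" "independent B" "S \<subseteq> span B" "card B = dim S"
    by (rule basis_exists)
  have sp: "span B = S" using B assms(2) by (metis span_minimal subset_antisym)
  have BA: "B \<subseteq> span A" using B A assms by blast
  have fin: "finite B" "card B \<le> card A" using independent_span_bound[OF A(1) B(2) BA] by auto
  show "finite_dimensional S" using sp fin by (auto simp: finite_dimensional_def)
  show "dim S \<le> dim T" using fin B A by simp
  assume eq: "dim S = dim T"
  have "A \<subseteq> span B"
  proof (rule ccontr)
    assume "\<not> A \<subseteq> span B"
    then obtain a where a: "a \<in> A" "a \<notin> span B" by blast
    then have ind: "independent (insert a B)" "a \<notin> B"
      using B(2) by (auto simp: independent_insert span_base)
    have "card (insert a B) \<le> card A"
      using independent_span_bound[OF A(1) ind(1)] BA a span_base by blast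
    then show False using ind(2) fin(1) A B eq by simp
  qed
  then have "T \<subseteq> S" using sp A span_minimal[of A S] assms(2) by auto
  then show "S = T" using assms(3) by auto
qed

lemma finite_dimensional_image_inj:
  assumes "finite_dimensional S" "linear_on S f" "inj_on f S"
  shows finite_dimensional_linear_image: "finite_dimensional (f ` S)"
    and dim_linear_image: "dim (f ` S) = dim S"
proof -
  obtain B where B: "finite B" "independent B" "span B = S" "card B = dim S"
    using finite_dimensional_basis assms(1) by blast
  obtain h where h: "linear h" "\<And>x. x \<in> S \<Longrightarrow> h x = f x"
    using linear_on_extend assms finite_dimensional_subspace by blast
  have im: "f ` S = span (h ` B)"
    using h B by (metis image_cong linear_span_image)
  have "inj_on h (span B)" using assms(3) h(2) B(3) by (simp add: inj_on_def)
  then have "independent (h ` B)"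
    using linear_independent_injective_image[OF h(1) B(2)] by blast
  moreover have "card (h ` B) = card B"
    using \<open>inj_on h (span B)\<close> by (meson card_image inj_on_subset span_superset)
  ultimately show "dim (f ` S) = dim S" using im B by (simp add: dim_eq_card_independent)
  show "finite_dimensional (f ` S)" using im B by (auto simp: finite_dimensional_def)
qed

lemma independent_Un_span:
  assumes "finite B" "independent A" "independent B" "span A \<inter> span B = {0}"
  shows "independent (A \<union> B)"
  using assms(1,3,4)
proof (induction B rule: finite_induct)
  case empty then show ?case using assms by simp
next
  case (insert b B)
  have iB: "independent B" "b \<notin> span B"
    using insert by (auto simp: independent_insert)
  have "span A \<inter> span B = {0}"
    using insert.prems(2) span_mono[of B "insert b B"] span_0 by blast
  then have IH: "independent (A \<union> B)" using insert iB by blast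
  have "b \<notin> span (A \<union> B)"
  proof
    assume "b \<in> span (A \<union> B)"
    then obtain x y where xy: "b = x + y" "x \<in> span A" "y \<in> span B"
      by (auto simp: span_Un)
    then have "x = b - y" by simp
    moreover have "y \<in> span (insert b B)"
      using xy(3) span_mono[of B "insert b B"] by blast
    ultimately have "x \<in> span (insert b B)"
      by (simp add: span_base span_diff)
    then have "x = 0" using xy insert.prems by blast
    then show False using xy iB by simp
  qed
  moreover from this have "b \<notin> A \<union> B" by (meson span_base)
  ultimately show ?case using IH by (simp add: independent_insert)
qed

lemma dim_direct_plus:
  assumes "finite_dimensional S" "finite_dimensional T" "S \<inter> T = {0}"
  shows finite_dimensional_plus: "finite_dimensional {x + y |x y. x \<in> S \<and> y \<in> T}"
    and dim_plus: "dim {x + y |x y. x \<in> S \<and> y \<in> T} = dim S + dim T"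
proof -
  obtain A where A: "finite A" "independent A" "span A = S" "card A = dim S"
    using finite_dimensional_basis assms(1) by blast
  obtain B where B: "finite B" "independent B" "span B = T" "card B = dim T"
    using finite_dimensional_basis assms(2) by blast
  have sp: "{x + y |x y. x \<in> S \<and> y \<in> T} = span (A \<union> B)"
    using A B by (auto simp: span_Un)
  have "A \<inter> B = {}"
    using assms A B dependent_zero span_base by (metis Int_emptyI Int_iff singletonD)
  then have "card (A \<union> B) = dim S + dim T" using A B by (simp add: card_Un_disjoint)
  moreover have "independent (A \<union> B)" using independent_Un_span A B assms by blast
  ultimately show "dim {x + y |x y. x \<in> S \<and> y \<in> T} = dim S + dim T"
    using sp by (simp add: dim_eq_card_independent)
  show "finite_dimensional {x + y |x y. x \<in> S \<and> y \<in> T}"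
    using sp A B by (auto simp: finite_dimensional_def)
qed

section \<open>Internal direct sums\<close>

lemma span_Union_subspaces:
  assumes "\<And>i. i \<in> I \<Longrightarrow> subspace (F i)" "x \<in> span (\<Union>i\<in>I. F i)"
  shows "\<exists>f. (\<forall>i\<in>I. f i \<in> F i) \<and> (\<forall>i. i \<notin> I \<longrightarrow> f i = 0) \<and>
       finite {i. f i \<noteq> 0} \<and> x = (\<Sum>i | f i \<noteq> 0. f i)"
proof -
  let ?R = "\<lambda>x f. (\<forall>i\<in>I. f i \<in> F i) \<and> (\<forall>i. i \<notin> I \<longrightarrow> f i = 0) \<and>
       finite {i. f i \<noteq> 0} \<and> x = (\<Sum>i | f i \<noteq> 0. f i)"
  have "span (\<Union>i\<in>I. F i) \<subseteq> {x. \<exists>f. ?R x f}"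
  proof (rule span_minimal)
    show "(\<Union>i\<in>I. F i) \<subseteq> {x. \<exists>f. ?R x f}"
    proof safe
      fix i x assume ix: "i \<in> I" "x \<in> F i"
      let ?f = "\<lambda>j. if j = i then x else 0"
      have "{j. ?f j \<noteq> 0} \<subseteq> {i}" by auto
      then have "(\<Sum>j | ?f j \<noteq> 0. ?f j) = (\<Sum>j\<in>{i}. ?f j)"
        by (intro sum.mono_neutral_left) auto
      moreover have "finite {j. ?f j \<noteq> 0}" using \<open>_ \<subseteq> {i}\<close> finite_subset by blast
      ultimately show "\<exists>f. ?R x f" using ix assms(1) by (intro exI[of _ ?f]) (auto simp: subspace_0)
    qed
    show "subspace {x. \<exists>f. ?R x f}"
      unfolding subspace_def
    proof (intro conjI ballI allI)
      show "0 \<in> {x. \<exists>f. ?R x f}"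
        using assms(1) by (auto intro!: exI[of _ "\<lambda>_. 0"] simp: subspace_0)
      fix x assume "x \<in> {x. \<exists>f. ?R x f}"
      then obtain f where f: "?R x f" by blast
      {
        fix y assume "y \<in> {x. \<exists>f. ?R x f}"
        then obtain g where g: "?R y g" by blast
        let ?U = "{i. f i \<noteq> 0} \<union> {i. g i \<noteq> 0}"
        have "(\<Sum>i | f i \<noteq> 0. f i) = (\<Sum>i\<in>?U. f i)" "(\<Sum>i | g i \<noteq> 0. g i) = (\<Sum>i\<in>?U. g i)"
          using f g by (auto intro!: sum.mono_neutral_left)
        moreover have "(\<Sum>i | f i + g i \<noteq> 0. f i + g i) = (\<Sum>i\<in>?U. f i + g i)"
          using f g by (intro sum.mono_neutral_left) auto
        moreover have "finite {i. f i + g i \<noteq> 0}"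
          using f g by (auto intro: finite_subset[of _ ?U])
        ultimately have "?R (x + y) (\<lambda>i. f i + g i)"
          using f g assms(1) by (auto simp: subspace_add sum.distrib)
        then show "x + y \<in> {x. \<exists>f. ?R x f}"
          unfolding mem_Collect_eq by (rule exI[of _ "\<lambda>i. f i + g i"])
      }
      fix r
      have "(\<Sum>i | r *\<^sub>R f i \<noteq> 0. r *\<^sub>R f i) = (\<Sum>i | f i \<noteq> 0. r *\<^sub>R f i)"
        using f by (intro sum.mono_neutral_left) auto
      moreover have "finite {i. r *\<^sub>R f i \<noteq> 0}"
        using f by (auto intro: finite_subset[of _ "{i. f i \<noteq> 0}"])
      ultimately have "?R (r *\<^sub>R x) (\<lambda>i. r *\<^sub>R f i)"
        using f assms(1) by (auto simp: subspace_scale scaleR_sum_right)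
      then show "r *\<^sub>R x \<in> {x. \<exists>f. ?R x f}"
        unfolding mem_Collect_eq by (rule exI[of _ "\<lambda>i. r *\<^sub>R f i"])
    qed
  qed
  with assms(2) show ?thesis by blast
qed

definition decomposes :: "'i set \<Rightarrow> ('i \<Rightarrow> 'a::real_vector set) \<Rightarrow> 'a \<Rightarrow> ('i \<Rightarrow> 'a) \<Rightarrow> bool" where
  "decomposes I F x f \<longleftrightarrow> (\<forall>i\<in>I. f i \<in> F i) \<and> (\<forall>i. i \<notin> I \<longrightarrow> f i = 0) \<and>
       finite {i. f i \<noteq> 0} \<and> x = (\<Sum>i | f i \<noteq> 0. f i)"

lemma internal_direct_sum_decomposes:
  "internal_direct_sum I F S \<longleftrightarrow> subspace S \<and> (\<forall>i\<in>I. subspace (F i) \<and> F i \<subseteq> S) \<and>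
     (\<forall>x\<in>S. \<exists>!f. decomposes I F x f)"
  by (simp add: internal_direct_sum_def decomposes_def)

text \<open>Spanning and independence are easier to check, and to transport along linear maps, than the
  unique existence of decompositions.\<close>

lemma internal_direct_sum_iff:
  "internal_direct_sum I F S \<longleftrightarrow>
     subspace S \<and> (\<forall>i\<in>I. subspace (F i) \<and> F i \<subseteq> S) \<and> S \<subseteq> span (\<Union>i\<in>I. F i) \<and>
     (\<forall>A f. finite A \<longrightarrow> A \<subseteq> I \<longrightarrow> (\<forall>i\<in>A. f i \<in> F i) \<longrightarrow> sum f A = 0 \<longrightarrow> (\<forall>i\<in>A. f i = 0))"
    (is "?L \<longleftrightarrow> ?R")
proof
  assume L: ?L
  then have s: "subspace S" "\<forall>i\<in>I. subspace (F i) \<and> F i \<subseteq> S"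
    and u: "\<And>x. x \<in> S \<Longrightarrow> \<exists>!f. decomposes I F x f"
    by (auto simp: internal_direct_sum_decomposes)
  have "S \<subseteq> span (\<Union>i\<in>I. F i)"
  proof
    fix x assume "x \<in> S"
    then obtain f where f: "decomposes I F x f" using u by blast
    then have "f i \<in> (\<Union>i\<in>I. F i)" if "f i \<noteq> 0" for i
      using that unfolding decomposes_def by blast
    then have "(\<Sum>i | f i \<noteq> 0. f i) \<in> span (\<Union>i\<in>I. F i)"
      by (intro span_sum span_base) simp
    then show "x \<in> span (\<Union>i\<in>I. F i)" using f by (simp add: decomposes_def)
  qed
  moreover have "\<forall>i\<in>A. f i = 0"
    if A: "finite A" "A \<subseteq> I" "\<forall>i\<in>A. f i \<in> F i" "sum f A = 0" for A f
  proof -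
    let ?f = "\<lambda>i. if i \<in> A then f i else 0"
    have "(\<Sum>i | ?f i \<noteq> 0. ?f i) = sum f A"
      using A by (intro sum.mono_neutral_cong_left) auto
    moreover have "finite {i. ?f i \<noteq> 0}" using A by (auto intro: finite_subset)
    ultimately have 1: "decomposes I F 0 ?f"
      using A s by (auto simp: subspace_0 decomposes_def)
    have 2: "decomposes I F 0 (\<lambda>_. 0)"
      using s by (auto simp: subspace_0 decomposes_def)
    have "0 \<in> S" using s subspace_0 by blast
    from u[OF this] obtain g where g: "\<And>f. decomposes I F 0 f \<Longrightarrow> f = g" by (elim ex1E) blast
    have "?f = (\<lambda>_. 0)" using g[OF 1] g[OF 2] by simp
    then show ?thesis by meson
  qed
  ultimately show ?R using s by blast
next
  assume R: ?R
  then have ind: "\<And>A f i. finite A \<Longrightarrow> A \<subseteq> I \<Longrightarrow> (\<And>i. i \<in> A \<Longrightarrow> f i \<in> F i) \<Longrightarrow> sum f A = 0 \<Longrightarrow> i \<in> A \<Longrightarrow> f i = 0"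
    by auto
  have "\<exists>!f. decomposes I F x f" if x: "x \<in> S" for x
  proof (rule ex_ex1I)
    show "\<exists>f. decomposes I F x f"
      unfolding decomposes_def using R x by (intro span_Union_subspaces) auto
    fix f g
    assume "decomposes I F x f" "decomposes I F x g"
    then have f: "(\<forall>i\<in>I. f i \<in> F i) \<and> (\<forall>i. i \<notin> I \<longrightarrow> f i = 0) \<and>
       finite {i. f i \<noteq> 0} \<and> x = (\<Sum>i | f i \<noteq> 0. f i)"
      and g: "(\<forall>i\<in>I. g i \<in> F i) \<and> (\<forall>i. i \<notin> I \<longrightarrow> g i = 0) \<and>
       finite {i. g i \<noteq> 0} \<and> x = (\<Sum>i | g i \<noteq> 0. g i)"
      by (auto simp: decomposes_def)
    let ?U = "{i. f i \<noteq> 0} \<union> {i. g i \<noteq> 0}"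
    have fin: "finite {i. f i \<noteq> 0}" "finite {i. g i \<noteq> 0}" using f g by auto
    have "(\<Sum>i | f i \<noteq> 0. f i) = (\<Sum>i\<in>?U. f i)"
      by (rule sum.mono_neutral_left) (use fin in auto)
    moreover have "(\<Sum>i | g i \<noteq> 0. g i) = (\<Sum>i\<in>?U. g i)"
      by (rule sum.mono_neutral_left) (use fin in auto)
    ultimately have "sum f ?U = sum g ?U" using f g by metis
    then have "(\<Sum>i\<in>?U. f i - g i) = 0" by (simp add: sum_subtractf)
    moreover have "finite ?U" using fin by simp
    moreover have sub: "?U \<subseteq> I" using f g by blast
    moreover have "\<forall>i\<in>?U. f i - g i \<in> F i"
    proof
      fix i assume "i \<in> ?U"
      then have "i \<in> I" using sub by blast
      then show "f i - g i \<in> F i" using f g R by (simp add: subspace_diff)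
    qed
    ultimately have "f i - g i = 0" if "i \<in> ?U" for i
      using that by (intro ind[of ?U "\<lambda>i. f i - g i" i]) auto
    then have "f i = g i" for i by (cases "i \<in> ?U") auto
    then show "f = g" by (simp add: fun_eq_iff)
  qed
  then show ?L using R by (simp add: internal_direct_sum_decomposes)
qed

lemma internal_direct_sum_image:
  assumes "internal_direct_sum I F S" "linear_on S \<phi>" "inj_on \<phi> S"
  shows "internal_direct_sum I (\<lambda>i. \<phi> ` F i) (\<phi> ` S)"
proof -
  from assms(1) have s: "subspace S" "\<And>i. i \<in> I \<Longrightarrow> subspace (F i)" "\<And>i. i \<in> I \<Longrightarrow> F i \<subseteq> S"
    "S \<subseteq> span (\<Union>i\<in>I. F i)"
    and d: "\<And>A f i. finite A \<Longrightarrow> A \<subseteq> I \<Longrightarrow> (\<And>i. i \<in> A \<Longrightarrow> f i \<in> F i) \<Longrightarrow> sum f A = 0 \<Longrightarrow> i \<in> A \<Longrightarrow> f i = 0"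
    by (auto simp: internal_direct_sum_iff)
  obtain h where h: "linear h" "\<And>x. x \<in> S \<Longrightarrow> h x = \<phi> x"
    using linear_on_extend s assms by blast
  have hF: "\<phi> ` F i = h ` F i" if "i \<in> I" for i using h(2) s(3)[OF that] by (metis image_cong subsetD)
  have "\<phi> ` S = h ` S" using h by force
  also have "\<dots> \<subseteq> h ` span (\<Union>i\<in>I. F i)" using s by blast
  also have "\<dots> = span (\<Union>i\<in>I. \<phi> ` F i)"
    using hF by (simp add: linear_span_image[OF h(1), symmetric] image_UN)
  finally have "\<phi> ` S \<subseteq> span (\<Union>i\<in>I. \<phi> ` F i)" .
  moreover have "f i = 0"
    if A: "finite A" "A \<subseteq> I" "\<And>i. i \<in> A \<Longrightarrow> f i \<in> \<phi> ` F i" "sum f A = 0" "i \<in> A" for A f i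
  proof -
    obtain g where g: "\<And>i. i \<in> A \<Longrightarrow> g i \<in> F i" "\<And>i. i \<in> A \<Longrightarrow> f i = \<phi> (g i)"
    proof -
      have "\<forall>i\<in>A. \<exists>y. y \<in> F i \<and> f i = \<phi> y" using A(3) by (auto simp: image_iff)
      from bchoice[OF this] obtain g where "\<forall>i\<in>A. g i \<in> F i \<and> f i = \<phi> (g i)" ..
      then show ?thesis by (intro that[of g]) simp_all
    qed
    have gS: "g i \<in> S" if "i \<in> A" for i using g(1)[OF that] s(3) A(2) that by auto
    have "\<phi> (sum g A) = 0" using A(4) g gS by (simp add: linear_on_sum[OF assms(2) s(1)])
    moreover have "\<phi> 0 = 0" "0 \<in> S" "sum g A \<in> S"
      using assms(2) s(1) gS by (simp_all add: linear_on_0 subspace_0 subspace_sum)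
    ultimately have "sum g A = 0" using inj_onD[OF assms(3), of "sum g A" 0] by simp
    then have "g i = 0" using d[of A g] A g by blast
    then show ?thesis using g(2)[OF A(5)] linear_on_0 assms s by metis
  qed
  moreover have "linear_on (F i) \<phi>" if "i \<in> I" for i
    using s(3)[OF that] linear_on_subset assms by blast
  moreover have "\<phi> ` F i \<subseteq> \<phi> ` S" if "i \<in> I" for i
    using s(3)[OF that] by blast
  ultimately show ?thesis using s
    by (auto simp: internal_direct_sum_iff assms subspace_linear_on_image simp del: image_subset_iff)
qed

text \<open>Linear maps can be prescribed on the summands because the union of bases of the summands is
  independent.\<close>

lemma internal_direct_sum_extend:
  assumes "internal_direct_sum I F S" "\<And>i. i \<in> I \<Longrightarrow> linear_on (F i) (\<Phi> i)"
  obtains \<phi> where "linear_on S \<phi>" "\<And>i x. i \<in> I \<Longrightarrow> x \<in> F i \<Longrightarrow> \<phi> x = \<Phi> i x"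
proof -
  from assms(1) have s: "subspace S" "\<And>i. i \<in> I \<Longrightarrow> subspace (F i)" "\<And>i. i \<in> I \<Longrightarrow> F i \<subseteq> S"
    "S \<subseteq> span (\<Union>i\<in>I. F i)"
    and d: "\<And>A f i. finite A \<Longrightarrow> A \<subseteq> I \<Longrightarrow> (\<And>i. i \<in> A \<Longrightarrow> f i \<in> F i) \<Longrightarrow> sum f A = 0 \<Longrightarrow> i \<in> A \<Longrightarrow> f i = 0"
    by (auto simp: internal_direct_sum_iff)
  have "\<exists>B. B \<subseteq> F i \<and> independent B \<and> F i \<subseteq> span B" for i
    by (rule maximal_independent_subset[of "F i"]) auto
  then obtain B where B: "\<And>i. B i \<subseteq> F i" "\<And>i. independent (B i)" "\<And>i. F i \<subseteq> span (B i)"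
    by metis
  \<comment> \<open>the union of bases of the summands is a basis\<close>
  define U where "U = (\<Union>i\<in>I. B i)"
  have disj: "i = j" if "x \<in> B i" "x \<in> B j" "i \<in> I" "j \<in> I" for x i j
  proof (rule ccontr)
    assume "i \<noteq> j"
    have "x \<in> F i" "- x \<in> F j" using that B(1) s(2) by (auto intro!: subspace_neg)
    then have "(if i = i then x else - x) = 0"
      by (intro d[of "{i, j}" "\<lambda>k. if k = i then x else - x" i])
        (use that \<open>i \<noteq> j\<close> in \<open>auto split: if_splits\<close>)
    then have "x = 0" by simp
    then show False using B(2) that dependent_zero by blast
  qed
  have indep: "independent U"
    unfolding independent_explicit_finite_subsets
  proof (intro allI impI ballI)
    fix A u a assume A: "A \<subseteq> U" "finite A" "(\<Sum>v\<in>A. u v *\<^sub>R v) = 0" "a \<in> A"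
    define ix where "ix x = (THE i. i \<in> I \<and> x \<in> B i)" for x
    have ix: "ix x = i" if "i \<in> I" "x \<in> B i" for i x
      unfolding ix_def using that disj by (intro the_equality) auto
    have ixA: "ix x \<in> I" "x \<in> B (ix x)" if "x \<in> A" for x
      using that A(1) ix unfolding U_def by fastforce+
    define f where "f i = (\<Sum>v\<in>{v\<in>A. ix v = i}. u v *\<^sub>R v)" for i
    have "sum f (ix ` A) = (\<Sum>v\<in>A. u v *\<^sub>R v)"
      unfolding f_def using A(2) by (intro sum.group) auto
    then have f0: "sum f (ix ` A) = 0" using A by simp
    have fF: "f i \<in> F i" if "i \<in> ix ` A" for i
      unfolding f_def
    proof (intro subspace_sum subspace_scale)
      show "subspace (F i)" "subspace (F i)" using that ixA s(2) by auto
      show "x \<in> F i" if "x \<in> {v \<in> A. ix v = i}" for x using that ixA B(1) by blast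
    qed
    have "f (ix a) = 0"
      using d[OF _ _ fF f0] A ixA by blast
    moreover have "independent (B (ix a))" by (rule B)
    moreover have "{v \<in> A. ix v = ix a} \<subseteq> B (ix a)"
    proof
      fix x assume "x \<in> {v \<in> A. ix v = ix a}"
      then show "x \<in> B (ix a)" using ixA(2)[of x] by simp
    qed
    ultimately show "u a = 0"
      using A(2,4) independentD[of "B (ix a)" "{v\<in>A. ix v = ix a}" u a]
      by (simp add: f_def)
  qed
  obtain h where h: "linear h" "\<And>x. x \<in> U \<Longrightarrow> h x = \<Phi> (THE i. i \<in> I \<and> x \<in> B i) x"
    using linear_independent_extend[OF indep, of "\<lambda>x. \<Phi> (THE i. i \<in> I \<and> x \<in> B i) x"] by blast
  have hlin: "linear_on T h" for T using h(1) by (auto simp: linear_on_def linear_add linear_scale)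
  have "h x = \<Phi> i x" if "i \<in> I" "x \<in> F i" for i x
  proof (rule linear_on_eq_on_span[OF s(2)[OF that(1)] hlin assms(2)[OF that(1)] B(1)])
    fix y assume "y \<in> B i"
    moreover from this have "(THE i. i \<in> I \<and> y \<in> B i) = i"
      using that disj by (intro the_equality) auto
    ultimately show "h y = \<Phi> i y" using h(2) that U_def by fastforce
  next
    show "x \<in> span (B i)" using that(2) B(3)[of i] by blast
  qed
  with hlin that show ?thesis by blast
qed

lemma internal_direct_sum_span:
  "internal_direct_sum I F S \<Longrightarrow> S = span (\<Union>i\<in>I. F i)"
  unfolding internal_direct_sum_iff by (meson UN_least span_minimal subset_antisym)

text \<open>The components of an element of the kernel go to different summands, so each of them lies in
  the kernel.\<close>

lemma internal_direct_sum_inj: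
  assumes F: "internal_direct_sum I F S" and G: "internal_direct_sum I G T"
    and \<phi>: "linear_on S \<phi>" "\<And>i. i \<in> I \<Longrightarrow> \<phi> ` F i \<subseteq> G i" "\<And>i. i \<in> I \<Longrightarrow> inj_on \<phi> (F i)"
  shows "inj_on \<phi> S"
proof (rule linear_on_inj_onI[OF \<phi>(1)])
  show S: "subspace S" using F by (simp add: internal_direct_sum_def)
  fix x assume x: "x \<in> S" "\<phi> x = 0"
  then obtain f where "decomposes I F x f"
    using F unfolding internal_direct_sum_decomposes by blast
  then have f: "\<forall>i\<in>I. f i \<in> F i" "\<forall>i. i \<notin> I \<longrightarrow> f i = 0"
       "finite {i. f i \<noteq> 0}" "x = (\<Sum>i | f i \<noteq> 0. f i)"
    by (auto simp: decomposes_def)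
  have sub: "{i. f i \<noteq> 0} \<subseteq> I" using f by blast
  have FS: "F i \<subseteq> S" "subspace (F i)" if "i \<in> I" for i
    using F that unfolding internal_direct_sum_def by blast+
  have "\<phi> x = (\<Sum>i | f i \<noteq> 0. \<phi> (f i))"
    unfolding f(4) using f(1) sub FS by (intro linear_on_sum[OF \<phi>(1) S]) blast
  then have s0: "(\<Sum>i | f i \<noteq> 0. \<phi> (f i)) = 0" using x by simp
  have "\<forall>i\<in>{i. f i \<noteq> 0}. \<phi> (f i) \<in> G i" using f(1) sub \<phi>(2) by blast
  then have 0: "\<forall>i\<in>{i. f i \<noteq> 0}. \<phi> (f i) = 0"
    using G f(3) sub s0 unfolding internal_direct_sum_iff by meson
  have "f i = 0" for i
  proof (rule ccontr)
    assume i: "f i \<noteq> 0"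
    then have iI: "i \<in> I" "f i \<in> F i" using f(1) sub by auto
    have "\<phi> (f i) = \<phi> 0" using 0 i linear_on_0[OF \<phi>(1) S] by simp
    then have "f i = 0"
      using \<phi>(3)[OF iI(1)] iI(2) subspace_0[OF FS(2)[OF iI(1)]] by (auto dest: inj_onD)
    with i show False ..
  qed
  then have "{i. f i \<noteq> 0} = {}" by simp
  then show "x = 0" unfolding f(4) by (metis sum.empty)
qed

text \<open>Coordinates with respect to a countable basis. They make a copy of a graded Lie algebra with
  finite-dimensional components available in the type over which the competitors of a maximal
  transitive prolongation range.\<close>

lemma countable_coordinates:
  fixes S :: "'a::real_vector set"
  assumes "S = span (\<Union>i\<in>I. F i)" "countable I" "\<And>i. i \<in> I \<Longrightarrow> finite_dimensional (F i)"
  obtains \<psi> :: "'a \<Rightarrow> nat \<Rightarrow> real" where "linear_on S \<psi>" "inj_on \<psi> S"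
proof -
  have "\<exists>C. \<forall>i\<in>I. finite (C i) \<and> F i = span (C i)"
    using assms(3) unfolding finite_dimensional_def by metis
  then obtain C where C: "\<And>i. i \<in> I \<Longrightarrow> finite (C i)" "\<And>i. i \<in> I \<Longrightarrow> F i = span (C i)"
    by auto
  obtain B where B: "B \<subseteq> (\<Union>i\<in>I. C i)" "independent B" "(\<Union>i\<in>I. C i) \<subseteq> span B"
    using maximal_independent_subset by blast
  have "F i \<subseteq> span B" if "i \<in> I" for i
    using that B(3) C(2) by (metis UN_subset_iff span_minimal subspace_span)
  then have "S \<subseteq> span B" unfolding assms(1) by (intro span_minimal) auto
  have "B \<subseteq> S"
    using B(1) C(2) unfolding assms(1) by (fastforce intro: span_base)
  have cB: "countable B"
    using B(1) C(1) assms(2) by (meson countable_UN countable_finite countable_subset)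
  define \<psi> where "\<psi> x n = (if B = {} then 0 else representation B x (from_nat_into B n))" for x and n :: nat
  have lin: "linear_on S \<psi>"
    using B(2) \<open>S \<subseteq> span B\<close> by (auto simp: linear_on_def \<psi>_def fun_eq_iff plus_fun_def scaleR_fun_def
        representation_add representation_scale subset_iff)
  have "inj_on \<psi> S"
  proof (rule linear_on_inj_onI[OF lin])
    show "subspace S" unfolding assms(1) by simp
    fix x assume x: "x \<in> S" "\<psi> x = 0"
    have "representation B x b = 0" for b
    proof (cases "b \<in> B")
      case True
      obtain n where "from_nat_into B n = b" using from_nat_into_surj[OF cB True] ..
      moreover have "B \<noteq> {}" using True by blast
      ultimately show ?thesis using fun_cong[OF x(2), of n] unfolding \<psi>_def zero_fun_def
          by (simp split: if_splits)
    qed (metis representation_ne_zero)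
    then show "x = 0"
      using sum_nonzero_representation_eq[OF B(2), of x] x \<open>S \<subseteq> span B\<close> by auto
  qed
  with lin that show ?thesis by blast
qed

section \<open>Graded Lie algebras\<close>

locale graded_lie =
  fixes L :: "'a::real_vector graded_lie"
  assumes gla: "graded_lie_algebra L"
begin

abbreviation "S \<equiv> lie_space L"
abbreviation "G \<equiv> lie_grade L"
abbreviation "br \<equiv> lie_bracket L"

lemma direct: "internal_direct_sum UNIV G S"
  using gla by (simp add: graded_lie_algebra_def)

lemma subspace_S: "subspace S" and subspace_G: "subspace (G p)" and G_S: "G p \<subseteq> S"
  and S_span: "S = span (\<Union>p. G p)"
  using direct internal_direct_sum_span[OF direct] by (auto simp: internal_direct_sum_def)

lemma G_SD: "x \<in> G p \<Longrightarrow> x \<in> S"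
  using G_S by blast

lemma br_closed: "x \<in> S \<Longrightarrow> y \<in> S \<Longrightarrow> br x y \<in> S"
  and br_grade: "x \<in> G p \<Longrightarrow> y \<in> G q \<Longrightarrow> br x y \<in> G (p + q)"
  and br_self: "x \<in> S \<Longrightarrow> br x x = 0"
  and jacobi0: "x \<in> S \<Longrightarrow> y \<in> S \<Longrightarrow> z \<in> S \<Longrightarrow> br x (br y z) + br y (br z x) + br z (br x y) = 0"
  using gla by (simp_all add: graded_lie_algebra_def)

lemma br_grade': "x \<in> G p \<Longrightarrow> y \<in> G q \<Longrightarrow> r = p + q \<Longrightarrow> br x y \<in> G r"
  using br_grade by simp

lemma linear_right: "x \<in> S \<Longrightarrow> linear_on S (br x)"
  and linear_left: "y \<in> S \<Longrightarrow> linear_on S (\<lambda>x. br x y)"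
  using gla by (simp_all add: graded_lie_algebra_def bilinear_on_def)

lemmas br_add_right = linear_on_add[OF linear_right]
  and br_add_left = linear_on_add[OF linear_left]
  and br_scale_right = linear_on_scale[OF linear_right]
  and br_scale_left = linear_on_scale[OF linear_left]
  and br_diff_right = linear_on_diff[OF linear_right subspace_S]
  and br_diff_left = linear_on_diff[OF linear_left subspace_S]
  and br_neg_right = linear_on_neg[OF linear_right]
  and br_neg_left = linear_on_neg[OF linear_left]
  and br_0_right = linear_on_0[OF linear_right subspace_S]
  and br_0_left = linear_on_0[OF linear_left subspace_S]

lemma br_anti: "x \<in> S \<Longrightarrow> y \<in> S \<Longrightarrow> br x y = - br y x"
  using br_self[of "x + y"] br_self[of x] br_self[of y] subspace_S
  by (simp add: br_add_left br_add_right subspace_add add_eq_0_iff)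

lemma jacobi:
  assumes "x \<in> S" "y \<in> S" "z \<in> S"
  shows "br (br x y) z = br x (br y z) - br y (br x z)"
proof -
  have "br z (br x y) = - br (br x y) z" "br y (br z x) = - br y (br x z)"
    using assms by (simp_all add: br_anti[of z] br_closed br_neg_right)
  then show ?thesis using jacobi0[OF assms] by (simp add: algebra_simps)
qed

end

text \<open>The components, on degrees \<open>-1\<close> and \<open>-2\<close>, of a derivation of degree \<open>p\<close> from the negative
  part of an algebra of depth two into the algebra. The last condition is the derivation property on
  \<open>[z, s]\<close>, which has degree \<open>-3\<close> and therefore vanishes.\<close>

definition negative_derivation ::
    "'a::real_vector graded_lie \<Rightarrow> int \<Rightarrow> ('a \<Rightarrow> 'a) \<Rightarrow> ('a \<Rightarrow> 'a) \<Rightarrow> bool" where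
  "negative_derivation L p D1 D2 \<longleftrightarrow>
    linear_on (lie_grade L (-1)) D1 \<and> linear_on (lie_grade L (-2)) D2 \<and>
    D1 ` lie_grade L (-1) \<subseteq> lie_grade L (p - 1) \<and> D2 ` lie_grade L (-2) \<subseteq> lie_grade L (p - 2) \<and>
    (\<forall>s\<in>lie_grade L (-1). \<forall>t\<in>lie_grade L (-1).
       D2 (lie_bracket L s t) = lie_bracket L (D1 s) t + lie_bracket L s (D1 t)) \<and>
    (\<forall>z\<in>lie_grade L (-2). \<forall>s\<in>lie_grade L (-1).
       lie_bracket L (D2 z) s + lie_bracket L z (D1 s) = 0)"

text \<open>The condition on derivations says that nothing can be added to \<open>L\<close> in degree \<open>p\<close>: any
  element of a larger transitive algebra would act on the negative part in the same way as an
  element of \<open>L\<close>. Transitivity in degree \<open>-1\<close> expresses that the bracket on degree \<open>-1\<close> is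
  nondegenerate.\<close>

definition full_prolongation :: "'a::real_vector graded_lie \<Rightarrow> bool" where
  "full_prolongation L \<longleftrightarrow> graded_lie_algebra L \<and> (\<forall>p. finite_dimensional (lie_grade L p)) \<and>
    (\<forall>p. p < -2 \<longrightarrow> lie_grade L p = {0}) \<and>
    (\<forall>p\<ge>-1. \<forall>X\<in>lie_grade L p. (\<forall>s\<in>lie_grade L (-1). lie_bracket L X s = 0) \<longrightarrow> X = 0) \<and>
    (\<forall>p\<ge>0. \<forall>D1 D2. negative_derivation L p D1 D2 \<longrightarrow>
      (\<exists>X\<in>lie_grade L p. (\<forall>s\<in>lie_grade L (-1). lie_bracket L X s = D1 s) \<and>
         (\<forall>z\<in>lie_grade L (-2). lie_bracket L X z = D2 z)))"

lemma full_prolongation_inner: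
  assumes "full_prolongation L" "0 \<le> p" "negative_derivation L p D1 D2"
  shows "\<exists>X\<in>lie_grade L p. (\<forall>s\<in>lie_grade L (-1). lie_bracket L X s = D1 s) \<and>
         (\<forall>z\<in>lie_grade L (-2). lie_bracket L X z = D2 z)"
  using assms by (simp add: full_prolongation_def)

section \<open>Embedding into a full prolongation\<close>

text \<open>The map \<open>\<alpha>\<close> identifies the negative parts; it is to be extended to all degrees.\<close>

locale prolongation_embedding = L: graded_lie L + g: graded_lie g
  for L :: "'l::real_vector graded_lie" and g :: "'g::real_vector graded_lie" +
  fixes \<alpha> :: "'g \<Rightarrow> 'l"
  assumes full: "full_prolongation L"
    and transitive: "\<And>p X. 0 \<le> p \<Longrightarrow> X \<in> lie_grade g p \<Longrightarrow>
      (\<And>s. s \<in> lie_grade g (-1) \<Longrightarrow> lie_bracket g X s = 0) \<Longrightarrow> X = 0"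
    and \<alpha>_linear: "\<And>p. p < 0 \<Longrightarrow> linear_on (lie_grade g p) \<alpha>"
    and \<alpha>_image: "\<And>p. p < 0 \<Longrightarrow> \<alpha> ` lie_grade g p = lie_grade L p"
    and \<alpha>_inj: "\<And>p. p < 0 \<Longrightarrow> inj_on \<alpha> (lie_grade g p)"
    and \<alpha>_hom: "\<And>p q x y. p < 0 \<Longrightarrow> q < 0 \<Longrightarrow> x \<in> lie_grade g p \<Longrightarrow> y \<in> lie_grade g q \<Longrightarrow>
      \<alpha> (lie_bracket g x y) = lie_bracket L (\<alpha> x) (\<alpha> y)"
begin

text \<open>The image of \<open>X\<close> is the element of \<open>L\<close> that brackets with degree \<open>-1\<close> as \<open>X\<close> does. The
  recursion is on the degree plus one, so that \<open>0\<close> stands for all negative degrees at once.\<close>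

primrec \<Psi> :: "nat \<Rightarrow> 'g \<Rightarrow> 'l" where
  "\<Psi> 0 = \<alpha>"
| "\<Psi> (Suc n) = (\<lambda>X. THE Y. Y \<in> L.G (int n) \<and> (\<forall>s\<in>g.G (-1). L.br Y (\<alpha> s) = \<Psi> n (g.br X s)))"

definition \<Phi> :: "int \<Rightarrow> 'g \<Rightarrow> 'l" where "\<Phi> p = \<Psi> (nat (p + 1))"

lemma \<Phi>_neg: "p < 0 \<Longrightarrow> \<Phi> p = \<alpha>"
  by (simp add: \<Phi>_def)

lemma \<Phi>_nonneg:
  assumes "0 \<le> p"
  shows "\<Phi> p X = (THE Y. Y \<in> L.G p \<and> (\<forall>s\<in>g.G (-1). L.br Y (\<alpha> s) = \<Phi> (p - 1) (g.br X s)))"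
proof -
  have "nat (p + 1) = Suc (nat p)" "nat (p - 1 + 1) = nat p" using assms by auto
  then show ?thesis using assms by (simp add: \<Phi>_def)
qed

lemma L_transitive:
  assumes "-1 \<le> p" "X \<in> L.G p" "\<And>s. s \<in> g.G (-1) \<Longrightarrow> L.br X (\<alpha> s) = 0"
  shows "X = 0"
proof -
  have "\<forall>s\<in>L.G (-1). L.br X s = 0" using assms(3) \<alpha>_image[of "-1"] by (auto simp flip: \<alpha>_image)
  with assms(1,2) full show ?thesis by (simp add: full_prolongation_def)
qed

lemma L_transitive_eq:
  assumes "-1 \<le> p" "X \<in> L.G p" "Y \<in> L.G p" "\<And>s. s \<in> g.G (-1) \<Longrightarrow> L.br X (\<alpha> s) = L.br Y (\<alpha> s)"
  shows "X = Y"
proof -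
  have \<alpha>S: "\<alpha> s \<in> L.S" if "s \<in> g.G (-1)" for s using that \<alpha>_image[of "-1"] L.G_S by fastforce
  have "X - Y = 0"
  proof (rule L_transitive[OF assms(1)])
    show "X - Y \<in> L.G p" using assms by (simp add: subspace_diff L.subspace_G)
    show "L.br (X - Y) (\<alpha> s) = 0" if "s \<in> g.G (-1)" for s
      using that assms \<alpha>S L.br_diff_left[OF \<alpha>S[OF that]] L.G_SD by simp
  qed
  then show ?thesis by simp
qed

lemma \<alpha>_in: "p < 0 \<Longrightarrow> x \<in> g.G p \<Longrightarrow> \<alpha> x \<in> L.G p"
  using \<alpha>_image by blast

lemma low_degrees: "p < -2 \<Longrightarrow> L.G p = {0}" "p < -2 \<Longrightarrow> x \<in> g.G p \<Longrightarrow> x = 0"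
proof -
  show *: "p < -2 \<Longrightarrow> L.G p = {0}" using full by (simp add: full_prolongation_def)
  assume p: "p < -2" and x: "x \<in> g.G p"
  then have "\<alpha> x = 0" using \<alpha>_image[of p] * by auto
  moreover have "\<alpha> 0 = 0" using linear_on_0[OF \<alpha>_linear g.subspace_G, of p] p by simp
  ultimately show "x = 0"
    using inj_onD[OF \<alpha>_inj, of p x 0] p x subspace_0[OF g.subspace_G] by simp
qed

text \<open>The invariant of the recursion. Compatibility with degree \<open>-2\<close> is needed to see that the
  prescription for the next degree respects \<open>[z, s] = 0\<close>.\<close>

definition compatible :: "int \<Rightarrow> bool" where
  "compatible p \<longleftrightarrow> linear_on (g.G p) (\<Phi> p) \<and> \<Phi> p ` g.G p \<subseteq> L.G p \<and>
    (\<forall>X\<in>g.G p. \<forall>s\<in>g.G (-1). L.br (\<Phi> p X) (\<alpha> s) = \<Phi> (p - 1) (g.br X s)) \<and>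
    (\<forall>X\<in>g.G p. \<forall>z\<in>g.G (-2). L.br (\<Phi> p X) (\<alpha> z) = \<Phi> (p - 2) (g.br X z))"

lemma compatible_neg: "p < 0 \<Longrightarrow> compatible p"
  unfolding compatible_def using \<alpha>_linear \<alpha>_image \<alpha>_hom[of p "-1"] \<alpha>_hom[of p "-2"] by (simp add: \<Phi>_neg)

text \<open>By the Jacobi identity, \<open>s \<mapsto> \<Phi> [X, s]\<close> is a derivation of the negative part of \<open>L\<close>. As \<open>L\<close>
  is full, an element of \<open>L\<close> induces it; as \<open>L\<close> is transitive, only one does.\<close>

lemma compatible_step:
  assumes p: "0 \<le> p" and less: "\<And>q. q < p \<Longrightarrow> compatible q"
  shows "compatible p"
proof -
  have lin1: "linear_on (g.G (p - 1)) (\<Phi> (p - 1))" and lin2: "linear_on (g.G (p - 2)) (\<Phi> (p - 2))"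
    and im1: "\<And>x. x \<in> g.G (p - 1) \<Longrightarrow> \<Phi> (p - 1) x \<in> L.G (p - 1)"
    and im2: "\<And>x. x \<in> g.G (p - 2) \<Longrightarrow> \<Phi> (p - 2) x \<in> L.G (p - 2)"
    and b1: "\<And>X s. X \<in> g.G (p - 1) \<Longrightarrow> s \<in> g.G (-1) \<Longrightarrow> L.br (\<Phi> (p - 1) X) (\<alpha> s) = \<Phi> (p - 2) (g.br X s)"
    and b2: "\<And>X s. X \<in> g.G (p - 2) \<Longrightarrow> s \<in> g.G (-1) \<Longrightarrow> L.br (\<Phi> (p - 2) X) (\<alpha> s) = \<Phi> (p - 3) (g.br X s)"
    and c1: "\<And>X z. X \<in> g.G (p - 1) \<Longrightarrow> z \<in> g.G (-2) \<Longrightarrow> L.br (\<Phi> (p - 1) X) (\<alpha> z) = \<Phi> (p - 3) (g.br X z)"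
    using less[of "p - 1"] less[of "p - 2"] less[of "p - 3"] by (auto simp: compatible_def)
  define inv1 where "inv1 = inv_into (g.G (-1)) \<alpha>"
  define inv2 where "inv2 = inv_into (g.G (-2)) \<alpha>"
  have inv1: "inv1 (\<alpha> s) = s" if "s \<in> g.G (-1)" for s
    using that \<alpha>_inj[of "-1"] by (simp add: inv1_def)
  have inv2: "inv2 (\<alpha> s) = s" if "s \<in> g.G (-2)" for s
    using that \<alpha>_inj[of "-2"] by (simp add: inv2_def)
  have lin_inv1: "linear_on (L.G (-1)) inv1"
    using linear_on_inv_into[OF g.subspace_G \<alpha>_linear \<alpha>_inj, of "-1"] by (simp add: inv1_def \<alpha>_image)
  have lin_inv2: "linear_on (L.G (-2)) inv2"
    using linear_on_inv_into[OF g.subspace_G \<alpha>_linear \<alpha>_inj, of "-2"] by (simp add: inv2_def \<alpha>_image)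
  have L1: "\<exists>s\<in>g.G (-1). s' = \<alpha> s" if "s' \<in> L.G (-1)" for s' using that \<alpha>_image[of "-1"] by auto
  have L2: "\<exists>s\<in>g.G (-2). s' = \<alpha> s" if "s' \<in> L.G (-2)" for s' using that \<alpha>_image[of "-2"] by auto
  have br1: "g.br X s \<in> g.G (p - 1)" if "X \<in> g.G p" "s \<in> g.G (-1)" for X s
    using g.br_grade[OF that] by simp
  have br2: "g.br X s \<in> g.G (p - 2)" if "X \<in> g.G p" "s \<in> g.G (-2)" for X s
    using g.br_grade[OF that] by simp
  \<comment> \<open>the derivation of the negative part of \<open>L\<close> that the image of \<open>X\<close> has to induce\<close>
  have ex: "\<exists>Y\<in>L.G p. (\<forall>s\<in>g.G (-1). L.br Y (\<alpha> s) = \<Phi> (p - 1) (g.br X s)) \<and>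
      (\<forall>z\<in>g.G (-2). L.br Y (\<alpha> z) = \<Phi> (p - 2) (g.br X z))" if X: "X \<in> g.G p" for X
  proof -
    have XS: "X \<in> g.S" using X g.G_SD by blast
    define D1 where "D1 y = \<Phi> (p - 1) (g.br X (inv1 y))" for y
    define D2 where "D2 y = \<Phi> (p - 2) (g.br X (inv2 y))" for y
    have D1: "D1 (\<alpha> s) = \<Phi> (p - 1) (g.br X s)" if "s \<in> g.G (-1)" for s
      using that by (simp add: D1_def inv1)
    have D2: "D2 (\<alpha> s) = \<Phi> (p - 2) (g.br X s)" if "s \<in> g.G (-2)" for s
      using that by (simp add: D2_def inv2)
    have "negative_derivation L p D1 D2"
      unfolding negative_derivation_def
    proof (intro conjI ballI)
      have "linear_on (g.G (-1)) (g.br X)" "linear_on (g.G (-2)) (g.br X)"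
        using linear_on_subset[OF g.linear_right[OF XS] g.G_S] by auto
      then have 1: "linear_on (g.G (-1)) (\<lambda>x. \<Phi> (p - 1) (g.br X x))"
        and 2: "linear_on (g.G (-2)) (\<lambda>x. \<Phi> (p - 2) (g.br X x))"
        using br1[OF X] br2[OF X]
        by (auto intro!: linear_on_comp[OF _ _ lin1] linear_on_comp[OF _ _ lin2])
      show "linear_on (L.G (-1)) D1"
        unfolding D1_def by (rule linear_on_comp[OF lin_inv1 _ 1]) (use L1 inv1 in force)
      show "linear_on (L.G (-2)) D2"
        unfolding D2_def by (rule linear_on_comp[OF lin_inv2 _ 2]) (use L2 inv2 in force)
      show "D1 ` L.G (-1) \<subseteq> L.G (p - 1)"
        using L1 br1[OF X] im1 by (fastforce simp: D1)
      show "D2 ` L.G (-2) \<subseteq> L.G (p - 2)"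
        using L2 br2[OF X] im2 by (fastforce simp: D2)
    next
      fix s' t' assume "s' \<in> L.G (-1)" "t' \<in> L.G (-1)"
      then obtain s t where st: "s \<in> g.G (-1)" "t \<in> g.G (-1)" "s' = \<alpha> s" "t' = \<alpha> t" using L1 by meson
      have S: "s \<in> g.S" "t \<in> g.S" using st g.G_SD by auto
      have b: "L.br (\<Phi> (p - 1) (g.br X s)) (\<alpha> t) = \<Phi> (p - 2) (g.br (g.br X s) t)"
        "L.br (\<Phi> (p - 1) (g.br X t)) (\<alpha> s) = \<Phi> (p - 2) (g.br (g.br X t) s)"
        using b1 br1[OF X] st by auto
      have D1L: "D1 t' \<in> L.S" "s' \<in> L.S"
        using st D1 br1[OF X] im1 L.G_SD \<alpha>_in[of "-1"] by (metis, force)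
      have gr: "g.br (g.br X s) t \<in> g.G (p - 2)" "g.br (g.br X t) s \<in> g.G (p - 2)"
        using g.br_grade'[OF br1[OF X st(1)] st(2)] g.br_grade'[OF br1[OF X st(2)] st(1)] by auto
      have "L.br s' (D1 t') = - L.br (D1 t') s'" by (rule L.br_anti[OF D1L(2,1)])
      then have "L.br (D1 s') t' + L.br s' (D1 t')
          = \<Phi> (p - 2) (g.br (g.br X s) t) - \<Phi> (p - 2) (g.br (g.br X t) s)"
        using st by (simp add: D1 b)
      also have "\<dots> = \<Phi> (p - 2) (g.br (g.br X s) t - g.br (g.br X t) s)"
        using linear_on_diff[OF lin2 g.subspace_G gr] by simp
      also have "g.br (g.br X s) t - g.br (g.br X t) s = g.br X (g.br s t)"
      proof -
        have "g.br (g.br X t) s = - g.br s (g.br X t)" using g.br_anti g.br_closed XS S by blast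
        then show ?thesis using g.jacobi[OF XS S(1,2)] g.jacobi[OF S(1) XS S(2)] g.br_anti[OF S(1) XS]
            g.br_neg_left[OF S(2), of "g.br X s"] g.br_closed XS S by (simp add: algebra_simps)
      qed
      also have "\<Phi> (p - 2) (g.br X (g.br s t)) = D2 (\<alpha> (g.br s t))"
        using g.br_grade[OF st(1,2)] by (simp add: D2)
      also have "\<alpha> (g.br s t) = L.br s' t'" using st \<alpha>_hom[of "-1" "-1" s t] by simp
      finally show "D2 (L.br s' t') = L.br (D1 s') t' + L.br s' (D1 t')" ..
    next
      fix z' s' assume "z' \<in> L.G (-2)" "s' \<in> L.G (-1)"
      then obtain z s where st: "z \<in> g.G (-2)" "s \<in> g.G (-1)" "z' = \<alpha> z" "s' = \<alpha> s" using L1 L2 by meson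
      have S: "s \<in> g.S" "z \<in> g.S" using st g.G_SD by auto
      have D1L: "D1 s' \<in> L.S" "z' \<in> L.S"
        using st D1 br1[OF X] im1 L.G_SD \<alpha>_in[of "-2"] by (metis, force)
      have b: "L.br (D2 z') s' = \<Phi> (p - 3) (g.br (g.br X z) s)"
        "L.br (D1 s') z' = \<Phi> (p - 3) (g.br (g.br X s) z)"
        using b2 c1 br1[OF X] br2[OF X] st by (auto simp: D1 D2)
      have gr: "g.br (g.br X z) s \<in> g.G (p - 3)" "g.br (g.br X s) z \<in> g.G (p - 3)"
        using g.br_grade'[OF br2[OF X st(1)] st(2)] g.br_grade'[OF br1[OF X st(2)] st(1)] by auto
      have "g.br z s \<in> g.G (-3)" using g.br_grade[OF st(1,2)] by simp
      then have "g.br z s = 0" using low_degrees(2)[of "-3"] by simp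
      then have "g.br (g.br X z) s = - g.br z (g.br X s)"
        using g.jacobi[OF XS S(2,1)] g.br_0_right[OF XS] by simp
      also have "\<dots> = g.br (g.br X s) z" using g.br_anti[of z "g.br X s"] g.br_closed XS S by simp
      finally have "L.br (D2 z') s' = L.br (D1 s') z'" using b by simp
      then show "L.br (D2 z') s' + L.br z' (D1 s') = 0" using L.br_anti[OF D1L(2,1)] by simp
    qed
    from full_prolongation_inner[OF full p this]
    obtain Y where "Y \<in> L.G p" "\<forall>s\<in>L.G (-1). L.br Y s = D1 s" "\<forall>s\<in>L.G (-2). L.br Y s = D2 s"
      by blast
    then show ?thesis using D1 D2 \<alpha>_in by (intro bexI[of _ Y]) auto
  qed
  have uniq: "\<Phi> p X = Y"
    if "Y \<in> L.G p" "\<forall>s\<in>g.G (-1). L.br Y (\<alpha> s) = \<Phi> (p - 1) (g.br X s)" for X Y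
    unfolding \<Phi>_nonneg[OF p]
  proof (rule the_equality)
    show "Y \<in> L.G p \<and> (\<forall>s\<in>g.G (-1). L.br Y (\<alpha> s) = \<Phi> (p - 1) (g.br X s))" using that by blast
    show "Y' = Y" if "Y' \<in> L.G p \<and> (\<forall>s\<in>g.G (-1). L.br Y' (\<alpha> s) = \<Phi> (p - 1) (g.br X s))" for Y'
      using that \<open>Y \<in> L.G p\<close> \<open>\<forall>s\<in>g.G (-1). L.br Y (\<alpha> s) = \<Phi> (p - 1) (g.br X s)\<close> p
      by (auto intro: L_transitive_eq[of p Y' Y])
  qed
  have sol: "\<Phi> p X \<in> L.G p \<and> (\<forall>s\<in>g.G (-1). L.br (\<Phi> p X) (\<alpha> s) = \<Phi> (p - 1) (g.br X s)) \<and>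
      (\<forall>z\<in>g.G (-2). L.br (\<Phi> p X) (\<alpha> z) = \<Phi> (p - 2) (g.br X z))" if X: "X \<in> g.G p" for X
    using ex[OF X] uniq by metis
  have \<alpha>S: "\<alpha> s \<in> L.S" if "s \<in> g.G (-1)" for s using \<alpha>_in[OF _ that] L.G_SD by simp
  have "linear_on (g.G p) (\<Phi> p)"
    unfolding linear_on_def
  proof (intro conjI ballI allI)
    fix x assume x: "x \<in> g.G p"
    {
      fix y assume y: "y \<in> g.G p"
      show "\<Phi> p (x + y) = \<Phi> p x + \<Phi> p y"
      proof (rule uniq, safe)
        show "\<Phi> p x + \<Phi> p y \<in> L.G p" using sol x y L.subspace_G by (simp add: subspace_add)
        fix s assume s: "s \<in> g.G (-1)"
        then show "L.br (\<Phi> p x + \<Phi> p y) (\<alpha> s) = \<Phi> (p - 1) (g.br (x + y) s)"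
          using sol[OF x] sol[OF y] L.br_add_left[OF \<alpha>S[OF s], of "\<Phi> p x" "\<Phi> p y"]
            g.br_add_left[of s x y] g.G_SD[OF x] g.G_SD[OF y] g.G_SD[OF s]
            L.G_SD[of "\<Phi> p x" p] L.G_SD[of "\<Phi> p y" p]
            linear_on_add[OF lin1 br1[OF x s] br1[OF y s]] by simp
      qed
    }
    fix r
    show "\<Phi> p (r *\<^sub>R x) = r *\<^sub>R \<Phi> p x"
    proof (rule uniq, safe)
      show "r *\<^sub>R \<Phi> p x \<in> L.G p" using sol x L.subspace_G by (simp add: subspace_scale)
      fix s assume s: "s \<in> g.G (-1)"
      then show "L.br (r *\<^sub>R \<Phi> p x) (\<alpha> s) = \<Phi> (p - 1) (g.br (r *\<^sub>R x) s)"
        using sol[OF x] L.br_scale_left[OF \<alpha>S[OF s], of "\<Phi> p x"]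
          g.br_scale_left[of s x] g.G_SD[OF x] g.G_SD[OF s] L.G_SD[of "\<Phi> p x" p]
          linear_on_scale[OF lin1 br1[OF x s]] by simp
    qed
  qed
  then show ?thesis unfolding compatible_def using sol by blast
qed

lemma compatible: "compatible p"
proof -
  have "compatible p" if "p < int n" for n using that
  proof (induction n arbitrary: p)
    case (Suc n)
    then show ?case using compatible_neg compatible_step by (cases "p < 0") force+
  qed (simp add: compatible_neg)
  from this[of "nat (p + 1)"] show ?thesis by simp
qed

lemma \<Phi>_linear: "linear_on (g.G p) (\<Phi> p)"
  and \<Phi>_in: "x \<in> g.G p \<Longrightarrow> \<Phi> p x \<in> L.G p"
  and \<Phi>_br1: "X \<in> g.G p \<Longrightarrow> s \<in> g.G (-1) \<Longrightarrow> L.br (\<Phi> p X) (\<alpha> s) = \<Phi> (p - 1) (g.br X s)"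
  and \<Phi>_br2: "X \<in> g.G p \<Longrightarrow> s \<in> g.G (-2) \<Longrightarrow> L.br (\<Phi> p X) (\<alpha> s) = \<Phi> (p - 2) (g.br X s)"
  using compatible[of p] by (auto simp: compatible_def)

text \<open>If \<open>\<Phi> X = 0\<close> then \<open>\<Phi> [X, s] = 0\<close> for all \<open>s\<close> of degree \<open>-1\<close>. By induction on the degree
  \<open>[X, s] = 0\<close>, and transitivity of \<open>g\<close> applies.\<close>

lemma \<Phi>_inj: "inj_on (\<Phi> p) (g.G p)"
proof -
  have "inj_on (\<Phi> p) (g.G p)" if "p < int n" for n using that
  proof (induction n arbitrary: p)
    case 0 then show ?case by (simp add: \<Phi>_neg \<alpha>_inj)
  next
    case (Suc n)
    show ?case
    proof (cases "p < 0")
      case True then show ?thesis by (simp add: \<Phi>_neg \<alpha>_inj)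
    next
      case False
      show ?thesis
      proof (rule linear_on_inj_onI[OF \<Phi>_linear g.subspace_G])
        fix x assume x: "x \<in> g.G p" "\<Phi> p x = 0"
        have "g.br x s = 0" if s: "s \<in> g.G (-1)" for s
        proof -
          have "\<Phi> (p - 1) (g.br x s) = 0"
            using \<Phi>_br1[OF x(1) s] x L.br_0_left[of "\<alpha> s"] \<alpha>_in[OF _ s] L.G_SD by simp
          moreover have "g.br x s \<in> g.G (p - 1)" using g.br_grade[OF x(1) s] by simp
          moreover have "\<Phi> (p - 1) 0 = 0" by (rule linear_on_0[OF \<Phi>_linear g.subspace_G])
          moreover have "inj_on (\<Phi> (p - 1)) (g.G (p - 1))" using Suc by simp
          ultimately show ?thesis using inj_onD[of "\<Phi> (p - 1)" "g.G (p - 1)" "g.br x s" 0]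
              subspace_0[OF g.subspace_G] by simp
        qed
        then show "x = 0" using transitive[of p x] x False by simp
      qed
    qed
  qed
  from this[of "nat (p + 1)"] show ?thesis by simp
qed

lemma \<Phi>_hom_neg:
  assumes "q < 0" "X \<in> g.G p" "Y \<in> g.G q"
  shows "\<Phi> (p + q) (g.br X Y) = L.br (\<Phi> p X) (\<Phi> q Y)"
proof -
  consider "q = -1" | "q = -2" | "q < -2" using assms(1) by linarith
  then show ?thesis
  proof cases
    case 3
    then have "Y = 0" using low_degrees assms by blast
    moreover have "X \<in> g.S" "\<Phi> p X \<in> L.S" using assms(2) \<Phi>_in L.G_SD g.G_SD by auto
    ultimately show ?thesis
      using g.br_0_right L.br_0_right linear_on_0[OF \<Phi>_linear g.subspace_G] by simp
  qed (use assms \<Phi>_br1[of X p Y] \<Phi>_br2[of X p Y] in \<open>simp_all add: \<Phi>_neg\<close>)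
qed

text \<open>By transitivity of \<open>L\<close> it suffices to compare brackets with degree \<open>-1\<close>. By the Jacobi
  identity these involve brackets of smaller total degree only.\<close>

lemma \<Phi>_hom:
  assumes "X \<in> g.G p" "Y \<in> g.G q"
  shows "\<Phi> (p + q) (g.br X Y) = L.br (\<Phi> p X) (\<Phi> q Y)"
proof -
  have neg: "\<Phi> (p + q) (g.br X Y) = L.br (\<Phi> p X) (\<Phi> q Y)"
    if "p < 0 \<or> q < 0" "X \<in> g.G p" "Y \<in> g.G q" for p q X Y
  proof (cases "q < 0")
    case True then show ?thesis using \<Phi>_hom_neg that by blast
  next
    case False
    then have "\<Phi> (q + p) (g.br Y X) = L.br (\<Phi> q Y) (\<Phi> p X)" using \<Phi>_hom_neg that by blast
    moreover have "g.br X Y = - g.br Y X" "L.br (\<Phi> p X) (\<Phi> q Y) = - L.br (\<Phi> q Y) (\<Phi> p X)"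
      using that by (auto intro!: g.br_anti L.br_anti g.G_SD L.G_SD \<Phi>_in)
    moreover have "g.br Y X \<in> g.G (q + p)" using that g.br_grade by blast
    ultimately show ?thesis using linear_on_neg[OF \<Phi>_linear, of "g.br Y X" "q + p"]
      by (simp add: add.commute)
  qed
  have "\<Phi> (p + q) (g.br X Y) = L.br (\<Phi> p X) (\<Phi> q Y)"
    if "p + q < int n" "X \<in> g.G p" "Y \<in> g.G q" for n using that
  proof (induction n arbitrary: p q X Y)
    case 0 then show ?case by (intro neg) auto
  next
    case (Suc n)
    note XY = Suc.prems(2,3)
    show ?case
    proof (cases "p < 0 \<or> q < 0")
      case True then show ?thesis using neg XY by blast
    next
      case False
      show ?thesis
      proof (rule L_transitive_eq[of "p + q"])
        show "\<Phi> (p + q) (g.br X Y) \<in> L.G (p + q)" "L.br (\<Phi> p X) (\<Phi> q Y) \<in> L.G (p + q)"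
          using XY by (auto intro!: \<Phi>_in g.br_grade L.br_grade)
        fix s assume s: "s \<in> g.G (-1)"
        have sS: "s \<in> g.S" "X \<in> g.S" "Y \<in> g.S" "\<alpha> s \<in> L.S" "\<Phi> p X \<in> L.S" "\<Phi> q Y \<in> L.S"
          using s XY \<alpha>_in[of "-1" s] \<Phi>_in[OF XY(1)] \<Phi>_in[OF XY(2)] g.G_SD L.G_SD by auto
        have gr: "g.br Y s \<in> g.G (q - 1)" "g.br X s \<in> g.G (p - 1)"
          using s XY by (auto intro!: g.br_grade')
        have "\<Phi> (p + (q - 1)) (g.br X (g.br Y s)) = L.br (\<Phi> p X) (\<Phi> (q - 1) (g.br Y s))"
          "\<Phi> (q + (p - 1)) (g.br Y (g.br X s)) = L.br (\<Phi> q Y) (\<Phi> (p - 1) (g.br X s))"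
          using Suc.prems gr by (auto intro!: Suc.IH)
        then have e: "\<Phi> (p + q - 1) (g.br X (g.br Y s)) = L.br (\<Phi> p X) (L.br (\<Phi> q Y) (\<alpha> s))"
          "\<Phi> (p + q - 1) (g.br Y (g.br X s)) = L.br (\<Phi> q Y) (L.br (\<Phi> p X) (\<alpha> s))"
          using \<Phi>_br1[OF XY(1) s] \<Phi>_br1[OF XY(2) s] by (simp_all add: algebra_simps)
        have gr2: "g.br X (g.br Y s) \<in> g.G (p + q - 1)" "g.br Y (g.br X s) \<in> g.G (p + q - 1)"
          by (auto intro: g.br_grade'[OF XY(1) gr(1)] g.br_grade'[OF XY(2) gr(2)])
        have "L.br (\<Phi> (p + q) (g.br X Y)) (\<alpha> s) = \<Phi> (p + q - 1) (g.br (g.br X Y) s)"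
          using s XY by (intro \<Phi>_br1) (auto intro!: g.br_grade)
        also have "\<dots> = \<Phi> (p + q - 1) (g.br X (g.br Y s)) - \<Phi> (p + q - 1) (g.br Y (g.br X s))"
          using g.jacobi[OF sS(2,3,1)] linear_on_diff[OF \<Phi>_linear g.subspace_G gr2] by simp
        also have "\<dots> = L.br (L.br (\<Phi> p X) (\<Phi> q Y)) (\<alpha> s)"
          using L.jacobi[OF sS(5,6,4)] e by simp
        finally show "L.br (\<Phi> (p + q) (g.br X Y)) (\<alpha> s) = L.br (L.br (\<Phi> p X) (\<Phi> q Y)) (\<alpha> s)" .
      qed (use False in simp)
    qed
  qed
  from this[of "nat (p + q + 1)"] assms show ?thesis by simp
qed

lemma linear_on_eq_on_grades:
  assumes "\<And>p x. x \<in> g.G p \<Longrightarrow> f x = h x" "linear_on g.S f" "linear_on g.S h" "x \<in> g.S"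
  shows "f x = h x"
proof (rule linear_on_eq_on_span[OF g.subspace_S assms(2,3)])
  show "(\<Union>p. g.G p) \<subseteq> g.S" using g.G_S by blast
  show "x \<in> span (\<Union>p. g.G p)" using assms(4) g.S_span by simp
  show "f x = h x" if "x \<in> (\<Union>p. g.G p)" for x using that assms(1) by blast
qed

theorem embedding: "\<exists>\<phi>. graded_lie_hom g L \<phi> \<and> inj_on \<phi> g.S"
proof -
  obtain \<phi> where lin: "linear_on g.S \<phi>" and \<phi>: "\<And>p x. x \<in> g.G p \<Longrightarrow> \<phi> x = \<Phi> p x"
    using internal_direct_sum_extend[OF g.direct, of \<Phi>] \<Phi>_linear by auto
  have im: "\<phi> ` g.G p \<subseteq> L.G p" for p using \<phi> \<Phi>_in by auto
  have "g.S \<subseteq> {x \<in> g.S. \<phi> x \<in> L.S}"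
    unfolding g.S_span
  proof (rule span_minimal)
    show "subspace {x \<in> span (\<Union>p. g.G p). \<phi> x \<in> L.S}"
      unfolding g.S_span[symmetric] using g.subspace_S L.subspace_S lin
      by (auto simp: subspace_def linear_on_0 linear_on_add linear_on_scale)
    show "(\<Union>p. g.G p) \<subseteq> {x \<in> span (\<Union>p. g.G p). \<phi> x \<in> L.S}"
      using im L.G_S g.G_S by (auto intro: span_base)
  qed
  then have imS: "\<phi> x \<in> L.S" if "x \<in> g.S" for x using that by blast
  have h1: "\<phi> (g.br X Y) = L.br (\<phi> X) (\<phi> Y)" if "X \<in> g.G p" "Y \<in> g.G q" for X Y p q
    using \<Phi>_hom[OF that] \<phi> that g.br_grade[OF that] by simp
  have compR: "linear_on g.S (\<lambda>y. \<phi> (g.br x y))" "linear_on g.S (\<lambda>y. L.br (\<phi> x) (\<phi> y))"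
    "linear_on g.S (\<lambda>y. \<phi> (g.br y x))" "linear_on g.S (\<lambda>y. L.br (\<phi> y) (\<phi> x))" if x: "x \<in> g.S" for x
  proof -
    have sub: "\<phi> ` g.S \<subseteq> L.S" "g.br x ` g.S \<subseteq> g.S" "(\<lambda>y. g.br y x) ` g.S \<subseteq> g.S"
      using imS g.br_closed x by auto
    show "linear_on g.S (\<lambda>y. \<phi> (g.br x y))" "linear_on g.S (\<lambda>y. \<phi> (g.br y x))"
      using linear_on_comp[OF g.linear_right[OF x] sub(2) lin]
        linear_on_comp[OF g.linear_left[OF x] sub(3) lin] by auto
    show "linear_on g.S (\<lambda>y. L.br (\<phi> x) (\<phi> y))" "linear_on g.S (\<lambda>y. L.br (\<phi> y) (\<phi> x))"
      using linear_on_comp[OF lin sub(1) L.linear_right[OF imS[OF x]]]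
        linear_on_comp[OF lin sub(1) L.linear_left[OF imS[OF x]]] by auto
  qed
  have h2: "\<phi> (g.br X Y) = L.br (\<phi> X) (\<phi> Y)" if "X \<in> g.G p" "Y \<in> g.S" for X Y p
  proof (rule linear_on_eq_on_grades[OF _ compR(1,2) that(2)])
    show "X \<in> g.S" "X \<in> g.S" using that g.G_SD by auto
  qed (rule h1[OF that(1)])
  have h3: "\<phi> (g.br X Y) = L.br (\<phi> X) (\<phi> Y)" if "X \<in> g.S" "Y \<in> g.S" for X Y
    using h2[OF _ that(2)] by (rule linear_on_eq_on_grades[OF _ compR(3,4)[OF that(2)] that(1)])
  have "inj_on \<phi> g.S"
  proof (rule internal_direct_sum_inj[OF g.direct L.direct lin im])
    show "inj_on \<phi> (g.G p)" for p using \<Phi>_inj[of p] \<phi> by (simp add: inj_on_def)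
  qed
  moreover have "graded_lie_hom g L \<phi>"
    using lin im imS h3 by (auto simp: graded_lie_hom_def)
  ultimately show ?thesis by blast
qed

end

section \<open>Isomorphisms of graded Lie algebras\<close>

lemma graded_lie_isomorphic_trans:
  assumes "L \<cong>\<^sub>g\<^sub>r M" "M \<cong>\<^sub>g\<^sub>r K"
  shows "L \<cong>\<^sub>g\<^sub>r K"
proof -
  obtain \<phi> where \<phi>: "graded_lie_hom L M \<phi>" "bij_betw \<phi> (lie_space L) (lie_space M)"
    "\<And>p. \<phi> ` lie_grade L p = lie_grade M p" using assms by (auto simp: graded_lie_isomorphic_def)
  obtain \<psi> where \<psi>: "graded_lie_hom M K \<psi>" "bij_betw \<psi> (lie_space M) (lie_space K)"
    "\<And>p. \<psi> ` lie_grade M p = lie_grade K p" using assms by (auto simp: graded_lie_isomorphic_def)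
  have 1: "graded_lie_hom L K (\<psi> \<circ> \<phi>)"
    unfolding graded_lie_hom_def
  proof (intro conjI ballI allI)
    have in_M: "\<phi> x \<in> lie_space M" if "x \<in> lie_space L" for x
      using \<phi>(1) that by (auto simp: graded_lie_hom_def)
    show "(\<psi> \<circ> \<phi>) ` lie_space L \<subseteq> lie_space K"
      using \<psi>(1) in_M by (auto simp: graded_lie_hom_def)
    show "linear_on (lie_space L) (\<psi> \<circ> \<phi>)"
      using \<phi>(1) \<psi>(1) unfolding graded_lie_hom_def o_def
      by (intro linear_on_comp[of "lie_space L" \<phi> "lie_space M" \<psi>]) auto
    show "(\<psi> \<circ> \<phi>) (lie_bracket L x y) = lie_bracket K ((\<psi> \<circ> \<phi>) x) ((\<psi> \<circ> \<phi>) y)"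
      if "x \<in> lie_space L" "y \<in> lie_space L" for x y
      using \<phi>(1) \<psi>(1) that in_M by (simp add: graded_lie_hom_def)
    show "(\<psi> \<circ> \<phi>) ` lie_grade L p \<subseteq> lie_grade K p" for p
      unfolding image_comp[symmetric] \<phi>(3) \<psi>(3) by simp
  qed
  have 2: "bij_betw (\<psi> \<circ> \<phi>) (lie_space L) (lie_space K)" by (rule bij_betw_trans[OF \<phi>(2) \<psi>(2)])
  have 3: "(\<psi> \<circ> \<phi>) ` lie_grade L p = lie_grade K p" for p
    unfolding image_comp[symmetric] \<phi>(3) \<psi>(3) ..
  show ?thesis unfolding graded_lie_isomorphic_def using 1 2 3 by blast
qed

text \<open>The inverse respects brackets because the bracket of two elements of \<open>L\<close> is again in the
  domain of the isomorphism; the definition of isomorphism does not include this closure.\<close>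

lemma graded_lie_isomorphic_sym:
  assumes "L \<cong>\<^sub>g\<^sub>r M" and S: "subspace (lie_space L)"
    and cl: "\<And>x y. x \<in> lie_space L \<Longrightarrow> y \<in> lie_space L \<Longrightarrow> lie_bracket L x y \<in> lie_space L"
    and gr: "\<And>p. lie_grade L p \<subseteq> lie_space L"
  shows "M \<cong>\<^sub>g\<^sub>r L"
proof -
  obtain \<phi> where \<phi>: "graded_lie_hom L M \<phi>" "bij_betw \<phi> (lie_space L) (lie_space M)"
    "\<And>p. \<phi> ` lie_grade L p = lie_grade M p" using assms by (auto simp: graded_lie_isomorphic_def)
  let ?\<psi> = "inv_into (lie_space L) \<phi>"
  have inj: "inj_on \<phi> (lie_space L)" and im: "\<phi> ` lie_space L = lie_space M"
    using \<phi>(2) by (auto simp: bij_betw_def)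
  have lin: "linear_on (lie_space L) \<phi>" using \<phi>(1) by (simp add: graded_lie_hom_def)
  have inv: "?\<psi> (\<phi> x) = x" if "x \<in> lie_space L" for x using inj that by simp
  have 2: "bij_betw ?\<psi> (lie_space M) (lie_space L)" by (rule bij_betw_inv_into[OF \<phi>(2)])
  have 3: "?\<psi> ` lie_grade M p = lie_grade L p" for p
    unfolding \<phi>(3)[symmetric] image_image using inv gr[of p] by (force simp: subset_iff)
  have "?\<psi> (lie_bracket M x y) = lie_bracket L (?\<psi> x) (?\<psi> y)"
    if xy: "x \<in> lie_space M" "y \<in> lie_space M" for x y
  proof -
    obtain a b where ab: "a \<in> lie_space L" "b \<in> lie_space L" "x = \<phi> a" "y = \<phi> b"
      using xy im by (metis imageE)
    then have "lie_bracket M x y = \<phi> (lie_bracket L a b)" using \<phi>(1) by (simp add: graded_lie_hom_def)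
    then show ?thesis using ab inv cl by simp
  qed
  moreover have "linear_on (lie_space M) ?\<psi>" using linear_on_inv_into[OF S lin inj] im by simp
  moreover have "?\<psi> ` lie_space M \<subseteq> lie_space L" using 2 by (simp add: bij_betw_def)
  ultimately have 1: "graded_lie_hom M L ?\<psi>" using 3 by (simp add: graded_lie_hom_def)
  show ?thesis unfolding graded_lie_isomorphic_def using 1 2 3 by blast
qed

lemma negative_part_isomorphic_sym:
  assumes "graded_lie_algebra L" "negative_part L \<cong>\<^sub>g\<^sub>r m"
  shows "m \<cong>\<^sub>g\<^sub>r negative_part L"
proof (rule graded_lie_isomorphic_sym[OF assms(2)])
  interpret graded_lie L by (rule graded_lie.intro[OF assms(1)])
  let ?N = "\<Union>p\<in>{p. p < 0}. G p"
  show "subspace (lie_space (negative_part L))" by (simp add: negative_part_def)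
  show "lie_grade (negative_part L) p \<subseteq> lie_space (negative_part L)" for p
    by (auto simp: negative_part_def intro: span_base span_0)
  have NS: "span ?N \<subseteq> S" using G_S subspace_S by (intro span_minimal) auto
  have 1: "br x y \<in> span ?N" if x: "x \<in> ?N" and y: "y \<in> span ?N" for x y
  proof -
    have xS: "x \<in> S" using x G_SD by blast
    have "span ?N \<subseteq> {y \<in> S. br x y \<in> span ?N}"
    proof (rule span_minimal)
      show "?N \<subseteq> {y \<in> S. br x y \<in> span ?N}"
      proof safe
        fix q y assume y: "y \<in> G q" "q < 0"
        then show "y \<in> S" using G_SD by blast
        obtain p where p: "p < 0" "x \<in> G p" using x by blast
        then have "br x y \<in> G (p + q)" using br_grade y by blast
        moreover have "p + q < 0" using p y by simp
        ultimately show "br x y \<in> span ?N" by (intro span_base) blast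
      qed
      show "subspace {y \<in> S. br x y \<in> span ?N}"
        unfolding subspace_def using subspace_S xS br_0_right br_add_right br_scale_right
        by (auto simp: subspace_0 subspace_add subspace_scale span_0 span_add span_scale)
    qed
    then show ?thesis using y by blast
  qed
  fix x y assume "x \<in> lie_space (negative_part L)" "y \<in> lie_space (negative_part L)"
  then have x: "x \<in> span ?N" and y: "y \<in> span ?N" by (simp_all add: negative_part_def)
  have yS: "y \<in> S" using y NS by blast
  have "span ?N \<subseteq> {x \<in> S. br x y \<in> span ?N}"
  proof (rule span_minimal)
    show "?N \<subseteq> {x \<in> S. br x y \<in> span ?N}" using 1 y G_SD by blast
    show "subspace {x \<in> S. br x y \<in> span ?N}"
      unfolding subspace_def using subspace_S yS br_0_left br_add_left br_scale_left
      by (auto simp: subspace_0 subspace_add subspace_scale span_0 span_add span_scale)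
  qed
  then show "lie_bracket (negative_part L) x y \<in> lie_space (negative_part L)"
    using x by (auto simp: negative_part_def)
qed

lemma negative_part_isomorphic:
  assumes "graded_lie_algebra L" "graded_lie_algebra M" "graded_lie_hom L M \<phi>"
    "inj_on \<phi> (lie_space L)" "\<And>p. \<phi> ` lie_grade L p = lie_grade M p"
  shows "negative_part L \<cong>\<^sub>g\<^sub>r negative_part M"
proof -
  interpret L: graded_lie L by (rule graded_lie.intro[OF assms(1)])
  let ?N = "\<lambda>L. \<Union>p\<in>{p. p < 0}. lie_grade L p"
  have lin: "linear_on L.S \<phi>" and br: "\<And>x y. x \<in> L.S \<Longrightarrow> y \<in> L.S \<Longrightarrow> \<phi> (L.br x y) = lie_bracket M (\<phi> x) (\<phi> y)"
    using assms(3) by (auto simp: graded_lie_hom_def)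
  obtain h where h: "linear h" "\<And>x. x \<in> L.S \<Longrightarrow> h x = \<phi> x"
    using linear_on_extend[OF L.subspace_S lin] by blast
  have NS: "span (?N L) \<subseteq> L.S" using L.G_S L.subspace_S by (intro span_minimal) auto
  have "\<phi> ` ?N L = ?N M" using assms(5) by (simp add: image_UN)
  moreover have "\<phi> ` span (?N L) = h ` span (?N L)" "\<phi> ` ?N L = h ` ?N L"
    using h(2) NS L.G_S by (auto intro!: image_cong simp: subset_iff)
  ultimately have im: "\<phi> ` span (?N L) = span (?N M)"
    using linear_span_image[OF h(1), of "?N L"] by simp
  have im0: "\<phi> ` {0} = {0}" using linear_on_0[OF lin L.subspace_S] by simp
  have "inj_on \<phi> (span (?N L))" using inj_on_subset[OF assms(4) NS] .
  then show ?thesis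
    unfolding graded_lie_isomorphic_def
    using im im0 linear_on_subset[OF lin NS] br NS assms(5)
    by (intro exI[of _ \<phi>]) (auto simp: graded_lie_hom_def negative_part_def bij_betw_def subset_iff)
qed

definition lie_image :: "('a \<Rightarrow> 'b) \<Rightarrow> 'a::real_vector graded_lie \<Rightarrow> 'b::real_vector graded_lie" where
  "lie_image \<psi> L = \<lparr>lie_space = \<psi> ` lie_space L,
     lie_bracket = (\<lambda>x y. \<psi> (lie_bracket L (inv_into (lie_space L) \<psi> x) (inv_into (lie_space L) \<psi> y))),
     lie_grade = (\<lambda>p. \<psi> ` lie_grade L p)\<rparr>"

lemma graded_lie_algebra_lie_image:
  assumes "graded_lie_algebra L" and lin: "linear_on (lie_space L) \<psi>" and inj: "inj_on \<psi> (lie_space L)"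
  shows "graded_lie_algebra (lie_image \<psi> L)" "graded_lie_hom L (lie_image \<psi> L) \<psi>"
proof -
  interpret graded_lie L by (rule graded_lie.intro[OF assms(1)])
  let ?i = "inv_into S \<psi>"
  have inv: "?i (\<psi> x) = x" if "x \<in> S" for x using inj that by simp
  have add: "\<psi> x + \<psi> y = \<psi> (x + y)" if "x \<in> S" "y \<in> S" for x y using lin that by (simp add: linear_on_add)
  have scale: "r *\<^sub>R \<psi> x = \<psi> (r *\<^sub>R x)" if "x \<in> S" for x r using lin that by (simp add: linear_on_scale)
  have zero: "0 = \<psi> 0" using linear_on_0[OF lin subspace_S] by simp
  have adds: "x + y \<in> S" "r *\<^sub>R x \<in> S" "0 \<in> S" if "x \<in> S" "y \<in> S" for x y r
    using that subspace_S by (auto simp: subspace_add subspace_scale subspace_0)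
  show "graded_lie_algebra (lie_image \<psi> L)"
    unfolding graded_lie_algebra_def lie_image_def graded_lie.simps
  proof (intro conjI ballI allI)
    show "subspace (\<psi> ` S)" using subspace_linear_on_image subspace_S lin by blast
    show "bilinear_on (\<psi> ` S) (\<psi> ` S) (\<lambda>x y. \<psi> (br (?i x) (?i y)))"
      by (auto simp: bilinear_on_def linear_on_def add scale inv adds br_closed
          br_add_left br_add_right br_scale_left br_scale_right)
    show "internal_direct_sum UNIV (\<lambda>p. \<psi> ` G p) (\<psi> ` S)"
      by (rule internal_direct_sum_image[OF direct lin inj])
    show "\<psi> (br (?i x) (?i y)) \<in> \<psi> ` S" if "x \<in> \<psi> ` S" "y \<in> \<psi> ` S" for x y
      using that by (auto simp: inv br_closed)
    show "\<psi> (br (?i x) (?i x)) = 0" if "x \<in> \<psi> ` S" for x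
      using that zero by (auto simp: inv br_self)
    show "\<psi> (br (?i x) (?i (\<psi> (br (?i y) (?i z))))) + \<psi> (br (?i y) (?i (\<psi> (br (?i z) (?i x))))) +
       \<psi> (br (?i z) (?i (\<psi> (br (?i x) (?i y))))) = 0"
      if "x \<in> \<psi> ` S" "y \<in> \<psi> ` S" "z \<in> \<psi> ` S" for x y z
      using that zero by (auto simp: inv br_closed add adds jacobi0)
    show "\<psi> (br (?i x) (?i y)) \<in> \<psi> ` G (p + q)" if "x \<in> \<psi> ` G p" "y \<in> \<psi> ` G q" for x y p q
      using that br_grade G_SD by (auto simp: inv)
  qed
  show "graded_lie_hom L (lie_image \<psi> L) \<psi>"
    using lin by (auto simp: graded_lie_hom_def lie_image_def inv)
qed

section \<open>Uniqueness of the maximal transitive prolongation\<close>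

text \<open>Both algebras embed into each other, the second one through its copy on sequences. Their
  components are finite-dimensional, so the embedding of \<open>g\<close> is onto in each degree.\<close>

theorem full_prolongation_unique:
  fixes L :: "'l::real_vector graded_lie" and g :: "'g::real_vector graded_lie"
  assumes full: "full_prolongation L" and mL: "negative_part L \<cong>\<^sub>g\<^sub>r m"
    and max: "maximal_transitive_prolongation m g"
  shows "g \<cong>\<^sub>g\<^sub>r L"
proof -
  have tp: "transitive_prolongation m g" using max by (simp add: maximal_transitive_prolongation_def)
  have glaL: "graded_lie_algebra L" and fdL: "\<And>p. finite_dimensional (lie_grade L p)"
    using full by (simp_all add: full_prolongation_def)
  have glag: "graded_lie_algebra g" and fdg: "\<And>p. finite_dimensional (lie_grade g p)"
    and gm: "negative_part g \<cong>\<^sub>g\<^sub>r m"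
    using tp by (simp_all add: transitive_prolongation_def)
  interpret L: graded_lie L by (rule graded_lie.intro[OF glaL])
  interpret g: graded_lie g by (rule graded_lie.intro[OF glag])
  have "negative_part g \<cong>\<^sub>g\<^sub>r negative_part L"
    by (rule graded_lie_isomorphic_trans[OF gm negative_part_isomorphic_sym[OF glaL mL]])
  then obtain \<alpha> where \<alpha>: "graded_lie_hom (negative_part g) (negative_part L) \<alpha>"
    "inj_on \<alpha> (lie_space (negative_part g))"
    "\<And>p. \<alpha> ` lie_grade (negative_part g) p = lie_grade (negative_part L) p"
    by (auto simp: graded_lie_isomorphic_def bij_betw_def)
  have gN: "g.G p \<subseteq> lie_space (negative_part g)" if "p < 0" for p
    using that by (auto simp: negative_part_def intro: span_base)
  have "prolongation_embedding L g \<alpha>"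
  proof
    show "full_prolongation L" by fact
    show "X = 0" if "0 \<le> p" "X \<in> g.G p" "\<And>s. s \<in> g.G (-1) \<Longrightarrow> g.br X s = 0" for p X
      using tp that by (simp add: transitive_prolongation_def)
    fix p :: int assume p: "p < 0"
    have "linear_on (lie_space (negative_part g)) \<alpha>" using \<alpha>(1) by (simp add: graded_lie_hom_def)
    then show "linear_on (g.G p) \<alpha>" using linear_on_subset gN[OF p] by blast
    show "\<alpha> ` g.G p = L.G p" using \<alpha>(3)[of p] p by (simp add: negative_part_def)
    show "inj_on \<alpha> (g.G p)" using inj_on_subset[OF \<alpha>(2) gN[OF p]] .
    fix q x y assume q: "(q::int) < 0" "x \<in> g.G p" "y \<in> g.G q"
    then have "x \<in> lie_space (negative_part g)" "y \<in> lie_space (negative_part g)" using gN p by blast+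
    then have "\<alpha> (lie_bracket (negative_part g) x y) = lie_bracket (negative_part L) (\<alpha> x) (\<alpha> y)"
      using \<alpha>(1) by (simp add: graded_lie_hom_def)
    then show "\<alpha> (g.br x y) = L.br (\<alpha> x) (\<alpha> y)" by (simp add: negative_part_def)
  qed
  then obtain \<phi> where \<phi>: "graded_lie_hom g L \<phi>" "inj_on \<phi> g.S"
    using prolongation_embedding.embedding by blast
  \<comment> \<open>conversely, a copy of \<open>L\<close> embeds into \<open>g\<close>\<close>
  obtain \<psi> :: "'l \<Rightarrow> nat \<Rightarrow> real" where \<psi>: "linear_on L.S \<psi>" "inj_on \<psi> L.S"
    using countable_coordinates[OF L.S_span _ fdL] by auto
  define M where "M = lie_image \<psi> L"
  have M: "graded_lie_algebra M" "graded_lie_hom L M \<psi>"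
    using graded_lie_algebra_lie_image[OF glaL \<psi>] by (simp_all add: M_def)
  have MG: "lie_grade M p = \<psi> ` L.G p" for p by (simp add: M_def lie_image_def)
  have \<psi>0: "\<psi> x = 0 \<longleftrightarrow> x = 0" if "x \<in> L.S" for x
    using \<psi> that linear_on_0[OF \<psi>(1) L.subspace_S] subspace_0[OF L.subspace_S] by (metis inj_onD)
  have NM: "negative_part L \<cong>\<^sub>g\<^sub>r negative_part M"
    by (rule negative_part_isomorphic[OF glaL M \<psi>(2)]) (simp add: MG)
  have "transitive_prolongation m M"
    unfolding transitive_prolongation_def
  proof (intro conjI allI ballI impI)
    show "graded_lie_algebra M" by fact
    show "finite_dimensional (lie_grade M p)" for p
      unfolding MG using linear_on_subset[OF \<psi>(1) L.G_S] inj_on_subset[OF \<psi>(2) L.G_S]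
      by (rule finite_dimensional_linear_image[OF fdL])
    show "negative_part M \<cong>\<^sub>g\<^sub>r m"
      by (rule graded_lie_isomorphic_trans[OF negative_part_isomorphic_sym[OF glaL NM] mL])
    fix p :: int and X assume p: "0 \<le> p" and X: "X \<in> lie_grade M p"
      and X0: "\<forall>s\<in>lie_grade M (-1). lie_bracket M X s = 0"
    obtain x where x: "x \<in> L.G p" "X = \<psi> x" using X MG by auto
    have "L.br x s = 0" if s: "s \<in> L.G (-1)" for s
    proof -
      have xs: "x \<in> L.S" "s \<in> L.S" using x s L.G_SD by auto
      have "\<psi> (L.br x s) = lie_bracket M (\<psi> x) (\<psi> s)"
        using M(2) xs by (simp add: graded_lie_hom_def)
      then have "\<psi> (L.br x s) = 0" using X0 s x MG by simp
      then show ?thesis using \<psi>0 L.br_closed xs by blast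
    qed
    moreover have "-1 \<le> p" using p by simp
    ultimately have "x = 0" using full x(1) by (simp add: full_prolongation_def)
    then show "X = 0" using x \<psi>0 subspace_0[OF L.subspace_S] by simp
  qed
  then obtain \<omega> where \<omega>: "graded_lie_hom M g \<omega>" "inj_on \<omega> (lie_space M)"
    using max unfolding maximal_transitive_prolongation_def by meson
  \<comment> \<open>since \<open>L\<close> embeds into \<open>g\<close>, no component of \<open>g\<close> is smaller than that of \<open>L\<close>\<close>
  have \<phi>G: "\<phi> ` g.G p = L.G p" for p
  proof (rule subspace_dim_eq[OF fdL])
    have lin: "linear_on (g.G p) \<phi>" using \<phi>(1) linear_on_subset g.G_S unfolding graded_lie_hom_def by meson
    have inj: "inj_on \<phi> (g.G p)" using \<phi>(2) g.G_S inj_on_subset by blast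
    show sub: "subspace (\<phi> ` g.G p)" by (rule subspace_linear_on_image[OF g.subspace_G lin])
    show le: "\<phi> ` g.G p \<subseteq> L.G p" using \<phi>(1) by (simp add: graded_lie_hom_def)
    interpret M: graded_lie M by (rule graded_lie.intro[OF M(1)])
    have fdM: "finite_dimensional (M.G p)" "dim (M.G p) = dim (L.G p)"
      unfolding MG using linear_on_subset[OF \<psi>(1) L.G_S] inj_on_subset[OF \<psi>(2) L.G_S]
      by (auto intro!: finite_dimensional_linear_image[OF fdL] dim_linear_image[OF fdL])
    have linM: "linear_on (M.G p) \<omega>" using \<omega>(1) linear_on_subset M.G_S unfolding graded_lie_hom_def by meson
    have "inj_on \<omega> (M.G p)" using \<omega>(2) M.G_S inj_on_subset by blast
    then have "dim (\<omega> ` M.G p) = dim (L.G p)" using dim_linear_image[OF fdM(1) linM] fdM(2) by simp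
    moreover have "\<omega> ` M.G p \<subseteq> g.G p" using \<omega>(1) by (simp add: graded_lie_hom_def)
    ultimately have "dim (L.G p) \<le> dim (g.G p)"
      using dim_mono_on[OF fdg subspace_linear_on_image[OF M.subspace_G linM]] by metis
    moreover have "dim (\<phi> ` g.G p) = dim (g.G p)" by (rule dim_linear_image[OF fdg lin inj])
    ultimately show "dim (\<phi> ` g.G p) = dim (L.G p)" using dim_mono_on[OF fdL sub le] by simp
  qed
  have "\<phi> ` g.S = L.S"
  proof
    show "\<phi> ` g.S \<subseteq> L.S" using \<phi>(1) by (simp add: graded_lie_hom_def)
    have "subspace (\<phi> ` g.S)"
      using \<phi>(1) g.subspace_S by (intro subspace_linear_on_image) (auto simp: graded_lie_hom_def)
    moreover have "(\<Union>p. L.G p) \<subseteq> \<phi> ` g.S" using \<phi>G g.G_S by blast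
    ultimately show "L.S \<subseteq> \<phi> ` g.S" unfolding L.S_span by (intro span_minimal) auto
  qed
  then show ?thesis
    unfolding graded_lie_isomorphic_def bij_betw_def using \<phi> \<phi>G by blast
qed

section \<open>Weighted homogeneous polynomials\<close>

lemmas pointwise = plus_fun_apply zero_fun_apply times_fun_apply one_fun_apply minus_apply uminus_apply
text \<open>Polynomial identities are proved by ring arithmetic on functions; passing to values is
  requested explicitly.\<close>

declare pointwise [simp del]

lemma sum_fun_apply: "(\<Sum>i\<in>A. f i) x = (\<Sum>i\<in>A. f i x)"
  for f :: "'i \<Rightarrow> 'a \<Rightarrow> 'b::comm_monoid_add"
  by (induction A rule: infinite_finite_induct) (simp_all add: pointwise)

definition monomial :: "nat \<Rightarrow> 'k::real_normed_field \<Rightarrow> (contact_coord \<Rightarrow> nat) \<Rightarrow> (contact_coord \<Rightarrow> 'k) \<Rightarrow> 'k"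
    where
  "monomial l k e = (\<lambda>x. k * (\<Prod>a\<in>coords l. x a ^ e a))"

definition degree_of :: "nat \<Rightarrow> (contact_coord \<Rightarrow> nat) \<Rightarrow> int" where
  "degree_of l e = (\<Sum>a\<in>coords l. weight a * int (e a))"

lemma finite_coords [simp]: "finite (coords l)"
  by (simp add: coords_def)

lemma weight_pos: "weight a > 0"
  by (cases a) auto

lemma degree_of_nonneg: "degree_of l e \<ge> 0"
  unfolding degree_of_def by (intro sum_nonneg mult_nonneg_nonneg) (auto intro: less_imp_le[OF weight_pos])

lemma polynomials_alt: "polynomials l = span {monomial l k e |k e. True}"
  and homogeneous_alt: "homogeneous_polynomials l w = span {monomial l k e |k e. degree_of l e = w}"
  by (simp_all add: polynomials_def homogeneous_polynomials_def monomial_def degree_of_def)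

lemma monomial_0: "monomial l 0 e = 0"
  by (simp add: monomial_def fun_eq_iff pointwise)

lemma scaleR_monomial: "c *\<^sub>R monomial l k e = monomial l (c *\<^sub>R k) e"
  by (simp add: monomial_def fun_eq_iff pointwise scaleR_fun_def)

lemma homogeneous_induct [consumes 1, case_names zero monomial add]:
  assumes "f \<in> homogeneous_polynomials l w" "P 0"
    "\<And>k e. degree_of l e = w \<Longrightarrow> P (monomial l k e)"
    "\<And>k e g. degree_of l e = w \<Longrightarrow> g \<in> homogeneous_polynomials l w \<Longrightarrow> P (monomial l k e) \<Longrightarrow> P g \<Longrightarrow>
        P (monomial l k e + g)"
  shows "P f"
proof -
  have "f \<in> span {monomial l k e |k e. degree_of l e = w}" using assms(1) by (simp add: homogeneous_alt)
  then have "f \<in> homogeneous_polynomials l w \<and> P f"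
  proof (induction rule: span_induct_alt)
    case base then show ?case using assms(2) by (simp add: homogeneous_alt span_0)
  next
    case (step c x y)
    then obtain k e where e: "degree_of l e = w" "x = monomial l k e" by blast
    have "monomial l (c *\<^sub>R k) e \<in> homogeneous_polynomials l w"
      using e by (auto simp: homogeneous_alt intro!: span_base)
    then show ?case using assms(3,4)[OF e(1)] step(2) e
      by (auto simp: scaleR_monomial homogeneous_alt span_add)
  qed
  then show ?thesis ..
qed

lemma homogeneous_subset: "homogeneous_polynomials l w \<subseteq> polynomials l"
  unfolding homogeneous_alt polynomials_alt by (intro span_mono) blast

lemma homogeneous_polynomial: "f \<in> homogeneous_polynomials l w \<Longrightarrow> f \<in> polynomials l"
  using homogeneous_subset by blast

lemma subspace_polynomials: "subspace (polynomials l)" "subspace (homogeneous_polynomials l w)"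
  by (simp_all add: polynomials_alt homogeneous_alt)

lemma monomial_in: "degree_of l e = w \<Longrightarrow> monomial l k e \<in> homogeneous_polynomials l w"
  unfolding homogeneous_alt by (rule span_base) blast

lemma polynomials_span_homogeneous: "polynomials l = span (\<Union>w. homogeneous_polynomials l w)"
proof
  show "polynomials l \<subseteq> span (\<Union>w. homogeneous_polynomials l w)"
    unfolding polynomials_alt by (intro span_mono) (auto intro: monomial_in)
  show "span (\<Union>w. homogeneous_polynomials l w) \<subseteq> polynomials l"
    using homogeneous_polynomial by (intro span_minimal subspace_polynomials) auto
qed

lemma polynomial_induct [consumes 1, case_names zero monomial add]:
  assumes "f \<in> polynomials l" "P 0"
    "\<And>k e. P (monomial l k e)"
    "\<And>k e g. g \<in> polynomials l \<Longrightarrow> P (monomial l k e) \<Longrightarrow> P g \<Longrightarrow> P (monomial l k e + g)"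
  shows "P f"
proof -
  have "f \<in> span {monomial l k e |k e. True}" using assms(1) by (simp add: polynomials_alt)
  then have "f \<in> polynomials l \<and> P f"
  proof (induction rule: span_induct_alt)
    case base then show ?case using assms(2) by (simp add: polynomials_alt span_0)
  next
    case (step c x y)
    then obtain k e where e: "x = monomial l k e" by blast
    have "monomial l (c *\<^sub>R k) e \<in> polynomials l" by (rule homogeneous_polynomial[OF monomial_in]) simp
    then show ?case using assms(3,4) step(2) e
      by (auto simp: scaleR_monomial polynomials_alt span_add)
  qed
  then show ?thesis ..
qed

lemma monomial_polynomial: "monomial l k e \<in> polynomials l"
  by (rule homogeneous_polynomial[OF monomial_in]) simp

lemma homogeneous_plus: "f \<in> homogeneous_polynomials l w \<Longrightarrow> g \<in> homogeneous_polynomials l w \<Longrightarrow>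
    f + g \<in> homogeneous_polynomials l w"
  and homogeneous_diff: "f \<in> homogeneous_polynomials l w \<Longrightarrow> g \<in> homogeneous_polynomials l w \<Longrightarrow>
    f - g \<in> homogeneous_polynomials l w"
  and homogeneous_uminus: "f \<in> homogeneous_polynomials l w \<Longrightarrow> - f \<in> homogeneous_polynomials l w"
  and homogeneous_0: "0 \<in> homogeneous_polynomials l w"
  and homogeneous_sum: "(\<And>i. i \<in> A \<Longrightarrow> h i \<in> homogeneous_polynomials l w) \<Longrightarrow>
    sum h A \<in> homogeneous_polynomials l w"
  and polynomial_plus: "f \<in> polynomials l \<Longrightarrow> g \<in> polynomials l \<Longrightarrow> f + g \<in> polynomials l"
  and polynomial_diff: "f \<in> polynomials l \<Longrightarrow> g \<in> polynomials l \<Longrightarrow> f - g \<in> polynomials l"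
  and polynomial_uminus: "f \<in> polynomials l \<Longrightarrow> - f \<in> polynomials l"
  and polynomial_0: "0 \<in> polynomials l"
  and polynomial_sum: "(\<And>i. i \<in> A \<Longrightarrow> h i \<in> polynomials l) \<Longrightarrow> sum h A \<in> polynomials l"
  by (simp_all add: subspace_add[OF subspace_polynomials(1)] subspace_add[OF subspace_polynomials(2)]
    subspace_diff[OF subspace_polynomials(1)] subspace_diff[OF subspace_polynomials(2)]
    subspace_neg[OF subspace_polynomials(1)] subspace_neg[OF subspace_polynomials(2)]
    subspace_0[OF subspace_polynomials(1)] subspace_0[OF subspace_polynomials(2)]
    subspace_sum[OF subspace_polynomials(1)] subspace_sum[OF subspace_polynomials(2)])

lemma degree_of_add: "degree_of l (\<lambda>a. e a + e' a) = degree_of l e + degree_of l e'"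
  by (simp add: degree_of_def sum.distrib algebra_simps)

lemma monomial_mult: "monomial l k e * monomial l k' e' = monomial l (k * k') (\<lambda>a. e a + e' a)"
  by (simp add: monomial_def fun_eq_iff pointwise power_add prod.distrib)

lemma homogeneous_mult:
  assumes "f \<in> homogeneous_polynomials l v" "g \<in> homogeneous_polynomials l w"
  shows "f * g \<in> homogeneous_polynomials l (v + w)"
  using assms(1)
proof (induction rule: homogeneous_induct)
  case (monomial k e)
  note e = monomial
  from assms(2) show ?case
  proof (induction rule: homogeneous_induct)
    case (monomial k' e')
    then show ?case using e by (auto simp: monomial_mult degree_of_add intro!: monomial_in)
  qed (simp_all add: distrib_left homogeneous_plus homogeneous_0)
qed (simp_all add: distrib_right homogeneous_plus homogeneous_0)

lemma polynomial_mult: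
  assumes "f \<in> polynomials l" "g \<in> polynomials l"
  shows "f * g \<in> polynomials l"
  using assms(1)
proof (induction rule: polynomial_induct)
  case (monomial k e)
  from assms(2) show ?case
  proof (induction rule: polynomial_induct)
    case (monomial k' e')
    then show ?case by (auto simp: monomial_mult intro!: monomial_polynomial)
  qed (simp_all add: distrib_left polynomial_plus polynomial_0)
qed (simp_all add: distrib_right polynomial_plus polynomial_0)

definition const :: "'k \<Rightarrow> (contact_coord \<Rightarrow> 'k) \<Rightarrow> 'k" where "const k = (\<lambda>_. k)"
definition coord :: "contact_coord \<Rightarrow> (contact_coord \<Rightarrow> 'k) \<Rightarrow> 'k" where "coord a = (\<lambda>x. x a)"

lemma homogeneous_const: "const k \<in> homogeneous_polynomials l 0"
proof -
  have "const k = monomial l k (\<lambda>_. 0)" by (simp add: const_def monomial_def)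
  then show ?thesis by (simp add: monomial_in degree_of_def)
qed

lemma homogeneous_coord:
  assumes "a \<in> coords l" shows "(coord a :: (contact_coord \<Rightarrow> 'a::real_normed_field) \<Rightarrow> 'a) \<in>
      homogeneous_polynomials l (weight a)"
proof -
  let ?e = "\<lambda>b. if b = a then 1 else 0"
  have "(\<Prod>b\<in>coords l. x b ^ ?e b) = x a" for x :: "contact_coord \<Rightarrow> 'a"
    using assms by (simp add: if_distrib[of "\<lambda>n. x _ ^ n"] prod.delta cong: if_cong)
  then have "coord a = (monomial l 1 ?e :: (contact_coord \<Rightarrow> 'a) \<Rightarrow> 'a)"
    unfolding coord_def monomial_def by simp
  moreover have "degree_of l ?e = weight a"
    using assms by (simp add: degree_of_def if_distrib[of int] if_distrib[of "\<lambda>n. weight _ * n"] cong: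
        if_cong)
  ultimately show ?thesis by (simp add: monomial_in)
qed

lemma polynomial_const: "const k \<in> polynomials l"
  and polynomial_coord: "a \<in> coords l \<Longrightarrow> coord a \<in> polynomials l"
  using homogeneous_const homogeneous_coord homogeneous_polynomial by blast+

lemma homogeneous_const_mult: "f \<in> homogeneous_polynomials l w \<Longrightarrow> const k * f \<in> homogeneous_polynomials l w"
  using homogeneous_mult[OF homogeneous_const] by fastforce

lemma homogeneous_negative: "f \<in> homogeneous_polynomials l w \<Longrightarrow> w < 0 \<Longrightarrow> f = 0"
  by (induction rule: homogeneous_induct) (use degree_of_nonneg not_less in blast)+

lemma homogeneous_degree_0: "f \<in> homogeneous_polynomials l 0 \<Longrightarrow> \<exists>k. f = const k"
proof (induction rule: homogeneous_induct)
  case zero show ?case by (auto simp: const_def fun_eq_iff pointwise)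
next
  case (monomial k e)
  then have "\<forall>a\<in>coords l. weight a * int (e a) = 0"
    unfolding degree_of_def
    by (subst (asm) sum_nonneg_eq_0_iff) (auto intro!: mult_nonneg_nonneg less_imp_le[OF weight_pos])
  then have "\<forall>a\<in>coords l. e a = 0" using weight_pos by (metis mult_eq_0_iff of_nat_eq_0_iff less_irrefl)
  then show ?case by (intro exI[of _ k]) (simp add: monomial_def const_def)
next
  case (add k e g)
  then obtain c d where "monomial l k e = const c" "g = const d" by blast
  then show ?case by (intro exI[of _ "c + d"]) (simp add: const_def fun_eq_iff pointwise)
qed

section \<open>Partial derivatives and the Euler operator\<close>

lemma has_derivative_monomial:
  assumes "a \<in> coords l"
  shows "((\<lambda>t. monomial l k e (x(a := t))) has_field_derivative
      monomial l (k * of_nat (e a)) (e(a := e a - 1)) (x(a := t))) (at t)"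
proof -
  have c: "coords l = insert a (coords l - {a})" using assms by blast
  have 1: "monomial l k e (x(a := t)) = k * (\<Prod>b\<in>coords l - {a}. x b ^ e b) * t ^ e a" for t
    unfolding monomial_def by (subst c, subst prod.insert) (auto simp: ac_simps intro!: prod.cong)
  have 2: "monomial l (k * of_nat (e a)) (e(a := e a - 1)) (x(a := t)) =
      k * (\<Prod>b\<in>coords l - {a}. x b ^ e b) * (of_nat (e a) * t ^ (e a - 1))"
    unfolding monomial_def by (subst c, subst prod.insert) (auto simp: ac_simps intro!: prod.cong)
  show ?thesis unfolding 1 2
    by (rule DERIV_cmult) (use DERIV_pow in \<open>auto intro!: derivative_eq_intros\<close>)
qed

lemma partial_deriv_eqI:
  "((\<lambda>t. f (x(a := t))) has_field_derivative D) (at (x a)) \<Longrightarrow> partial_deriv a f x = D"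
  unfolding partial_deriv_def by (rule DERIV_imp_deriv)

lemma partial_deriv_monomial:
  assumes "a \<in> coords l"
  shows "partial_deriv a (monomial l k e) = monomial l (k * of_nat (e a)) (e(a := e a - 1))"
proof
  fix x
  show "partial_deriv a (monomial l k e) x = monomial l (k * of_nat (e a)) (e(a := e a - 1)) x"
    using has_derivative_monomial[OF assms, of k e x "x a"] by (intro partial_deriv_eqI) simp
qed

lemma has_partial_deriv:
  assumes "f \<in> polynomials l" "a \<in> coords l"
  shows "((\<lambda>t. f (x(a := t))) has_field_derivative partial_deriv a f x) (at (x a))"
proof -
  have "\<exists>D. ((\<lambda>t. f (x(a := t))) has_field_derivative D) (at (x a))"
    using assms(1)
  proof (induction rule: polynomial_induct)
    case zero show ?case by (auto simp: pointwise intro!: exI[of _ 0])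
  next
    case (monomial k e) then show ?case using has_derivative_monomial[OF assms(2)] by blast
  next
    case (add k e g)
    then show ?case by (auto simp: pointwise intro: DERIV_add)
  qed
  then show ?thesis using partial_deriv_eqI by blast
qed

lemma partial_deriv_add:
  assumes "f \<in> polynomials l" "g \<in> polynomials l" "a \<in> coords l"
  shows "partial_deriv a (f + g) = partial_deriv a f + partial_deriv a g"
proof
  fix x
  show "partial_deriv a (f + g) x = (partial_deriv a f + partial_deriv a g) x"
    unfolding pointwise
    by (intro partial_deriv_eqI) (simp add: DERIV_add has_partial_deriv[OF assms(1,3)]
        has_partial_deriv[OF assms(2,3)])
qed

lemma partial_deriv_mult:
  assumes "f \<in> polynomials l" "g \<in> polynomials l" "a \<in> coords l"
  shows "partial_deriv a (f * g) = partial_deriv a f * g + f * partial_deriv a g"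
proof
  fix x
  have "((\<lambda>t. f (x(a := t)) * g (x(a := t))) has_field_derivative
    partial_deriv a f x * g (x(a := x a)) + partial_deriv a g x * f (x(a := x a))) (at (x a))"
    by (rule DERIV_mult[OF has_partial_deriv[OF assms(1,3)] has_partial_deriv[OF assms(2,3)]])
  then show "partial_deriv a (f * g) x = (partial_deriv a f * g + f * partial_deriv a g) x"
    by (intro partial_deriv_eqI) (simp add: pointwise mult.commute)
qed

lemma partial_deriv_const [simp]: "partial_deriv a (const k) = 0"
  by (auto simp: fun_eq_iff pointwise const_def intro!: partial_deriv_eqI)

lemma partial_deriv_coord [simp]: "partial_deriv a (coord b) = const (if a = b then 1 else 0)"
  by (auto simp: fun_eq_iff pointwise coord_def const_def intro!: partial_deriv_eqI)

lemma partial_deriv_0 [simp]: "partial_deriv a 0 = 0"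
  using partial_deriv_const[of a 0] by (simp add: const_def zero_fun_def)

lemma partial_deriv_const_mult:
  assumes "f \<in> polynomials l" "a \<in> coords l"
  shows "partial_deriv a (const k * f) = const k * partial_deriv a f"
  using partial_deriv_mult[OF polynomial_const assms] by simp

lemma scaleR_const_mult: "r *\<^sub>R f = const (of_real r) * f"
  by (simp add: const_def fun_eq_iff pointwise scaleR_fun_def scaleR_conv_of_real)

lemma linear_on_partial_deriv: "a \<in> coords l \<Longrightarrow> linear_on (polynomials l) (partial_deriv a)"
  by (simp add: linear_on_def partial_deriv_add scaleR_const_mult partial_deriv_const_mult)

lemmas partial_deriv_diff = linear_on_diff[OF linear_on_partial_deriv subspace_polynomials(1)]
  and partial_deriv_uminus = linear_on_neg[OF linear_on_partial_deriv]
  and partial_deriv_sum = linear_on_sum[OF linear_on_partial_deriv subspace_polynomials(1)]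

lemma homogeneous_partial_deriv:
  assumes "f \<in> homogeneous_polynomials l w" "a \<in> coords l"
  shows "partial_deriv a f \<in> homogeneous_polynomials l (w - weight a)"
  using assms(1)
proof (induction rule: homogeneous_induct)
  case zero then show ?case by (simp add: homogeneous_0)
next
  case (monomial k e)
  show ?case
  proof (cases "e a = 0")
    case True then show ?thesis using assms(2)
        by (simp add: partial_deriv_monomial monomial_0 homogeneous_0)
  next
    case False
    have c: "coords l = insert a (coords l - {a})" using assms(2) by blast
    have "degree_of l e = weight a * int (e a) + (\<Sum>b\<in>coords l - {a}. weight b * int (e b))"
      unfolding degree_of_def by (subst c, subst sum.insert) auto
    moreover have "degree_of l (e(a := e a - 1)) = weight a * int (e a - 1) + (\<Sum>b\<in>coords l - {a}.
        weight b * int (e b))"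
      unfolding degree_of_def by (subst c, subst sum.insert) (auto intro!: sum.cong)
    ultimately have "degree_of l (e(a := e a - 1)) = w - weight a"
      using monomial False by (simp add: of_nat_diff algebra_simps)
    then show ?thesis using assms(2) by (simp add: partial_deriv_monomial monomial_in)
  qed
next
  case (add k e g)
  then show ?case using assms(2) by (simp add: partial_deriv_add[OF monomial_polynomial
      homogeneous_polynomial] homogeneous_plus)
qed

lemma polynomial_partial_deriv:
  assumes "f \<in> polynomials l" "a \<in> coords l"
  shows "partial_deriv a f \<in> polynomials l"
  using assms(1)
  by (induction rule: polynomial_induct)
    (simp_all add: assms(2) polynomial_0 partial_deriv_monomial monomial_polynomial
      partial_deriv_add[OF monomial_polynomial] polynomial_plus)

lemma partial_deriv_commute:
  assumes "f \<in> polynomials l" "a \<in> coords l" "b \<in> coords l"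
  shows "partial_deriv a (partial_deriv b f) = partial_deriv b (partial_deriv a f)"
  using assms(1)
proof (induction rule: polynomial_induct)
  case (monomial k e)
  then show ?case using assms(2,3)
    by (cases "a = b") (simp_all add: partial_deriv_monomial fun_upd_twist mult.commute mult.left_commute)
next
  case (add k e g)
  then show ?case using assms(2,3)
    by (simp add: partial_deriv_add[OF monomial_polynomial]
        partial_deriv_add[of _ l, OF polynomial_partial_deriv polynomial_partial_deriv] monomial_polynomial)
qed simp

definition euler :: "nat \<Rightarrow> ((contact_coord \<Rightarrow> 'k::real_normed_field) \<Rightarrow> 'k) \<Rightarrow> (contact_coord \<Rightarrow> 'k) \<Rightarrow> 'k" where
  "euler l f = (\<Sum>a\<in>coords l. const (of_int (weight a)) * coord a * partial_deriv a f)"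

lemma linear_on_euler:
  "linear_on (polynomials l :: ((contact_coord \<Rightarrow> 'k::real_normed_field) \<Rightarrow> 'k) set) (euler l)"
proof -
  have "euler l (f + g) = euler l f + euler l g" if "f \<in> polynomials l" "g \<in> polynomials l"
    for f g :: "(contact_coord \<Rightarrow> 'k) \<Rightarrow> 'k"
    using that by (simp add: euler_def partial_deriv_add distrib_left sum.distrib)
  moreover have "euler l (r *\<^sub>R f) = r *\<^sub>R euler l f" if "f \<in> polynomials l"
    for f :: "(contact_coord \<Rightarrow> 'k) \<Rightarrow> 'k" and r
    using that unfolding euler_def scaleR_const_mult
    by (simp add: partial_deriv_const_mult sum_distrib_left mult.left_commute)
  ultimately show ?thesis by (simp add: linear_on_def)
qed

lemma euler_homogeneous:
  assumes "f \<in> homogeneous_polynomials l w"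
  shows "euler l f = const (of_int w) * f"
  using assms
proof (induction rule: homogeneous_induct)
  case zero then show ?case by (simp add: euler_def)
next
  case (monomial k e)
  have 1: "coord a * monomial l (k * of_nat (e a)) (e(a := e a - 1)) = const (of_nat (e a)) * monomial l
      k e"
    if "a \<in> coords l" for a
  proof (cases "e a = 0")
    case False
    have c: "coords l = insert a (coords l - {a})" using that by blast
    have "x a * monomial l (k * of_nat (e a)) (e(a := e a - 1)) x = of_nat (e a) * monomial l k e x" for x
      unfolding monomial_def
      by (subst (1 2) c, subst (1 2) prod.insert)
        (use False in \<open>auto simp: ac_simps power_eq_if intro!: prod.cong\<close>)
    then show ?thesis by (simp add: coord_def const_def fun_eq_iff pointwise)
  qed (simp add: monomial_0 const_def fun_eq_iff pointwise)
  have "euler l (monomial l k e) = (\<Sum>a\<in>coords l. const (of_int (weight a)) * (const (of_nat (e a)) *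
      monomial l k e))"
    unfolding euler_def
    by (rule sum.cong[OF refl]) (simp only: partial_deriv_monomial 1 mult.assoc)
  also have "\<dots> = const (of_int (degree_of l e)) * monomial l k e"
    by (simp add: fun_eq_iff pointwise const_def degree_of_def sum_distrib_right mult.assoc sum_fun_apply)
  finally show ?case using monomial by simp
next
  case (add k e g)
  then show ?case
    using linear_on_add[OF linear_on_euler monomial_polynomial homogeneous_polynomial[OF add(2)]]
    by (simp add: distrib_left)
qed

section \<open>Decomposition into homogeneous components\<close>

text \<open>Homogeneous polynomials are eigenvectors of the Euler operator with distinct eigenvalues:
  subtracting \<open>v\<close> from the operator kills the component of weight \<open>v\<close> and rescales the others.\<close>

lemma homogeneous_independent:
  fixes f :: "int \<Rightarrow> (contact_coord \<Rightarrow> 'k::real_normed_field) \<Rightarrow> 'k"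
  assumes "finite A" "\<And>w. w \<in> A \<Longrightarrow> f w \<in> homogeneous_polynomials l w" "sum f A = 0" "w \<in> A"
  shows "f w = 0"
  using assms
proof (induction arbitrary: f w rule: finite_induct)
  case (insert v A)
  have f: "f u \<in> homogeneous_polynomials l u" if "u \<in> insert v A" for u using insert.prems(1) that by simp
  let ?c = "\<lambda>u. const (of_int (u - v)) :: (contact_coord \<Rightarrow> 'k) \<Rightarrow> 'k"
  have "0 = euler l (sum f (insert v A))"
    unfolding insert.prems(2) by (rule linear_on_0[OF linear_on_euler subspace_polynomials(1), symmetric])
  also have "\<dots> = (\<Sum>u\<in>insert v A. euler l (f u))"
    using f homogeneous_polynomial by (intro linear_on_sum[OF linear_on_euler subspace_polynomials(1)])
        blast
  also have "\<dots> = (\<Sum>u\<in>insert v A. const (of_int u) * f u)"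
    by (rule sum.cong) (use f euler_homogeneous in auto)
  also have "\<dots> = (\<Sum>u\<in>insert v A. ?c u * f u + const (of_int v) * f u)"
    by (rule sum.cong) (simp_all add: fun_eq_iff pointwise const_def algebra_simps)
  also have "\<dots> = (\<Sum>u\<in>insert v A. ?c u * f u) + const (of_int v) * sum f (insert v A)"
    by (simp only: sum.distrib sum_distrib_left)
  finally have "(\<Sum>u\<in>insert v A. ?c u * f u) = 0" using insert.prems(2) by simp
  moreover have "?c v * f v = 0" by (simp add: fun_eq_iff pointwise const_def)
  ultimately have "(\<Sum>u\<in>A. ?c u * f u) = 0" using insert.hyps by simp
  then have z: "?c u * f u = 0" if "u \<in> A" for u
    using f that by (intro insert.IH[of "\<lambda>u. ?c u * f u" u]) (auto intro: homogeneous_const_mult)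
  have A0: "f u = 0" if "u \<in> A" for u
  proof -
    have "u \<noteq> v" using that insert.hyps by blast
    then show ?thesis using z[OF that] by (auto simp: fun_eq_iff pointwise const_def)
  qed
  then have "f v = 0" using insert.prems(2) insert.hyps by simp
  with A0 insert.prems(3) show ?case by blast
qed simp

text \<open>All weights are at least one, so the total weight bounds the exponents.\<close>

lemma finite_dimensional_homogeneous:
  "finite_dimensional (homogeneous_polynomials l w :: ((contact_coord \<Rightarrow> 'k::{real_normed_field,
      euclidean_space}) \<Rightarrow> 'k) set)"
proof -
  define E where "E = (coords l \<rightarrow>\<^sub>E {..nat w})"
  define B where "B = (\<lambda>(k, e). monomial l k e) ` ((Basis :: 'k set) \<times> {e \<in> E. degree_of l e = w})"
  have "finite B" unfolding B_def E_def by (intro finite_imageI finite_cartesian_product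
      finite_subset[OF _ finite_PiE[of "coords l" "\<lambda>_. {..nat w}"]]) auto
  moreover have "homogeneous_polynomials l w = span B"
  proof
    show "span B \<subseteq> homogeneous_polynomials l w"
      unfolding homogeneous_alt B_def by (intro span_mono) auto
    have "monomial l k e \<in> span B" if e: "degree_of l e = w" for k :: 'k and e
    proof -
      let ?e = "restrict e (coords l)"
      have m: "monomial l c e = monomial l c ?e" for c :: 'k
          by (simp add: monomial_def fun_eq_iff pointwise)
      have d: "degree_of l ?e = w" using e by (simp add: degree_of_def)
      have "e a \<le> nat w" if "a \<in> coords l" for a
      proof -
        have "weight a * int (e a) \<le> degree_of l e"
          unfolding degree_of_def using that
          by (intro member_le_sum) (auto intro!: mult_nonneg_nonneg less_imp_le[OF weight_pos])
        moreover have "int (e a) \<le> weight a * int (e a)" using weight_pos[of a]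
          by (simp add: mult_le_cancel_right1)
        ultimately show ?thesis using e by simp
      qed
      then have eE: "?e \<in> E" by (auto simp: E_def)
      have "monomial l k ?e = (\<Sum>b\<in>Basis. (k \<bullet> b) *\<^sub>R monomial l b ?e)"
      proof
        fix x
        have "(\<Sum>b\<in>Basis. (k \<bullet> b) *\<^sub>R monomial l b ?e) x = (\<Sum>b\<in>Basis. (k \<bullet> b) *\<^sub>R b) * (\<Prod>a\<in>coords l.
            x a ^ ?e a)"
          by (simp add: sum_fun_apply scaleR_fun_def monomial_def sum_distrib_right)
        then show "monomial l k ?e x = (\<Sum>b\<in>Basis. (k \<bullet> b) *\<^sub>R monomial l b ?e) x"
          by (simp only: euclidean_representation) (simp add: monomial_def)
      qed
      also have "\<dots> \<in> span B"
        using eE d by (intro span_sum span_scale span_base) (auto simp: B_def)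
      finally show ?thesis using m by simp
    qed
    then show "homogeneous_polynomials l w \<subseteq> span B"
      unfolding homogeneous_alt by (intro span_minimal) auto
  qed
  ultimately show ?thesis unfolding finite_dimensional_def by blast
qed

section \<open>Polynomial vector fields\<close>

type_synonym 'k fn = "(contact_coord \<Rightarrow> 'k) \<Rightarrow> 'k"

definition along :: "nat \<Rightarrow> 'k::real_normed_field vfield \<Rightarrow> ((contact_coord \<Rightarrow> 'k) \<Rightarrow> 'k) \<Rightarrow> (contact_coord \<Rightarrow>
    'k) \<Rightarrow> 'k" where
  "along l X f = (\<Sum>c\<in>coords l. X c * partial_deriv c f)"

lemma coords_iff [simp]: "CX i \<in> coords l \<longleftrightarrow> 1 \<le> i \<and> i \<le> l" "CY i \<in> coords l \<longleftrightarrow> 1 \<le> i \<and> i \<le> l" "CZ \<in> coords l"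
  by (auto simp: coords_def)

lemma sum_coords: "(\<Sum>c\<in>coords l. h c) = (\<Sum>i=1..l. h (CX i)) + (\<Sum>i=1..l. h (CY i)) + h CZ"
proof -
  have "(\<Sum>c\<in>coords l. h c) = (\<Sum>c\<in>CX ` {1..l} \<union> CY ` {1..l}. h c) + h CZ"
    unfolding coords_def by (subst sum.union_disjoint) auto
  also have "(\<Sum>c\<in>CX ` {1..l} \<union> CY ` {1..l}. h c) = (\<Sum>c\<in>CX ` {1..l}. h c) + (\<Sum>c\<in>CY ` {1..l}. h c)"
    by (rule sum.union_disjoint) auto
  also have "(\<Sum>c\<in>CX ` {1..l}. h c) = (\<Sum>i=1..l. h (CX i))"
    by (subst sum.reindex) (auto simp: inj_on_def)
  also have "(\<Sum>c\<in>CY ` {1..l}. h c) = (\<Sum>i=1..l. h (CY i))"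
    by (subst sum.reindex) (auto simp: inj_on_def)
  finally show ?thesis .
qed

lemma vfield_bracket_along: "vfield_bracket l X Y a = along l X (Y a) - along l Y (X a)"
  by (simp add: vfield_bracket_def along_def fun_eq_iff pointwise sum_fun_apply sum_subtractf)

lemma polynomial_vfieldD: "X \<in> polynomial_vfields l \<Longrightarrow> X a \<in> polynomials l"
  by (cases "a \<in> coords l") (simp_all add: polynomial_vfields_def polynomial_0)

lemma polynomial_vfield_outside: "X \<in> polynomial_vfields l \<Longrightarrow> a \<notin> coords l \<Longrightarrow> X a = 0"
  by (simp add: polynomial_vfields_def)

lemma polynomial_along: "X \<in> polynomial_vfields l \<Longrightarrow> f \<in> polynomials l \<Longrightarrow> along l X f \<in> polynomials l"
  unfolding along_def
  by (intro polynomial_sum polynomial_mult polynomial_vfieldD[of X] polynomial_partial_deriv)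

lemma along_add: "f \<in> polynomials l \<Longrightarrow> g \<in> polynomials l \<Longrightarrow> along l X (f + g) = along l X f + along l X g"
  by (simp add: along_def partial_deriv_add distrib_left sum.distrib)

lemma along_diff: "f \<in> polynomials l \<Longrightarrow> g \<in> polynomials l \<Longrightarrow> along l X (f - g) = along l X f - along l X g"
  by (simp add: along_def partial_deriv_diff right_diff_distrib sum_subtractf)

lemma along_uminus: "f \<in> polynomials l \<Longrightarrow> along l X (- f) = - along l X f"
  by (simp add: along_def partial_deriv_uminus sum_negf)

lemma along_const [simp]: "along l X (const k) = 0"
  by (simp add: along_def)

lemma along_0 [simp]: "along l X 0 = 0"
  by (simp add: along_def)

lemma along_mult: "f \<in> polynomials l \<Longrightarrow> g \<in> polynomials l \<Longrightarrow>
    along l X (f * g) = along l X f * g + f * along l X g"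
  by (simp add: along_def partial_deriv_mult distrib_left sum.distrib sum_distrib_left sum_distrib_right
      mult.assoc mult.left_commute)

lemma along_const_mult: "f \<in> polynomials l \<Longrightarrow> along l X (const k * f) = const k * along l X f"
  by (simp add: along_mult polynomial_const)

lemma along_sum: "(\<And>i. i \<in> A \<Longrightarrow> h i \<in> polynomials l) \<Longrightarrow> along l X (sum h A) = (\<Sum>i\<in>A. along l X (h i))"
  unfolding along_def by (subst sum.swap) (simp add: partial_deriv_sum sum_distrib_left)

lemma const_1 [simp]: "const 1 = 1" and const_0 [simp]: "const 0 = 0"
  by (auto simp: const_def fun_eq_iff pointwise)

lemma along_coord: "a \<in> coords l \<Longrightarrow> along l X (coord a) = X a"
  by (simp add: along_def if_distrib[of const] if_distrib[of "\<lambda>z. X _ * z"] cong: if_cong)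

lemma along_plus_field: "along l (X + Y) f = along l X f + along l Y f"
  by (simp add: along_def pointwise distrib_right sum.distrib)

lemma along_scale_field: "along l (\<lambda>a. const k * X a) f = const k * along l X f"
  by (simp add: along_def sum_distrib_left mult.assoc)

text \<open>The terms of second order cancel because partial derivatives commute.\<close>

lemma along_bracket:
  assumes "X \<in> polynomial_vfields l" "Y \<in> polynomial_vfields l" "f \<in> polynomials l"
  shows "along l (vfield_bracket l X Y) f = along l X (along l Y f) - along l Y (along l X f)"
proof -
  have e: "along l X (along l Y f) = (\<Sum>c\<in>coords l. along l X (Y c) * partial_deriv c f) +
      (\<Sum>c\<in>coords l. \<Sum>d\<in>coords l. Y c * (X d * partial_deriv d (partial_deriv c f)))"
    if "X \<in> polynomial_vfields l" "Y \<in> polynomial_vfields l" for X Y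
  proof -
    have "along l X (along l Y f) = (\<Sum>c\<in>coords l. along l X (Y c * partial_deriv c f))"
      unfolding along_def[of l Y f] using that assms(3)
      by (intro along_sum polynomial_mult polynomial_vfieldD[of Y] polynomial_partial_deriv)
    also have "\<dots> = (\<Sum>c\<in>coords l. along l X (Y c) * partial_deriv c f + Y c * along l X (partial_deriv c f))"
      using that assms(3) by (intro sum.cong refl along_mult polynomial_vfieldD[of Y]
          polynomial_partial_deriv)
    finally show ?thesis by (simp add: sum.distrib along_def sum_distrib_left)
  qed
  have "(\<Sum>c\<in>coords l. \<Sum>d\<in>coords l. Y c * (X d * partial_deriv d (partial_deriv c f))) =
      (\<Sum>d\<in>coords l. \<Sum>c\<in>coords l. Y c * (X d * partial_deriv d (partial_deriv c f)))"
    by (rule sum.swap)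
  also have "\<dots> = (\<Sum>c\<in>coords l. \<Sum>d\<in>coords l. X c * (Y d * partial_deriv d (partial_deriv c f)))"
    using assms(3) by (intro sum.cong refl) (simp add: partial_deriv_commute[of f l] mult.left_commute)
  finally have s: "(\<Sum>c\<in>coords l. \<Sum>d\<in>coords l. Y c * (X d * partial_deriv d (partial_deriv c f))) = \<dots>" .
  show ?thesis
    unfolding e[OF assms(1,2)] e[OF assms(2,1)] s
    by (simp add: along_def[of l "vfield_bracket l X Y"] vfield_bracket_along left_diff_distrib
        sum_subtractf)
qed

lemma bracket_polynomial:
  assumes "X \<in> polynomial_vfields l" "Y \<in> polynomial_vfields l"
  shows "vfield_bracket l X Y \<in> polynomial_vfields l"
proof -
  have "vfield_bracket l X Y a \<in> polynomials l" for a
    unfolding vfield_bracket_along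
    by (intro polynomial_diff polynomial_along assms polynomial_vfieldD[OF assms(1)]
        polynomial_vfieldD[OF assms(2)])
  moreover have "vfield_bracket l X Y a = 0" if "a \<notin> coords l" for a
    unfolding vfield_bracket_along
    using polynomial_vfield_outside[OF assms(1) that] polynomial_vfield_outside[OF assms(2) that] by simp
  ultimately show ?thesis unfolding polynomial_vfields_def by blast
qed

lemma polynomial_vfield_add: "X \<in> polynomial_vfields l \<Longrightarrow> Y \<in> polynomial_vfields l \<Longrightarrow> X +
    Y \<in> polynomial_vfields l"
  and polynomial_vfield_scale: "X \<in> polynomial_vfields l \<Longrightarrow> (\<lambda>a. const k * X a) \<in> polynomial_vfields l"
  and polynomial_vfield_0: "0 \<in> polynomial_vfields l"
  by (auto simp: polynomial_vfields_def pointwise polynomial_plus polynomial_0 polynomial_mult[OF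
      polynomial_const])

lemma bracket_add_right:
  assumes "Y \<in> polynomial_vfields l" "Z \<in> polynomial_vfields l"
  shows "vfield_bracket l X (Y + Z) = vfield_bracket l X Y + vfield_bracket l X Z"
  using polynomial_vfieldD[OF assms(1)] polynomial_vfieldD[OF assms(2)]
  by (auto simp: fun_eq_iff[where 'a = contact_coord] vfield_bracket_along pointwise along_add
      along_plus_field)

lemma bracket_scale_right:
  assumes "Y \<in> polynomial_vfields l"
  shows "vfield_bracket l X (\<lambda>a. const k * Y a) = (\<lambda>a. const k * vfield_bracket l X Y a)"
  using polynomial_vfieldD[OF assms]
  by (auto simp: fun_eq_iff[where 'a = contact_coord] vfield_bracket_along along_const_mult
      along_scale_field right_diff_distrib)

lemma bracket_swap: "vfield_bracket l X Y = - vfield_bracket l Y X"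
  by (rule ext) (simp add: vfield_bracket_along pointwise)

lemma bracket_scale_left:
  assumes "X \<in> polynomial_vfields l"
  shows "vfield_bracket l (\<lambda>a. const k * X a) Y = (\<lambda>a. const k * vfield_bracket l X Y a)"
  using bracket_scale_right[OF assms, of Y k]
  by (simp add: bracket_swap[of l _ Y] fun_eq_iff[where 'a = contact_coord] pointwise)

text \<open>The bracket is the commutator of the derivations given by the fields, applied to
  coefficients.\<close>

lemma bracket_jacobi:
  assumes "X \<in> polynomial_vfields l" "Y \<in> polynomial_vfields l" "Z \<in> polynomial_vfields l"
  shows "vfield_bracket l (vfield_bracket l X Y) Z =
     vfield_bracket l X (vfield_bracket l Y Z) - vfield_bracket l Y (vfield_bracket l X Z)"
proof
  fix a
  note p = assms[THEN polynomial_vfieldD]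
  note q = polynomial_along[OF assms(1)] polynomial_along[OF assms(2)] polynomial_along[OF assms(3)]
  show "vfield_bracket l (vfield_bracket l X Y) Z a =
     (vfield_bracket l X (vfield_bracket l Y Z) - vfield_bracket l Y (vfield_bracket l X Z)) a"
    by (simp add: pointwise vfield_bracket_along[of l "vfield_bracket l X Y"] vfield_bracket_along[of l
        X] vfield_bracket_along[of l Y]
      along_bracket assms p q along_diff)
qed

lemma scaleR_vfield: "r *\<^sub>R (X :: 'k::real_normed_field vfield) = (\<lambda>a. const (of_real r) * X a)"
  by (rule ext) (simp add: scaleR_fun_def[of r X] scaleR_const_mult)

section \<open>The contact form and generating functions\<close>

lemma contact_form_alt: "contact_form l X = X CZ - (\<Sum>i=1..l. coord (CY i) * X (CX i))"
  by (simp add: contact_form_def fun_eq_iff pointwise sum_fun_apply coord_def)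

lemma polynomial_contact_form: "X \<in> polynomial_vfields l \<Longrightarrow> contact_form l X \<in> polynomials l"
  unfolding contact_form_alt
  by (intro polynomial_diff polynomial_sum polynomial_mult polynomial_vfieldD[of X] polynomial_coord) auto

lemma contact_form_add: "contact_form l (X + Y) = contact_form l X + contact_form l Y"
  by (simp add: contact_form_alt pointwise distrib_left sum.distrib)

lemma contact_form_uminus: "contact_form l (- X) = - contact_form l X"
  by (simp add: contact_form_alt pointwise sum_negf)

lemma contact_form_diff: "contact_form l (X - Y) = contact_form l X - contact_form l Y"
  by (simp add: contact_form_alt pointwise right_diff_distrib sum_subtractf)

lemma contact_form_0: "contact_form l 0 = 0"
  by (simp add: contact_form_alt pointwise)

lemma contact_form_scale: "contact_form l (\<lambda>a. const k * X a) = const k * contact_form l X"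
  by (simp add: contact_form_alt right_diff_distrib sum_distrib_left mult.left_commute)

text \<open>Cartan's formula for the exterior derivative \<open>\<Sum>i. dx_i \<and> dy_i\<close> of the contact form.\<close>

lemma contact_form_bracket:
  fixes X Y :: "'k::real_normed_field vfield"
  assumes "X \<in> polynomial_vfields l" "Y \<in> polynomial_vfields l"
  shows "contact_form l (vfield_bracket l X Y) = along l X (contact_form l Y) - along l Y (contact_form l X)
     + (\<Sum>i=1..l. X (CY i) * Y (CX i)) - (\<Sum>i=1..l. Y (CY i) * X (CX i))"
proof -
  have e: "along l X (contact_form l Y) = along l X (Y CZ) -
     (\<Sum>i=1..l. X (CY i) * Y (CX i)) - (\<Sum>i=1..l. coord (CY i) * along l X (Y (CX i)))"
    if "Y \<in> polynomial_vfields l" for X Y :: "'k vfield"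
  proof -
    have p: "(coord (CY i) :: 'k fn) \<in> polynomials l" "coord (CY i) * Y (CX i) \<in> polynomials l"
        if "i \<in> {1..l}" for i
      using that polynomial_vfieldD[OF \<open>Y \<in> _\<close>] by (auto intro!: polynomial_mult polynomial_coord)
    have "along l X (contact_form l Y) = along l X (Y CZ) - along l X (\<Sum>i=1..l. coord (CY i) * Y (CX i))"
      unfolding contact_form_alt using p polynomial_vfieldD[OF that]
      by (intro along_diff polynomial_sum)
    also have "along l X (\<Sum>i=1..l. coord (CY i) * Y (CX i)) = (\<Sum>i=1..l.
        along l X (coord (CY i) * Y (CX i)))"
      using p by (intro along_sum)
    also have "\<dots> = (\<Sum>i=1..l. X (CY i) * Y (CX i) + coord (CY i) * along l X (Y (CX i)))"
      using p polynomial_vfieldD[OF that] by (intro sum.cong refl) (simp add: along_mult along_coord)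
    finally show ?thesis by (simp add: sum.distrib)
  qed
  show ?thesis unfolding e[OF assms(1)] e[OF assms(2)]
    by (simp add: contact_form_alt vfield_bracket_along right_diff_distrib sum_subtractf)
qed

text \<open>The contact field with generating function \<open>f\<close>. The conditions \<open>\<theta>(X) = f\<close> and
  \<open>df + \<iota>_X d\<theta> = (\<partial>f/\<partial>z) \<theta>\<close>, where \<open>\<theta>\<close> is the contact form, determine its coefficients.\<close>

fun contact_field :: "nat \<Rightarrow> ((contact_coord \<Rightarrow> 'k::real_normed_field) \<Rightarrow> 'k) \<Rightarrow> 'k vfield" where
  "contact_field l f (CX i) = (if 1 \<le> i \<and> i \<le> l then - partial_deriv (CY i) f else 0)"
| "contact_field l f (CY i) = (if 1 \<le> i \<and> i \<le> l then partial_deriv (CX i) f +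
    coord (CY i) * partial_deriv CZ f else 0)"
| "contact_field l f CZ = f - (\<Sum>i=1..l. coord (CY i) * partial_deriv (CY i) f)"

lemma contact_form_contact_field: "contact_form l (contact_field l f) = f"
  by (simp add: contact_form_alt sum_negf)

lemma contact_field_polynomial:
  assumes "f \<in> polynomials l" shows "contact_field l f \<in> polynomial_vfields l"
proof -
  have "contact_field l f a \<in> polynomials l" if "a \<in> coords l" for a
    using assms that by (cases a)
      (auto intro!: polynomial_diff polynomial_plus polynomial_uminus polynomial_sum polynomial_mult
        polynomial_partial_deriv polynomial_coord)
  moreover have "contact_field l f a = 0" if "a \<notin> coords l" for a using that by (cases a) auto
  ultimately show ?thesis by (simp add: polynomial_vfields_def)
qed

lemma contact_field_contact:
  assumes f: "f \<in> polynomials l" shows "contact_field l f \<in> contact_vfields l"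
proof -
  have "contact_form l (vfield_bracket l (contact_field l f) Y) = 0"
    if Y: "Y \<in> polynomial_vfields l" "contact_form l Y = 0" for Y
  proof -
    have z: "Y CZ = (\<Sum>i=1..l. coord (CY i) * Y (CX i))" using Y(2) by (simp add: contact_form_alt)
    have "along l Y f = (\<Sum>i=1..l. Y (CX i) * partial_deriv (CX i) f) + (\<Sum>i=1..l.
        Y (CY i) * partial_deriv (CY i) f)
        + (\<Sum>i=1..l. coord (CY i) * Y (CX i)) * partial_deriv CZ f"
      by (simp add: along_def sum_coords z)
    also have "\<dots> = (\<Sum>i=1..l. contact_field l f (CY i) * Y (CX i)) - (\<Sum>i=1..l. Y (CY i) * contact_field l
        f (CX i))"
      by (simp add: sum_distrib_right sum_distrib_left distrib_left sum.distrib sum_negf mult.commute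
          mult.left_commute)
    finally show ?thesis
      using contact_form_bracket[OF contact_field_polynomial[OF f] Y(1)] Y(2)
      by (simp add: contact_form_contact_field)
  qed
  then show ?thesis by (simp add: contact_vfields_def contact_field_polynomial[OF f])
qed

lemma contact_vfield_polynomial: "X \<in> contact_vfields l \<Longrightarrow> X \<in> polynomial_vfields l"
  by (simp add: contact_vfields_def)

lemma sum_single: "1 \<le> i \<and> i \<le> l \<Longrightarrow> (\<Sum>j=Suc 0..l. f j * (if j = i then g j else 0)) = f i * g i"
  "1 \<le> i \<and> i \<le> l \<Longrightarrow> (\<Sum>j=Suc 0..l. (if j = i then g j else 0) * f j) = g i * f i"
  for f g :: "nat \<Rightarrow> 'b::semiring_0" and i l :: nat
  by (simp_all add: if_distrib[of "\<lambda>z. f _ * z"] if_distrib[of "\<lambda>z. z * f _"] cong: if_cong)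

text \<open>The distribution is spanned by \<open>\<partial>/\<partial>y_i\<close> and \<open>\<partial>/\<partial>x_i + y_i \<partial>/\<partial>z\<close>. Testing the contact
  condition on these sections expresses the coefficients of \<open>X\<close> by derivatives of its generating
  function.\<close>

lemma contact_field_contact_form:
  fixes X :: "'k::real_normed_field vfield"
  assumes X: "X \<in> contact_vfields l" shows "contact_field l (contact_form l X) = X"
proof
  fix a
  note Xp = contact_vfield_polynomial[OF X]
  have X0: "contact_form l (vfield_bracket l X Y) = 0"
    if "Y \<in> polynomial_vfields l" "contact_form l Y = 0" for Y
    using X that by (simp add: contact_vfields_def)
  show "contact_field l (contact_form l X) a = X a"
  proof (cases "a \<in> coords l")
    case False
    then show ?thesis using polynomial_vfield_outside[OF Xp False] by (cases a) auto
  next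
    case True
    have CX: "contact_field l (contact_form l X) (CX i) = X (CX i)" if i: "i \<in> {1..l}" for i
    proof -
      let ?Y = "(\<lambda>b. if b = CY i then 1 else 0) :: 'k vfield"
      have p: "?Y \<in> polynomial_vfields l"
        using i polynomial_const[of "1 :: 'k" l] by (auto simp: polynomial_vfields_def polynomial_0)
      have f: "contact_form l ?Y = 0" by (simp add: contact_form_alt)
      have "along l ?Y (contact_form l X) = partial_deriv (CY i) (contact_form l X)"
        using i by (simp add: along_def if_distrib[of "\<lambda>z. z * _"] cong: if_cong)
      then show ?thesis using X0[OF p f] contact_form_bracket[OF Xp p] f i
        by (simp add: sum_single add_eq_0_iff)
    qed
    have CY: "contact_field l (contact_form l X) (CY i) = X (CY i)" if i: "i \<in> {1..l}" for i
    proof -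
      let ?Y = "(\<lambda>b. if b = CZ then coord (CY i) else if b = CX i then 1 else 0) :: 'k vfield"
      have p: "?Y \<in> polynomial_vfields l"
        using i polynomial_const[of "1 :: 'k" l]
        by (auto simp: polynomial_vfields_def polynomial_0 intro: polynomial_coord)
      have f: "contact_form l ?Y = 0" using i by (simp add: contact_form_alt sum_single)
      have "along l ?Y (contact_form l X) = partial_deriv (CX i) (contact_form l X) +
          coord (CY i) * partial_deriv CZ (contact_form l X)"
        using i by (simp add: along_def sum_coords sum_single)
      then show ?thesis using X0[OF p f] contact_form_bracket[OF Xp p] f i
        by (simp add: sum_single add_eq_0_iff)
    qed
    show ?thesis
    proof (cases a)
      case CZ
      have "(\<Sum>i=1..l. coord (CY i) * partial_deriv (CY i) (contact_form l X)) = - (\<Sum>i=1..l.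
          coord (CY i) * X (CX i))"
        unfolding sum_negf[symmetric] using CX by (intro sum.cong refl) (simp add: CX[symmetric] del: CX)
      then show ?thesis using CZ by (simp add: contact_form_alt)
    qed (use True CX CY in \<open>auto simp del: contact_field.simps\<close>)
  qed
qed

lemma contact_vfields_eq: "contact_vfields l = contact_field l ` polynomials l"
  using contact_field_contact contact_field_contact_form polynomial_contact_form contact_vfield_polynomial
  by (metis (no_types, lifting) image_iff subsetI subset_antisym)

lemma contact_vfield_eqI: "X \<in> contact_vfields l \<Longrightarrow> Y \<in> contact_vfields l \<Longrightarrow> contact_form l X =
    contact_form l Y \<Longrightarrow> X = Y"
  by (metis contact_field_contact_form)

text \<open>By the Jacobi identity, since brackets with contact fields preserve the sections of the
  distribution.\<close>

lemma contact_vfields_bracket: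
  assumes X: "X \<in> contact_vfields l" and Y: "Y \<in> contact_vfields l"
  shows "vfield_bracket l X Y \<in> contact_vfields l"
proof -
  note p = assms[THEN contact_vfield_polynomial]
  have "contact_form l (vfield_bracket l (vfield_bracket l X Y) Z) = 0"
    if Z: "Z \<in> polynomial_vfields l" "contact_form l Z = 0" for Z
  proof -
    have "contact_form l (vfield_bracket l X Z) = 0" "contact_form l (vfield_bracket l Y Z) = 0"
      using X Y Z by (simp_all add: contact_vfields_def)
    then have "contact_form l (vfield_bracket l X (vfield_bracket l Y Z)) = 0"
      "contact_form l (vfield_bracket l Y (vfield_bracket l X Z)) = 0"
      using X Y bracket_polynomial[OF p(1) Z(1)] bracket_polynomial[OF p(2) Z(1)]
      by (simp_all add: contact_vfields_def)
    then show ?thesis by (simp add: bracket_jacobi[OF p Z(1)] contact_form_diff)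
  qed
  then show ?thesis by (simp add: contact_vfields_def bracket_polynomial p)
qed

lemma contact_vfields_scale: "X \<in> contact_vfields l \<Longrightarrow> (\<lambda>a. const k * X a) \<in> contact_vfields l"
  by (simp add: contact_vfields_def polynomial_vfield_scale bracket_scale_left contact_form_scale)

lemma subspace_contact_vfields: "subspace (contact_vfields l :: 'k::real_normed_field vfield set)"
  unfolding subspace_def
proof (intro conjI ballI allI)
  have b0: "vfield_bracket l 0 Y = 0" for Y :: "'k vfield"
    by (rule ext) (simp add: vfield_bracket_along pointwise along_def)
  show "(0 :: 'k vfield) \<in> contact_vfields l"
    by (simp add: contact_vfields_def polynomial_vfield_0 b0 contact_form_0)
  fix X :: "'k vfield" assume X: "X \<in> contact_vfields l"
  then show "r *\<^sub>R X \<in> contact_vfields l" for r unfolding scaleR_vfield by (rule contact_vfields_scale)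
  fix Y :: "'k vfield" assume Y: "Y \<in> contact_vfields l"
  have "contact_form l (vfield_bracket l (X + Y) Z) = 0"
    if "Z \<in> polynomial_vfields l" "contact_form l Z = 0" for Z
  proof -
    have "vfield_bracket l (X + Y) Z = - vfield_bracket l Z (X + Y)" by (rule bracket_swap)
    also have "\<dots> = vfield_bracket l X Z + vfield_bracket l Y Z"
      using bracket_add_right[of X l Y Z] X Y bracket_swap[of l X Z] bracket_swap[of l Y Z]
      by (simp add: contact_vfields_def)
    finally show ?thesis using X Y that by (simp add: contact_form_add contact_vfields_def)
  qed
  then show "X + Y \<in> contact_vfields l" using X Y by (simp add: contact_vfields_def polynomial_vfield_add)
qed

lemma linear_contact_form: "linear_on S (contact_form l)"
  by (simp add: linear_on_def contact_form_add scaleR_vfield scaleR_const_mult contact_form_scale)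

lemma linear_contact_field: "linear_on (polynomials l) (contact_field l)"
  unfolding linear_on_def
proof (intro conjI ballI allI)
  fix f :: "(contact_coord \<Rightarrow> 'a) \<Rightarrow> 'a" assume f: "f \<in> polynomials l"
  then show "contact_field l (r *\<^sub>R f) = r *\<^sub>R contact_field l f" for r
    by (intro contact_vfield_eqI[of _ l] contact_field_contact subspace_scale subspace_contact_vfields
        subspace_polynomials)
      (simp_all add: contact_form_contact_field linear_on_scale[OF linear_contact_form[of UNIV]])
  fix g :: "(contact_coord \<Rightarrow> 'a) \<Rightarrow> 'a" assume g: "g \<in> polynomials l"
  with f show "contact_field l (f + g) = contact_field l f + contact_field l g"
    by (intro contact_vfield_eqI[of _ l] contact_field_contact subspace_add subspace_contact_vfields
        subspace_polynomials)
      (simp_all add: contact_form_contact_field contact_form_add)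
qed

lemma inj_contact_field: "inj_on (contact_field l) S"
  by (rule inj_onI) (metis contact_form_contact_field)

text \<open>The shift by two is the weight of \<open>z\<close>: the field \<open>\<partial>/\<partial>z\<close> has degree \<open>-2\<close> and generating
  function \<open>1\<close>.\<close>

lemma contact_grade_eq: "lie_grade (contact_algebra l) p = contact_field l ` homogeneous_polynomials l
    (p + 2)"
proof safe
  fix X :: "'a vfield" assume X: "X \<in> lie_grade (contact_algebra l) p"
  then have Xc: "X \<in> contact_vfields l" and h: "\<And>a. a \<in> coords l \<Longrightarrow> X a \<in> homogeneous_polynomials l (p +
      weight a)"
    by (auto simp: contact_algebra_def)
  have "coord (CY i) * X (CX i) \<in> homogeneous_polynomials l (p + 2)" if "i \<in> {1..l}" for i
    using homogeneous_mult[OF homogeneous_coord[of "CY i" l] h[of "CX i"]] that by (simp add: algebra_simps)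
  then have "contact_form l X \<in> homogeneous_polynomials l (p + 2)"
    unfolding contact_form_alt using h[of CZ] by (intro homogeneous_diff homogeneous_sum) auto
  then show "X \<in> contact_field l ` homogeneous_polynomials l (p + 2)"
    using contact_field_contact_form[OF Xc] by (metis imageI)
next
  fix f :: "(contact_coord \<Rightarrow> 'a) \<Rightarrow> 'a" assume f: "f \<in> homogeneous_polynomials l (p + 2)"
  have d: "partial_deriv a f \<in> homogeneous_polynomials l (p + 2 - weight a)" if "a \<in> coords l" for a
    using homogeneous_partial_deriv[OF f that] .
  have yd: "coord (CY i) * partial_deriv a f \<in> homogeneous_polynomials l (p + 3 - weight a)"
      if "i \<in> {1..l}" "a \<in> coords l" for i a
    using homogeneous_mult[OF homogeneous_coord[of "CY i" l] d[OF that(2)]] that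
        by (simp add: algebra_simps)
  have "contact_field l f a \<in> homogeneous_polynomials l (p + weight a)" if "a \<in> coords l" for a
  proof (cases a)
    case (CX i) then show ?thesis using d[of "CY i"] that by (simp add: homogeneous_uminus add.commute)
  next
    case (CY i) then show ?thesis using d[of "CX i"] yd[of i CZ] that
        by (simp add: homogeneous_plus add.commute)
  next
    case CZ then show ?thesis using f yd[of _ "CY _"]
        by (auto intro!: homogeneous_diff homogeneous_sum simp: add.commute)
  qed
  then show "contact_field l f \<in> lie_grade (contact_algebra l) p"
    using contact_field_contact[OF homogeneous_polynomial[OF f]] by (simp add: contact_algebra_def)
qed

lemma contact_algebra_simps [simp]: "lie_space (contact_algebra l) = contact_vfields l"
  "lie_bracket (contact_algebra l) = vfield_bracket l"
  by (simp_all add: contact_algebra_def)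

lemma contact_gradeD:
  assumes "X \<in> lie_grade (contact_algebra l) p"
  shows "X \<in> contact_vfields l" "contact_form l X \<in> homogeneous_polynomials l (p + 2)"
      "X \<in> polynomial_vfields l"
proof -
  obtain f where f: "f \<in> homogeneous_polynomials l (p + 2)" "X = contact_field l f"
    using assms by (auto simp: contact_grade_eq)
  show "X \<in> contact_vfields l" "X \<in> polynomial_vfields l"
    using contact_field_contact contact_field_polynomial homogeneous_polynomial[OF f(1)] f(2) by auto
  show "contact_form l X \<in> homogeneous_polynomials l (p + 2)"
    using f by (simp add: contact_form_contact_field)
qed

lemma contact_gradeI: "X \<in> contact_vfields l \<Longrightarrow> contact_form l X \<in> homogeneous_polynomials l (p + 2) \<Longrightarrow>
    X \<in> lie_grade (contact_algebra l) p"
  unfolding contact_grade_eq using contact_field_contact_form by (metis imageI)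

lemma homogeneous_along:
  assumes X: "X \<in> lie_grade (contact_algebra l) p" and f: "f \<in> homogeneous_polynomials l w"
  shows "along l X f \<in> homogeneous_polynomials l (p + w)"
  unfolding along_def
proof (rule homogeneous_sum)
  fix c assume c: "c \<in> coords l"
  then have "X c \<in> homogeneous_polynomials l (p + weight c)" using X by (simp add: contact_algebra_def)
  from homogeneous_mult[OF this homogeneous_partial_deriv[OF f c]]
  show "X c * partial_deriv c f \<in> homogeneous_polynomials l (p + w)" by simp
qed

lemma contact_bracket_grade:
  assumes "X \<in> lie_grade (contact_algebra l) p" "Y \<in> lie_grade (contact_algebra l) q"
  shows "vfield_bracket l X Y \<in> lie_grade (contact_algebra l) (p + q)"
proof -
  have h: "X a \<in> homogeneous_polynomials l (p + weight a)" "Y a \<in> homogeneous_polynomials l (q + weight a)"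
    if "a \<in> coords l" for a using assms that by (auto simp: contact_algebra_def)
  have "vfield_bracket l X Y a \<in> homogeneous_polynomials l (p + q + weight a)" if "a \<in> coords l" for a
    using homogeneous_along[OF assms(1) h(2)[OF that]] homogeneous_along[OF assms(2) h(1)[OF that]]
    by (auto simp: vfield_bracket_along algebra_simps intro!: homogeneous_diff)
  moreover have "vfield_bracket l X Y \<in> contact_vfields l"
    using assms contact_gradeD(1) contact_vfields_bracket by blast
  ultimately show ?thesis by (simp add: contact_algebra_def)
qed

text \<open>The decomposition of the generating functions, indexed by the degree of their fields.\<close>

lemma shifted_direct_sum:
  "internal_direct_sum UNIV (\<lambda>p. homogeneous_polynomials l (p +
      2) :: ((contact_coord \<Rightarrow> 'k::real_normed_field) \<Rightarrow> 'k) set) (polynomials l)"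
  unfolding internal_direct_sum_iff
proof (intro conjI allI ballI impI)
  show "polynomials l \<subseteq> span (\<Union>w. homogeneous_polynomials l (w + 2) :: ((contact_coord \<Rightarrow> 'k) \<Rightarrow> 'k) set)"
  proof -
    have "(\<Union>w. homogeneous_polynomials l w :: ((contact_coord \<Rightarrow> 'k) \<Rightarrow> 'k) set) \<subseteq> (\<Union>w.
        homogeneous_polynomials l (w + 2))"
    proof
      fix f :: "(contact_coord \<Rightarrow> 'k) \<Rightarrow> 'k" assume "f \<in> (\<Union>w. homogeneous_polynomials l w)"
      then obtain w where "f \<in> homogeneous_polynomials l ((w - 2) + 2)" by auto
      then show "f \<in> (\<Union>w. homogeneous_polynomials l (w + 2))" by blast
    qed
    then show ?thesis unfolding polynomials_span_homogeneous by (rule span_mono)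
  qed
  fix A and f :: "int \<Rightarrow> (contact_coord \<Rightarrow> 'k) \<Rightarrow> 'k" and w
  assume A: "finite A" "\<forall>i\<in>A. f i \<in> homogeneous_polynomials l (i + 2)" "sum f A = 0" "w \<in> A"
  have "(\<Sum>v\<in>(\<lambda>p. p + 2) ` A. f (v - 2)) = 0" using A(3) by (subst sum.reindex) (auto simp: inj_on_def)
  then have "f ((w + 2) - 2) = 0"
    using A by (intro homogeneous_independent[of "(\<lambda>p. p + 2) ` A" "\<lambda>v. f (v - 2)" l "w + 2"]) auto
  then show "f w = 0" by simp
qed (simp_all add: subspace_polynomials homogeneous_subset)

lemma graded_lie_algebra_contact: "graded_lie_algebra (contact_algebra l :: 'k::real_normed_field vfield
    graded_lie)"
  unfolding graded_lie_algebra_def contact_algebra_simps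
proof (intro conjI ballI allI)
  let ?S = "contact_vfields l :: 'k vfield set"
  show "subspace ?S" by (rule subspace_contact_vfields)
  show "vfield_bracket l X Y \<in> ?S" if "X \<in> ?S" "Y \<in> ?S" for X Y using that by (rule contact_vfields_bracket)
  have lin: "linear_on ?S (vfield_bracket l X)" if "X \<in> ?S" for X
    unfolding linear_on_def scaleR_vfield
    by (simp add: bracket_add_right bracket_scale_right contact_vfield_polynomial)
  show "bilinear_on ?S ?S (vfield_bracket l)"
    unfolding bilinear_on_def
  proof (intro conjI ballI)
    show "linear_on ?S (\<lambda>X. vfield_bracket l X Y)" if "Y \<in> ?S" for Y
      using lin[OF that] unfolding bracket_swap[of l _ Y] by (simp add: linear_on_def)
  qed (rule lin)
  show "vfield_bracket l X X = 0" for X :: "'k vfield"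
    by (rule ext) (simp add: vfield_bracket_along pointwise)
  show "vfield_bracket l X (vfield_bracket l Y Z) + vfield_bracket l Y (vfield_bracket l Z X) +
       vfield_bracket l Z (vfield_bracket l X Y) = 0" if "X \<in> ?S" "Y \<in> ?S" "Z \<in> ?S" for X Y Z
  proof -
    note p = that[THEN contact_vfield_polynomial]
    have "vfield_bracket l Y (- vfield_bracket l X Z) = - vfield_bracket l Y (vfield_bracket l X Z)"
      using linear_on_neg[OF lin[OF that(2)], of "vfield_bracket l X Z"] that contact_vfields_bracket
          by blast
    then show ?thesis
      unfolding bracket_swap[of l Z "vfield_bracket l X Y"] bracket_jacobi[OF p]
      using bracket_swap[of l Z X] by simp
  qed
  show "internal_direct_sum UNIV (lie_grade (contact_algebra l)) ?S"
    unfolding contact_vfields_eq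
    using internal_direct_sum_image[OF shifted_direct_sum linear_contact_field inj_contact_field]
    by (simp add: contact_grade_eq[abs_def])
  show "vfield_bracket l X Y \<in> lie_grade (contact_algebra l) (p + q)"
    if "X \<in> lie_grade (contact_algebra l) p" "Y \<in> lie_grade (contact_algebra l) q"
        for X Y :: "'k vfield" and p q
    using that by (rule contact_bracket_grade)
qed

section \<open>Potentials of closed one-forms\<close>

lemma diff_eq_diff_swap: "q + b' = c' + r \<Longrightarrow> b' = p \<Longrightarrow> c' = b \<Longrightarrow> q - b = r - p" for q :: "'a::ab_group_add"
  by (simp add: algebra_simps)

lemma neg_eq_self_imp_0: "- x = x \<Longrightarrow> x = 0" for x :: "'a::real_vector"
  using scaleR_2[of x] by (metis add.right_inverse scaleR_eq_0_iff zero_neq_numeral)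

text \<open>Contracting the closed one-form \<open>\<Sum>a. g_a da\<close> with the Euler field and dividing by its weight
  \<open>n\<close> gives a potential, by Euler's formula for the coefficients \<open>g_a\<close>.\<close>

lemma homogeneous_poincare:
  fixes g :: "contact_coord \<Rightarrow> 'k::real_normed_field fn"
  assumes n: "n > 0" and g: "\<And>a. a \<in> coords l \<Longrightarrow> g a \<in> homogeneous_polynomials l (n - weight a)"
    and closed: "\<And>a b. a \<in> coords l \<Longrightarrow> b \<in> coords l \<Longrightarrow> partial_deriv a (g b) = partial_deriv b (g a)"
  obtains f where "f \<in> homogeneous_polynomials l n" "\<And>a. a \<in> coords l \<Longrightarrow> partial_deriv a f = g a"
proof -
  let ?w = "\<lambda>a. const (of_int (weight a)) :: 'k fn"
  have xg: "coord a * g a \<in> homogeneous_polynomials l n" if "a \<in> coords l" for a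
    using homogeneous_mult[OF homogeneous_coord[OF that] g[OF that]] by simp
  have h: "(\<Sum>a\<in>coords l. ?w a * (coord a * g a)) \<in> homogeneous_polynomials l n"
    using xg by (intro homogeneous_sum homogeneous_const_mult)
  let ?f = "const (1 / of_int n) * (\<Sum>a\<in>coords l. ?w a * (coord a * g a))"
  have "partial_deriv b ?f = g b" if b: "b \<in> coords l" for b
  proof -
    have gp: "g a \<in> polynomials l" if "a \<in> coords l" for a using g[OF that] homogeneous_polynomial by blast
    have t: "partial_deriv b (?w a * (coord a * g a)) = ?w a * const (if b = a then 1 else 0) * g a +
        ?w a * coord a * partial_deriv a (g b)"
      if a: "a \<in> coords l" for a
    proof -
      have "partial_deriv b (?w a * (coord a * g a)) = ?w a * partial_deriv b (coord a * g a)"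
        using xg[OF a] b homogeneous_polynomial by (intro partial_deriv_const_mult) auto
      also have "partial_deriv b (coord a * g a) = const (if b = a then 1 else 0) * g a +
          coord a * partial_deriv b (g a)"
        using partial_deriv_mult[OF polynomial_coord[OF a] gp[OF a] b] by simp
      also have "partial_deriv b (g a) = partial_deriv a (g b)" using closed a b by blast
      finally show ?thesis by (simp add: distrib_left mult.assoc)
    qed
    have "partial_deriv b ?f = const (1 / of_int n) * partial_deriv b (\<Sum>a\<in>coords l. ?w a * (coord a * g a))"
      using h b homogeneous_polynomial by (intro partial_deriv_const_mult) auto
    also have "partial_deriv b (\<Sum>a\<in>coords l. ?w a * (coord a * g a)) = (\<Sum>a\<in>coords l.
        partial_deriv b (?w a * (coord a * g a)))"
      using xg b by (intro partial_deriv_sum homogeneous_polynomial[OF homogeneous_const_mult]) auto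
    also have "\<dots> = (\<Sum>a\<in>coords l. ?w a * const (if b = a then 1 else 0) * g a) + euler l (g b)"
      by (simp add: t sum.distrib euler_def)
    also have "(\<Sum>a\<in>coords l. ?w a * const (if b = a then 1 else 0) * g a) = ?w b * g b"
    proof -
      have "(\<Sum>a\<in>coords l. ?w a * const (if b = a then 1 else 0) * g a) = (\<Sum>a\<in>coords l. if b =
          a then ?w a * g a else 0)"
        by (rule sum.cong) auto
      then show ?thesis using b by simp
    qed
    also have "euler l (g b) = const (of_int (n - weight b)) * g b" by (rule euler_homogeneous[OF g[OF b]])
    also have "const (1 / of_int n) * (?w b * g b + const (of_int (n - weight b)) * g b) = g b"
      using n by (simp add: fun_eq_iff pointwise const_def field_simps)
    finally show ?thesis .
  qed
  with h show ?thesis by (intro that[of ?f]) (auto intro: homogeneous_const_mult)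
qed

section \<open>The negative part of the contact algebra\<close>

text \<open>The generating functions of the fields \<open>\<partial>/\<partial>x_i\<close>, \<open>\<partial>/\<partial>y_i + x_i \<partial>/\<partial>z\<close> and \<open>\<partial>/\<partial>z\<close>. These
  fields preserve the contact form itself and not only its kernel, and they span the negative part
  of the contact algebra over the scalars.\<close>

fun strict_gen :: "contact_coord \<Rightarrow> 'k::real_normed_field fn" where
  "strict_gen (CX i) = - coord (CY i)" | "strict_gen (CY i) = coord (CX i)" | "strict_gen CZ = 1"

definition strict_field :: "nat \<Rightarrow> contact_coord \<Rightarrow> 'k::real_normed_field vfield" where
  "strict_field l a = contact_field l (strict_gen a)"

fun strict_deriv :: "contact_coord \<Rightarrow> 'k::real_normed_field fn \<Rightarrow> 'k fn" where
  "strict_deriv (CX i) f = partial_deriv (CX i) f"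
| "strict_deriv (CY i) f = partial_deriv (CY i) f + coord (CX i) * partial_deriv CZ f"
| "strict_deriv CZ f = partial_deriv CZ f"

lemma partial_deriv_1 [simp]: "partial_deriv a 1 = 0"
  using partial_deriv_const[of a 1] by simp

lemma partial_deriv_minus_coord: "a \<in> coords l \<Longrightarrow> b \<in> coords l \<Longrightarrow>
    partial_deriv a (- coord b :: 'k::real_normed_field fn) = - const (if a = b then 1 else 0)"
  by (simp add: partial_deriv_uminus[OF _ polynomial_coord])

lemma strict_field_eq:
  "1 \<le> i \<and> i \<le> l \<Longrightarrow> strict_field l (CX i) = (\<lambda>b. if b = CX i then 1 else 0 :: 'k::real_normed_field fn)"
  "1 \<le> i \<and> i \<le> l \<Longrightarrow> strict_field l (CY i) = (\<lambda>b. if b = CZ then coord (CX i) else if b =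
      CY i then 1 else 0 :: 'k::real_normed_field fn)"
  "strict_field l CZ = (\<lambda>b. if b = CZ then 1 else 0 :: 'k::real_normed_field fn)"
proof -
  show "strict_field l CZ = (\<lambda>b. if b = CZ then 1 else 0 :: 'k fn)"
  proof
    show "strict_field l CZ b = (if b = CZ then 1 else 0 :: 'k fn)" for b
        by (cases b) (auto simp: strict_field_def)
  qed
  assume i: "1 \<le> i \<and> i \<le> l"
  show "strict_field l (CX i) = (\<lambda>b. if b = CX i then 1 else 0 :: 'k fn)"
  proof
    show "strict_field l (CX i) b = (if b = CX i then 1 else 0 :: 'k fn)" for b
    proof (cases b)
      case CZ
      have "(\<Sum>j=Suc 0..l. coord (CY j) * partial_deriv (CY j) (- coord (CY i) :: 'k fn)) =
          (\<Sum>j=Suc 0..l. coord (CY j) * (if j = i then - 1 else 0))"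
        using i by (intro sum.cong refl) (auto simp: partial_deriv_minus_coord[of _ l])
      then show ?thesis using CZ i by (simp add: strict_field_def sum_single)
    qed (use i in \<open>auto simp: strict_field_def partial_deriv_minus_coord[of _ l]\<close>)
  qed
  show "strict_field l (CY i) = (\<lambda>b. if b = CZ then coord (CX i) else if b = CY i then 1 else 0 :: 'k fn)"
  proof
    show "strict_field l (CY i) b = (if b = CZ then coord (CX i) else if b = CY i then 1 else 0 :: 'k
        fn)" for b
      using i by (cases b) (auto simp: strict_field_def)
  qed
qed

lemma along_strict_field:
  assumes "a \<in> coords l"
  shows "along l (strict_field l a) f = strict_deriv a f"
proof -
  have d: "(\<Sum>c\<in>coords l. (if c = b then h c else 0) * partial_deriv c f) = h b * partial_deriv b f"
      if "b \<in> coords l"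
    for b h
  proof -
    have "(\<Sum>c\<in>coords l. (if c = b then h c else 0) * partial_deriv c f) = (\<Sum>c\<in>coords l. if c =
        b then h c * partial_deriv c f else 0)"
      by (rule sum.cong) auto
    then show ?thesis using that by simp
  qed
  show ?thesis
  proof (cases a)
    case (CX i)
    then show ?thesis using assms d[of a "\<lambda>_. 1"] by (simp add: along_def strict_field_eq)
  next
    case (CY i)
    have "(\<Sum>c\<in>coords l. (if c = CZ then coord (CX i) else if c = CY i then 1 else 0) * partial_deriv c f) =
      (\<Sum>c\<in>coords l. (if c = CZ then coord (CX i) else 0) * partial_deriv c f) +
      (\<Sum>c\<in>coords l. (if c = CY i then 1 else 0) * partial_deriv c f)"
      unfolding sum.distrib[symmetric] by (rule sum.cong) auto
    then show ?thesis using CY assms d[of a "\<lambda>_. 1"] d[of CZ "\<lambda>_. coord (CX i)"]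
      by (simp add: along_def strict_field_eq add.commute)
  next
    case CZ
    then show ?thesis using assms d[of a "\<lambda>_. 1"] by (simp add: along_def strict_field_eq)
  qed
qed

lemma homogeneous_strict_gen: "a \<in> coords l \<Longrightarrow> strict_gen a \<in> homogeneous_polynomials l (2 - weight a)"
  using homogeneous_const[of 1 l] by (cases a) (auto intro: homogeneous_uminus homogeneous_coord[where l
      = l, of "CY _", simplified]
      homogeneous_coord[where l = l, of "CX _", simplified])

lemma strict_field_grade: "a \<in> coords l \<Longrightarrow> strict_field l a \<in> lie_grade (contact_algebra l) (- weight a)"
  unfolding strict_field_def contact_grade_eq using homogeneous_strict_gen by auto

lemma contact_form_strict_field: "contact_form l (strict_field l a) = strict_gen a"
  by (simp add: strict_field_def contact_form_contact_field)

lemma strict_field_contact: "a \<in> coords l \<Longrightarrow> strict_field l a \<in> contact_vfields l"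
  using strict_field_grade contact_gradeD(1) by blast

text \<open>The Lie derivative of the contact form along a strict field is zero, so it commutes with the
  passage to the generating function.\<close>

lemma contact_form_bracket_strict:
  fixes X :: "'k::real_normed_field vfield"
  assumes X: "X \<in> polynomial_vfields l" and a: "a \<in> coords l"
  shows "contact_form l (vfield_bracket l X (strict_field l a)) = - strict_deriv a (contact_form l X)"
proof -
  have "along l X (strict_gen a) + (\<Sum>i=Suc 0..l. X (CY i) * strict_field l a (CX i)) - (\<Sum>i=Suc 0..l.
      strict_field l a (CY i) * X (CX i)) = 0"
  proof (cases a)
    case (CX i)
    then show ?thesis using a
      by (simp add: strict_field_eq sum_single along_uminus[OF polynomial_coord] along_coord)
  next
    case (CY i)
    then show ?thesis using a by (simp add: strict_field_eq sum_single along_coord)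
  next
    case CZ
    then show ?thesis using along_const[of l X 1] by (simp add: strict_field_eq)
  qed
  then show ?thesis
    using contact_form_bracket[OF X contact_vfield_polynomial[OF strict_field_contact[OF a]]]
    by (simp add: contact_form_strict_field along_strict_field[OF a] algebra_simps)
qed

lemma homogeneous_degree_1:
  assumes "f \<in> homogeneous_polynomials l 1"
  obtains u v where "f = (\<Sum>i=1..l. const (u i) * coord (CX i) + const (v i) * coord (CY i))"
proof -
  have d: "partial_deriv a f \<in> homogeneous_polynomials l (1 - weight a)" if "a \<in> coords l" for a
    by (rule homogeneous_partial_deriv[OF assms that])
  have z: "partial_deriv CZ f = 0" using homogeneous_negative[OF d[of CZ]] by simp
  have "\<exists>k. partial_deriv (CX i) f = const k" if "i \<in> {1..l}" for i
    using d[of "CX i"] that by (intro homogeneous_degree_0[of _ l]) simp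
  then have "\<forall>i\<in>{1..l}. \<exists>k. partial_deriv (CX i) f = const k" by blast
  from bchoice[OF this] obtain u where u: "\<forall>i\<in>{1..l}. partial_deriv (CX i) f = const (u i)" ..
  have "\<exists>k. partial_deriv (CY i) f = const k" if "i \<in> {1..l}" for i
    using d[of "CY i"] that by (intro homogeneous_degree_0[of _ l]) simp
  then have "\<forall>i\<in>{1..l}. \<exists>k. partial_deriv (CY i) f = const k" by blast
  from bchoice[OF this] obtain v where v: "\<forall>i\<in>{1..l}. partial_deriv (CY i) f = const (v i)" ..
  have "f = euler l f" using euler_homogeneous[OF assms] by simp
  also have "\<dots> = (\<Sum>i=1..l. const (u i) * coord (CX i)) + (\<Sum>i=1..l. const (v i) * coord (CY i))"
    unfolding euler_def sum_coords using u v z by (simp add: mult.commute)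
  finally show ?thesis using that[of u v] by (simp add: sum.distrib)
qed

lemma scale_vfield_add: "(\<lambda>a. const k * (X + Y) a) = (\<lambda>a. const k * X a) + (\<lambda>a. const k * Y a)"
  for X Y :: "'k::real_normed_field vfield"
  by (rule ext) (simp add: pointwise distrib_left)

lemma contact_grade_scale: "X \<in> lie_grade (contact_algebra l) p \<Longrightarrow> (\<lambda>a. const k * X a) \<in> lie_grade
    (contact_algebra l) p"
  using contact_gradeD[of X l p] by (intro contact_gradeI contact_vfields_scale)
      (auto simp: contact_form_scale homogeneous_const_mult)

text \<open>Serves as an induction rule for degree \<open>-1\<close>.\<close>

lemma contact_grade_minus1_subset:
  fixes S :: "'k::real_normed_field vfield set"
  assumes S: "subspace S" "\<And>k X. X \<in> S \<Longrightarrow> (\<lambda>a. const k * X a) \<in> S"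
    "\<And>i. 1 \<le> i \<and> i \<le> l \<Longrightarrow> strict_field l (CX i) \<in> S" "\<And>i. 1 \<le> i \<and> i \<le> l \<Longrightarrow> strict_field l (CY i) \<in> S"
  shows "lie_grade (contact_algebra l) (-1) \<subseteq> S"
proof
  fix X :: "'k vfield" assume X: "X \<in> lie_grade (contact_algebra l) (-1)"
  have "contact_form l X \<in> homogeneous_polynomials l 1" using contact_gradeD(2)[OF X] by simp
  then obtain u v where uv: "contact_form l X = (\<Sum>i=1..l. const (u i) * coord (CX i) +
      const (v i) * coord (CY i))"
    by (rule homogeneous_degree_1)
  let ?t = "\<lambda>i. (\<lambda>a. const (u i) * strict_field l (CY i) a) + (\<lambda>a. const (- v i) * strict_field l (CX i) a)"
  have cm: "const (- k) = - const k" for k :: 'k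
    by (simp add: const_def fun_eq_iff pointwise)
  have t: "contact_form l (?t i) = const (u i) * coord (CX i) + const (v i) * coord (CY i)" for i
    unfolding contact_form_add contact_form_scale contact_form_strict_field by (simp add: cm)
  have "(\<Sum>i=1..l. ?t i) \<in> contact_vfields l"
    by (intro subspace_sum[OF subspace_contact_vfields] subspace_add[OF subspace_contact_vfields]
        contact_vfields_scale strict_field_contact) auto
  moreover have "contact_form l (\<Sum>i=1..l. ?t i) = (\<Sum>i=1..l. contact_form l (?t i))"
    by (rule linear_on_sum[OF linear_contact_form subspace_UNIV]) simp
  ultimately have "X = (\<Sum>i=1..l. ?t i)"
    using contact_gradeD(1)[OF X]
    by (intro contact_vfield_eqI[of _ l]) (simp_all only: uv t)
  also have "\<dots> \<in> S"
    using assms by (intro subspace_sum subspace_add) auto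
  finally show "X \<in> S" .
qed

lemma contact_grade_minus2:
  assumes "X \<in> lie_grade (contact_algebra l) (-2)"
  obtains k where "X = (\<lambda>a. const k * strict_field l CZ a)"
proof -
  have "contact_form l X \<in> homogeneous_polynomials l 0" using contact_gradeD(2)[OF assms] by simp
  then obtain k where "contact_form l X = const k" using homogeneous_degree_0 by blast
  then have "X = (\<lambda>a. const k * strict_field l CZ a)"
    using contact_gradeD(1)[OF assms]
    by (intro contact_vfield_eqI[of _ l]) (simp_all add: contact_vfields_scale strict_field_contact
        contact_form_scale contact_form_strict_field)
  then show ?thesis by (rule that)
qed

lemma bracket_strict_fields:
  assumes "1 \<le> i \<and> i \<le> l" "1 \<le> j \<and> j \<le> l"
  shows "vfield_bracket l (strict_field l (CX i)) (strict_field l (CX j)) =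
      (0 :: 'k::real_normed_field vfield)"
    "vfield_bracket l (strict_field l (CY i)) (strict_field l (CY j)) = (0 :: 'k::real_normed_field vfield)"
    "vfield_bracket l (strict_field l (CX i)) (strict_field l (CY j)) = (if i = j then strict_field l CZ
        else 0 :: 'k::real_normed_field vfield)"
proof -
  have c: "strict_field l (CX i) \<in> contact_vfields l" "strict_field l (CX j) \<in> contact_vfields l"
    "strict_field l (CY i) \<in> contact_vfields l" "strict_field l (CY j) \<in> contact_vfields l"
        "strict_field l CZ \<in> contact_vfields l"
    using assms by (auto intro: strict_field_contact)
  note p = c[THEN contact_vfield_polynomial]
  have z: "0 \<in> contact_vfields l" by (rule subspace_0[OF subspace_contact_vfields])
  note d = partial_deriv_minus_coord[of _ l]
  show "vfield_bracket l (strict_field l (CX i)) (strict_field l (CX j)) = (0 :: 'k vfield)"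
    by (rule contact_vfield_eqI[OF contact_vfields_bracket[OF c(1,2)] z])
      (use assms in \<open>simp add: contact_form_bracket_strict[OF p(1)] contact_form_strict_field
          contact_form_0 d\<close>)
  show "vfield_bracket l (strict_field l (CY i)) (strict_field l (CY j)) = (0 :: 'k vfield)"
    by (rule contact_vfield_eqI[OF contact_vfields_bracket[OF c(3,4)] z])
      (use assms in \<open>simp add: contact_form_bracket_strict[OF p(3)] contact_form_strict_field
          contact_form_0 d\<close>)
  show "vfield_bracket l (strict_field l (CX i)) (strict_field l (CY j)) = (if i =
      j then strict_field l CZ else 0 :: 'k vfield)"
    by (rule contact_vfield_eqI[OF contact_vfields_bracket[OF c(1,4)]])
      (use assms c(5) z in \<open>auto simp: contact_form_bracket_strict[OF p(1)] contact_form_strict_field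
          contact_form_0 d\<close>)
qed

section \<open>Transitivity of the contact algebra\<close>

text \<open>A field that commutes with degree \<open>-1\<close> also commutes with \<open>\<partial>/\<partial>z\<close>, the bracket of \<open>\<partial>/\<partial>x_1\<close>
  and \<open>\<partial>/\<partial>y_1 + x_1 \<partial>/\<partial>z\<close>. So all partial derivatives of the generating function vanish, and a
  function of weight \<open>p + 2 > 0\<close> with this property is zero by Euler's formula.\<close>

lemma contact_transitive:
  fixes X :: "'k::real_normed_field vfield"
  assumes l: "l \<ge> 1" and p: "p \<ge> -1" and X: "X \<in> lie_grade (contact_algebra l) p"
    and 0: "\<And>s. s \<in> lie_grade (contact_algebra l) (-1) \<Longrightarrow> vfield_bracket l X s = 0"
  shows "X = 0"
proof -
  let ?f = "contact_form l X"
  note Xg = contact_gradeD[OF X]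
  have fp: "?f \<in> polynomials l" by (rule homogeneous_polynomial[OF Xg(2)])
  have d: "strict_deriv a ?f = 0" if "a \<in> coords l" "weight a = 1" for a
  proof -
    have "strict_field l a \<in> lie_grade (contact_algebra l) (-1)" using strict_field_grade[OF that(1)]
        that(2) by simp
    from 0[OF this] show ?thesis using contact_form_bracket_strict[OF Xg(3) that(1)]
        by (simp add: contact_form_0)
  qed
  have dx: "partial_deriv (CX i) ?f = 0" if "1 \<le> i \<and> i \<le> l" for i
    using d[of "CX i"] that by simp
  have dy: "partial_deriv (CY i) ?f = - (coord (CX i) * partial_deriv CZ ?f)" if "1 \<le> i \<and> i \<le> l" for i
    using d[of "CY i"] that by (simp add: add_eq_0_iff2)
  have c1: "CX 1 \<in> coords l" "CY 1 \<in> coords l" using l by auto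
  have "0 = partial_deriv (CX 1) (partial_deriv (CY 1) ?f + coord (CX 1) * partial_deriv CZ ?f)"
    using dy[of 1] l by simp
  also have "\<dots> = partial_deriv (CX 1) (partial_deriv (CY 1) ?f) + partial_deriv (CX 1) (coord (CX 1) *
      partial_deriv CZ ?f)"
    using c1 fp by (intro partial_deriv_add[of _ l])
        (auto intro!: polynomial_partial_deriv polynomial_mult polynomial_coord)
  also have "partial_deriv (CX 1) (partial_deriv (CY 1) ?f) = 0"
    using partial_deriv_commute[OF fp c1] dx[of 1] l by simp
  also have "partial_deriv (CX 1) (coord (CX 1) * partial_deriv CZ ?f) = partial_deriv CZ ?f +
      coord (CX 1) * partial_deriv (CX 1) (partial_deriv CZ ?f)"
    using partial_deriv_mult[OF polynomial_coord[OF c1(1)] polynomial_partial_deriv[OF fp] c1(1), of CZ]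
        by simp
  also have "partial_deriv (CX 1) (partial_deriv CZ ?f) = 0"
    using partial_deriv_commute[OF fp c1(1), of CZ] dx[of 1] l by simp
  finally have dz: "partial_deriv CZ ?f = 0" by simp
  have "partial_deriv a ?f = 0" if "a \<in> coords l" for a
    using that dx dy dz by (cases a) auto
  then have "euler l ?f = 0" by (simp add: euler_def)
  then have "const (of_int (p + 2)) * ?f = 0" using euler_homogeneous[OF Xg(2)] by simp
  moreover have "of_int (p + 2) \<noteq> (0 :: 'k)" using p by (simp only: of_int_eq_0_iff)
  ultimately have "?f = 0" by (simp add: fun_eq_iff pointwise const_def)
  then show ?thesis
    using contact_vfield_eqI[OF Xg(1) subspace_0[OF subspace_contact_vfields]] by (simp add: contact_form_0)
qed

section \<open>Derivations of the negative part are inner\<close>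

text \<open>In terms of generating functions, the derivation is induced by the field of \<open>f\<close> if
  \<open>Z f = h_Z\<close> for the strict fields \<open>Z\<close>, with given \<open>h_Z\<close>. This prescribes the partial derivatives
  of \<open>f\<close>, and the derivation property says precisely that they form a closed one-form. The strict
  fields span only over the scalars, whence the linearity assumption.\<close>

lemma contact_inner_derivation:
  fixes D1 D2 :: "'k::real_normed_field vfield \<Rightarrow> 'k vfield"
  assumes l: "l \<ge> 1" and p: "p \<ge> 0" and D: "negative_derivation (contact_algebra l) p D1 D2"
    and K: "\<And>k s. s \<in> lie_grade (contact_algebra l) (-1) \<Longrightarrow> D1 (\<lambda>a. const k * s a) = (\<lambda>a. const k * D1 s a)"
  shows "\<exists>X\<in>lie_grade (contact_algebra l) p. (\<forall>s\<in>lie_grade (contact_algebra l) (-1).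
      vfield_bracket l X s = D1 s) \<and>
    (\<forall>z\<in>lie_grade (contact_algebra l) (-2). vfield_bracket l X z = D2 z)"
proof -
  let ?Z = "strict_field l :: contact_coord \<Rightarrow> 'k vfield"
  let ?G = "lie_grade (contact_algebra l) :: int \<Rightarrow> 'k vfield set"
  from D have lin1: "linear_on (?G (-1)) D1" and lin2: "linear_on (?G (-2)) D2"
    and D1g: "\<And>s. s \<in> ?G (-1) \<Longrightarrow> D1 s \<in> ?G (p - 1)" and D2g: "\<And>s. s \<in> ?G (-2) \<Longrightarrow> D2 s \<in> ?G (p - 2)"
    and D12: "\<And>s t. s \<in> ?G (-1) \<Longrightarrow> t \<in> ?G (-1) \<Longrightarrow> D2 (vfield_bracket l s t) = vfield_bracket l (D1 s) t +
        vfield_bracket l s (D1 t)"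
    and D21: "\<And>z s. z \<in> ?G (-2) \<Longrightarrow> s \<in> ?G (-1) \<Longrightarrow> vfield_bracket l (D2 z) s + vfield_bracket l z (D1 s) = 0"
    by (auto simp: negative_derivation_def)
  have Z1: "?Z a \<in> ?G (-1)" if "a \<in> coords l" "a \<noteq> CZ" for a
    using strict_field_grade[OF that(1)] that by (cases a) auto
  have Z2: "?Z CZ \<in> ?G (-2)" using strict_field_grade[of CZ l] by simp
  define d where "d a = (if a = CZ then D2 (?Z CZ) else D1 (?Z a))" for a
  define h where "h a = - contact_form l (d a)" for a
  have dg: "d a \<in> ?G (p - weight a)" if "a \<in> coords l" for a
    using D1g[OF Z1[OF that]] D2g[OF Z2] by (cases a) (auto simp: d_def)
  note dD = contact_gradeD[OF dg]
  have hg: "h a \<in> homogeneous_polynomials l (p + 2 - weight a)" if "a \<in> coords l" for a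
    using homogeneous_uminus[OF dD(2)[OF that]] by (simp add: h_def algebra_simps)
  have hp: "h a \<in> polynomials l" if "a \<in> coords l" for a by (rule homogeneous_polynomial[OF hg[OF that]])
  have cd: "contact_form l (vfield_bracket l (d a) (?Z b)) = strict_deriv b (h a)" if "a \<in> coords l"
      "b \<in> coords l" for a b
  proof -
    have "strict_deriv b (contact_form l (d a)) = strict_deriv b (- h a)" by (simp add: h_def)
    also have "\<dots> = - strict_deriv b (h a)" using that hp
      by (cases b) (auto simp: partial_deriv_uminus[OF _ hp])
    finally show ?thesis using contact_form_bracket_strict[OF dD(3)[OF that(1)] that(2)] by simp
  qed
  have dc: "contact_form l (vfield_bracket l (?Z b) (d a)) = - strict_deriv b (h a)" if "a \<in> coords l"
      "b \<in> coords l" for a b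
    unfolding bracket_swap[of l "?Z b"] contact_form_uminus cd[OF that] ..
  \<comment> \<open>the derivation property in terms of the functions \<open>h\<close>\<close>
  have comm: "strict_deriv b (h a) - strict_deriv a (h b) = contact_form l (D2 (vfield_bracket l (?Z a)
      (?Z b)))"
    if "a \<in> coords l" "b \<in> coords l" "a \<noteq> CZ" "b \<noteq> CZ" for a b
    using D12[OF Z1 Z1, of a b] cd[of a b] dc[of b a] that by (simp add: contact_form_add d_def)
  have D20: "D2 0 = 0" using linear_on_0[OF lin2] graded_lie.subspace_G[OF graded_lie.intro[OF
      graded_lie_algebra_contact]] by blast
  have xx: "partial_deriv (CX j) (h (CX i)) = partial_deriv (CX i) (h (CX j))" if "1 \<le> i \<and> i \<le> l"
      "1 \<le> j \<and> j \<le> l" for i j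
    using comm[of "CX i" "CX j"] that D20 by (simp add: bracket_strict_fields contact_form_0)
  have yy: "strict_deriv (CY j) (h (CY i)) = strict_deriv (CY i) (h (CY j))" if "1 \<le> i \<and> i \<le> l"
      "1 \<le> j \<and> j \<le> l" for i j
    using comm[of "CY i" "CY j"] that D20 by (simp add: bracket_strict_fields contact_form_0)
  have xy: "strict_deriv (CY j) (h (CX i)) - partial_deriv (CX i) (h (CY j)) = (if i =
      j then - h CZ else 0)"
    if "1 \<le> i \<and> i \<le> l" "1 \<le> j \<and> j \<le> l" for i j
    using comm[of "CX i" "CY j"] that D20 by (simp add: bracket_strict_fields contact_form_0 h_def d_def)
  have z: "strict_deriv a (h CZ) = partial_deriv CZ (h a)" if "a \<in> coords l" "a \<noteq> CZ" for a
  proof -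
    have "vfield_bracket l (d CZ) (?Z a) + vfield_bracket l (?Z CZ) (d a) = 0"
      using D21[OF Z2 Z1[OF that]] that by (simp add: d_def)
    then have "contact_form l (vfield_bracket l (d CZ) (?Z a)) + contact_form l (vfield_bracket l
        (?Z CZ) (d a)) = 0"
      by (metis contact_form_0 contact_form_add)
    then show ?thesis using cd[of CZ a] dc[of a CZ] that by simp
  qed
  \<comment> \<open>solving the triangular system \<open>Z f = h_Z\<close> for the partial derivatives of \<open>f\<close>\<close>
  define g where "g a = (case a of CY i \<Rightarrow> h (CY i) - coord (CX i) * h CZ | _ \<Rightarrow> h a)" for a
  have gs: "g (CX i) = h (CX i)" "g CZ = h CZ" "g (CY i) = h (CY i) - coord (CX i) * h CZ" for i
    by (simp_all add: g_def)
  have gg: "g a \<in> homogeneous_polynomials l (p + 2 - weight a)" if "a \<in> coords l" for a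
  proof (cases a)
    case (CY i)
    have "coord (CX i) * h CZ \<in> homogeneous_polynomials l (p + 2 - weight a)"
      using homogeneous_mult[OF homogeneous_coord[of "CX i" l] hg[of CZ]] that CY
          by (simp add: algebra_simps)
    then show ?thesis using hg[OF that] CY by (simp add: gs homogeneous_diff)
  qed (use hg[OF that] in \<open>simp_all add: gs\<close>)
  have pxz: "partial_deriv a (coord (CX i) * h CZ) = const (if a = CX i then 1 else 0) * h CZ +
      coord (CX i) * partial_deriv a (h CZ)"
    if "a \<in> coords l" "1 \<le> i \<and> i \<le> l" for a i
    using partial_deriv_mult[OF polynomial_coord hp that(1), of "CX i" CZ] that by simp
  have pgy: "partial_deriv a (g (CY i)) = partial_deriv a (h (CY i)) - (const (if a =
      CX i then 1 else 0) * h CZ + coord (CX i) * partial_deriv a (h CZ))"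
    if "a \<in> coords l" "1 \<le> i \<and> i \<le> l" for a i
    using partial_deriv_diff[OF that(1) hp polynomial_mult[OF polynomial_coord hp], of "CY i" "CX i" CZ]
        pxz that
    by (simp add: gs)
  have hz: "partial_deriv CZ (h (CX i)) = partial_deriv (CX i) (h CZ)"
    "partial_deriv CZ (h (CY i)) = partial_deriv (CY i) (h CZ) + coord (CX i) * partial_deriv CZ (h CZ)"
    if "1 \<le> i \<and> i \<le> l" for i
    using z[of "CX i"] z[of "CY i"] that by simp_all
  have cl_xz: "partial_deriv (CX i) (g CZ) = partial_deriv CZ (g (CX i))" if "1 \<le> i \<and> i \<le> l" for i
    using hz that by (simp add: gs)
  have cl_yz: "partial_deriv (CY i) (g CZ) = partial_deriv CZ (g (CY i))" if "1 \<le> i \<and> i \<le> l" for i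
    using hz that by (simp add: pgy gs(2))
  have cl_xy: "partial_deriv (CX i) (g (CY j)) = partial_deriv (CY j) (g (CX i))" if "1 \<le> i \<and> i \<le> l"
      "1 \<le> j \<and> j \<le> l" for i j
  proof -
    have "partial_deriv (CX i) (h (CY j)) = strict_deriv (CY j) (h (CX i)) - (if i = j then - h CZ else 0)"
      using xy[OF that] by (simp add: algebra_simps)
    then show ?thesis using that hz[OF that(1)] by (auto simp: pgy gs(1))
  qed
  have cl_yy: "partial_deriv (CY i) (g (CY j)) = partial_deriv (CY j) (g (CY i))" if "1 \<le> i \<and> i \<le> l"
      "1 \<le> j \<and> j \<le> l" for i j
    using yy[OF that] that hz(2)[OF that(1)] hz(2)[OF that(2)] by (simp add: pgy algebra_simps)
  have closed: "partial_deriv a (g b) = partial_deriv b (g a)" if ab: "a \<in> coords l" "b \<in> coords l" for a b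
  proof (cases a)
    case (CX i)
    then show ?thesis using ab cl_xy cl_xz xx by (cases b) (auto simp: gs(1))
  next
    case (CY i)
    then show ?thesis using ab cl_xy[symmetric] cl_yy cl_yz by (cases b) auto
  next
    case CZ
    then show ?thesis using ab cl_xz cl_yz by (cases b) auto
  qed
  obtain f where f: "f \<in> homogeneous_polynomials l (p + 2)" "\<And>a. a \<in> coords l \<Longrightarrow> partial_deriv a f = g a"
    using homogeneous_poincare[of "p + 2" l g] p gg closed by auto
  define X where "X = contact_field l f"
  have X: "X \<in> ?G p" unfolding X_def contact_grade_eq using f by blast
  note XD = contact_gradeD[OF X]
  have Xf: "contact_form l X = f" by (simp add: X_def contact_form_contact_field)
  have XZ: "vfield_bracket l X (?Z a) = d a" if a: "a \<in> coords l" for a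
  proof (rule contact_vfield_eqI)
    show "vfield_bracket l X (?Z a) \<in> contact_vfields l"
        by (rule contact_vfields_bracket[OF XD(1) strict_field_contact[OF a]])
    show "d a \<in> contact_vfields l" by (rule dD(1)[OF a])
    have "strict_deriv a f = h a" using f(2) a by (cases a) (auto simp: gs)
    then show "contact_form l (vfield_bracket l X (?Z a)) = contact_form l (d a)"
      using contact_form_bracket_strict[OF XD(3) a] by (simp add: Xf h_def)
  qed
  interpret c: graded_lie "contact_algebra l :: 'k vfield graded_lie"
      by (rule graded_lie.intro[OF graded_lie_algebra_contact])
  have "?G (-1) \<subseteq> {s \<in> ?G (-1). vfield_bracket l X s = D1 s}"
  proof (rule contact_grade_minus1_subset)
    have "linear_on (?G (-1)) (vfield_bracket l X)"
      using linear_on_subset[OF c.linear_right c.G_S] XD(1) by simp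
    then show "subspace {s \<in> ?G (-1). vfield_bracket l X s = D1 s}"
      by (rule subspace_linear_on_eq[OF c.subspace_G _ lin1])
    show "?Z (CX i) \<in> {s \<in> ?G (-1). vfield_bracket l X s = D1 s}" if "1 \<le> i \<and> i \<le> l" for i
      using XZ[of "CX i"] Z1[of "CX i"] that by (simp add: d_def)
    show "?Z (CY i) \<in> {s \<in> ?G (-1). vfield_bracket l X s = D1 s}" if "1 \<le> i \<and> i \<le> l" for i
      using XZ[of "CY i"] Z1[of "CY i"] that by (simp add: d_def)
    show "(\<lambda>a. const k * s a) \<in> {s \<in> ?G (-1). vfield_bracket l X s = D1 s}"
      if "s \<in> {s \<in> ?G (-1). vfield_bracket l X s = D1 s}" for k s
      using that K contact_grade_scale bracket_scale_right contact_gradeD(3) by fastforce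
  qed
  \<comment> \<open>degree \<open>-2\<close> consists of brackets, so \<open>D1\<close> determines \<open>D2\<close>\<close>
  moreover have "vfield_bracket l X z = D2 z" if z: "z \<in> ?G (-2)" for z
  proof -
    obtain n where n: "1 \<le> n \<and> n \<le> l" using l by auto
    obtain k where k: "z = (\<lambda>a. const k * ?Z CZ a)" using contact_grade_minus2[OF z] by blast
    have Z: "?Z (CX n) \<in> ?G (-1)" "?Z (CY n) \<in> ?G (-1)" using Z1 n by auto
    have br: "vfield_bracket l (?Z (CX n)) (?Z (CY n)) = ?Z CZ" using bracket_strict_fields(3)[OF n n]
        by simp
    have pv: "?Z (CX n) \<in> polynomial_vfields l" "D1 (?Z (CX n)) \<in> polynomial_vfields l"
        "?Z CZ \<in> polynomial_vfields l"
      using contact_gradeD(3) Z(1) D1g[OF Z(1)] Z2 by blast+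
    have "D2 z = D2 (vfield_bracket l (\<lambda>a. const k * ?Z (CX n) a) (?Z (CY n)))"
      unfolding k bracket_scale_left[OF pv(1)] br ..
    also have "\<dots> = (\<lambda>a. const k * (vfield_bracket l (D1 (?Z (CX n))) (?Z (CY n)) +
        vfield_bracket l (?Z (CX n)) (D1 (?Z (CY n)))) a)"
      using D12[OF contact_grade_scale[OF Z(1)] Z(2)] K[OF Z(1)]
      by (simp add: bracket_scale_left pv scale_vfield_add)
    also have "\<dots> = (\<lambda>a. const k * D2 (?Z CZ) a)" using D12[OF Z] br by simp
    also have "D2 (?Z CZ) = vfield_bracket l X (?Z CZ)" using XZ[of CZ] by (simp add: d_def)
    finally show ?thesis using bracket_scale_right[OF pv(3), of X k] k by simp
  qed
  ultimately show ?thesis using X by blast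
qed

lemma contact_full_prolongation:
  assumes l: "l \<ge> 1"
    and K: "\<And>p (D1 :: 'k vfield \<Rightarrow> 'k vfield) D2 k s. p \<ge> 0 \<Longrightarrow> negative_derivation (contact_algebra l) p
        D1 D2 \<Longrightarrow> s \<in> lie_grade (contact_algebra l) (-1) \<Longrightarrow>
      D1 (\<lambda>a. const k * s a) = (\<lambda>a. const k * D1 s a)"
  shows "full_prolongation (contact_algebra l :: 'k::{real_normed_field,
      euclidean_space} vfield graded_lie)"
  unfolding full_prolongation_def contact_algebra_simps
proof (intro conjI allI impI ballI)
  show "graded_lie_algebra (contact_algebra l :: 'k vfield graded_lie)" by (rule graded_lie_algebra_contact)
  fix p :: int
  show "finite_dimensional (lie_grade (contact_algebra l) p :: 'k vfield set)"
    unfolding contact_grade_eq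
    by (rule finite_dimensional_linear_image[OF finite_dimensional_homogeneous
          linear_on_subset[OF linear_contact_field homogeneous_subset] inj_contact_field])
  show "lie_grade (contact_algebra l :: 'k vfield graded_lie) p = {0}" if "p < - 2"
  proof -
    have "homogeneous_polynomials l (p + 2) = ({0} :: 'k fn set)"
      using homogeneous_negative[of _ l "p + 2"] that homogeneous_0 by auto
    then show ?thesis
      unfolding contact_grade_eq using linear_on_0[OF linear_contact_field subspace_polynomials(1), of
          l] by simp
  qed
  show "X = 0" if "- 1 \<le> p" "X \<in> lie_grade (contact_algebra l) p"
    "\<forall>s\<in>lie_grade (contact_algebra l) (- 1). vfield_bracket l X s = 0" for X :: "'k vfield"
    using contact_transitive[OF l that(1,2)] that(3) by blast
  show "\<exists>X\<in>lie_grade (contact_algebra l) p. (\<forall>s\<in>lie_grade (contact_algebra l) (- 1).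
      vfield_bracket l X s = D1 s) \<and>
            (\<forall>z\<in>lie_grade (contact_algebra l) (- 2). vfield_bracket l X z = D2 z)"
    if "0 \<le> p" "negative_derivation (contact_algebra l) p D1 D2" for D1 D2 :: "'k vfield \<Rightarrow> 'k vfield"
    using contact_inner_derivation[OF l that] K[OF that] by blast
qed

theorem real_contact_full_prolongation:
  assumes "l \<ge> 1" shows "full_prolongation (contact_algebra l :: real vfield graded_lie)"
proof (rule contact_full_prolongation[OF assms])
  fix p and D1 D2 :: "real vfield \<Rightarrow> real vfield" and k and s :: "real vfield"
  assume "negative_derivation (contact_algebra l) p D1 D2" "s \<in> lie_grade (contact_algebra l) (- 1)"
  then show "D1 (\<lambda>a. const k * s a) = (\<lambda>a. const k * D1 s a)"
    using linear_on_scale[of "lie_grade (contact_algebra l) (-1)" D1 s k]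
    by (simp add: negative_derivation_def scaleR_vfield)
qed

text \<open>Complex linearity of a derivation \<open>D\<close> comes for free. The derivation property and
  \<open>[\<i> s, t] = [s, \<i> t]\<close> give \<open>[E s, t] = [s, E t]\<close> for the defect \<open>E s = D (\<i> s) - \<i> D s\<close>. Replacing
  \<open>s\<close> by \<open>\<i> s\<close> changes the sign of the left hand side relative to the right hand side, because
  \<open>E (\<i> s) = - \<i> E s\<close>; so \<open>[E s, t] = 0\<close>.\<close>

theorem complex_contact_full_prolongation:
  assumes l: "l \<ge> 1" shows "full_prolongation (contact_algebra l :: complex vfield graded_lie)"
proof (rule contact_full_prolongation[OF assms])
  fix p and D1 D2 :: "complex vfield \<Rightarrow> complex vfield" and k and s :: "complex vfield"
  let ?G = "lie_grade (contact_algebra l) :: int \<Rightarrow> complex vfield set"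
  define J where "J = (\<lambda>X :: complex vfield. (\<lambda>a. const \<i> * X a))"
  assume p: "0 \<le> p" and D: "negative_derivation (contact_algebra l) p D1 D2" and s: "s \<in> ?G (- 1)"
  interpret c: graded_lie "contact_algebra l :: complex vfield graded_lie"
      by (rule graded_lie.intro[OF graded_lie_algebra_contact])
  from D have lin1: "linear_on (?G (-1)) D1"
    and D1g: "\<And>s. s \<in> ?G (-1) \<Longrightarrow> D1 s \<in> ?G (p - 1)"
    and D12: "\<And>s t. s \<in> ?G (-1) \<Longrightarrow> t \<in> ?G (-1) \<Longrightarrow> D2 (vfield_bracket l s t) = vfield_bracket l (D1 s) t +
        vfield_bracket l s (D1 t)"
    by (auto simp: negative_derivation_def)
  have JG: "J s \<in> ?G q" if "s \<in> ?G q" for s q using that contact_grade_scale by (simp add: J_def)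
  have JJ: "J (J X) = - X" for X by (rule ext) (simp add: J_def pointwise const_def fun_eq_iff flip:
      mult.assoc)
  have Jadd: "J (X + Y) = J X + J Y" "J (X - Y) = J X - J Y" "J (- X) = - J X" for X Y
    by (rule ext, simp add: J_def pointwise algebra_simps)+
  have Jl: "vfield_bracket l (J X) Y = J (vfield_bracket l X Y)" if "X \<in> ?G q" for X Y q
    using contact_gradeD(3)[OF that] bracket_scale_left by (simp add: J_def)
  have Jr: "vfield_bracket l X (J Y) = J (vfield_bracket l X Y)" if "Y \<in> ?G q" for X Y q
    using contact_gradeD(3)[OF that] bracket_scale_right by (simp add: J_def)
  have S: "X \<in> c.S" if "X \<in> ?G q" for X q using that c.G_SD by blast
  define E where "E s = D1 (J s) - J (D1 s)" for s
  have EG: "E s \<in> ?G (p - 1)" if "s \<in> ?G (-1)" for s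
    unfolding E_def using that D1g JG by (intro subspace_diff[OF c.subspace_G]) auto
  have E1: "vfield_bracket l (E s) t = vfield_bracket l s (E t)" if st: "s \<in> ?G (-1)" "t \<in> ?G (-1)" for s t
  proof -
    have "vfield_bracket l (D1 (J s)) t + vfield_bracket l (J s) (D1 t) = vfield_bracket l (D1 s) (J t)
        + vfield_bracket l s (D1 (J t))"
      using D12[OF JG[OF st(1)] st(2)] D12[OF st(1) JG[OF st(2)]] Jl[OF st(1)] Jr[OF st(2)] by metis
    moreover have "vfield_bracket l (J s) (D1 t) = vfield_bracket l s (J (D1 t))"
      "vfield_bracket l (D1 s) (J t) = vfield_bracket l (J (D1 s)) t"
      using Jl[OF st(1)] Jr[OF st(2)] Jl[OF D1g[OF st(1)]] Jr[OF D1g[OF st(2)]] by metis+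
    moreover have "vfield_bracket l (E s) t = vfield_bracket l (D1 (J s)) t - vfield_bracket l (J (D1 s)) t"
      "vfield_bracket l s (E t) = vfield_bracket l s (D1 (J t)) - vfield_bracket l s (J (D1 t))"
      unfolding E_def using c.br_diff_left[OF S[OF st(2)] S[OF D1g[OF JG[OF st(1)]]] S[OF JG[OF D1g[OF
          st(1)]]]]
        c.br_diff_right[OF S[OF st(1)] S[OF D1g[OF JG[OF st(2)]]] S[OF JG[OF D1g[OF st(2)]]]] by simp_all
    ultimately show ?thesis by (metis diff_eq_diff_swap)
  qed
  have EJ: "E (J s) = - J (E s)" if s: "s \<in> ?G (-1)" for s
    using linear_on_neg[OF lin1 s] by (simp add: E_def JJ Jadd)
  have "E s = 0" if s: "s \<in> ?G (-1)" for s
  proof (rule contact_transitive[OF l _ EG[OF s]])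
    fix t assume t: "t \<in> ?G (-1)"
    have "- J (vfield_bracket l (E s) t) = vfield_bracket l (E (J s)) t"
      using Jl[OF EG[OF s]] c.br_neg_left[OF S[OF t] S[OF JG[OF EG[OF s]]]] by (simp add: EJ[OF s])
    also have "\<dots> = J (vfield_bracket l (E s) t)"
      using E1[OF JG[OF s] t] Jl[OF s] E1[OF s t] by simp
    finally have "J (vfield_bracket l (E s) t) = 0" by (rule neg_eq_self_imp_0)
    then have "J (J (vfield_bracket l (E s) t)) = J 0" by simp
    then show "vfield_bracket l (E s) t = 0" using Jadd(2)[of 0 0] by (simp add: JJ)
  qed (use p in simp)
  then have DJ: "D1 (J s) = J (D1 s)" using s by (simp add: E_def)
  have dec: "(\<lambda>a. const k * X a) = Re k *\<^sub>R X + Im k *\<^sub>R J X" for X :: "complex vfield"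
  proof
    fix a
    have "k * w = of_real (Re k) * w + of_real (Im k) * (\<i> * w)" for w
      by (simp add: complex_eq_iff algebra_simps)
    then show "const k * X a = (Re k *\<^sub>R X + Im k *\<^sub>R J X) a"
      unfolding scaleR_vfield J_def by (intro ext) (simp add: pointwise const_def)
  qed
  show "D1 (\<lambda>a. const k * s a) = (\<lambda>a. const k * D1 s a)"
    unfolding dec using s JG[OF s] DJ
    by (simp add: linear_on_add[OF lin1] linear_on_scale[OF lin1] subspace_scale[OF c.subspace_G])
qed

section \<open>Direct sums of full prolongations\<close>

lemma lie_direct_sum_simps [simp]:
  "lie_space (L \<oplus>\<^sub>g\<^sub>r M) = lie_space L \<times> lie_space M"
  "lie_bracket (L \<oplus>\<^sub>g\<^sub>r M) x y = (lie_bracket L (fst x) (fst y), lie_bracket M (snd x) (snd y))"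
  "lie_grade (L \<oplus>\<^sub>g\<^sub>r M) p = lie_grade L p \<times> lie_grade M p"
  by (simp_all add: lie_direct_sum_def case_prod_beta)

lemma span_Times_Union:
  assumes "\<And>i. i \<in> I \<Longrightarrow> 0 \<in> F i" "\<And>i. i \<in> I \<Longrightarrow> 0 \<in> G i"
  shows "span (\<Union>i\<in>I. F i \<times> G i) = span (\<Union>i\<in>I. F i) \<times> span (\<Union>i\<in>I. G i)"
proof
  show "span (\<Union>i\<in>I. F i \<times> G i) \<subseteq> span (\<Union>i\<in>I. F i) \<times> span (\<Union>i\<in>I. G i)"
    by (intro span_minimal subspace_Times subspace_span) (auto intro: span_base)
  have 1: "(x, 0) \<in> span (\<Union>i\<in>I. F i \<times> G i)" if "x \<in> span (\<Union>i\<in>I. F i)" for x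
  proof -
    have "linear (\<lambda>x. (x, 0 :: 'c))" by (rule linearI) auto
    then have "(\<lambda>x. (x, 0 :: 'c)) ` span (\<Union>i\<in>I. F i) = span ((\<lambda>x. (x, 0)) ` (\<Union>i\<in>I. F i))"
      by (rule linear_span_image[symmetric])
    also have "\<dots> \<subseteq> span (\<Union>i\<in>I. F i \<times> G i)" using assms by (intro span_mono) auto
    finally show ?thesis using that by blast
  qed
  have 2: "(0, y) \<in> span (\<Union>i\<in>I. F i \<times> G i)" if "y \<in> span (\<Union>i\<in>I. G i)" for y
  proof -
    have "linear (\<lambda>x. (0 :: 'b, x))" by (rule linearI) auto
    then have "(\<lambda>x. (0 :: 'b, x)) ` span (\<Union>i\<in>I. G i) = span ((\<lambda>x. (0, x)) ` (\<Union>i\<in>I. G i))"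
      by (rule linear_span_image[symmetric])
    also have "\<dots> \<subseteq> span (\<Union>i\<in>I. F i \<times> G i)" using assms by (intro span_mono) auto
    finally show ?thesis using that by blast
  qed
  show "span (\<Union>i\<in>I. F i) \<times> span (\<Union>i\<in>I. G i) \<subseteq> span (\<Union>i\<in>I. F i \<times> G i)"
  proof clarify
    fix x y assume "x \<in> span (\<Union>i\<in>I. F i)" "y \<in> span (\<Union>i\<in>I. G i)"
    from span_add[OF 1[OF this(1)] 2[OF this(2)]] show "(x, y) \<in> span (\<Union>i\<in>I. F i \<times> G i)" by simp
  qed
qed

lemma negative_part_direct_sum:
  assumes "graded_lie_algebra L" "graded_lie_algebra M"
  shows "negative_part (L \<oplus>\<^sub>g\<^sub>r M) = negative_part L \<oplus>\<^sub>g\<^sub>r negative_part M"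
proof -
  interpret L: graded_lie L by (rule graded_lie.intro[OF assms(1)])
  interpret M: graded_lie M by (rule graded_lie.intro[OF assms(2)])
  have "0 \<in> L.G p" "0 \<in> M.G p" for p using L.subspace_G M.subspace_G subspace_0 by auto
  then show ?thesis
    by (auto simp: negative_part_def lie_direct_sum_def span_Times_Union fun_eq_iff zero_prod_def)
qed

lemma graded_lie_algebra_direct_sum:
  assumes "graded_lie_algebra L" "graded_lie_algebra M"
  shows "graded_lie_algebra (L \<oplus>\<^sub>g\<^sub>r M)"
proof -
  interpret L: graded_lie L by (rule graded_lie.intro[OF assms(1)])
  interpret M: graded_lie M by (rule graded_lie.intro[OF assms(2)])
  have z: "0 \<in> L.G p" "0 \<in> M.G p" for p using L.subspace_G M.subspace_G subspace_0 by auto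
  have LM: "f i = 0" if "finite A" "\<And>i. i \<in> A \<Longrightarrow> f i \<in> L.G i" "sum f A = 0" "i \<in> A" for f A i
    using L.direct that by (auto simp: internal_direct_sum_iff)
  have MM: "f i = 0" if "finite A" "\<And>i. i \<in> A \<Longrightarrow> f i \<in> M.G i" "sum f A = 0" "i \<in> A" for f A i
    using M.direct that by (auto simp: internal_direct_sum_iff)
  show ?thesis
    unfolding graded_lie_algebra_def
  proof (intro conjI ballI allI)
    let ?N = "L \<oplus>\<^sub>g\<^sub>r M"
    show "subspace (lie_space ?N)" unfolding lie_direct_sum_simps
        by (intro subspace_Times L.subspace_S M.subspace_S)
    show "bilinear_on (lie_space ?N) (lie_space ?N) (lie_bracket ?N)"
      by (auto simp: bilinear_on_def linear_on_def L.br_add_left L.br_add_right L.br_scale_left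
          L.br_scale_right
          M.br_add_left M.br_add_right M.br_scale_left M.br_scale_right)
    show "internal_direct_sum UNIV (lie_grade ?N) (lie_space ?N)"
      unfolding internal_direct_sum_iff lie_direct_sum_simps
    proof (intro conjI ballI allI impI)
      show "L.S \<times> M.S \<subseteq> span (\<Union>i. L.G i \<times> M.G i)"
        unfolding L.S_span M.S_span using z by (subst span_Times_Union) auto
      show "L.G p \<times> M.G p \<subseteq> L.S \<times> M.S" for p using L.G_S M.G_S by blast
      fix A and f :: "int \<Rightarrow> 'a \<times> 'b" and i
      assume A: "finite A" "\<forall>i\<in>A. f i \<in> L.G i \<times> M.G i" "sum f A = 0" "i \<in> A"
      have "(\<Sum>i\<in>A. fst (f i)) = 0" "(\<Sum>i\<in>A. snd (f i)) = 0"
        using A(3) by (simp_all add: fst_sum[symmetric] snd_sum[symmetric])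
      then have "fst (f i) = 0" "snd (f i) = 0"
        using LM[of A "\<lambda>i. fst (f i)" i] MM[of A "\<lambda>i. snd (f i)" i] A(1,2,4) by (auto simp: mem_Times_iff)
      then show "f i = 0" by (simp add: prod_eq_iff)
    qed (auto intro!: subspace_Times L.subspace_S M.subspace_S L.subspace_G M.subspace_G)
    show "lie_bracket ?N x x = 0" if "x \<in> lie_space ?N" for x
      using that by (auto simp: L.br_self M.br_self zero_prod_def)
  qed (auto simp: L.br_closed M.br_closed L.jacobi0 M.jacobi0 L.br_grade M.br_grade zero_prod_def)
qed

lemma linear_on_inject:
  assumes "linear_on (F \<times> G) D" "subspace F" "subspace G"
  shows "linear_on F (\<lambda>x. fst (D (x, 0)))" "linear_on G (\<lambda>y. snd (D (0, y)))"
  using linear_on_add[OF assms(1), of "(_, 0)" "(_, 0)"] linear_on_scale[OF assms(1), of "(_, 0)"]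
    linear_on_add[OF assms(1), of "(0, _)" "(0, _)"] linear_on_scale[OF assms(1), of "(0, _)"]
    subspace_0[OF assms(2)] subspace_0[OF assms(3)]
  by (simp_all add: linear_on_def)

text \<open>For \<open>s\<close> in \<open>L\<close> and \<open>t\<close> in \<open>M\<close>, both of degree \<open>-1\<close>, the derivation property of \<open>[s, t] = 0\<close>
  shows that the \<open>M\<close>-component of \<open>D s\<close> commutes with \<open>t\<close>; so it vanishes by transitivity. In degree
  \<open>-2\<close> transitivity is not available when \<open>p = 0\<close>, and the mixed components vanish because degree
  \<open>-2\<close> consists of brackets.\<close>

theorem full_prolongation_direct_sum:
  assumes fL: "full_prolongation L" and fM: "full_prolongation M"
    and genL: "\<And>z. z \<in> lie_grade L (-2) \<Longrightarrow> \<exists>s\<in>lie_grade L (-1). \<exists>t\<in>lie_grade L (-1). z = lie_bracket L s t"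
    and genM: "\<And>z. z \<in> lie_grade M (-2) \<Longrightarrow> \<exists>s\<in>lie_grade M (-1). \<exists>t\<in>lie_grade M (-1). z = lie_bracket M s t"
  shows "full_prolongation (L \<oplus>\<^sub>g\<^sub>r M)"
proof -
  have gla: "graded_lie_algebra L" "graded_lie_algebra M" using assms
      by (simp_all add: full_prolongation_def)
  interpret L: graded_lie L by (rule graded_lie.intro[OF gla(1)])
  interpret M: graded_lie M by (rule graded_lie.intro[OF gla(2)])
  have zL [simp]: "0 \<in> L.G p" "0 \<in> L.S" for p using L.subspace_G L.subspace_S subspace_0 by auto
  have zM [simp]: "0 \<in> M.G p" "0 \<in> M.S" for p using M.subspace_G M.subspace_S subspace_0 by auto
  have trL: "X = 0" if "-1 \<le> p" "X \<in> L.G p" "\<And>s. s \<in> L.G (-1) \<Longrightarrow> L.br X s = 0" for X p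
    using fL that by (simp add: full_prolongation_def)
  have trM: "X = 0" if "-1 \<le> p" "X \<in> M.G p" "\<And>s. s \<in> M.G (-1) \<Longrightarrow> M.br X s = 0" for X p
    using fM that by (simp add: full_prolongation_def)
  show ?thesis
    unfolding full_prolongation_def
  proof (intro conjI allI impI ballI)
    show "graded_lie_algebra (L \<oplus>\<^sub>g\<^sub>r M)" by (rule graded_lie_algebra_direct_sum[OF gla])
    show "finite_dimensional (lie_grade (L \<oplus>\<^sub>g\<^sub>r M) p)" for p
    proof -
      have "finite_dimensional (L.G p)" "finite_dimensional (M.G p)"
        using fL fM by (simp_all add: full_prolongation_def)
      moreover obtain A where "finite A" "L.G p = span A"
        using \<open>finite_dimensional (L.G p)\<close> unfolding finite_dimensional_def by (elim exE conjE)
      moreover obtain B where "finite B" "M.G p = span B"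
        using \<open>finite_dimensional (M.G p)\<close> unfolding finite_dimensional_def by (elim exE conjE)
      ultimately have "lie_grade (L \<oplus>\<^sub>g\<^sub>r M) p = span (insert 0 A \<times> insert 0 B)"
        using span_Times_Union[of "{()}" "\<lambda>_. insert 0 A" "\<lambda>_. insert 0 B"] by simp
      moreover have "finite (insert 0 A \<times> insert 0 B)" using \<open>finite A\<close> \<open>finite B\<close> by simp
      ultimately show ?thesis unfolding finite_dimensional_def by blast
    qed
    show "lie_grade (L \<oplus>\<^sub>g\<^sub>r M) p = {0}" if "p < - 2" for p
      using that assms by (auto simp: full_prolongation_def zero_prod_def)
    show "X = 0" if p: "- 1 \<le> p" and X: "X \<in> lie_grade (L \<oplus>\<^sub>g\<^sub>r M) p"
      and 0: "\<forall>s\<in>lie_grade (L \<oplus>\<^sub>g\<^sub>r M) (- 1). lie_bracket (L \<oplus>\<^sub>g\<^sub>r M) X s = 0" for p X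
    proof -
      have "L.br (fst X) s = 0" if "s \<in> L.G (-1)" for s
        using bspec[OF 0, of "(s, 0)"] that by (simp add: zero_prod_def)
      moreover have "M.br (snd X) s = 0" if "s \<in> M.G (-1)" for s
        using bspec[OF 0, of "(0, s)"] that by (simp add: zero_prod_def)
      ultimately have "fst X = 0" "snd X = 0" using trL[OF p] trM[OF p] X by (auto simp: mem_Times_iff)
      then show ?thesis by (simp add: prod_eq_iff)
    qed
    fix p D1 D2 assume p: "0 \<le> p" and D: "negative_derivation (L \<oplus>\<^sub>g\<^sub>r M) p D1 D2"
    note D' = D[unfolded negative_derivation_def lie_direct_sum_simps]
    have lin1: "linear_on (L.G (-1) \<times> M.G (-1)) D1" and lin2: "linear_on (L.G (-2) \<times> M.G (-2)) D2"
      and D1g: "\<And>x y. x \<in> L.G (-1) \<Longrightarrow> y \<in> M.G (-1) \<Longrightarrow> D1 (x, y) \<in> L.G (p - 1) \<times> M.G (p - 1)"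
      and D2g: "\<And>x y. x \<in> L.G (-2) \<Longrightarrow> y \<in> M.G (-2) \<Longrightarrow> D2 (x, y) \<in> L.G (p - 2) \<times> M.G (p - 2)"
      and D12: "\<And>x y x' y'. x \<in> L.G (-1) \<Longrightarrow> y \<in> M.G (-1) \<Longrightarrow> x' \<in> L.G (-1) \<Longrightarrow> y' \<in> M.G (-1) \<Longrightarrow>
        D2 (L.br x x', M.br y y') = (L.br (fst (D1 (x, y))) x' + L.br x (fst (D1 (x', y'))),
          M.br (snd (D1 (x, y))) y' + M.br y (snd (D1 (x', y'))))"
      and D21: "\<And>x y x' y'. x \<in> L.G (-2) \<Longrightarrow> y \<in> M.G (-2) \<Longrightarrow> x' \<in> L.G (-1) \<Longrightarrow> y' \<in> M.G (-1) \<Longrightarrow>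
        L.br (fst (D2 (x, y))) x' + L.br x (fst (D1 (x', y'))) = 0 \<and>
          M.br (snd (D2 (x, y))) y' + M.br y (snd (D1 (x', y'))) = 0"
      using D' by (auto simp: zero_prod_def)
    have zz: "L.br 0 x = 0" "L.br x 0 = 0" if "x \<in> L.S" for x using that L.br_0_left L.br_0_right by auto
    have zzM: "M.br 0 x = 0" "M.br x 0 = 0" if "x \<in> M.S" for x using that M.br_0_left M.br_0_right by auto
    have D1S: "fst (D1 (x, y)) \<in> L.S" "snd (D1 (x, y)) \<in> M.S" if "x \<in> L.G (-1)" "y \<in> M.G (-1)" for x y
      using D1g[OF that] L.G_SD M.G_SD by (auto simp: mem_Times_iff)
    have D20: "D2 (0, 0) = (0, 0)"
      using linear_on_0[OF lin2 subspace_Times[OF L.subspace_G M.subspace_G]] by (simp add: zero_prod_def)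
    have p1: "-1 \<le> p - 1" using p by simp
    \<comment> \<open>the mixed components vanish\<close>
    have c1: "snd (D1 (x, 0)) = 0" if x: "x \<in> L.G (-1)" for x
    proof (rule trM[OF p1])
      show "snd (D1 (x, 0)) \<in> M.G (p - 1)" using D1g[OF x, of 0] by (auto simp: mem_Times_iff)
      fix t assume t: "t \<in> M.G (-1)"
      have "D2 (L.br x 0, M.br 0 t) = (0, 0)" using D20 zz zzM x t L.G_SD M.G_SD by simp
      then show "M.br (snd (D1 (x, 0))) t = 0"
        using D12[of x 0 0 t] x t zzM(1)[OF D1S(2)[of 0 t]] by simp
    qed
    have c2: "fst (D1 (0, y)) = 0" if y: "y \<in> M.G (-1)" for y
    proof (rule trL[OF p1])
      show "fst (D1 (0, y)) \<in> L.G (p - 1)" using D1g[OF _ y, of 0] by (auto simp: mem_Times_iff)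
      fix t assume t: "t \<in> L.G (-1)"
      have "D2 (L.br 0 t, M.br y 0) = (0, 0)" using D20 zz zzM y t L.G_SD M.G_SD by simp
      then show "L.br (fst (D1 (0, y))) t = 0"
        using D12[of 0 y t 0] y t zz(1)[OF D1S(1)[of t 0]] by simp
    qed
    have d1: "snd (D2 (x, 0)) = 0" if x: "x \<in> L.G (-2)" for x
    proof -
      obtain s t where st: "s \<in> L.G (-1)" "t \<in> L.G (-1)" "x = L.br s t" using genL[OF x] by blast
      have "D2 (x, 0) = D2 (L.br s t, M.br 0 0)" using st zzM by simp
      then show ?thesis using D12[of s 0 t 0] st c1 zzM by simp
    qed
    have d2: "fst (D2 (0, y)) = 0" if y: "y \<in> M.G (-2)" for y
    proof -
      obtain s t where st: "s \<in> M.G (-1)" "t \<in> M.G (-1)" "y = M.br s t" using genM[OF y] by blast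
      have "D2 (0, y) = D2 (L.br 0 0, M.br s t)" using st zz by simp
      then show ?thesis using D12[of 0 s 0 t] st c2 zz by simp
    qed
    have "negative_derivation L p (\<lambda>x. fst (D1 (x, 0))) (\<lambda>x. fst (D2 (x, 0)))"
      unfolding negative_derivation_def
    proof (intro conjI ballI)
      show "linear_on (L.G (-1)) (\<lambda>x. fst (D1 (x, 0)))" "linear_on (L.G (-2)) (\<lambda>x. fst (D2 (x, 0)))"
        using linear_on_inject(1)[OF lin1 L.subspace_G M.subspace_G]
            linear_on_inject(1)[OF lin2 L.subspace_G M.subspace_G] .
      show "(\<lambda>x. fst (D1 (x, 0))) ` L.G (-1) \<subseteq> L.G (p - 1)" "(\<lambda>x. fst (D2 (x, 0))) ` L.G (-2) \<subseteq> L.G (p - 2)"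
        using D1g[OF _ zM(1)] D2g[OF _ zM(1)] by (auto simp: mem_Times_iff)
      show "fst (D2 (L.br s t, 0)) = L.br (fst (D1 (s, 0))) t + L.br s (fst (D1 (t, 0)))"
        if "s \<in> L.G (-1)" "t \<in> L.G (-1)" for s t
        using D12[of s 0 t 0] that zzM by simp
      show "L.br (fst (D2 (z, 0))) s + L.br z (fst (D1 (s, 0))) = 0"
        if "z \<in> L.G (-2)" "s \<in> L.G (-1)" for z s using D21[of z 0 s 0] that by simp
    qed
    from full_prolongation_inner[OF fL p this]
    obtain X where X: "X \<in> L.G p" "\<And>s. s \<in> L.G (-1) \<Longrightarrow> L.br X s = fst (D1 (s, 0))"
      "\<And>s. s \<in> L.G (-2) \<Longrightarrow> L.br X s = fst (D2 (s, 0))" by blast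
    have "negative_derivation M p (\<lambda>x. snd (D1 (0, x))) (\<lambda>x. snd (D2 (0, x)))"
      unfolding negative_derivation_def
    proof (intro conjI ballI)
      show "linear_on (M.G (-1)) (\<lambda>x. snd (D1 (0, x)))" "linear_on (M.G (-2)) (\<lambda>x. snd (D2 (0, x)))"
        using linear_on_inject(2)[OF lin1 L.subspace_G M.subspace_G]
            linear_on_inject(2)[OF lin2 L.subspace_G M.subspace_G] .
      show "(\<lambda>x. snd (D1 (0, x))) ` M.G (-1) \<subseteq> M.G (p - 1)" "(\<lambda>x. snd (D2 (0, x))) ` M.G (-2) \<subseteq> M.G (p - 2)"
        using D1g[OF zL(1)] D2g[OF zL(1)] by (auto simp: mem_Times_iff)
      show "snd (D2 (0, M.br s t)) = M.br (snd (D1 (0, s))) t + M.br s (snd (D1 (0, t)))"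
        if "s \<in> M.G (-1)" "t \<in> M.G (-1)" for s t
        using D12[of 0 s 0 t] that zz by simp
      show "M.br (snd (D2 (0, z))) s + M.br z (snd (D1 (0, s))) = 0"
        if "z \<in> M.G (-2)" "s \<in> M.G (-1)" for z s using D21[of 0 z 0 s] that by simp
    qed
    from full_prolongation_inner[OF fM p this]
    obtain Y where Y: "Y \<in> M.G p" "\<And>s. s \<in> M.G (-1) \<Longrightarrow> M.br Y s = snd (D1 (0, s))"
      "\<And>s. s \<in> M.G (-2) \<Longrightarrow> M.br Y s = snd (D2 (0, s))" by blast
    show "\<exists>X\<in>lie_grade (L \<oplus>\<^sub>g\<^sub>r M) p. (\<forall>s\<in>lie_grade (L \<oplus>\<^sub>g\<^sub>r M) (- 1). lie_bracket (L \<oplus>\<^sub>g\<^sub>r M) X s = D1 s) \<and>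
      (\<forall>z\<in>lie_grade (L \<oplus>\<^sub>g\<^sub>r M) (- 2). lie_bracket (L \<oplus>\<^sub>g\<^sub>r M) X z = D2 z)"
    proof (intro bexI[of _ "(X, Y)"] conjI ballI)
      fix s assume "s \<in> lie_grade (L \<oplus>\<^sub>g\<^sub>r M) (- 1)"
      then obtain x y where s: "s = (x, y)" "x \<in> L.G (-1)" "y \<in> M.G (-1)" by auto
      have "D1 s = D1 (x, 0) + D1 (0, y)" using linear_on_add[OF lin1, of "(x, 0)" "(0, y)"] s by simp
      then show "lie_bracket (L \<oplus>\<^sub>g\<^sub>r M) (X, Y) s = D1 s" unfolding s(1) using s(2,3) X Y c1 c2
          by (simp add: prod_eq_iff)
    next
      fix s assume "s \<in> lie_grade (L \<oplus>\<^sub>g\<^sub>r M) (- 2)"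
      then obtain x y where s: "s = (x, y)" "x \<in> L.G (-2)" "y \<in> M.G (-2)" by auto
      have "D2 s = D2 (x, 0) + D2 (0, y)" using linear_on_add[OF lin2, of "(x, 0)" "(0, y)"] s by simp
      then show "lie_bracket (L \<oplus>\<^sub>g\<^sub>r M) (X, Y) s = D2 s" unfolding s(1) using s(2,3) X Y d1 d2
          by (simp add: prod_eq_iff)
    qed (use X Y in simp)
  qed
qed

lemma contact_generated:
  fixes z :: "'k::real_normed_field vfield"
  assumes l: "l \<ge> 1" and z: "z \<in> lie_grade (contact_algebra l) (-2)"
  shows "\<exists>s\<in>lie_grade (contact_algebra l) (-1). \<exists>t\<in>lie_grade (contact_algebra l) (-1). z =
      lie_bracket (contact_algebra l) s t"
proof -
  obtain n where n: "1 \<le> n \<and> n \<le> l" using l by auto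
  obtain k where k: "z = (\<lambda>a. const k * strict_field l CZ a)" by (rule contact_grade_minus2[OF z])
  have Z: "(strict_field l (CX n) :: 'k vfield) \<in> lie_grade (contact_algebra l) (-1)"
    "(strict_field l (CY n) :: 'k vfield) \<in> lie_grade (contact_algebra l) (-1)"
    using strict_field_grade[of "CX n" l] strict_field_grade[of "CY n" l] n by simp_all
  have "z = vfield_bracket l (\<lambda>a. const k * strict_field l (CX n) a) (strict_field l (CY n))"
    unfolding bracket_scale_left[OF contact_gradeD(3)[OF Z(1)]] bracket_strict_fields(3)[OF n n] k by simp
  then show ?thesis using Z contact_grade_scale by (metis contact_algebra_simps(2))
qed

lemma lie_direct_sum_isomorphic:
  assumes "L \<cong>\<^sub>g\<^sub>r L'" "M \<cong>\<^sub>g\<^sub>r M'"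
  shows "L \<oplus>\<^sub>g\<^sub>r M \<cong>\<^sub>g\<^sub>r L' \<oplus>\<^sub>g\<^sub>r M'"
proof -
  obtain \<phi> where \<phi>: "graded_lie_hom L L' \<phi>" "bij_betw \<phi> (lie_space L) (lie_space L')"
    "\<And>p. \<phi> ` lie_grade L p = lie_grade L' p" using assms by (auto simp: graded_lie_isomorphic_def)
  obtain \<psi> where \<psi>: "graded_lie_hom M M' \<psi>" "bij_betw \<psi> (lie_space M) (lie_space M')"
    "\<And>p. \<psi> ` lie_grade M p = lie_grade M' p" using assms by (auto simp: graded_lie_isomorphic_def)
  have 1: "graded_lie_hom (L \<oplus>\<^sub>g\<^sub>r M) (L' \<oplus>\<^sub>g\<^sub>r M') (map_prod \<phi> \<psi>)"
    using \<phi>(1) \<psi>(1) by (auto simp: graded_lie_hom_def linear_on_def image_subset_iff)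
  have 2: "bij_betw (map_prod \<phi> \<psi>) (lie_space (L \<oplus>\<^sub>g\<^sub>r M)) (lie_space (L' \<oplus>\<^sub>g\<^sub>r M'))"
    using \<phi>(2) \<psi>(2) by (auto simp: bij_betw_def map_prod_inj_on map_prod_surj_on)
  have 3: "map_prod \<phi> \<psi> ` lie_grade (L \<oplus>\<^sub>g\<^sub>r M) p = lie_grade (L' \<oplus>\<^sub>g\<^sub>r M') p" for p
    unfolding lie_direct_sum_simps using \<phi>(3) \<psi>(3) by (rule map_prod_surj_on)
  show ?thesis unfolding graded_lie_isomorphic_def using 1 2 3 by blast
qed

section \<open>Symplectic bases\<close>

text \<open>The scalars act by real-linear maps and dimensions are counted over the reals, so that one
  statement covers real and complex symplectic spaces.\<close>

locale symplectic_module =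
  fixes W :: "'w::real_vector set" and act :: "'k::{real_normed_field, euclidean_space} \<Rightarrow> 'w \<Rightarrow> 'w"
    and \<Omega> :: "'w \<Rightarrow> 'w \<Rightarrow> 'k"
  assumes subspace_W: "subspace W" and finite_dimensional_W: "finite_dimensional W"
    and act_closed: "s \<in> W \<Longrightarrow> act k s \<in> W"
    and act_add_left: "s \<in> W \<Longrightarrow> act (k + k') s = act k s + act k' s"
    and act_add_right: "s \<in> W \<Longrightarrow> t \<in> W \<Longrightarrow> act k (s + t) = act k s + act k t"
    and act_of_real: "s \<in> W \<Longrightarrow> act (of_real r) s = r *\<^sub>R s"
    and act_mult: "s \<in> W \<Longrightarrow> act (k * k') s = act k (act k' s)"
    and \<Omega>_add_left: "s \<in> W \<Longrightarrow> t \<in> W \<Longrightarrow> u \<in> W \<Longrightarrow> \<Omega> (s + t) u = \<Omega> s u + \<Omega> t u"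
    and \<Omega>_act_left: "s \<in> W \<Longrightarrow> t \<in> W \<Longrightarrow> \<Omega> (act k s) t = k * \<Omega> s t"
    and \<Omega>_skew: "s \<in> W \<Longrightarrow> t \<in> W \<Longrightarrow> \<Omega> s t = - \<Omega> t s"
    and \<Omega>_nondegenerate: "s \<in> W \<Longrightarrow> (\<And>t. t \<in> W \<Longrightarrow> \<Omega> s t = 0) \<Longrightarrow> s = 0"
begin

lemma act_scale_left: "s \<in> W \<Longrightarrow> act (r *\<^sub>R k) s = r *\<^sub>R act k s"
  using act_mult[of s "of_real r" k] act_of_real[OF act_closed] by (simp add: scaleR_conv_of_real)

lemma act_0 [simp]: "s \<in> W \<Longrightarrow> act 0 s = 0"
  using act_of_real[of s 0] by simp

lemma \<Omega>_scale_left: "s \<in> W \<Longrightarrow> t \<in> W \<Longrightarrow> \<Omega> (r *\<^sub>R s) t = r *\<^sub>R \<Omega> s t"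
  using \<Omega>_act_left[of s t "of_real r"] by (simp add: act_of_real scaleR_conv_of_real)

lemma linear_\<Omega>_left: "t \<in> W \<Longrightarrow> linear_on W (\<lambda>s. \<Omega> s t)"
  by (simp add: linear_on_def \<Omega>_add_left \<Omega>_scale_left)

lemma \<Omega>_add_right: "s \<in> W \<Longrightarrow> t \<in> W \<Longrightarrow> u \<in> W \<Longrightarrow> \<Omega> u (s + t) = \<Omega> u s + \<Omega> u t"
  using \<Omega>_skew[of u "s + t"] \<Omega>_skew[of u s] \<Omega>_skew[of u t] subspace_add[OF subspace_W]
      by (simp add: \<Omega>_add_left)

lemma \<Omega>_act_right: "s \<in> W \<Longrightarrow> t \<in> W \<Longrightarrow> \<Omega> s (act k t) = k * \<Omega> s t"
  using \<Omega>_skew[of s "act k t"] \<Omega>_skew[of s t] act_closed[of t k] by (simp add: \<Omega>_act_left)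

lemma linear_\<Omega>_right: "t \<in> W \<Longrightarrow> linear_on W (\<Omega> t)"
  using \<Omega>_act_right[of t _ "of_real _"] by (simp add: linear_on_def \<Omega>_add_right act_of_real
      scaleR_conv_of_real)

lemma \<Omega>_self: "s \<in> W \<Longrightarrow> \<Omega> s s = 0"
  using \<Omega>_skew[of s s] neg_eq_self_imp_0[of "\<Omega> s s"] by metis

end

lemma finite_dimensional_UNIV: "finite_dimensional (UNIV :: 'a::euclidean_space set)"
  unfolding finite_dimensional_def by (intro exI[of _ Basis]) simp

text \<open>Split off one hyperbolic plane over the scalars and continue with its orthogonal complement,
  which has smaller dimension. Nondegeneracy passes to the complement.\<close>

theorem symplectic_basis:
  fixes act :: "'k::{real_normed_field, euclidean_space} \<Rightarrow> 'w::real_vector \<Rightarrow> 'w"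
  assumes "symplectic_module W act \<Omega>"
  shows "\<exists>l p q. dim W = 2 * l * DIM('k) \<and> (\<forall>i\<in>{1..l}. p i \<in> W \<and> q i \<in> W) \<and>
    (\<forall>i\<in>{1..l}. \<forall>j\<in>{1..l}. \<Omega> (p i) (q j) = (if i = j then 1 else 0) \<and> \<Omega> (p i) (p j) = 0 \<and> \<Omega> (q i) (q j)
        = 0) \<and>
    (\<forall>w\<in>W. w = (\<Sum>i=1..l. act (\<Omega> w (q i)) (p i) + act (\<Omega> (p i) w) (q i)))"
  using assms
proof (induction "dim W" arbitrary: W rule: less_induct)
  case less
  interpret symplectic_module W act \<Omega> by fact
  show ?case
  proof (cases "W = {0}")
    case True
    have "dim W = dim (span ({} :: 'w set))" unfolding True by simp
    also have "\<dots> = card ({} :: 'w set)" by (rule dim_span_eq_card_independent[OF independent_empty])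
    finally have "dim W = 0" by simp
    then show ?thesis using True by (intro exI[of _ 0]) auto
  next
    case False
    then obtain p where p: "p \<in> W" "p \<noteq> 0" using subspace_0[OF subspace_W] by blast
    then obtain t where t: "t \<in> W" "\<Omega> p t \<noteq> 0" using \<Omega>_nondegenerate by blast
    define q where "q = act (1 / \<Omega> p t) t"
    have q: "q \<in> W" using t act_closed by (simp add: q_def)
    have pq: "\<Omega> p q = 1" "\<Omega> q p = -1" "\<Omega> p p = 0" "\<Omega> q q = 0"
      using t p q \<Omega>_act_right[of p t "1 / \<Omega> p t"] \<Omega>_skew[of q p] by (simp_all add: q_def \<Omega>_self)
    let ?h = "\<lambda>kk. act (fst kk) p + act (snd kk) q"
    \<comment> \<open>\<open>P\<close> is a hyperbolic plane over the scalars and \<open>W'\<close> is its orthogonal complement\<close>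
    define P where "P = ?h ` (UNIV :: ('k \<times> 'k) set)"
    define W' where "W' = {w \<in> W. \<Omega> w p = 0 \<and> \<Omega> w q = 0}"
    have hW: "?h kk \<in> W" for kk using p q by (intro subspace_add[OF subspace_W] act_closed)
    have h\<Omega>: "\<Omega> (?h kk) p = - snd kk" "\<Omega> (?h kk) q = fst kk" for kk
      using p q pq by (simp_all add: \<Omega>_add_left \<Omega>_act_left act_closed)
    have lin_h: "linear_on UNIV ?h"
      using p q by (simp add: linear_on_def act_add_left act_scale_left scaleR_add_right)
    have inj_h: "inj_on ?h UNIV"
      by (rule linear_on_inj_onI[OF lin_h subspace_UNIV])
        (use h\<Omega> linear_on_0[OF linear_\<Omega>_left subspace_W] p q in \<open>metis neg_equal_0_iff_equal prod_eq_iff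
            fst_zero snd_zero\<close>)
    have dimP: "finite_dimensional P" "dim P = 2 * DIM('k)"
      unfolding P_def using finite_dimensional_linear_image[OF finite_dimensional_UNIV lin_h inj_h]
        dim_linear_image[OF finite_dimensional_UNIV lin_h inj_h] by simp_all
    have subW': "subspace W'"
      unfolding subspace_def W'_def using p q subspace_W
      by (auto simp: \<Omega>_add_left \<Omega>_scale_left subspace_add subspace_scale subspace_0
          linear_on_0[OF linear_\<Omega>_left subspace_W])
    have W'W: "W' \<subseteq> W" by (auto simp: W'_def)
    have fdW': "finite_dimensional W'" by (rule finite_dimensional_mono[OF finite_dimensional_W subW' W'W])
    have dec: "w - ?h (\<Omega> w q, \<Omega> p w) \<in> W'" if w: "w \<in> W" for w
    proof -
      have "\<Omega> (w - ?h (\<Omega> w q, \<Omega> p w)) p = \<Omega> w p - \<Omega> (?h (\<Omega> w q, \<Omega> p w)) p"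
        "\<Omega> (w - ?h (\<Omega> w q, \<Omega> p w)) q = \<Omega> w q - \<Omega> (?h (\<Omega> w q, \<Omega> p w)) q"
        using linear_on_diff[OF linear_\<Omega>_left subspace_W w hW] p q by blast+
      then show ?thesis
        unfolding W'_def using h\<Omega>[of "(\<Omega> w q, \<Omega> p w)"] subspace_diff[OF subspace_W w hW]
            \<Omega>_skew[OF w p(1)] by auto
    qed
    have int: "P \<inter> W' = {0}"
    proof
      show "{0} \<subseteq> P \<inter> W'"
        using subspace_linear_on_image[OF subspace_UNIV lin_h] subW' by (auto simp: P_def subspace_0)
      show "P \<inter> W' \<subseteq> {0}"
      proof
        fix x assume x: "x \<in> P \<inter> W'"
        then obtain kk where kk: "x = ?h kk" by (auto simp: P_def)
        then have "snd kk = 0" "fst kk = 0" using h\<Omega>[of kk] x by (auto simp: W'_def)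
        then show "x \<in> {0}" using kk p q by simp
      qed
    qed
    have sum: "W = {x + y |x y. x \<in> P \<and> y \<in> W'}"
    proof
      show "W \<subseteq> {x + y |x y. x \<in> P \<and> y \<in> W'}"
      proof
        fix w assume w: "w \<in> W"
        have "w = ?h (\<Omega> w q, \<Omega> p w) + (w - ?h (\<Omega> w q, \<Omega> p w))" by simp
        then show "w \<in> {x + y |x y. x \<in> P \<and> y \<in> W'}" using dec[OF w] unfolding P_def by blast
      qed
      show "{x + y |x y. x \<in> P \<and> y \<in> W'} \<subseteq> W"
      proof -
        have "P \<subseteq> W" unfolding P_def using hW by (rule image_subsetI)
        then show ?thesis using W'W subspace_add[OF subspace_W] by blast
      qed
    qed
    have dimW: "dim W = 2 * DIM('k) + dim W'"
      using dim_plus[OF dimP(1) fdW' int] dimP(2) sum by simp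
    have "symplectic_module W' act \<Omega>"
    proof
      show "subspace W'" "finite_dimensional W'" by fact+
      show "act k s \<in> W'" if "s \<in> W'" for k s
        using that p q by (auto simp: W'_def act_closed \<Omega>_act_left)
      show "s = 0" if s: "s \<in> W'" and z: "\<And>t. t \<in> W' \<Longrightarrow> \<Omega> s t = 0" for s
      proof (rule \<Omega>_nondegenerate)
        show "s \<in> W" using s W'W by blast
        fix t assume t: "t \<in> W"
        have "\<Omega> s t = \<Omega> s (t - ?h (\<Omega> t q, \<Omega> p t)) + \<Omega> s (?h (\<Omega> t q, \<Omega> p t))"
          using linear_on_diff[OF linear_\<Omega>_right[OF \<open>s \<in> W\<close>] subspace_W t hW, of "(\<Omega> t q, \<Omega> p t)"] by simp
        also have "\<dots> = 0"
          using z[OF dec[OF t]] s p q by (simp add: W'_def \<Omega>_add_right \<Omega>_act_right act_closed)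
        finally show "\<Omega> s t = 0" .
      qed
    qed (use W'W in \<open>simp_all add: subset_iff act_add_left act_add_right act_of_real act_mult \<Omega>_add_left
        \<Omega>_act_left \<Omega>_skew[symmetric]\<close>)
    from less.hyps[OF _ this] dimW obtain l p' q' where IH1: "dim W' = 2 * l * DIM('k)"
      and IH: "\<forall>i\<in>{1..l}. p' i \<in> W' \<and> q' i \<in> W'"
      "\<forall>i\<in>{1..l}. \<forall>j\<in>{1..l}. \<Omega> (p' i) (q' j) = (if i = j then 1 else 0) \<and> \<Omega> (p' i) (p' j) = 0 \<and>
          \<Omega> (q' i) (q' j) = 0"
      "\<forall>w\<in>W'. w = (\<Sum>i=1..l. act (\<Omega> w (q' i)) (p' i) + act (\<Omega> (p' i) w) (q' i))"
      by auto
    have IH2: "\<And>i. i \<in> {1..l} \<Longrightarrow> p' i \<in> W' \<and> q' i \<in> W'" using IH(1) by simp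
    have IH3: "\<And>i j. i \<in> {1..l} \<Longrightarrow> j \<in> {1..l} \<Longrightarrow> \<Omega> (p' i) (q' j) = (if i = j then 1 else 0) \<and>
        \<Omega> (p' i) (p' j) = 0 \<and> \<Omega> (q' i) (q' j) = 0"
      using IH(2) by simp
    have IH4: "w = (\<Sum>i=1..l. act (\<Omega> w (q' i)) (p' i) + act (\<Omega> (p' i) w) (q' i))" if "w \<in> W'" for w
      using IH(3) that by (rule bspec)
    let ?p = "p'(Suc l := p)" and ?q = "q'(Suc l := q)"
    have W'0: "\<Omega> s p = 0" "\<Omega> s q = 0" "\<Omega> p s = 0" "\<Omega> q s = 0" if "s \<in> W'" for s
      using that p q \<Omega>_skew[of p s] \<Omega>_skew[of q s] by (auto simp: W'_def)
    have "w = (\<Sum>i=1..Suc l. act (\<Omega> w (?q i)) (?p i) + act (\<Omega> (?p i) w) (?q i))" if w: "w \<in> W" for w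
    proof -
      let ?v = "w - ?h (\<Omega> w q, \<Omega> p w)"
      have e: "\<Omega> ?v (q' i) = \<Omega> w (q' i)" "\<Omega> (p' i) ?v = \<Omega> (p' i) w" if i: "i \<in> {1..l}" for i
      proof -
        have pq': "p' i \<in> W" "q' i \<in> W" using IH2[OF i] W'W by auto
        have "\<Omega> (?h (\<Omega> w q, \<Omega> p w)) (q' i) = 0" "\<Omega> (p' i) (?h (\<Omega> w q, \<Omega> p w)) = 0"
          using W'0 IH2[OF i] p q pq' by (simp_all add: \<Omega>_add_left \<Omega>_act_left \<Omega>_add_right \<Omega>_act_right
              act_closed)
        then show "\<Omega> ?v (q' i) = \<Omega> w (q' i)" "\<Omega> (p' i) ?v = \<Omega> (p' i) w"
          using linear_on_diff[OF linear_\<Omega>_left subspace_W w hW]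
              linear_on_diff[OF linear_\<Omega>_right subspace_W w hW] pq' by auto
      qed
      have "w = ?v + ?h (\<Omega> w q, \<Omega> p w)" by simp
      also have "?v = (\<Sum>i=1..l. act (\<Omega> w (q' i)) (p' i) + act (\<Omega> (p' i) w) (q' i))"
        by (subst IH4[OF dec[OF w]], rule sum.cong) (simp_all only: e)
      also have "\<dots> = (\<Sum>i=1..l. act (\<Omega> w (?q i)) (?p i) + act (\<Omega> (?p i) w) (?q i))"
        by (rule sum.cong) auto
      finally show ?thesis by simp
    qed
    moreover have "\<Omega> (?p i) (?q j) = (if i = j then 1 else 0) \<and> \<Omega> (?p i) (?p j) = 0 \<and> \<Omega> (?q i) (?q j) = 0"
      if "i \<in> {1..Suc l}" "j \<in> {1..Suc l}" for i j
      using that IH2[of i] IH2[of j] IH3[of i j] pq W'0 by (auto simp: le_Suc_eq)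
    moreover have "?p i \<in> W \<and> ?q i \<in> W" if "i \<in> {1..Suc l}" for i
      using that IH2[of i] W'W p q by (auto simp: le_Suc_eq)
    ultimately show ?thesis
      using dimW IH1 by (intro exI[of _ "Suc l"] exI[of _ ?p] exI[of _ ?q]) simp
  qed
qed

section \<open>The Heisenberg algebra of a symplectic module\<close>

text \<open>The Heisenberg algebra of \<open>W\<close> without a choice of basis.\<close>

definition heisenberg_model :: "'w::real_vector set \<Rightarrow> ('w \<Rightarrow> 'w \<Rightarrow> 'k::real_normed_field) \<Rightarrow> ('k \<times> 'w)
    graded_lie" where
  "heisenberg_model W \<Omega> = \<lparr>lie_space = UNIV \<times> W, lie_bracket = (\<lambda>x y. (\<Omega> (snd x) (snd y), 0)),
     lie_grade = (\<lambda>p. if p = -2 then UNIV \<times> {0} else if p = -1 then {0} \<times> W else {0})\<rparr>"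

definition linear_form :: "nat \<Rightarrow> (nat \<Rightarrow> 'k::real_normed_field) \<Rightarrow> (nat \<Rightarrow> 'k) \<Rightarrow> 'k fn" where
  "linear_form l u v = (\<Sum>i=1..l. const (u i) * coord (CX i) + const (v i) * coord (CY i))"

lemma homogeneous_linear_form: "linear_form l u v \<in> homogeneous_polynomials l 1"
proof -
  have "coord (CX i) \<in> homogeneous_polynomials l 1" "coord (CY i) \<in> homogeneous_polynomials l 1"
      if "i \<in> {1..l}" for i
    using homogeneous_coord[of "CX i" l] homogeneous_coord[of "CY i" l] that by auto
  then show ?thesis unfolding linear_form_def
    by (intro homogeneous_sum homogeneous_plus homogeneous_const_mult)
qed

lemma partial_deriv_linear_form:
  fixes u v :: "nat \<Rightarrow> 'k::real_normed_field"
  assumes "a \<in> coords l"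
  shows "partial_deriv a (linear_form l u v) = (case a of CX i \<Rightarrow> const (u i) | CY i \<Rightarrow> const (v i) | CZ \<Rightarrow> 0)"
proof -
  have p: "(coord (CX i) :: 'k fn) \<in> polynomials l" "(coord (CY i) :: 'k fn) \<in> polynomials l"
      if "i \<in> {1..l}" for i
    using that by (auto intro: polynomial_coord)
  have "partial_deriv a (linear_form l u v) = (\<Sum>i=1..l. partial_deriv a (const (u i) * coord (CX i) +
      const (v i) * coord (CY i)))"
    unfolding linear_form_def using assms p
    by (intro partial_deriv_sum polynomial_plus polynomial_mult polynomial_const) auto
  also have "\<dots> = (\<Sum>i=1..l. const (u i) * const (if a = CX i then 1 else 0) + const (v i) * const (if a =
      CY i then 1 else 0))"
  proof (intro sum.cong refl)
    fix i assume i: "i \<in> {1..l}"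
    have "partial_deriv a (const (u i) * coord (CX i) + const (v i) * coord (CY i)) =
        partial_deriv a (const (u i) * coord (CX i)) + partial_deriv a (const (v i) * coord (CY i))"
      using p[OF i] assms by (intro partial_deriv_add[of _ l] polynomial_mult polynomial_const)
    then show "partial_deriv a (const (u i) * coord (CX i) + const (v i) * coord (CY i)) =
        const (u i) * const (if a = CX i then 1 else 0) + const (v i) * const (if a = CY i then 1 else 0)"
      using partial_deriv_const_mult[OF p(1)[OF i] assms, of "u i"]
          partial_deriv_const_mult[OF p(2)[OF i] assms, of "v i"]
      by simp
  qed
  also have "\<dots> = (case a of CX i \<Rightarrow> const (u i) | CY i \<Rightarrow> const (v i) | CZ \<Rightarrow> 0)"
  proof (cases a)
    case (CX j)
    have "(\<Sum>i=1..l. const (u i) * const (if a = CX i then 1 else 0) + const (v i) * const (if a =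
        CY i then 1 else 0)) =
        (\<Sum>i=1..l. if j = i then const (u i) else 0)" using CX by (intro sum.cong refl) auto
    then show ?thesis using CX assms by simp
  next
    case (CY j)
    have "(\<Sum>i=1..l. const (u i) * const (if a = CX i then 1 else 0) + const (v i) * const (if a =
        CY i then 1 else 0)) =
        (\<Sum>i=1..l. if j = i then const (v i) else 0)" using CY by (intro sum.cong refl) auto
    then show ?thesis using CY assms by simp
  qed simp
  finally show ?thesis .
qed

lemma linear_form_add: "linear_form l u v + linear_form l u' v' = linear_form l (\<lambda>i. u i + u' i) (\<lambda>i.
    v i + v' i)"
proof -
  have "const (a + b) = const a + const b" for a b :: 'a by (simp add: const_def fun_eq_iff pointwise)
  then show ?thesis by (simp add: linear_form_def sum.distrib distrib_right add_ac)
qed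

lemma linear_form_scale: "r *\<^sub>R linear_form l u v = linear_form l (\<lambda>i. r *\<^sub>R u i) (\<lambda>i. r *\<^sub>R v i)"
proof -
  have "const (r *\<^sub>R a) = const (of_real r) * const a" for a :: 'a
      by (simp add: const_def fun_eq_iff pointwise scaleR_conv_of_real)
  then show ?thesis by (simp add: linear_form_def scaleR_const_mult sum_distrib_left distrib_left
      mult.assoc)
qed

text \<open>The Lagrange bracket of two functions of weight at most one is the standard symplectic
  pairing of their linear parts.\<close>

lemma contact_form_bracket_affine:
  fixes z z' :: "'k::real_normed_field"
  shows "contact_form l (vfield_bracket l (contact_field l (const z + linear_form l u v)) (contact_field
      l (const z' + linear_form l u' v'))) =
    const (\<Sum>i=1..l. u i * v' i - v i * u' i)"
proof -
  let ?f = "\<lambda>z u v. const z + linear_form l u v :: 'k fn"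
  have fp: "?f z u v \<in> polynomials l" for z u v
    by (intro polynomial_plus polynomial_const homogeneous_polynomial[OF homogeneous_linear_form])
  have d: "partial_deriv a (?f z u v) = (case a of CX i \<Rightarrow> const (u i) | CY i \<Rightarrow> const (v i) | CZ \<Rightarrow> 0)"
    if "a \<in> coords l" for a z u v
    using that partial_deriv_add[OF polynomial_const homogeneous_polynomial[OF homogeneous_linear_form]
        that]
    by (simp add: partial_deriv_linear_form)
  have comp: "contact_field l (?f z u v) (CX i) = - const (v i)" "contact_field l (?f z u v) (CY i) =
      const (u i)"
    if "i \<in> {1..l}" for z u v i using that d by auto
  have al: "along l (contact_field l (?f z u v)) (?f z' u' v') = (\<Sum>i=1..l. const (u i) * const (v' i)) -
      (\<Sum>i=1..l. const (v i) * const (u' i))"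
    for z u v z' u' v'
  proof -
    have "(\<Sum>i=1..l. contact_field l (?f z u v) (CX i) * partial_deriv (CX i) (?f z' u' v')) = (\<Sum>i=1..l.
        - (const (v i) * const (u' i)))"
      by (intro sum.cong refl) (simp add: comp d del: contact_field.simps)
    moreover have "(\<Sum>i=1..l. contact_field l (?f z u v) (CY i) * partial_deriv (CY i) (?f z' u' v')) =
        (\<Sum>i=1..l. const (u i) * const (v' i))"
      by (intro sum.cong refl) (simp add: comp d del: contact_field.simps)
    ultimately show ?thesis unfolding along_def sum_coords by (simp add: d sum_negf)
  qed
  have s: "(\<Sum>i=1..l. contact_field l (?f z u v) (CY i) * contact_field l (?f z' u' v') (CX i)) =
      - (\<Sum>i=1..l. const (u i) * const (v' i))"
    for z u v z' u' v'
    unfolding sum_negf[symmetric] by (intro sum.cong refl) (simp add: comp del: contact_field.simps)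
  have "contact_form l (vfield_bracket l (contact_field l (?f z u v)) (contact_field l (?f z' u' v'))) =
     (\<Sum>i=1..l. const (u i) * const (v' i)) - (\<Sum>i=1..l. const (v i) * const (u' i))"
    unfolding contact_form_bracket[OF contact_field_polynomial[OF fp] contact_field_polynomial[OF fp]]
      contact_form_contact_field al s by (simp add: mult.commute)
  then show ?thesis
    by (simp add: fun_eq_iff pointwise const_def sum_fun_apply sum_subtractf)
qed

text \<open>Send \<open>(z, w)\<close> to the contact field whose generating function has constant term \<open>z\<close> and, as
  its linear part, the coordinates of \<open>w\<close> in a symplectic basis.\<close>

theorem heisenberg_model_isomorphic:
  fixes act :: "'k::{real_normed_field, euclidean_space} \<Rightarrow> 'w::real_vector \<Rightarrow> 'w"
  assumes "symplectic_module W act \<Omega>"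
  shows "\<exists>l. dim W = 2 * l * DIM('k) \<and> heisenberg_model W \<Omega> \<cong>\<^sub>g\<^sub>r (heisenberg_algebra l :: 'k vfield
      graded_lie)"
proof -
  interpret symplectic_module W act \<Omega> by fact
  from symplectic_basis[OF assms] obtain l p q where dim: "dim W = 2 * l * DIM('k)"
    and B: "\<forall>i\<in>{1..l}. p i \<in> W \<and> q i \<in> W"
    "\<forall>i\<in>{1..l}. \<forall>j\<in>{1..l}. \<Omega> (p i) (q j) = (if i = j then 1 else 0) \<and> \<Omega> (p i) (p j) = 0 \<and> \<Omega> (q i) (q j) = 0"
    "\<forall>w\<in>W. w = (\<Sum>i=1..l. act (\<Omega> w (q i)) (p i) + act (\<Omega> (p i) w) (q i))"
    by (elim exE conjE)
  have pq: "\<And>i. i \<in> {1..l} \<Longrightarrow> p i \<in> W" "\<And>i. i \<in> {1..l} \<Longrightarrow> q i \<in> W" using B(1) by simp_all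
  have \<Omega>pq: "\<And>i j. i \<in> {1..l} \<Longrightarrow> j \<in> {1..l} \<Longrightarrow> \<Omega> (p i) (q j) = (if i = j then 1 else 0) \<and> \<Omega> (p i) (p j) =
      0 \<and> \<Omega> (q i) (q j) = 0"
    using B(2) by simp
  have w_eq: "w = (\<Sum>i=1..l. act (\<Omega> w (q i)) (p i) + act (\<Omega> (p i) w) (q i))" if "w \<in> W" for w
    using B(3) that by (rule bspec)
  define F where "F x = const (fst x) + linear_form l (\<lambda>i. \<Omega> (snd x) (q i)) (\<lambda>i. \<Omega> (p i) (snd x))"
      for x :: "'k \<times> 'w"
  define \<psi> where "\<psi> x = contact_field l (F x)" for x
  let ?S = "UNIV \<times> W :: ('k \<times> 'w) set"
  have linF: "linear_on ?S F"
  proof -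
    have c: "const (a + b) = const a + const b" "const (r *\<^sub>R a) = r *\<^sub>R const a" for a b :: 'k and r
      by (simp_all add: const_def fun_eq_iff pointwise scaleR_fun_def)
    have lc: "linear_form l u v = linear_form l u' v'" if "\<And>i. i \<in> {1..l} \<Longrightarrow> u i = u' i"
        "\<And>i. i \<in> {1..l} \<Longrightarrow> v i = v' i"
      for u v u' v' :: "nat \<Rightarrow> 'k"
      unfolding linear_form_def using that by (intro sum.cong refl) auto
    show ?thesis
      unfolding linear_on_def
    proof (intro conjI ballI allI)
      fix x assume x: "x \<in> ?S"
      {
        fix y assume y: "y \<in> ?S"
        have "linear_form l (\<lambda>i. \<Omega> (snd (x + y)) (q i)) (\<lambda>i. \<Omega> (p i) (snd (x + y))) =
          linear_form l (\<lambda>i. \<Omega> (snd x) (q i) + \<Omega> (snd y) (q i)) (\<lambda>i. \<Omega> (p i) (snd x) + \<Omega> (p i) (snd y))"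
          using x y pq by (intro lc) (auto simp: \<Omega>_add_left \<Omega>_add_right)
        then show "F (x + y) = F x + F y" by (simp add: F_def c linear_form_add[symmetric] add_ac)
      }
      fix r
      have "linear_form l (\<lambda>i. \<Omega> (snd (r *\<^sub>R x)) (q i)) (\<lambda>i. \<Omega> (p i) (snd (r *\<^sub>R x))) =
        linear_form l (\<lambda>i. r *\<^sub>R \<Omega> (snd x) (q i)) (\<lambda>i. r *\<^sub>R \<Omega> (p i) (snd x))"
        using x pq by (intro lc) (auto simp: \<Omega>_scale_left linear_on_scale[OF linear_\<Omega>_right])
      then show "F (r *\<^sub>R x) = r *\<^sub>R F x"
          by (simp add: F_def c linear_form_scale[symmetric] scaleR_add_right)
    qed
  qed
  have Fp: "F x \<in> polynomials l" for x
    unfolding F_def by (intro polynomial_plus polynomial_const homogeneous_polynomial[OF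
        homogeneous_linear_form])
  have lin: "linear_on ?S \<psi>"
    unfolding \<psi>_def by (rule linear_on_comp[OF linF _ linear_contact_field]) (use Fp in auto)
  have subS: "subspace ?S" by (intro subspace_Times subspace_UNIV subspace_W)
  have coordF: "partial_deriv (CX i) (F x) = const (\<Omega> (snd x) (q i))"
      "partial_deriv (CY i) (F x) = const (\<Omega> (p i) (snd x))"
    if "i \<in> {1..l}" for i x
    using that unfolding F_def
    by (simp_all add: partial_deriv_linear_form
        partial_deriv_add[of _ l, OF polynomial_const homogeneous_polynomial[OF homogeneous_linear_form]])
  have const_inj: "const a = const b \<longleftrightarrow> a = b" for a b :: 'k by (auto simp: const_def fun_eq_iff)
  have "inj_on \<psi> ?S"
  proof (rule linear_on_inj_onI[OF lin subS])
    fix x assume x: "x \<in> ?S" "\<psi> x = 0"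
    have F0: "F x = 0" using arg_cong[OF x(2), of "contact_form l"]
        by (simp add: \<psi>_def contact_form_contact_field contact_form_0)
    have "const (\<Omega> (snd x) (q i)) = const 0" "const (\<Omega> (p i) (snd x)) = const 0" if "i \<in> {1..l}" for i
      using coordF[OF that, of x] F0 by simp_all
    then have z: "\<Omega> (snd x) (q i) = 0" "\<Omega> (p i) (snd x) = 0" if "i \<in> {1..l}" for i
      using that const_inj by blast+
    have "snd x = (\<Sum>i=1..l. act (\<Omega> (snd x) (q i)) (p i) + act (\<Omega> (p i) (snd x)) (q i))"
      using x by (intro w_eq) auto
    also have "\<dots> = 0" using z pq by (intro sum.neutral) simp
    finally have "snd x = 0" .
    moreover from z have "linear_form l (\<lambda>i. \<Omega> (snd x) (q i)) (\<lambda>i. \<Omega> (p i) (snd x)) = 0"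
      unfolding linear_form_def by (intro sum.neutral) simp
    then have "const (fst x) = const 0" using F0 by (simp add: F_def)
    then have "fst x = 0" using const_inj by blast
    ultimately show "x = 0" by (simp add: prod_eq_iff)
  qed
  have form0: "linear_form l (\<lambda>i. \<Omega> 0 (q i)) (\<lambda>i. \<Omega> (p i) 0) = 0"
    unfolding linear_form_def
    by (intro sum.neutral) (use pq linear_on_0[OF linear_\<Omega>_left subspace_W] linear_on_0[OF
        linear_\<Omega>_right subspace_W] in simp)
  have grade: "\<psi> ` lie_grade (heisenberg_model W \<Omega>) n = lie_grade (heisenberg_algebra l) n" for n
  proof -
    have z: "\<psi> ` {0} = {0}" using linear_on_0[OF lin subS] by simp
    have n2: "\<psi> ` (UNIV \<times> {0}) = contact_field l ` homogeneous_polynomials l 0"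
    proof -
      have "homogeneous_polynomials l 0 = range (const :: 'k \<Rightarrow> _)"
      proof
        show "homogeneous_polynomials l 0 \<subseteq> range (const :: 'k \<Rightarrow> _)"
        proof
          fix f :: "'k fn" assume "f \<in> homogeneous_polynomials l 0"
          from homogeneous_degree_0[OF this] obtain k where "f = const k" ..
          then show "f \<in> range const" by simp
        qed
        show "range (const :: 'k \<Rightarrow> _) \<subseteq> homogeneous_polynomials l 0"
          using homogeneous_const by auto
      qed
      then have "contact_field l ` homogeneous_polynomials l 0 = range (\<lambda>z.
          contact_field l (const z :: 'k fn))" by auto
      moreover have "\<psi> (z, 0) = contact_field l (const z)" for z by (simp add: \<psi>_def F_def form0)
      ultimately show ?thesis by (auto simp: image_iff)
    qed
    have n1: "\<psi> ` ({0} \<times> W) = contact_field l ` homogeneous_polynomials l 1"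
    proof -
      have "F ` ({0} \<times> W) = homogeneous_polynomials l 1"
      proof
        show "F ` ({0} \<times> W) \<subseteq> homogeneous_polynomials l 1" by (auto simp: F_def homogeneous_linear_form)
        show "homogeneous_polynomials l 1 \<subseteq> F ` ({0} \<times> W)"
        proof
          fix f :: "'k fn" assume "f \<in> homogeneous_polynomials l 1"
          then obtain u v where f: "f = linear_form l u v"
            unfolding linear_form_def by (rule homogeneous_degree_1)
          let ?w = "\<Sum>i=1..l. act (u i) (p i) + act (v i) (q i)"
          have tW: "act (u i) (p i) \<in> W" "act (v i) (q i) \<in> W" "act (u i) (p i) + act (v i) (q i) \<in> W"
              if "i \<in> {1..l}" for i
            using that pq by (auto intro!: act_closed subspace_add[OF subspace_W])
          have wW: "?w \<in> W" using tW by (intro subspace_sum[OF subspace_W])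
          have "\<Omega> ?w (q j) = u j" "\<Omega> (p j) ?w = v j" if j: "j \<in> {1..l}" for j
          proof -
            have "\<Omega> ?w (q j) = (\<Sum>i=1..l. \<Omega> (act (u i) (p i) + act (v i) (q i)) (q j))"
              using tW pq(2)[OF j] by (intro linear_on_sum[OF linear_\<Omega>_left subspace_W])
            also have "\<dots> = (\<Sum>i=1..l. if i = j then u i else 0)"
              using tW pq j \<Omega>pq by (intro sum.cong refl) (simp add: \<Omega>_add_left \<Omega>_act_left)
            finally show "\<Omega> ?w (q j) = u j" using j by simp
            have "\<Omega> (p j) ?w = (\<Sum>i=1..l. \<Omega> (p j) (act (u i) (p i) + act (v i) (q i)))"
              using tW pq(1)[OF j] by (intro linear_on_sum[OF linear_\<Omega>_right subspace_W])
            also have "\<dots> = (\<Sum>i=1..l. if j = i then v i else 0)"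
              using tW pq j \<Omega>pq by (intro sum.cong refl) (simp add: \<Omega>_add_right \<Omega>_act_right)
            finally show "\<Omega> (p j) ?w = v j" using j by simp
          qed
          then have "F (0, ?w) = f" unfolding F_def f linear_form_def fst_conv snd_conv const_0 add_0
            by (intro sum.cong refl) simp
          then show "f \<in> F ` ({0} \<times> W)" using wW by (intro image_eqI[of _ _ "(0, ?w)"]) auto
        qed
      qed
      then show ?thesis unfolding \<psi>_def image_image[symmetric, of "contact_field l" F] by simp
    qed
    have low: "contact_field l ` homogeneous_polynomials l m = ({0} :: 'k vfield set)" if "m < 0" for m
    proof -
      have "homogeneous_polynomials l m = ({0} :: 'k fn set)"
        using homogeneous_negative[of _ l m] that homogeneous_0 by auto
      then show ?thesis using linear_on_0[OF linear_contact_field subspace_polynomials(1), of l] by simp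
    qed
    consider "n = -2" | "n = -1" | "n \<ge> 0" | "n < -2" by linarith
    then show ?thesis
      by cases (use n1 n2 z low[of "n + 2"] in \<open>simp_all add: heisenberg_algebra_def negative_part_def
          heisenberg_model_def contact_grade_eq\<close>)
  qed
  have space: "\<psi> ` ?S = lie_space (heisenberg_algebra l)"
  proof
    show "\<psi> ` ?S \<subseteq> lie_space (heisenberg_algebra l)"
    proof
      fix y assume "y \<in> \<psi> ` ?S"
      then obtain z w where y: "y = \<psi> (z, w)" "w \<in> W" by auto
      have "y = \<psi> (z, 0) + \<psi> (0, w)"
        using linear_on_add[OF lin, of "(z, 0)" "(0, w)"] y subspace_0[OF subspace_W] by simp
      moreover have "\<psi> (z, 0) \<in> lie_grade (heisenberg_algebra l) (-2)"
          "\<psi> (0, w) \<in> lie_grade (heisenberg_algebra l) (-1)"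
        unfolding grade[symmetric] using y by (auto simp: heisenberg_model_def)
      moreover have "lie_grade (heisenberg_algebra l) n \<subseteq> (lie_space (heisenberg_algebra l) :: 'k vfield
          set)" for n
        by (auto simp: heisenberg_algebra_def negative_part_def intro: span_base span_0)
      moreover have "subspace (lie_space (heisenberg_algebra l) :: 'k vfield set)"
        by (simp add: heisenberg_algebra_def negative_part_def)
      ultimately show "y \<in> lie_space (heisenberg_algebra l)"
        by (auto simp: subset_iff subspace_add)
    qed
    have "lie_grade (contact_algebra l) n \<subseteq> \<psi> ` ?S" if "n < 0" for n
    proof -
      have "lie_grade (contact_algebra l) n = \<psi> ` lie_grade (heisenberg_model W \<Omega>) n"
        unfolding grade using that by (simp add: heisenberg_algebra_def negative_part_def)
      also have "\<dots> \<subseteq> \<psi> ` ?S"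
        using subspace_0[OF subspace_W] by (intro image_mono)
            (auto simp: heisenberg_model_def zero_prod_def)
      finally show ?thesis .
    qed
    then show "lie_space (heisenberg_algebra l) \<subseteq> \<psi> ` ?S"
      unfolding heisenberg_algebra_def negative_part_def graded_lie.simps
      by (intro span_minimal subspace_linear_on_image[OF subS lin]) auto
  qed
  have bracket: "\<psi> (lie_bracket (heisenberg_model W \<Omega>) x y) = lie_bracket (heisenberg_algebra l) (\<psi> x)
      (\<psi> y)"
    if x: "x \<in> ?S" and y: "y \<in> ?S" for x y
  proof -
    have W: "snd x \<in> W" "snd y \<in> W" using x y by auto
    have tW: "act (\<Omega> (snd x) (q i)) (p i) \<in> W" "act (\<Omega> (p i) (snd x)) (q i) \<in> W"
      "act (\<Omega> (snd x) (q i)) (p i) + act (\<Omega> (p i) (snd x)) (q i) \<in> W" if "i \<in> {1..l}" for i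
      using that pq by (auto intro!: act_closed subspace_add[OF subspace_W])
    have "\<Omega> (snd x) (snd y) = \<Omega> (\<Sum>i=1..l. act (\<Omega> (snd x) (q i)) (p i) + act (\<Omega> (p i) (snd x)) (q i))
        (snd y)"
      using w_eq[OF W(1)] by simp
    also have "\<dots> = (\<Sum>i=1..l. \<Omega> (act (\<Omega> (snd x) (q i)) (p i) + act (\<Omega> (p i) (snd x)) (q i)) (snd y))"
      using tW W by (intro linear_on_sum[OF linear_\<Omega>_left subspace_W])
    also have "\<dots> = (\<Sum>i=1..l. \<Omega> (snd x) (q i) * \<Omega> (p i) (snd y) - \<Omega> (p i) (snd x) * \<Omega> (snd y) (q i))"
      using tW W pq by (intro sum.cong refl) (simp add: \<Omega>_add_left \<Omega>_act_left \<Omega>_skew[of "q _" "snd y"])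
    finally have e: "\<Omega> (snd x) (snd y) = \<dots>" .
    have "vfield_bracket l (\<psi> x) (\<psi> y) = contact_field l (const (\<Omega> (snd x) (snd y)))"
    proof (rule contact_vfield_eqI)
      show "vfield_bracket l (\<psi> x) (\<psi> y) \<in> contact_vfields l"
        unfolding \<psi>_def by (intro contact_vfields_bracket contact_field_contact Fp)
      show "contact_field l (const (\<Omega> (snd x) (snd y))) \<in> contact_vfields l"
        by (intro contact_field_contact polynomial_const)
      show "contact_form l (vfield_bracket l (\<psi> x) (\<psi> y)) =
          contact_form l (contact_field l (const (\<Omega> (snd x) (snd y))))"
        unfolding \<psi>_def F_def contact_form_bracket_affine contact_form_contact_field e ..
    qed
    also have "\<dots> = \<psi> (\<Omega> (snd x) (snd y), 0)" by (simp add: \<psi>_def F_def form0)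
    finally show ?thesis by (simp add: heisenberg_model_def heisenberg_algebra_def negative_part_def)
  qed
  have Sm: "lie_space (heisenberg_model W \<Omega>) = ?S" by (simp add: heisenberg_model_def)
  have "heisenberg_model W \<Omega> \<cong>\<^sub>g\<^sub>r (heisenberg_algebra l :: 'k vfield graded_lie)"
    unfolding graded_lie_isomorphic_def graded_lie_hom_def bij_betw_def Sm
    using lin \<open>inj_on \<psi> ?S\<close> grade space bracket by (intro exI[of _ \<psi>]) blast
  then show ?thesis using dim by blast
qed

section \<open>Counting irreducible components\<close>

lemma internal_direct_sum_0: "internal_direct_sum {..<0::nat} F S \<longleftrightarrow> S = {0}"
proof -
  have "subspace S \<and> S \<subseteq> {0} \<longleftrightarrow> S = {0}" using subspace_0[of S] by auto
  then show ?thesis by (simp add: internal_direct_sum_iff)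
qed

text \<open>Lets decompositions grow by one summand, and dimensions be computed by induction.\<close>

lemma internal_direct_sum_Suc:
  "internal_direct_sum {..<Suc n} F U \<longleftrightarrow> (\<exists>S. internal_direct_sum {..<n} F S \<and> subspace (F n) \<and> S \<inter> F n =
      {0} \<and>
     U = {x + y |x y. x \<in> S \<and> y \<in> F n})" (is "?L \<longleftrightarrow> ?R")
proof
  assume L: ?L
  then have s: "subspace U" "\<And>i. i < Suc n \<Longrightarrow> subspace (F i)" "\<And>i. i < Suc n \<Longrightarrow> F i \<subseteq> U"
    "U \<subseteq> span (\<Union>i\<in>{..<Suc n}. F i)"
    and d: "\<And>A f i. finite A \<Longrightarrow> A \<subseteq> {..<Suc n} \<Longrightarrow> (\<And>i. i \<in> A \<Longrightarrow> f i \<in> F i) \<Longrightarrow> sum f A = 0 \<Longrightarrow> i \<in> A \<Longrightarrow> f i = 0"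
    by (auto simp: internal_direct_sum_iff)
  define S where "S = span (\<Union>i\<in>{..<n}. F i)"
  have FS: "F i \<subseteq> S" if "i < n" for i using that unfolding S_def by (auto intro: span_base)
  have 1: "internal_direct_sum {..<n} F S"
    unfolding internal_direct_sum_iff
  proof (intro conjI ballI allI impI)
    show "subspace S" by (simp add: S_def)
    show "subspace (F i)" if "i \<in> {..<n}" for i using s(2)[of i] that by simp
    show "F i \<subseteq> S" if "i \<in> {..<n}" for i using FS that by simp
    show "S \<subseteq> span (\<Union>i\<in>{..<n}. F i)" by (simp add: S_def)
    show "f i = 0" if "finite A" "A \<subseteq> {..<n}" "\<forall>i\<in>A. f i \<in> F i" "sum f A = 0" "i \<in> A" for A f i
      by (rule d[of A f i]) (use that in \<open>auto simp: subset_iff less_Suc_eq\<close>)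
  qed
  have 2: "S \<inter> F n = {0}"
  proof
    show "{0} \<subseteq> S \<inter> F n" using s(2)[of n] by (auto simp: S_def subspace_0 span_0)
    show "S \<inter> F n \<subseteq> {0}"
    proof
      fix x assume x: "x \<in> S \<inter> F n"
      have "\<exists>f. (\<forall>i\<in>{..<n}. f i \<in> F i) \<and> (\<forall>i. i \<notin> {..<n} \<longrightarrow> f i = 0) \<and> finite {i. f i \<noteq> 0} \<and> x =
          (\<Sum>i | f i \<noteq> 0. f i)"
        using x s(2) by (intro span_Union_subspaces) (auto simp: S_def)
      then obtain f where f: "\<forall>i\<in>{..<n}. f i \<in> F i" "\<forall>i. i \<notin> {..<n} \<longrightarrow> f i = 0" "x = (\<Sum>i | f i \<noteq> 0. f i)"
        by (elim exE conjE)
      have "{i. f i \<noteq> 0} \<subseteq> {..<n}" using f(2) by auto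
      then have xs: "x = (\<Sum>i<n. f i)" unfolding f(3) by (intro sum.mono_neutral_left) auto
      have "(f(n := - x)) n = 0"
      proof (rule d[of "{..<Suc n}" "f(n := - x)" n])
        show "sum (f(n := - x)) {..<Suc n} = 0" using xs by simp
        show "(f(n := - x)) i \<in> F i" if "i \<in> {..<Suc n}" for i
          using that f(1) x s(2)[of n] by (auto simp: subspace_neg less_Suc_eq)
      qed auto
      then show "x \<in> {0}" by simp
    qed
  qed
  have 3: "U = {x + y |x y. x \<in> S \<and> y \<in> F n}"
  proof
    have "(\<Union>i\<in>{..<Suc n}. F i) = (\<Union>i\<in>{..<n}. F i) \<union> F n" by (auto simp: less_Suc_eq)
    then have "span (\<Union>i\<in>{..<Suc n}. F i) = {x + y |x y. x \<in> S \<and> y \<in> F n}"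
      using span_Un[of "\<Union>i\<in>{..<n}. F i" "F n"] span_eq_iff[THEN iffD2, OF s(2)[of n]] by (simp add: S_def)
    then show "U \<subseteq> {x + y |x y. x \<in> S \<and> y \<in> F n}" using s(4) by simp
    have "S \<subseteq> U" unfolding S_def using s(1,3) by (intro span_minimal) (auto simp: less_Suc_eq)
    then show "{x + y |x y. x \<in> S \<and> y \<in> F n} \<subseteq> U" using s(1) s(3)[of n] subspace_add by blast
  qed
  show ?R using 1 2 3 s(2)[of n] by blast
next
  assume ?R
  then obtain S where S: "internal_direct_sum {..<n} F S" and Fn: "subspace (F n)" "S \<inter> F n = {0}"
    and U: "U = {x + y |x y. x \<in> S \<and> y \<in> F n}" by blast
  have s: "subspace S" "\<And>i. i < n \<Longrightarrow> subspace (F i)" "\<And>i. i < n \<Longrightarrow> F i \<subseteq> S"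
    "S \<subseteq> span (\<Union>i\<in>{..<n}. F i)"
    and d: "\<And>A f i. finite A \<Longrightarrow> A \<subseteq> {..<n} \<Longrightarrow> (\<And>i. i \<in> A \<Longrightarrow> f i \<in> F i) \<Longrightarrow> sum f A = 0 \<Longrightarrow> i \<in> A \<Longrightarrow> f i = 0"
    using S by (auto simp: internal_direct_sum_iff)
  have SU: "S \<subseteq> U" "F n \<subseteq> U"
  proof -
    have "x + 0 \<in> U" if "x \<in> S" for x unfolding U using that subspace_0[OF Fn(1)] by blast
    then show "S \<subseteq> U" by auto
    have "0 + x \<in> U" if "x \<in> F n" for x unfolding U using that subspace_0[OF s(1)] by blast
    then show "F n \<subseteq> U" by auto
  qed
  show ?L
    unfolding internal_direct_sum_iff
  proof (intro conjI ballI allI impI)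
    show "subspace U" unfolding U by (rule subspace_sums[OF s(1) Fn(1)])
    show "subspace (F i)" if "i \<in> {..<Suc n}" for i using that s(2) Fn(1) by (auto simp: less_Suc_eq)
    show "F i \<subseteq> U" if "i \<in> {..<Suc n}" for i using that s(3)[of i] SU by (auto simp: less_Suc_eq)
    show "U \<subseteq> span (\<Union>i\<in>{..<Suc n}. F i)"
    proof
      fix u assume "u \<in> U"
      then obtain x y where u: "u = x + y" "x \<in> S" "y \<in> F n" using U by blast
      have "x \<in> span (\<Union>i\<in>{..<Suc n}. F i)"
        using u(2) s(4) span_mono[of "\<Union>i\<in>{..<n}. F i" "\<Union>i\<in>{..<Suc n}. F i"] by (force simp: less_Suc_eq)
      moreover have "y \<in> span (\<Union>i\<in>{..<Suc n}. F i)" using u(3) by (intro span_base) auto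
      ultimately show "u \<in> span (\<Union>i\<in>{..<Suc n}. F i)" unfolding u(1) by (rule span_add)
    qed
    fix A f i assume A: "finite A" "A \<subseteq> {..<Suc n}" "\<forall>i\<in>A. f i \<in> F i" "sum f A = 0" "i \<in> A"
    have in_S: "f j \<in> S" if "j \<in> A - {n}" for j
    proof -
      have "j < n" using that A(2) by (auto simp: less_Suc_eq subset_iff)
      then show ?thesis using that A(3) s(3)[of j] by blast
    qed
    have fn: "n \<in> A \<Longrightarrow> f n = 0"
    proof -
      assume n: "n \<in> A"
      then have "f n = - sum f (A - {n})" using A(4) sum.remove[OF A(1) n, of f]
          by (simp add: eq_neg_iff_add_eq_0)
      also have "\<dots> \<in> S" using in_S by (intro subspace_neg[OF s(1)] subspace_sum[OF s(1)])
      finally show "f n = 0" using Fn(2) A(3) n by blast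
    qed
    have s0: "sum f (A - {n}) = 0"
      using A(4) fn sum.remove[OF A(1), of n f] by (cases "n \<in> A") auto
    then have "f j = 0" if "j \<in> A - {n}" for j
    proof -
      have "A - {n} \<subseteq> {..<n}" using A(2) by (auto simp: less_Suc_eq subset_iff)
      then show ?thesis using d[of "A - {n}" f j] that A s0 by auto
    qed
    then show "f i = 0" using fn A(5) by (cases "i = n") auto
  qed
qed

lemma dim_internal_direct_sum:
  fixes F :: "nat \<Rightarrow> 'b::real_vector set"
  assumes "internal_direct_sum {..<n} F S" "\<And>i. i < n \<Longrightarrow> finite_dimensional (F i) \<and> dim (F i) = d"
  shows "finite_dimensional S \<and> dim S = n * d"
  using assms
proof (induction n arbitrary: S)
  case 0
  then have "S = span {}" using internal_direct_sum_0[of F S] by simp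
  moreover have "dim (span {} :: 'b set) = 0"
      by (simp only: dim_span_eq_card_independent[OF independent_empty] card.empty)
  moreover have "finite_dimensional (span {} :: 'b set)" unfolding finite_dimensional_def by blast
  ultimately show ?case by simp
next
  case (Suc n)
  obtain S' where S': "internal_direct_sum {..<n} F S'" "S' \<inter> F n = {0}"
      "S = {x + y |x y. x \<in> S' \<and> y \<in> F n}"
    using Suc.prems(1) unfolding internal_direct_sum_Suc by blast
  then have "finite_dimensional S'" "dim S' = n * d" using Suc by auto
  then show ?case
    unfolding S'(3) using Suc.prems(2)[of n] finite_dimensional_plus[OF _ _ S'(2)]
        dim_plus[OF _ _ S'(2)] by simp
qed

text \<open>The set \<open>E\<close> consists of generators of cyclic submodules of dimension \<open>d\<close>. Since every
  nonzero submodule contains such a generator, the irreducible submodules are exactly these cyclic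
  ones. Since no proper submodule contains all generators, a maximal direct sum of irreducible
  submodules is all of \<open>W\<close>; counting dimensions gives the number of summands of any decomposition.\<close>

lemma num_irreducible_components_eq:
  fixes W :: "'b::real_vector set"
  assumes fd: "finite_dimensional W" and d: "d > 0"
    and Q: "\<And>w. w \<in> E \<Longrightarrow> clifford_submodule V c W (Q w) \<and> w \<in> Q w \<and> w \<noteq> 0 \<and> dim (Q w) = d"
    and min: "\<And>w T. w \<in> E \<Longrightarrow> clifford_submodule V c W T \<Longrightarrow> w \<in> T \<Longrightarrow> Q w \<subseteq> T"
    and ne: "\<And>T. clifford_submodule V c W T \<Longrightarrow> T \<noteq> {0} \<Longrightarrow> \<exists>w\<in>E. w \<in> T"
    and out: "\<And>S. clifford_submodule V c W S \<Longrightarrow> S \<noteq> W \<Longrightarrow> \<exists>w\<in>E. w \<notin> S"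
    and WW: "clifford_submodule V c W W" and lin: "\<And>v. v \<in> V \<Longrightarrow> linear_on W (c v)"
  shows "dim W = d * num_irreducible_components V W c"
proof -
  let ?irr = "irreducible_submodule V c W"
  have sub: "clifford_submodule V c W T" if "clifford_submodule V c W S" "clifford_submodule V c S T"
      for S T
    using that by (auto simp: clifford_submodule_def)
  have sub': "clifford_submodule V c S T" if "clifford_submodule V c W T" "T \<subseteq> S" for S T
    using that by (auto simp: clifford_submodule_def)
  have sfd: "finite_dimensional T" if "clifford_submodule V c W T" for T
    using finite_dimensional_mono[OF fd] that by (auto simp: clifford_submodule_def)
  have irrD: "finite_dimensional T \<and> dim T = d" if T: "?irr T" for T
  proof -
    have T': "clifford_submodule V c W T" "T \<noteq> {0}" using T by (simp_all add: irreducible_submodule_def)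
    then obtain w where w: "w \<in> E" "w \<in> T" using ne by blast
    then have "Q w = T" using T min[OF w(1) T'(1) w(2)] Q[OF w(1)] sub'[of "Q w" T]
      unfolding irreducible_submodule_def by blast
    then show ?thesis using Q[OF w(1)] sfd[OF T'(1)] by auto
  qed
  have irrQ: "?irr (Q w)" if w: "w \<in> E" for w
    unfolding irreducible_submodule_def
  proof (intro conjI allI impI)
    show "clifford_submodule V c W (Q w)" "Q w \<noteq> {0}" using Q[OF w] by auto
    fix T assume T: "clifford_submodule V c (Q w) T"
    have TW: "clifford_submodule V c W T" using sub T Q[OF w] by blast
    show "T = {0} \<or> T = Q w"
    proof (cases "T = {0}")
      case False
      then obtain w' where w': "w' \<in> E" "w' \<in> T" using ne TW by blast
      have "Q w' \<subseteq> T" "T \<subseteq> Q w" using min[OF w'(1) TW w'(2)] T by (auto simp: clifford_submodule_def)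
      moreover from this have "Q w' = Q w"
        using Q[OF w] Q[OF w'(1)] subspace_dim_eq[OF sfd[of "Q w"], of "Q w'"]
            by (auto simp: clifford_submodule_def)
      ultimately show ?thesis by blast
    qed simp
  qed
  define P where "P n \<longleftrightarrow> (\<exists>F S. (\<forall>i<n. ?irr (F i)) \<and> internal_direct_sum {..<n} F S \<and>
      clifford_submodule V c W S)" for n :: nat
  have dimS: "finite_dimensional S \<and> dim S = n * d" if "\<forall>i<n. ?irr (F i)"
      "internal_direct_sum {..<n} F S" for n F S
    using dim_internal_direct_sum[OF that(2)] irrD that(1) by blast
  have subW: "subspace W" using WW by (simp add: clifford_submodule_def)
  have P0: "P 0"
  proof -
    have "c v 0 = 0" if "v \<in> V" for v using linear_on_0[OF lin[OF that] subW] .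
    then have "clifford_submodule V c W {0}" using subspace_0[OF subW]
        by (auto simp: clifford_submodule_def)
    moreover have "internal_direct_sum {..<0::nat} (\<lambda>_. {0}) {0 :: 'b}"
      by (simp only: internal_direct_sum_0)
    ultimately show ?thesis unfolding P_def by (intro exI[of _ "\<lambda>_. {0}"] exI[of _ "{0}"]) simp
  qed
  have step: "P (Suc n)" if F: "\<forall>i<n. ?irr (F i)" "internal_direct_sum {..<n} F S"
      "clifford_submodule V c W S" "S \<noteq> W"
    for n F S
  proof -
    obtain w where w: "w \<in> E" "w \<notin> S" using out[OF F(3,4)] by blast
    have S: "subspace S" "S \<subseteq> W" "\<And>v s. v \<in> V \<Longrightarrow> s \<in> S \<Longrightarrow> c v s \<in> S"
      and QS: "subspace (Q w)" "Q w \<subseteq> W" "\<And>v s. v \<in> V \<Longrightarrow> s \<in> Q w \<Longrightarrow> c v s \<in> Q w" "w \<in> Q w"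
      using F(3) Q[OF w(1)] by (auto simp: clifford_submodule_def)
    have "clifford_submodule V c (Q w) (S \<inter> Q w)"
      using S QS by (auto simp: clifford_submodule_def subspace_inter)
    then have int: "S \<inter> Q w = {0}" using irrQ[OF w(1)] w(2) QS(4) unfolding irreducible_submodule_def
        by blast
    let ?F = "F(n := Q w)" and ?U = "{x + y |x y. x \<in> S \<and> y \<in> Q w}"
    have FS: "internal_direct_sum {..<n} ?F S" using F(2)
        by (simp add: internal_direct_sum_def cong: conj_cong ball_cong_simp)
    have "internal_direct_sum {..<Suc n} ?F ?U"
      unfolding internal_direct_sum_Suc using FS QS(1) int by (intro exI[of _ S]) simp
    moreover have "clifford_submodule V c W ?U"
      unfolding clifford_submodule_def
    proof (intro conjI ballI)
      show "subspace ?U" by (rule subspace_sums[OF S(1) QS(1)])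
      show "?U \<subseteq> W" using S(2) QS(2) subspace_add[OF subW] by blast
      fix v u assume v: "v \<in> V" and "u \<in> ?U"
      then obtain x y where u: "u = x + y" "x \<in> S" "y \<in> Q w" by blast
      have "c v u = c v x + c v y" using u S(2) QS(2) by (auto intro!: linear_on_add[OF lin[OF v]])
      then show "c v u \<in> ?U" using S(3)[OF v u(2)] QS(3)[OF v u(3)] by blast
    qed
    moreover have "\<forall>i<Suc n. ?irr (?F i)" using F(1) irrQ[OF w(1)] by (auto simp: less_Suc_eq)
    ultimately show ?thesis unfolding P_def by blast
  qed
  have "n \<le> dim W" if Pn: "P n" for n
  proof -
    obtain F S where F: "\<forall>i<n. ?irr (F i)" "internal_direct_sum {..<n} F S" "clifford_submodule V c W S"
      using Pn unfolding P_def by blast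
    have "n * d = dim S" using dimS[OF F(1,2)] by simp
    also have "\<dots> \<le> dim W" using F(3) by (intro dim_mono_on[OF fd]) (auto simp: clifford_submodule_def)
    finally have "n * d \<le> dim W" .
    moreover have "n \<le> n * d" using mult_le_mono2[of 1 d n] d by simp
    ultimately show ?thesis by (rule le_trans[rotated])
  qed
  then have "\<exists>n. P n \<and> (\<forall>m. P m \<longrightarrow> m \<le> n)"
    using ex_has_greatest_nat[of P 0 "\<lambda>n. n" "Suc (dim W)"] P0 by (metis less_Suc_eq_le)
  then obtain n where n: "P n" "\<And>m. P m \<Longrightarrow> m \<le> n" by blast
  obtain F S where F: "\<forall>i<n. ?irr (F i)" "internal_direct_sum {..<n} F S" "clifford_submodule V c W S"
    using n(1) unfolding P_def by blast
  have "S = W" using step[OF F] n(2)[of "Suc n"] by auto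
  then have 1: "(\<forall>i<n. ?irr (F i)) \<and> internal_direct_sum {..<n} F W" using F by simp
  have dimW: "dim W = m * d" if "(\<forall>i<m. ?irr (F i)) \<and> internal_direct_sum {..<m} F W" for m F
    using dimS that by blast
  have "num_irreducible_components V W c = n"
    unfolding num_irreducible_components_def
  proof (rule the_equality)
    show "\<exists>F. (\<forall>i<n. ?irr (F i)) \<and> internal_direct_sum {..<n} F W" using 1 by blast
    show "m = n" if "\<exists>F. (\<forall>i<m. ?irr (F i)) \<and> internal_direct_sum {..<m} F W" for m
    proof -
      have "m * d = n * d" using that dimW dimW[OF 1] by auto
      then show ?thesis using d by simp
    qed
  qed
  then show ?thesis using dimW[OF 1] by simp
qed

section \<open>Orthonormal bases of the plane\<close>

text \<open>Polarization gives a vector that is not isotropic; a basis of its orthogonal complement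
  completes it.\<close>

lemma quadratic_space_signature:
  assumes q: "quadratic_space V b" and dim: "dim V = 2"
  shows "has_signature V b 2 0 \<or> has_signature V b 0 2 \<or> has_signature V b 1 1"
proof -
  from q have sV: "subspace V" and fV: "finite_dimensional V" and V0: "V \<noteq> {0}"
    and linr: "\<And>v. v \<in> V \<Longrightarrow> linear_on V (b v)" and linl: "\<And>v. v \<in> V \<Longrightarrow> linear_on V (\<lambda>u. b u v)"
    and sym: "\<And>u v. u \<in> V \<Longrightarrow> v \<in> V \<Longrightarrow> b u v = b v u"
    and nd: "\<And>v. v \<in> V \<Longrightarrow> (\<And>u. u \<in> V \<Longrightarrow> b v u = 0) \<Longrightarrow> v = 0"
    by (auto simp: quadratic_space_def bilinear_on_def)
  have "\<exists>v\<in>V. b v v \<noteq> 0"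
  proof (rule ccontr)
    assume "\<not> (\<exists>v\<in>V. b v v \<noteq> 0)"
    then have z: "b v v = 0" if "v \<in> V" for v using that by blast
    have "b v u = 0" if "v \<in> V" "u \<in> V" for u v
      using z[of "v + u"] z[OF that(1)] z[OF that(2)] that sym[OF that] subspace_add[OF sV that]
      by (simp add: linear_on_add[OF linr] linear_on_add[OF linl])
    then have "v = 0" if "v \<in> V" for v using nd that by blast
    then show False using V0 subspace_0[OF sV] by blast
  qed
  then obtain v where v: "v \<in> V" "b v v \<noteq> 0" by blast
  have v0: "v \<noteq> 0" using v linear_on_0[OF linr[OF v(1)] sV] by auto
  have "span {v} \<noteq> V"
  proof
    assume "span {v} = V"
    moreover have "dim (span {v}) = card {v}" using v0 by (intro dim_span_eq_card_independent) simp
    ultimately show False using dim by simp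
  qed
  moreover have "span {v} \<subseteq> V" using v sV by (intro span_minimal) auto
  ultimately obtain u where u: "u \<in> V" "u \<notin> span {v}" by blast
  define w where "w = u - (b v u / b v v) *\<^sub>R v"
  have wV: "w \<in> V" unfolding w_def using u v sV by (intro subspace_diff subspace_scale)
  have vw: "b v w = 0" unfolding w_def
    using u v sV by (simp add: linear_on_diff[OF linr[OF v(1)] sV] linear_on_scale[OF linr] subspace_scale)
  have wv: "b w v = 0" using vw sym[OF v(1) wV] by simp
  have "w \<notin> span {v}"
  proof
    assume "w \<in> span {v}"
    then have "w + (b v u / b v v) *\<^sub>R v \<in> span {v}" by (intro span_add span_scale) (auto intro: span_base)
    then show False using u by (simp add: w_def)
  qed
  then have wne: "w \<noteq> v" "independent {w, v}" using v0 by (auto simp: independent_insert intro: span_base)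
  have sp: "span {w, v} = V"
  proof (rule subspace_dim_eq[OF fV])
    show "span {w, v} \<subseteq> V" using wV v sV by (intro span_minimal) auto
    show "dim (span {w, v}) = dim V" using dim_span_eq_card_independent[OF wne(2)] wne(1) dim by simp
  qed simp
  have ww: "b w w \<noteq> 0"
  proof
    assume z: "b w w = 0"
    have "V \<subseteq> {x \<in> V. b w x = (\<lambda>_. 0) x}"
      unfolding sp[symmetric]
    proof (rule span_minimal)
      show "subspace {x \<in> span {w, v}. b w x = (\<lambda>_. 0) x}"
        unfolding sp using sV linr[OF wV] by (intro subspace_linear_on_eq) (auto simp: linear_on_def)
      show "{w, v} \<subseteq> {x \<in> span {w, v}. b w x = (\<lambda>_. 0) x}" using z wv by (auto intro: span_base)
    qed
    then have "w = 0" using nd[OF wV] by blast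
    then show False using \<open>w \<notin> span {v}\<close> span_0 by blast
  qed
  have sig: "has_signature V b (card {e \<in> {w, v}. b e e > 0}) (card {e \<in> {w, v}. b e e < 0})"
    unfolding has_signature_def using wne sp v ww vw wv by (intro exI[of _ "{w, v}"]) auto
  have set: "{e \<in> {w, v}. P e} = (if P w then {w} else {}) \<union> (if P v then {v} else {})" for P by auto
  show ?thesis using sig[unfolded set] v(2) ww wne(1)
    by (cases "b v v > 0"; cases "b w w > 0") (auto simp: not_less le_less numeral_2_eq_2)
qed

lemma has_signature_basis:
  assumes q: "quadratic_space V b" and sig: "has_signature V b p n" and pn: "p + n = 2"
  shows "\<exists>e1 e2. e1 \<in> V \<and> e2 \<in> V \<and> (\<forall>v\<in>V. \<exists>x y. v = x *\<^sub>R e1 + y *\<^sub>R e2) \<and>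
    b e1 e2 = 0 \<and> b e1 e1 = (if p = 0 then -1 else 1) \<and> b e2 e2 = (if n = 0 then 1 else -1)"
proof -
  from q have sV: "subspace V"
    and linr: "\<And>v. v \<in> V \<Longrightarrow> linear_on V (b v)" and linl: "\<And>v. v \<in> V \<Longrightarrow> linear_on V (\<lambda>u. b u v)"
    by (auto simp: quadratic_space_def bilinear_on_def)
  obtain B where B: "finite B" "independent B" "span B = V" "\<And>e f. e \<in> B \<Longrightarrow> f \<in> B \<Longrightarrow> e \<noteq> f \<Longrightarrow> b e f = 0"
    "\<And>e. e \<in> B \<Longrightarrow> b e e \<noteq> 0" "card {e \<in> B. b e e > 0} = p" "card {e \<in> B. b e e < 0} = n"
    using sig unfolding has_signature_def by blast
  have Bs: "B = {e \<in> B. b e e > 0} \<union> {e \<in> B. b e e < 0}" using B(5) by force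
  have "\<exists>e f. B = {e, f} \<and> e \<noteq> f \<and> (if p = 0 then b e e < 0 else b e e > 0) \<and> (if n =
      0 then b f f > 0 else b f f < 0)"
  proof -
    consider "p = 0" "n = 2" | "p = 1" "n = 1" | "p = 2" "n = 0" using pn by linarith
    then show ?thesis
    proof cases
      case 1
      then have p0: "{e \<in> B. b e e > 0} = {}" using B(1,6) by auto
      have "card {e \<in> B. b e e < 0} = 2" using B(7) 1 by simp
      then obtain e f where ef: "{e \<in> B. b e e < 0} = {e, f}" "e \<noteq> f" unfolding card_2_iff by blast
      have "B = {e, f}" by (rule trans[OF Bs]) (simp only: p0 ef Un_empty_left Un_empty_right)
      moreover have "b e e < 0" "b f f < 0" using ef(1) by blast+
      ultimately show ?thesis using 1 ef(2) by (intro exI[of _ e] exI[of _ f]) simp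
    next
      case 2
      have "card {e \<in> B. b e e > 0} = 1" "card {e \<in> B. b e e < 0} = 1" using B(6,7) 2 by simp_all
      then obtain e f where e: "{e \<in> B. b e e > 0} = {e}" and f: "{e \<in> B. b e e < 0} = {f}"
        by (meson card_1_singletonE)
      have "B = {e} \<union> {f}" by (rule trans[OF Bs]) (simp only: e f)
      then have "B = {e, f}" by auto
      moreover have "b e e > 0" "b f f < 0" using e f by blast+
      moreover from this have "e \<noteq> f" by auto
      ultimately show ?thesis using 2 by (intro exI[of _ e] exI[of _ f]) auto
    next
      case 3
      then have p0: "{e \<in> B. b e e < 0} = {}" using B(1,7) by auto
      have "card {e \<in> B. b e e > 0} = 2" using B(6) 3 by simp
      then obtain e f where ef: "{e \<in> B. b e e > 0} = {e, f}" "e \<noteq> f" unfolding card_2_iff by blast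
      have "B = {e, f}" by (rule trans[OF Bs]) (simp only: p0 ef Un_empty_left Un_empty_right)
      moreover have "b e e > 0" "b f f > 0" using ef(1) by blast+
      ultimately show ?thesis using 3 ef(2) by (intro exI[of _ e] exI[of _ f]) simp
    qed
  qed
  then obtain e f where ef: "B = {e, f}" "e \<noteq> f" "if p = 0 then b e e < 0 else b e e > 0"
      "if n = 0 then b f f > 0 else b f f < 0"
    by blast
  have V: "e \<in> V" "f \<in> V" unfolding B(3)[symmetric] ef(1) by (auto intro: span_base)
  define k where "k x = 1 / sqrt \<bar>b x x\<bar>" for x
  have bs: "b (r *\<^sub>R x) (r' *\<^sub>R y) = r * r' * b x y" if "x \<in> V" "y \<in> V" for r r' x y
    using that sV linear_on_scale[OF linl, of "r' *\<^sub>R y"] linear_on_scale[OF linr, of x]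
        by (simp add: subspace_scale)
  have kk: "k x * k x * b x x = sgn (b x x)" for x
    by (cases "b x x = 0") (auto simp: k_def sgn_if field_simps)
  have kn: "k x \<noteq> 0" if "b x x \<noteq> 0" for x using that by (simp add: k_def)
  show ?thesis
  proof (rule exI[of _ "k e *\<^sub>R e"], rule exI[of _ "k f *\<^sub>R f"], intro conjI ballI)
    show "k e *\<^sub>R e \<in> V" "k f *\<^sub>R f \<in> V" using V sV by (auto intro: subspace_scale)
    show "b (k e *\<^sub>R e) (k f *\<^sub>R f) = 0" using bs[OF V] B(4)[of e f] ef by simp
    show "b (k e *\<^sub>R e) (k e *\<^sub>R e) = (if p = 0 then -1 else 1)"
      using bs[OF V(1,1)] kk[of e] ef(3) by (auto split: if_splits)
    show "b (k f *\<^sub>R f) (k f *\<^sub>R f) = (if n = 0 then 1 else -1)"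
      using bs[OF V(2,2)] kk[of f] ef(4) by (auto split: if_splits)
    fix v assume "v \<in> V"
    then have "v \<in> span {e, f}" using B(3) ef by simp
    then obtain x where "v - x *\<^sub>R e \<in> span {f}" unfolding span_breakdown_eq by blast
    then obtain y where "v - x *\<^sub>R e = y *\<^sub>R f" unfolding span_singleton by blast
    then have v: "v = x *\<^sub>R e + y *\<^sub>R f" by (simp add: algebra_simps)
    have "x *\<^sub>R e = (x / k e) *\<^sub>R (k e *\<^sub>R e)" "y *\<^sub>R f = (y / k f) *\<^sub>R (k f *\<^sub>R f)"
      using kn[of e] kn[of f] B(5) ef by auto
    from arg_cong2[OF this, of "(+)"] have "v = (x / k e) *\<^sub>R (k e *\<^sub>R e) + (y / k f) *\<^sub>R (k f *\<^sub>R f)"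
      by (rule trans[OF v])
    then show "\<exists>x y. v = x *\<^sub>R (k e *\<^sub>R e) + y *\<^sub>R (k f *\<^sub>R f)" by blast
  qed
qed

section \<open>Clifford modules of the plane\<close>

text \<open>In an orthonormal basis the Clifford relations say that \<open>e1\<close> and \<open>e2\<close> act by anticommuting
  operators with squares \<open>- \<kappa>1\<close> and \<open>- \<kappa>2\<close>, where \<open>\<kappa>1, \<kappa>2 = \<plusminus>1\<close>.\<close>

locale clifford_plane =
  fixes V :: "'v::real_vector set" and b and W :: "'w::real_vector set" and c and \<beta> and e1 e2 \<kappa>1 \<kappa>2
  assumes data: "extended_translation_data V b W c \<beta>"
    and e1: "e1 \<in> V" and e2: "e2 \<in> V" and V_eq: "\<And>v. v \<in> V \<Longrightarrow> \<exists>x y. v = x *\<^sub>R e1 + y *\<^sub>R e2"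
    and b12: "b e1 e2 = 0" and b11: "b e1 e1 = \<kappa>1" and b22: "b e2 e2 = \<kappa>2"
    and \<kappa>1: "\<kappa>1 = 1 \<or> \<kappa>1 = (-1::real)" and \<kappa>2: "\<kappa>2 = 1 \<or> \<kappa>2 = (-1::real)"
begin

lemma subspace_V: "subspace V"
  and lin_b_right: "v \<in> V \<Longrightarrow> linear_on V (b v)" and lin_b_left: "v \<in> V \<Longrightarrow> linear_on V (\<lambda>u. b u v)"
  and b_sym: "u \<in> V \<Longrightarrow> v \<in> V \<Longrightarrow> b u v = b v u"
  and b_nondegenerate: "v \<in> V \<Longrightarrow> (\<And>u. u \<in> V \<Longrightarrow> b v u = 0) \<Longrightarrow> v = 0"
  and subspace_W: "subspace W" and finite_W: "finite_dimensional W" and W_nonzero: "W \<noteq> {0}"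
  and c_in: "v \<in> V \<Longrightarrow> s \<in> W \<Longrightarrow> c v s \<in> W" and lin_c: "v \<in> V \<Longrightarrow> linear_on W (c v)"
  and lin_c_left: "s \<in> W \<Longrightarrow> linear_on V (\<lambda>v. c v s)"
  and clifford: "v \<in> V \<Longrightarrow> u \<in> V \<Longrightarrow> s \<in> W \<Longrightarrow> c v (c u s) + c u (c v s) = (- 2 * b v u) *\<^sub>R s"
  and lin_\<beta>_right: "s \<in> W \<Longrightarrow> linear_on W (\<beta> s)" and lin_\<beta>_left: "s \<in> W \<Longrightarrow> linear_on W (\<lambda>t. \<beta> t s)"
  and \<beta>_nondegenerate: "s \<in> W \<Longrightarrow> (\<And>t. t \<in> W \<Longrightarrow> \<beta> s t = 0) \<Longrightarrow> s = 0"
  using data by (auto simp: extended_translation_data_def quadratic_space_def clifford_module_def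
      admissible_form_def bilinear_on_def)

text \<open>The volume element \<open>J\<close> and the identity span the even part of the Clifford algebra.\<close>

definition "E1 = c e1"
definition "E2 = c e2"
definition "J s = E1 (E2 s)"

lemma E_in [simp]: "s \<in> W \<Longrightarrow> E1 s \<in> W" "s \<in> W \<Longrightarrow> E2 s \<in> W" "s \<in> W \<Longrightarrow> J s \<in> W"
  using c_in e1 e2 by (simp_all add: E1_def E2_def J_def)

lemma lin_E: "linear_on W E1" "linear_on W E2" "linear_on W J"
proof -
  show l: "linear_on W E1" "linear_on W E2" using lin_c e1 e2 by (simp_all add: E1_def E2_def)
  show "linear_on W J" unfolding J_def by (rule linear_on_comp[OF l(2) _ l(1)]) auto
qed

lemmas E1_simps = linear_on_add[OF lin_E(1)] linear_on_scale[OF lin_E(1)] linear_on_neg[OF lin_E(1)]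
    linear_on_diff[OF lin_E(1) subspace_W]
lemmas E2_simps = linear_on_add[OF lin_E(2)] linear_on_scale[OF lin_E(2)] linear_on_neg[OF lin_E(2)]
    linear_on_diff[OF lin_E(2) subspace_W]
lemmas J_simps = linear_on_add[OF lin_E(3)] linear_on_scale[OF lin_E(3)] linear_on_neg[OF lin_E(3)]
    linear_on_diff[OF lin_E(3) subspace_W]
lemmas W_simps = subspace_add[OF subspace_W] subspace_diff[OF subspace_W] subspace_scale[OF subspace_W]
    subspace_neg[OF subspace_W]
lemmas E_simps = E1_simps E2_simps J_simps W_simps

lemma half_eq: "s + s = (- 2 * k) *\<^sub>R t \<Longrightarrow> s = (- k) *\<^sub>R t" for s t :: "'x::real_vector"
proof -
  assume "s + s = (- 2 * k) *\<^sub>R t"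
  then have "(1/2) *\<^sub>R (2 *\<^sub>R s) = (1/2) *\<^sub>R ((- 2 * k) *\<^sub>R t)" by (simp only: scaleR_2)
  then show ?thesis by simp
qed

lemma E11: "s \<in> W \<Longrightarrow> E1 (E1 s) = (- \<kappa>1) *\<^sub>R s"
  using half_eq[of "E1 (E1 s)" \<kappa>1 s] clifford[OF e1 e1, of s] b11 by (simp add: E1_def)

lemma E22: "s \<in> W \<Longrightarrow> E2 (E2 s) = (- \<kappa>2) *\<^sub>R s"
  using half_eq[of "E2 (E2 s)" \<kappa>2 s] clifford[OF e2 e2, of s] b22 by (simp add: E2_def)

lemma E21: "s \<in> W \<Longrightarrow> E2 (E1 s) = - J s"
  using clifford[OF e1 e2, of s] b12 by (simp add: E1_def E2_def J_def eq_neg_iff_add_eq_0 add.commute)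

lemma E1J: "s \<in> W \<Longrightarrow> E1 (J s) = (- \<kappa>1) *\<^sub>R E2 s"
  by (simp add: J_def E11)

lemma JE2: "s \<in> W \<Longrightarrow> J (E2 s) = (- \<kappa>2) *\<^sub>R E1 s"
  by (simp add: J_def E22 E_simps)

lemma JE1: "s \<in> W \<Longrightarrow> J (E1 s) = \<kappa>1 *\<^sub>R E2 s"
  using E21[of "s"] E1J[of s] by (simp add: J_def E_simps)

lemma E2J: "s \<in> W \<Longrightarrow> E2 (J s) = \<kappa>2 *\<^sub>R E1 s"
  using E21[of "E2 s"] by (simp add: J_def[of s] JE2)

lemma JJ: "s \<in> W \<Longrightarrow> J (J s) = (- (\<kappa>1 * \<kappa>2)) *\<^sub>R s"
  using E2J[of s] by (simp add: J_def[of "J s"] E_simps E11)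

lemma clifford_submodule_iff:
  "clifford_submodule V c W S \<longleftrightarrow> subspace S \<and> S \<subseteq> W \<and> (\<forall>s\<in>S. E1 s \<in> S \<and> E2 s \<in> S)"
proof -
  have "c v s \<in> S" if S: "subspace S" "S \<subseteq> W" "\<forall>s\<in>S. E1 s \<in> S \<and> E2 s \<in> S" and vs: "v \<in> V" "s \<in> S" for S v s
  proof -
    obtain x y where v: "v = x *\<^sub>R e1 + y *\<^sub>R e2" using V_eq vs by blast
    have "c v s = x *\<^sub>R E1 s + y *\<^sub>R E2 s"
      using vs S e1 e2 unfolding v E1_def E2_def
      by (simp add: linear_on_add[OF lin_c_left] linear_on_scale[OF lin_c_left] subspace_scale[OF
          subspace_V] subset_iff)
    then show ?thesis using S vs by (simp add: subspace_add subspace_scale)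
  qed
  moreover have "E1 s \<in> S \<and> E2 s \<in> S" if "clifford_submodule V c W S" "s \<in> S" for s
    using that e1 e2 by (simp add: clifford_submodule_def E1_def E2_def)
  ultimately show ?thesis unfolding clifford_submodule_def by (intro iffI)
      (simp_all add: clifford_submodule_def)
qed

lemma W_submodule: "clifford_submodule V c W W"
  using subspace_W by (simp add: clifford_submodule_iff)

text \<open>Up to sign, the components of the bracket of \<open>s\<close> and \<open>t\<close>.\<close>

definition "A s t = \<beta> (E1 s) t"
definition "B s t = \<beta> (E2 s) t"

lemma AB_linear: "t \<in> W \<Longrightarrow> linear_on W (\<lambda>s. A s t)" "s \<in> W \<Longrightarrow> linear_on W (A s)"
   "t \<in> W \<Longrightarrow> linear_on W (\<lambda>s. B s t)" "s \<in> W \<Longrightarrow> linear_on W (B s)"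
  unfolding A_def B_def using lin_\<beta>_right lin_\<beta>_left
  by (auto intro!: linear_on_comp[OF lin_E(1) _ lin_\<beta>_left] linear_on_comp[OF lin_E(2) _ lin_\<beta>_left])

text \<open>The symmetry of \<open>\<beta>\<close> and the symmetry of the action of vectors have opposite signs.\<close>

lemma AB_skew: "s \<in> W \<Longrightarrow> t \<in> W \<Longrightarrow> A s t = - A t s" "s \<in> W \<Longrightarrow> t \<in> W \<Longrightarrow> B s t = - B t s"
proof -
  obtain \<epsilon> :: real where \<epsilon>: "(\<forall>s\<in>W. \<forall>t\<in>W. \<beta> s t = \<beta> t s) \<and> \<epsilon> = -1 \<or> (\<forall>s\<in>W. \<forall>t\<in>W. \<beta> s t = - \<beta> t s) \<and> \<epsilon> = 1"
    "\<forall>v\<in>V. \<forall>s\<in>W. \<forall>t\<in>W. \<beta> (c v s) t = \<epsilon> * \<beta> s (c v t)"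
  proof -
    have "admissible_form V b W c \<beta>" using data by (simp add: extended_translation_data_def)
    then show ?thesis unfolding admissible_form_def using that by (elim conjE exE)
  qed
  show "A s t = - A t s" if "s \<in> W" "t \<in> W"
    using \<epsilon>(1) \<epsilon>(2)[rule_format, OF e1 that] that E_in(1)[OF that(2)] by (auto simp: A_def E1_def)
  show "B s t = - B t s" if "s \<in> W" "t \<in> W"
    using \<epsilon>(1) \<epsilon>(2)[rule_format, OF e2 that] that E_in(2)[OF that(2)] by (auto simp: B_def E2_def)
qed

text \<open>Multiplying \<open>s\<close> by \<open>J\<close> exchanges the components of the bracket, up to sign. This makes the
  bracket bilinear over the even Clifford algebra.\<close>

lemma AJ: "s \<in> W \<Longrightarrow> t \<in> W \<Longrightarrow> A (J s) t = - \<kappa>1 * B s t"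
  using linear_on_scale[OF lin_\<beta>_left, of t "E2 s" "- \<kappa>1"] by (simp add: A_def B_def E1J)

lemma BJ: "s \<in> W \<Longrightarrow> t \<in> W \<Longrightarrow> B (J s) t = \<kappa>2 * A s t"
  using linear_on_scale[OF lin_\<beta>_left, of t "E1 s" \<kappa>2] by (simp add: A_def B_def E2J)

lemma A_nondegenerate: "s \<in> W \<Longrightarrow> (\<And>t. t \<in> W \<Longrightarrow> A s t = 0) \<Longrightarrow> s = 0"
  using \<beta>_nondegenerate[of "E1 s"] E11[of s] \<kappa>1 linear_on_0[OF lin_E(1) subspace_W] by (force simp: A_def)

abbreviation "m \<equiv> extended_translation_algebra V b W c \<beta>"

lemma m_bracket:
  assumes "s \<in> W" "t \<in> W"
  shows "\<exists>z\<in>V. b z e1 = A s t \<and> b z e2 = B s t \<and> (\<forall>x y. lie_bracket m (x, s) (y, t) = (z, 0))"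
proof -
  have \<kappa>\<kappa>: "\<kappa>1 * \<kappa>1 = 1" "\<kappa>2 * \<kappa>2 = 1" using \<kappa>1 \<kappa>2 by auto
  define z where "z = (\<kappa>1 * A s t) *\<^sub>R e1 + (\<kappa>2 * B s t) *\<^sub>R e2"
  have zV: "z \<in> V" unfolding z_def using e1 e2
      by (intro subspace_add[OF subspace_V] subspace_scale[OF subspace_V])
  have b21: "b e2 e1 = 0" using b_sym[OF e1 e2] b12 by simp
  have bz: "b z u = \<kappa>1 * A s t * b e1 u + \<kappa>2 * B s t * b e2 u" if "u \<in> V" for u
    unfolding z_def using that e1 e2
    by (simp add: linear_on_add[OF lin_b_left] linear_on_scale[OF lin_b_left] subspace_scale[OF subspace_V])
  have z1: "b z e1 = A s t" and z2: "b z e2 = B s t"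
    using bz[OF e1] bz[OF e2] b11 b22 b12 b21 \<kappa>\<kappa>
        by (simp_all add: mult.commute[of _ "A s t"] mult.commute[of _ "B s t"] mult.assoc)
  have all: "b z v = \<beta> (c v s) t" if "v \<in> V" for v
  proof -
    obtain x y where v: "v = x *\<^sub>R e1 + y *\<^sub>R e2" using V_eq \<open>v \<in> V\<close> by blast
    have "c v s = x *\<^sub>R E1 s + y *\<^sub>R E2 s"
      using assms e1 e2 unfolding v E1_def E2_def
      by (simp add: linear_on_add[OF lin_c_left] linear_on_scale[OF lin_c_left] subspace_scale[OF
          subspace_V])
    then have "\<beta> (c v s) t = x * A s t + y * B s t"
      using assms by (simp add: A_def B_def linear_on_add[OF lin_\<beta>_left] linear_on_scale[OF lin_\<beta>_left]
          W_simps)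
    moreover have "b z v = x * b z e1 + y * b z e2"
      unfolding v using zV e1 e2
      by (simp add: linear_on_add[OF lin_b_right] linear_on_scale[OF lin_b_right] subspace_scale[OF
          subspace_V])
    ultimately show ?thesis using z1 z2 by simp
  qed
  have "(THE z. z \<in> V \<and> (\<forall>v\<in>V. b z v = \<beta> (c v s) t)) = z"
  proof (rule the_equality)
    show "z \<in> V \<and> (\<forall>v\<in>V. b z v = \<beta> (c v s) t)" using zV all by blast
    fix z' assume z': "z' \<in> V \<and> (\<forall>v\<in>V. b z' v = \<beta> (c v s) t)"
    have "z' - z = 0"
    proof (rule b_nondegenerate)
      show "z' - z \<in> V" using z' zV subspace_diff[OF subspace_V] by blast
      show "b (z' - z) u = 0" if "u \<in> V" for u
        using linear_on_diff[OF lin_b_left[OF that] subspace_V, of z' z] z' zV all that by simp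
    qed
    then show "z' = z" by simp
  qed
  then show ?thesis using zV z1 z2 by (intro bexI[of _ z]) (simp_all add: extended_translation_algebra_def)
qed

lemma m_simps: "lie_space m = V \<times> W"
  "lie_grade m p = (if p = -2 then V \<times> {0} else if p = -1 then {0} \<times> W else {0})"
  by (simp_all add: extended_translation_algebra_def)

lemma b_coordinates: "v \<in> V \<Longrightarrow> b v e1 = 0 \<Longrightarrow> b v e2 = 0 \<Longrightarrow> v = 0"
proof -
  assume v: "v \<in> V" "b v e1 = 0" "b v e2 = 0"
  show "v = 0"
  proof (rule b_nondegenerate[OF v(1)])
    fix u assume "u \<in> V"
    then obtain x y where u: "u = x *\<^sub>R e1 + y *\<^sub>R e2" using V_eq by blast
    show "b v u = 0" unfolding u using v e1 e2
      by (simp add: linear_on_add[OF lin_b_right] linear_on_scale[OF lin_b_right] subspace_scale[OF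
          subspace_V])
  qed
qed

lemma b_coordinates_surj: "\<exists>v\<in>V. b v e1 = x \<and> b v e2 = y"
proof -
  have \<kappa>\<kappa>: "\<kappa>1 * \<kappa>1 = 1" "\<kappa>2 * \<kappa>2 = 1" using \<kappa>1 \<kappa>2 by auto
  have b21: "b e2 e1 = 0" using b_sym[OF e1 e2] b12 by simp
  let ?v = "(\<kappa>1 * x) *\<^sub>R e1 + (\<kappa>2 * y) *\<^sub>R e2"
  have "?v \<in> V" using e1 e2 by (intro subspace_add[OF subspace_V] subspace_scale[OF subspace_V])
  moreover have "b ?v e1 = x" "b ?v e2 = y"
    using e1 e2 b11 b22 b12 b21 \<kappa>\<kappa>
    by (simp_all add: linear_on_add[OF lin_b_left] linear_on_scale[OF lin_b_left] subspace_scale[OF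
        subspace_V]
        mult.commute[of _ x] mult.commute[of _ y] mult.assoc)
  ultimately show ?thesis by blast
qed

end

context clifford_plane
begin

lemma m_isomorphic_sym:
  assumes "m \<cong>\<^sub>g\<^sub>r M" shows "M \<cong>\<^sub>g\<^sub>r m"
proof (rule graded_lie_isomorphic_sym[OF assms])
  show "subspace (lie_space m)" unfolding m_simps by (intro subspace_Times subspace_V subspace_W)
  have 0: "0 \<in> V" "0 \<in> W" using subspace_0 subspace_V subspace_W by auto
  show "lie_grade m p \<subseteq> lie_space m" for p unfolding m_simps using 0 by (auto simp: zero_prod_def)
  fix x y assume "x \<in> lie_space m" "y \<in> lie_space m"
  then have xy: "snd x \<in> W" "snd y \<in> W" by (auto simp: m_simps)
  obtain z where z: "z \<in> V" "b z e1 = A (snd x) (snd y)" "b z e2 = B (snd x) (snd y)"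
    "\<And>v u. lie_bracket m (v, snd x) (u, snd y) = (z, 0)" using m_bracket[OF xy] by blast
  have "lie_bracket m x y = (z, 0)" using z(4)[of "fst x" "fst y"] by simp
  then show "lie_bracket m x y \<in> lie_space m" using z(1) 0 by (simp add: m_simps)
qed

lemma dim_W_pos: "dim W > 0"
proof (rule ccontr)
  assume "\<not> dim W > 0"
  obtain B where "finite B" "span B = W" "card B = dim W" using finite_dimensional_basis[OF finite_W]
      by blast
  then have "W = {0}" using \<open>\<not> dim W > 0\<close> by auto
  then show False using W_nonzero by simp
qed

section \<open>Clifford modules of definite planes\<close>

definition "complex_act k s = Re k *\<^sub>R s + Im k *\<^sub>R J s"

text \<open>In definite signature \<open>J\<close> is a complex structure on \<open>W\<close>, and the relations
  \<open>A (J s) t = - \<kappa>1 B s t\<close> and \<open>B (J s) t = \<kappa>1 A s t\<close> say that \<open>A + \<i> \<kappa>1 B\<close> is complex linear in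
  \<open>s\<close>.\<close>

lemma symplectic_definite:
  assumes \<kappa>: "\<kappa>1 = \<kappa>2"
  shows "symplectic_module W complex_act (\<lambda>s t. Complex (A s t) (\<kappa>1 * B s t))"
proof
  have \<kappa>\<kappa>: "\<kappa>1 * \<kappa>1 = 1" using \<kappa>1 by auto
  have JJ': "J (J s) = - s" if "s \<in> W" for s using JJ[OF that] \<kappa>\<kappa> \<kappa> by simp
  show "subspace W" "finite_dimensional W" by (rule subspace_W finite_W)+
  show "complex_act k s \<in> W" if "s \<in> W" for k s using that by (simp add: complex_act_def W_simps)
  show "complex_act (k + k') s = complex_act k s + complex_act k' s" for s k k'
      by (simp add: complex_act_def scaleR_add_left)
  show "complex_act k (s + t) = complex_act k s + complex_act k t" if "s \<in> W" "t \<in> W" for s t k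
    using that by (simp add: complex_act_def E_simps scaleR_add_right)
  show "complex_act (of_real r) s = r *\<^sub>R s" for s r by (simp add: complex_act_def)
  show "complex_act (k * k') s = complex_act k (complex_act k' s)" if "s \<in> W" for s k k'
    using that JJ'[OF that] by (simp add: complex_act_def E_simps algebra_simps)
  show "Complex (A (s + t) u) (\<kappa>1 * B (s + t) u) = Complex (A s u) (\<kappa>1 * B s u) +
      Complex (A t u) (\<kappa>1 * B t u)"
    if "s \<in> W" "t \<in> W" "u \<in> W" for s t u
    using that by (simp add: linear_on_add[OF AB_linear(1)] linear_on_add[OF AB_linear(3)]
        complex_eq_iff algebra_simps)
  show "Complex (A (complex_act k s) t) (\<kappa>1 * B (complex_act k s) t) = k * Complex (A s t) (\<kappa>1 * B s t)"
    if "s \<in> W" "t \<in> W" for s t k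
  proof -
    have "A (complex_act k s) t = Re k * A s t + Im k * (- \<kappa>1 * B s t)"
        "B (complex_act k s) t = Re k * B s t + Im k * (\<kappa>2 * A s t)"
      unfolding complex_act_def using that
      by (simp_all add: linear_on_add[OF AB_linear(1)] linear_on_add[OF AB_linear(3)] linear_on_scale[OF
          AB_linear(1)]
          linear_on_scale[OF AB_linear(3)] W_simps AJ BJ)
    then show ?thesis using \<kappa>[symmetric] \<kappa>1 by (auto simp: complex_eq_iff algebra_simps)
  qed
  show "Complex (A s t) (\<kappa>1 * B s t) = - Complex (A t s) (\<kappa>1 * B t s)" if "s \<in> W" "t \<in> W" for s t
    using AB_skew[OF that] by (simp add: complex_eq_iff)
  show "s = 0" if "s \<in> W" "\<And>t. t \<in> W \<Longrightarrow> Complex (A s t) (\<kappa>1 * B s t) = 0" for s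
    using A_nondegenerate[OF that(1)] that(2) by (simp add: complex_eq_iff)
qed

lemma m_definite:
  "m \<cong>\<^sub>g\<^sub>r heisenberg_model W (\<lambda>s t. Complex (A s t) (\<kappa>1 * B s t))"
proof -
  define \<phi> where "\<phi> v = Complex (b v e1) (\<kappa>1 * b v e2)" for v
  have lin: "linear_on V \<phi>"
    unfolding linear_on_def \<phi>_def using e1 e2
    by (simp add: linear_on_add[OF lin_b_left] linear_on_scale[OF lin_b_left] complex_eq_iff algebra_simps)
  have inj: "inj_on \<phi> V"
    by (rule linear_on_inj_onI[OF lin subspace_V])
        (use b_coordinates \<kappa>1 in \<open>auto simp: \<phi>_def complex_eq_iff\<close>)
  have surj: "\<phi> ` V = UNIV"
  proof (rule set_eqI)
    fix z
    obtain v where "v \<in> V" "b v e1 = Re z" "b v e2 = \<kappa>1 * Im z" using b_coordinates_surj by blast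
    then have "\<phi> v = z" using \<kappa>1 by (auto simp: \<phi>_def complex_eq_iff)
    then show "z \<in> \<phi> ` V \<longleftrightarrow> z \<in> UNIV" using \<open>v \<in> V\<close> by blast
  qed
  let ?H = "heisenberg_model W (\<lambda>s t. Complex (A s t) (\<kappa>1 * B s t))"
  let ?f = "map_prod \<phi> (\<lambda>s :: 'w. s)"
  have \<phi>0: "\<phi> 0 = 0" by (rule linear_on_0[OF lin subspace_V])
  have grades: "?f ` lie_grade m p = lie_grade ?H p" for p
  proof -
    have "?f ` (V \<times> {0}) = UNIV \<times> {0}" by (rule map_prod_surj_on[OF surj]) simp
    moreover have "?f ` ({0} \<times> W) = {0} \<times> W" by (rule map_prod_surj_on) (simp_all add: \<phi>0)
    ultimately show ?thesis by (simp add: m_simps heisenberg_model_def \<phi>0 zero_prod_def)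
  qed
  have br: "?f (lie_bracket m x y) = lie_bracket ?H (?f x) (?f y)" if "x \<in> lie_space m"
      "y \<in> lie_space m" for x y
  proof -
    have xy: "snd x \<in> W" "snd y \<in> W" using that by (auto simp: m_simps)
    obtain z where z: "z \<in> V" "b z e1 = A (snd x) (snd y)" "b z e2 = B (snd x) (snd y)"
      "\<And>v u. lie_bracket m (v, snd x) (u, snd y) = (z, 0)" using m_bracket[OF xy] by blast
    have "lie_bracket m x y = (z, 0)" using z(4)[of "fst x" "fst y"] by simp
    then show ?thesis using z(2,3) by (simp add: heisenberg_model_def \<phi>_def)
  qed
  have "linear_on (lie_space m) ?f"
    using lin by (auto simp: linear_on_def m_simps)
  moreover have "bij_betw ?f (lie_space m) (lie_space ?H)"
    using map_prod_inj_on[OF inj, of "\<lambda>s. s" W] map_prod_surj_on[OF surj, of "\<lambda>s. s" W W]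
    by (simp add: bij_betw_def m_simps heisenberg_model_def)
  ultimately show ?thesis
    unfolding graded_lie_isomorphic_def graded_lie_hom_def using grades br
    by (intro exI[of _ ?f]) (auto simp: bij_betw_def)
qed

text \<open>In signature \<open>(2, 0)\<close> the Clifford algebra is the division algebra of quaternions, so every
  nonzero vector generates a free module of rank one.\<close>

lemma num_components_quaternionic:
  assumes "\<kappa>1 = 1" "\<kappa>2 = 1"
  shows "dim W = 4 * num_irreducible_components V W c"
proof -
  define q where "q w p = fst p *\<^sub>R w + fst (snd p) *\<^sub>R E1 w + fst (snd (snd p)) *\<^sub>R E2 w +
      snd (snd (snd p)) *\<^sub>R J w"
    for w and p :: "real \<times> real \<times> real \<times> real"
  have E: "E1 (E1 s) = - s" "E2 (E2 s) = - s" "J (J s) = - s" "E1 (J s) = - E2 s" "J (E1 s) = E2 s"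
      "E2 (J s) = E1 s"
    "J (E2 s) = - E1 s" "E1 (E2 s) = J s" "E2 (E1 s) = - J s" if "s \<in> W" for s
    using E11[OF that] E22[OF that] JJ[OF that] E1J[OF that] JE1[OF that] E2J[OF that] JE2[OF that]
        E21[OF that]
    by (simp_all add: assms J_def[of s, symmetric])
  have qW: "q w p \<in> W" if "w \<in> W" for w p using that by (simp add: q_def W_simps)
  have lin: "linear_on UNIV (q w)" for w
    by (simp add: linear_on_def q_def scaleR_add_left scaleR_add_right)
  have inj: "inj_on (q w) UNIV" if w: "w \<in> W" "w \<noteq> 0" for w
  proof (rule linear_on_inj_onI[OF lin subspace_UNIV])
    fix p assume p: "q w p = 0"
    obtain x y z u where xyzu: "p = (x, y, z, u)" by (metis prod_cases4)
    \<comment> \<open>multiply by the conjugate quaternion\<close>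
    have "x *\<^sub>R q w p - y *\<^sub>R E1 (q w p) - z *\<^sub>R E2 (q w p) - u *\<^sub>R J (q w p) = (x * x + y * y + z * z +
        u * u) *\<^sub>R w"
      using w(1) E[OF w(1)] by (simp add: q_def xyzu E_simps algebra_simps)
    moreover have "E1 0 = 0" "E2 0 = 0" "J 0 = 0" using linear_on_0[OF _ subspace_W] lin_E by auto
    ultimately have "x * x + y * y + z * z + u * u = 0" using p w(2) by simp
    then have "x = 0 \<and> y = 0 \<and> z = 0 \<and> u = 0"
      by (smt (verit) mult_eq_0_iff zero_le_square)
    then show "p = 0" using xyzu by (simp add: zero_prod_def)
  qed
  have "dim (UNIV :: (real \<times> real \<times> real \<times> real) set) = 4" by simp
  show ?thesis
  proof (rule num_irreducible_components_eq[OF finite_W, where E = "W - {0}" and Q = "\<lambda>w. range (q w)"])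
    fix w assume w: "w \<in> W - {0}"
    have "clifford_submodule V c W (range (q w))"
      unfolding clifford_submodule_iff
    proof (intro conjI ballI)
      show "subspace (range (q w))" by (rule subspace_linear_on_image[OF subspace_UNIV lin])
      show "range (q w) \<subseteq> W" using qW w by auto
      fix s assume "s \<in> range (q w)"
      then obtain p where s: "s = q w p" by blast
      obtain x y z u where xyzu: "p = (x, y, z, u)" by (metis prod_cases4)
      have "E1 s = q w (- y, x, - u, z)" "E2 s = q w (- z, u, x, - y)"
        using w E[of w] by (simp_all add: s xyzu q_def E_simps algebra_simps)
      then show "E1 s \<in> range (q w)" "E2 s \<in> range (q w)" by blast+
    qed
    moreover have "q w (1, 0, 0, 0) = w" by (simp add: q_def)
    moreover have "dim (range (q w)) = 4"
      using dim_linear_image[OF finite_dimensional_UNIV lin inj, of w] w by simp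
    ultimately show "clifford_submodule V c W (range (q w)) \<and> w \<in> range (q w) \<and> w \<noteq> 0 \<and>
        dim (range (q w)) = 4"
      using w by (metis DiffD2 insertI1 rangeI)
  next
    fix w T assume T: "clifford_submodule V c W T" "w \<in> T"
    then show "range (q w) \<subseteq> T"
      by (auto simp: clifford_submodule_iff q_def J_def intro!: subspace_add subspace_scale)
  next
    fix T assume "clifford_submodule V c W T" "T \<noteq> {0}"
    then show "\<exists>w\<in>W - {0}. w \<in> T" using subspace_0[of T] by (auto simp: clifford_submodule_iff)
  next
    fix S assume S: "clifford_submodule V c W S" "S \<noteq> W"
    then show "\<exists>w\<in>W - {0}. w \<notin> S" using subspace_0[of S] by (auto simp: clifford_submodule_iff)
  qed (simp_all add: W_submodule lin_c)
qed

text \<open>In the other signatures a basis vector acts as an involution \<open>e\<close>, and the other one, \<open>f\<close>,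
  anticommutes with it. An eigenvector \<open>w\<close> of \<open>e\<close> generates the plane spanned by \<open>w\<close> and \<open>f w\<close>, and
  every vector is a sum of two eigenvectors.\<close>

lemma num_components_split:
  assumes ef: "e = E1 \<and> f = E2 \<or> e = E2 \<and> f = E1" and ee: "\<And>s. s \<in> W \<Longrightarrow> e (e s) = s"
  shows "dim W = 2 * num_irreducible_components V W c"
proof -
  define q where "q w p = fst p *\<^sub>R w + snd p *\<^sub>R f w" for w and p :: "real \<times> real"
  have inW: "e s \<in> W" "f s \<in> W" if "s \<in> W" for s using ef that by auto
  have lin_ef: "linear_on W e" "linear_on W f" using ef lin_E by auto
  have anti: "e (f s) = - f (e s)" if "s \<in> W" for s using ef E21[OF that] by (auto simp: J_def)
  obtain \<sigma> where \<sigma>: "\<sigma> \<noteq> (0::real)" "\<And>s. s \<in> W \<Longrightarrow> f (f s) = \<sigma> *\<^sub>R s"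
  proof (cases "f = E2")
    case True then show ?thesis using that[of "- \<kappa>2"] E22 \<kappa>2 by auto
  next
    case False then show ?thesis using that[of "- \<kappa>1"] ef E11 \<kappa>1 by auto
  qed
  have es: "e (x *\<^sub>R s) = x *\<^sub>R e s" "f (x *\<^sub>R s) = x *\<^sub>R f s" if "s \<in> W" for s x
    using linear_on_scale[OF lin_ef(1) that] linear_on_scale[OF lin_ef(2) that] by simp_all
  have ea: "e (s + t) = e s + e t" "f (s + t) = f s + f t" if "s \<in> W" "t \<in> W" for s t
    using linear_on_add[OF lin_ef(1) that] linear_on_add[OF lin_ef(2) that] by simp_all
  have ed: "e (s - t) = e s - e t" if "s \<in> W" "t \<in> W" for s t
    by (rule linear_on_diff[OF lin_ef(1) subspace_W that])
  have e0: "e 0 = 0" "f 0 = 0" using linear_on_0[OF lin_ef(1) subspace_W]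
      linear_on_0[OF lin_ef(2) subspace_W] .
  have qW: "q w p \<in> W" if "w \<in> W" for w p using that by (simp add: q_def W_simps inW)
  have lin: "linear_on UNIV (q w)" for w
    by (simp add: linear_on_def q_def scaleR_add_left scaleR_add_right)
  let ?E = "{w \<in> W. w \<noteq> 0 \<and> (e w = w \<or> e w = - w)}"
  have sub_ef: "clifford_submodule V c W S \<longleftrightarrow> subspace S \<and> S \<subseteq> W \<and> (\<forall>s\<in>S. e s \<in> S \<and> f s \<in> S)" for S
    using ef unfolding clifford_submodule_iff by blast
  have inj: "inj_on (q w) UNIV" if w: "w \<in> ?E" for w
  proof (rule linear_on_inj_onI[OF lin subspace_UNIV])
    fix p assume p: "q w p = 0"
    have wW: "w \<in> W" "f w \<in> W" using w inW by auto
    have fw: "f w \<noteq> 0"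
    proof
      assume "f w = 0"
      then have "\<sigma> *\<^sub>R w = 0" using \<sigma>(2)[OF wW(1)] e0 by simp
      then show False using w \<sigma>(1) by simp
    qed
    have "e (q w p) = fst p *\<^sub>R e w - snd p *\<^sub>R f (e w)"
      using wW anti[OF wW(1)] by (simp add: q_def ea es W_simps)
    then have "fst p *\<^sub>R e w - snd p *\<^sub>R f (e w) = 0" using p e0 by simp
    moreover have "f (- w) = - f w" using es(2)[OF wW(1), of "-1"] by simp
    ultimately have "fst p *\<^sub>R w - snd p *\<^sub>R f w = 0" using w by auto
    moreover have "fst p *\<^sub>R w + snd p *\<^sub>R f w = 0" using p by (simp add: q_def)
    ultimately have "2 *\<^sub>R (fst p *\<^sub>R w) = 0" "2 *\<^sub>R (snd p *\<^sub>R f w) = 0"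
      unfolding scaleR_2 by (simp_all add: algebra_simps)
    then show "p = 0" using w fw by (simp add: prod_eq_iff)
  qed
  have eigen: "s + e s \<in> ?E \<or> s + e s = 0" "s - e s \<in> ?E \<or> s - e s = 0" if "s \<in> W" for s
    using that inW ee[OF that] by (auto simp: ea ed W_simps)
  have halves: "s = (1/2) *\<^sub>R (s + e s) + (1/2) *\<^sub>R (s - e s)" for s
    by (simp add: scaleR_add_right[symmetric] scaleR_2[symmetric] del: scaleR_add_right)
  show ?thesis
  proof (rule num_irreducible_components_eq[OF finite_W, where E = ?E and Q = "\<lambda>w. range (q w)"])
    fix w assume w: "w \<in> ?E"
    have wW: "w \<in> W" "f w \<in> W" using w inW by auto
    have fneg: "f (- w) = - f w" using es(2)[OF wW(1), of "-1"] by simp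
    have "clifford_submodule V c W (range (q w))"
      unfolding sub_ef
    proof (intro conjI ballI)
      show "subspace (range (q w))" by (rule subspace_linear_on_image[OF subspace_UNIV lin])
      show "range (q w) \<subseteq> W" using qW wW by auto
      fix s assume "s \<in> range (q w)"
      then obtain p where s: "s = q w p" by blast
      have "e s = fst p *\<^sub>R e w - snd p *\<^sub>R f (e w)"
        using wW anti[OF wW(1)] by (simp add: s q_def ea es W_simps)
      then have "e s = q w (fst p, - snd p) \<or> e s = q w (- fst p, snd p)" using w by (auto simp: q_def fneg)
      then show "e s \<in> range (q w)" by blast
      have "f s = q w (snd p * \<sigma>, fst p)" using wW \<sigma>(2)[OF wW(1)] by (simp add: s q_def ea es W_simps)
      then show "f s \<in> range (q w)" by blast
    qed
    moreover have "q w (1, 0) = w" by (simp add: q_def)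
    moreover have "dim (range (q w)) = 2"
      using dim_linear_image[OF finite_dimensional_UNIV lin inj[OF w]] by simp
    ultimately show "clifford_submodule V c W (range (q w)) \<and> w \<in> range (q w) \<and> w \<noteq> 0 \<and>
        dim (range (q w)) = 2"
      using w by (metis (mono_tags, lifting) mem_Collect_eq rangeI)
  next
    fix w T assume T: "clifford_submodule V c W T" "w \<in> T"
    then show "range (q w) \<subseteq> T"
      by (auto simp: sub_ef q_def intro!: subspace_add subspace_scale)
  next
    fix T assume T: "clifford_submodule V c W T" "T \<noteq> {0}"
    then obtain s where s: "s \<in> T" "s \<noteq> 0" using subspace_0[of T] by (auto simp: sub_ef)
    have "s + e s \<in> T" "s - e s \<in> T" "s \<in> W" using s T by (auto simp: sub_ef subspace_add subspace_diff)
    moreover have "s + e s \<noteq> 0 \<or> s - e s \<noteq> 0" using halves[of s] s(2)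
        by (metis add.right_neutral scaleR_zero_right)
    ultimately show "\<exists>w\<in>?E. w \<in> T" using eigen[of s] by blast
  next
    fix S assume S: "clifford_submodule V c W S" "S \<noteq> W"
    then obtain s where s: "s \<in> W" "s \<notin> S" by (auto simp: sub_ef)
    have sS: "subspace S" using S by (simp add: sub_ef)
    have "s + e s \<notin> S \<or> s - e s \<notin> S"
    proof (rule ccontr)
      assume "\<not> ?thesis"
      then have "(1/2) *\<^sub>R (s + e s) \<in> S" "(1/2) *\<^sub>R (s - e s) \<in> S"
        using subspace_scale[OF sS] by blast+
      then have "(1/2) *\<^sub>R (s + e s) + (1/2) *\<^sub>R (s - e s) \<in> S" by (rule subspace_add[OF sS])
      then show False using halves[of s] s(2) by simp
    qed
    then show "\<exists>w\<in>?E. w \<notin> S"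
      using eigen[OF s(1)] subspace_0[OF sS] by (elim disjE) auto
  qed (simp_all add: W_submodule lin_c)
qed

section \<open>Clifford modules of the Lorentzian plane\<close>

definition "eigenspace \<sigma> = {s \<in> W. J s = \<sigma> *\<^sub>R s}"
definition "eigenproj \<sigma> s = (1/2) *\<^sub>R (s + \<sigma> *\<^sub>R J s)" for \<sigma> :: real

context
  assumes \<kappa>: "\<kappa>1 = 1" "\<kappa>2 = -1"
begin

lemma JJ_id: "s \<in> W \<Longrightarrow> J (J s) = s"
  using JJ \<kappa> by simp

lemma subspace_eigenspace: "subspace (eigenspace \<sigma>)"
  unfolding eigenspace_def
  by (rule subspace_linear_on_eq[OF subspace_W lin_E(3)]) (simp add: linear_on_def scaleR_add_right)

lemma eigenspace_W: "s \<in> eigenspace \<sigma> \<Longrightarrow> s \<in> W"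
  by (simp add: eigenspace_def)

lemma AB_eigenspace: "s \<in> eigenspace \<sigma> \<Longrightarrow> t \<in> W \<Longrightarrow> B s t = - \<sigma> * A s t"
  using AJ[of s t] linear_on_scale[OF AB_linear(1), of t s \<sigma>] \<kappa> by (simp add: eigenspace_def)

text \<open>On an eigenspace of \<open>J\<close> the component \<open>B\<close> is a multiple of \<open>A\<close>, with opposite factors for
  the two eigenspaces.\<close>

lemma eigenspaces_orthogonal:
  assumes "s \<in> eigenspace \<sigma>" "t \<in> eigenspace (- \<sigma>)" "\<sigma> \<noteq> 0"
  shows "A s t = 0"
proof -
  note w = eigenspace_W[OF assms(1)] eigenspace_W[OF assms(2)]
  have "B s t = - \<sigma> * A s t" "B t s = \<sigma> * A t s"
    using AB_eigenspace[OF assms(1) w(2)] AB_eigenspace[OF assms(2) w(1)] by simp_all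
  moreover have "A s t = - A t s" "B s t = - B t s" using AB_skew[OF w] by auto
  ultimately have "\<sigma> * A s t = 0" by (simp add: algebra_simps)
  then show ?thesis using assms(3) by simp
qed

lemma eigenproj_in: "s \<in> W \<Longrightarrow> eigenproj 1 s \<in> eigenspace 1" "s \<in> W \<Longrightarrow> eigenproj (-1) s \<in> eigenspace (-1)"
  by (auto simp: eigenproj_def eigenspace_def E_simps JJ_id scaleR_add_right scaleR_diff_right add.commute)

lemma eigenproj_sum: "s = eigenproj 1 s + eigenproj (-1) s"
proof -
  have "eigenproj 1 s + eigenproj (-1) s = (1/2) *\<^sub>R (s + s)"
      by (simp add: eigenproj_def flip: scaleR_add_right)
  then show ?thesis by (simp add: scaleR_2[symmetric])
qed

lemma eigenproj_id: "s \<in> eigenspace 1 \<Longrightarrow> eigenproj 1 s = s" "s \<in> eigenspace (-1) \<Longrightarrow> eigenproj (-1) s = s"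
   "s \<in> eigenspace 1 \<Longrightarrow> eigenproj (-1) s = 0" "s \<in> eigenspace (-1) \<Longrightarrow> eigenproj 1 s = 0"
  by (simp_all add: eigenproj_def eigenspace_def scaleR_2[symmetric])

lemma lin_eigenproj: "linear_on W (eigenproj \<sigma>)"
  by (simp add: linear_on_def eigenproj_def E_simps scaleR_add_right mult.commute)

lemma AB_eigenproj:
  assumes "s \<in> W" "t \<in> W"
  shows "A s t = A (eigenproj 1 s) (eigenproj 1 t) + A (eigenproj (-1) s) (eigenproj (-1) t)"
    "B s t = - A (eigenproj 1 s) (eigenproj 1 t) + A (eigenproj (-1) s) (eigenproj (-1) t)"
proof -
  note p = eigenproj_in[OF assms(1)] eigenproj_in[OF assms(2)]
  note w = p[THEN eigenspace_W]
  have "A s t = A (eigenproj 1 s + eigenproj (-1) s) (eigenproj 1 t + eigenproj (-1) t)"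
      using eigenproj_sum by metis
  then show "A s t = A (eigenproj 1 s) (eigenproj 1 t) + A (eigenproj (-1) s) (eigenproj (-1) t)"
    using w eigenspaces_orthogonal[OF p(1), of "eigenproj (-1) t"]
        eigenspaces_orthogonal[OF p(2), of "eigenproj 1 t"] p
    by (simp add: linear_on_add[OF AB_linear(1)] linear_on_add[OF AB_linear(2)] W_simps)
  have "B s t = B (eigenproj 1 s + eigenproj (-1) s) (eigenproj 1 t + eigenproj (-1) t)"
      using eigenproj_sum by metis
  also have "\<dots> = - A (eigenproj 1 s) (eigenproj 1 t) + A (eigenproj (-1) s) (eigenproj (-1) t)"
    using w eigenspaces_orthogonal[OF p(1), of "eigenproj (-1) t"]
        eigenspaces_orthogonal[OF p(2), of "eigenproj 1 t"] p AB_eigenspace[OF p(1)] AB_eigenspace[OF p(2)]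
    by (simp add: linear_on_add[OF AB_linear(3)] linear_on_add[OF AB_linear(4)] W_simps)
  finally show "B s t = - A (eigenproj 1 s) (eigenproj 1 t) + A (eigenproj (-1) s) (eigenproj (-1) t)" .
qed

lemma finite_eigenspace: "finite_dimensional (eigenspace \<sigma>)"
  by (rule finite_dimensional_mono[OF finite_W subspace_eigenspace]) (auto simp: eigenspace_def)

lemma symplectic_eigenspace:
  assumes \<sigma>: "\<sigma> = 1 \<or> \<sigma> = -1"
  shows "symplectic_module (eigenspace \<sigma>) (*\<^sub>R) A"
proof
  show "subspace (eigenspace \<sigma>)" "finite_dimensional (eigenspace \<sigma>)"
      by (rule subspace_eigenspace finite_eigenspace)+
  show "k *\<^sub>R s \<in> eigenspace \<sigma>" if "s \<in> eigenspace \<sigma>" for k s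
      using subspace_scale[OF subspace_eigenspace that] .
  show "A (s + t) u = A s u + A t u" if "s \<in> eigenspace \<sigma>" "t \<in> eigenspace \<sigma>" "u \<in> eigenspace \<sigma>" for s t u
    using that eigenspace_W by (intro linear_on_add[OF AB_linear(1)]) auto
  show "A (k *\<^sub>R s) t = k * A s t" if "s \<in> eigenspace \<sigma>" "t \<in> eigenspace \<sigma>" for s t k
    using that eigenspace_W linear_on_scale[OF AB_linear(1), of t s k] by simp
  show "A s t = - A t s" if "s \<in> eigenspace \<sigma>" "t \<in> eigenspace \<sigma>" for s t using that eigenspace_W
      AB_skew by blast
  show "s = 0" if s: "s \<in> eigenspace \<sigma>" and z: "\<And>t. t \<in> eigenspace \<sigma> \<Longrightarrow> A s t = 0" for s
  proof (rule A_nondegenerate)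
    show sW: "s \<in> W" by (rule eigenspace_W[OF s])
    fix t assume t: "t \<in> W"
    have "A s t = A s (eigenproj 1 t) + A s (eigenproj (-1) t)"
      using linear_on_add[OF AB_linear(2)[OF sW] eigenspace_W[OF eigenproj_in(1)[OF t]] eigenspace_W[OF
          eigenproj_in(2)[OF t]]] eigenproj_sum[of t] by simp
    moreover have "A s (eigenproj 1 t) = 0" "A s (eigenproj (-1) t) = 0"
      using \<sigma> s z eigenproj_in[OF t] eigenspaces_orthogonal[of s \<sigma>] by auto
    ultimately show "A s t = 0" by simp
  qed
qed (simp_all add: scaleR_add_left scaleR_add_right)

text \<open>The vector \<open>e1\<close> anticommutes with \<open>J\<close>, so it interchanges the eigenspaces.\<close>

lemma dim_eigenspace: "dim (eigenspace 1) = dim (eigenspace (-1))"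
    "dim W = dim (eigenspace 1) + dim (eigenspace (-1))"
proof -
  have 1: "E1 ` eigenspace \<sigma> \<subseteq> eigenspace (- \<sigma>)" for \<sigma>
  proof safe
    fix s assume s: "s \<in> eigenspace \<sigma>"
    then have sW: "s \<in> W" "J s = \<sigma> *\<^sub>R s" by (auto simp: eigenspace_def)
    have "J (E1 s) = - E1 (J s)" using JE1[OF sW(1)] E1J[OF sW(1)] by simp
    then show "E1 s \<in> eigenspace (- \<sigma>)" using sW by (simp add: eigenspace_def E_simps)
  qed
  have 2: "inj_on E1 (eigenspace \<sigma>)" for \<sigma>
    by (rule inj_onI) (metis E11 eigenspace_W \<kappa>(1) scaleR_minus1_left neg_equal_iff_equal)
  have lin: "linear_on (eigenspace \<sigma>) E1" for \<sigma> using linear_on_subset[OF lin_E(1)]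
      by (auto simp: eigenspace_def)
  have "dim (eigenspace \<sigma>) \<le> dim (eigenspace (- \<sigma>))" for \<sigma>
    using dim_mono_on[OF finite_eigenspace subspace_linear_on_image[OF subspace_eigenspace lin] 1]
      dim_linear_image[OF finite_eigenspace lin 2] by metis
  from this[of 1] this[of "-1"] show "dim (eigenspace 1) = dim (eigenspace (-1))" by simp
  have int: "eigenspace 1 \<inter> eigenspace (-1) = {0}"
  proof
    show "{0} \<subseteq> eigenspace 1 \<inter> eigenspace (-1)" using subspace_0[OF subspace_eigenspace] by auto
    show "eigenspace 1 \<inter> eigenspace (-1) \<subseteq> {0}"
    proof
      fix x assume "x \<in> eigenspace 1 \<inter> eigenspace (-1)"
      then have "x = eigenproj 1 x" "eigenproj 1 x = 0" using eigenproj_id(1)[of x]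
          eigenproj_id(4)[of x] by auto
      then show "x \<in> {0}" by simp
    qed
  qed
  have "W = {x + y |x y. x \<in> eigenspace 1 \<and> y \<in> eigenspace (-1)}"
  proof
    show "W \<subseteq> {x + y |x y. x \<in> eigenspace 1 \<and> y \<in> eigenspace (-1)}" using eigenproj_in eigenproj_sum
        by blast
    show "{x + y |x y. x \<in> eigenspace 1 \<and> y \<in> eigenspace (-1)} \<subseteq> W" using eigenspace_W
        by (auto simp: W_simps)
  qed
  then show "dim W = dim (eigenspace 1) + dim (eigenspace (-1))"
      using dim_plus[OF finite_eigenspace finite_eigenspace int] by simp
qed

text \<open>The two null lines of \<open>V\<close> are the centres of the summands: on the eigenspaces of \<open>J\<close> the
  bracket takes values in the lines spanned by \<open>e1 + e2\<close> and \<open>e1 - e2\<close>.\<close>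

lemma m_lorentzian: "m \<cong>\<^sub>g\<^sub>r heisenberg_model (eigenspace 1) A \<oplus>\<^sub>g\<^sub>r heisenberg_model (eigenspace (-1)) A"
proof -
  let ?H = "heisenberg_model (eigenspace 1) A \<oplus>\<^sub>g\<^sub>r heisenberg_model (eigenspace (-1)) A"
  \<comment> \<open>coordinates with respect to the null basis \<open>e1 + e2\<close>, \<open>e1 - e2\<close> of \<open>V\<close>\<close>
  define f where "f x = (((b (fst x) e1 - b (fst x) e2) / 2, eigenproj 1 (snd x)), ((b (fst x) e1 +
      b (fst x) e2) / 2, eigenproj (-1) (snd x)))"
    for x :: "'v \<times> 'w"
  have lin: "linear_on (lie_space m) f"
    unfolding linear_on_def f_def m_simps using e1 e2
    by (auto simp: linear_on_add[OF lin_b_left] linear_on_scale[OF lin_b_left] linear_on_add[OF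
        lin_eigenproj] linear_on_scale[OF lin_eigenproj]
        algebra_simps add_divide_distrib diff_divide_distrib)
  have subm: "subspace (lie_space m)" unfolding m_simps by (intro subspace_Times subspace_V subspace_W)
  have inj: "inj_on f (lie_space m)"
  proof (rule linear_on_inj_onI[OF lin subm])
    fix x assume x: "x \<in> lie_space m" "f x = 0"
    then have V: "fst x \<in> V" "b (fst x) e1 = 0" "b (fst x) e2 = 0"
      and W: "eigenproj 1 (snd x) = 0" "eigenproj (-1) (snd x) = 0"
      by (auto simp: m_simps f_def zero_prod_def)
    have "snd x = 0" using eigenproj_sum[of "snd x"] W by simp
    then show "x = 0" using b_coordinates[OF V] by (simp add: prod_eq_iff)
  qed
  have prs: "\<exists>s\<in>W. eigenproj 1 s = x \<and> eigenproj (-1) s = y" if "x \<in> eigenspace 1" "y \<in> eigenspace (-1)"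
      for x y
    using that linear_on_add[OF lin_eigenproj, of x y] eigenproj_id eigenspace_W
        by (intro bexI[of _ "x + y"]) (auto simp: W_simps)
  have bs: "\<exists>v\<in>V. (b v e1 - b v e2) / 2 = x \<and> (b v e1 + b v e2) / 2 = y" for x y
    using b_coordinates_surj[of "x + y" "y - x"] by force
  have b0: "b 0 e1 = 0" "b 0 e2 = 0" using linear_on_0[OF lin_b_left subspace_V] e1 e2 by auto
  have pr0: "eigenproj \<sigma> 0 = 0" for \<sigma> by (rule linear_on_0[OF lin_eigenproj subspace_W])
  have space: "f ` lie_space m = lie_space ?H"
  proof
    show "f ` lie_space m \<subseteq> lie_space ?H" using eigenproj_in
        by (auto simp: f_def m_simps heisenberg_model_def)
    show "lie_space ?H \<subseteq> f ` lie_space m"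
    proof
      fix h assume "h \<in> lie_space ?H"
      then obtain x y s t where h: "h = ((x, s), (y, t))" "s \<in> eigenspace 1" "t \<in> eigenspace (-1)"
          by (auto simp: heisenberg_model_def)
      obtain v where v: "v \<in> V" "(b v e1 - b v e2) / 2 = x" "(b v e1 + b v e2) / 2 = y" using bs by blast
      obtain u where u: "u \<in> W" "eigenproj 1 u = s" "eigenproj (-1) u = t" using prs[OF h(2,3)] by blast
      have "h = f (v, u)" using h v u by (simp add: f_def)
      then show "h \<in> f ` lie_space m" using v u by (simp add: m_simps)
    qed
  qed
  have grades: "f ` lie_grade m p = lie_grade ?H p" for p
  proof -
    have 2: "f ` (V \<times> {0}) = (UNIV \<times> {0}) \<times> (UNIV \<times> {0})"
    proof
      show "f ` (V \<times> {0}) \<subseteq> (UNIV \<times> {0}) \<times> (UNIV \<times> {0})" by (auto simp: f_def pr0)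
      show "(UNIV \<times> {0}) \<times> (UNIV \<times> {0}) \<subseteq> f ` (V \<times> {0})"
      proof clarify
        fix x y :: real
        obtain v where v: "v \<in> V" "(b v e1 - b v e2) / 2 = x" "(b v e1 + b v e2) / 2 = y" using bs by blast
        then have "((x, 0), (y, 0)) = f (v, 0)" by (simp add: f_def pr0)
        then show "((x, 0), (y, 0)) \<in> f ` (V \<times> {0})" using v by blast
      qed
    qed
    have 1: "f ` ({0} \<times> W) = ({0} \<times> eigenspace 1) \<times> ({0} \<times> eigenspace (-1))"
    proof
      show "f ` ({0} \<times> W) \<subseteq> ({0} \<times> eigenspace 1) \<times> ({0} \<times> eigenspace (-1))" using eigenproj_in
          by (auto simp: f_def b0)
      show "({0} \<times> eigenspace 1) \<times> ({0} \<times> eigenspace (-1)) \<subseteq> f ` ({0} \<times> W)"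
      proof clarify
        fix s t assume st: "s \<in> eigenspace 1" "t \<in> eigenspace (-1)"
        obtain u where u: "u \<in> W" "eigenproj 1 u = s" "eigenproj (-1) u = t" using prs[OF st] by blast
        then have "((0, s), (0, t)) = f (0, u)" by (simp add: f_def b0)
        then show "((0, s), (0, t)) \<in> f ` ({0} \<times> W)" using u by blast
      qed
    qed
    have 0: "f ` {0} = {0} \<times> {0}" using linear_on_0[OF lin subm] by (simp add: zero_prod_def)
    show ?thesis using 0 1 2 by (simp add: m_simps heisenberg_model_def)
  qed
  have br: "f (lie_bracket m x y) = lie_bracket ?H (f x) (f y)" if "x \<in> lie_space m" "y \<in> lie_space m"
      for x y
  proof -
    have xy: "snd x \<in> W" "snd y \<in> W" using that by (auto simp: m_simps)
    obtain z where z: "z \<in> V" "b z e1 = A (snd x) (snd y)" "b z e2 = B (snd x) (snd y)"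
      "\<And>v u. lie_bracket m (v, snd x) (u, snd y) = (z, 0)" using m_bracket[OF xy] by blast
    have "lie_bracket m x y = (z, 0)" using z(4)[of "fst x" "fst y"] by simp
    then show ?thesis using z(2,3) AB_eigenproj[OF xy] by (simp add: heisenberg_model_def f_def pr0)
  qed
  show ?thesis
    unfolding graded_lie_isomorphic_def graded_lie_hom_def bij_betw_def
    using lin inj space grades br by (intro exI[of _ f]) auto
qed

end

end

section \<open>Realization of all dimensions\<close>

definition coord_space :: "nat \<Rightarrow> (nat \<Rightarrow> real) set" where
  "coord_space m = {f. \<forall>k\<ge>m. f k = 0}"

lemma coord_space_dim: "finite_dimensional (coord_space m) \<and> dim (coord_space m) = m"
proof (induction m)
  case 0
  have "coord_space 0 = span {}" by (auto simp: coord_space_def fun_eq_iff pointwise)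
  moreover have "dim (span {} :: (nat \<Rightarrow> real) set) = 0"
    by (simp only: dim_span_eq_card_independent[OF independent_empty] card.empty)
  moreover have "finite_dimensional (span {} :: (nat \<Rightarrow> real) set)" unfolding finite_dimensional_def by blast
  ultimately show ?case by simp
next
  case (Suc m)
  let ?h = "\<lambda>r k. if k = m then r else 0 :: real"
  have lin: "linear_on UNIV ?h"
    by (auto simp: linear_on_def fun_eq_iff pointwise scaleR_fun_def)
  have inj: "inj_on ?h UNIV" by (rule inj_onI) (metis (mono_tags))
  have R: "finite_dimensional (range ?h)" "dim (range ?h) = 1"
    using finite_dimensional_linear_image[OF finite_dimensional_UNIV lin inj]
        dim_linear_image[OF finite_dimensional_UNIV lin inj] by simp_all
  have int: "coord_space m \<inter> range ?h = {0}"
  proof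
    have "(0 :: nat \<Rightarrow> real) = ?h 0" by (auto simp: fun_eq_iff pointwise)
    then have "0 \<in> range ?h" by (rule range_eqI)
    moreover have "0 \<in> coord_space m" by (simp add: coord_space_def pointwise)
    ultimately show "{0} \<subseteq> coord_space m \<inter> range ?h" by simp
    show "coord_space m \<inter> range ?h \<subseteq> {0}"
      by (auto simp: coord_space_def fun_eq_iff pointwise)
  qed
  have sum: "coord_space (Suc m) = {x + y |x y. x \<in> coord_space m \<and> y \<in> range ?h}"
  proof (intro subset_antisym subsetI)
    fix f assume f: "f \<in> coord_space (Suc m)"
    have "f = f(m := 0) + ?h (f m)" by (auto simp: fun_eq_iff pointwise)
    moreover have "f(m := 0) \<in> coord_space m" using f by (auto simp: coord_space_def le_Suc_eq Suc_le_eq)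
    ultimately show "f \<in> {x + y |x y. x \<in> coord_space m \<and> y \<in> range ?h}" by blast
  qed (auto simp: coord_space_def pointwise)
  show ?case unfolding sum using finite_dimensional_plus[OF _ R(1) int] dim_plus[OF _ R(1) int] Suc R(2)
      by simp
qed

lemma scaleR_fun_apply: "(r *\<^sub>R f) x = r *\<^sub>R f x"
  by (simp add: scaleR_fun_def)

lemma subspace_coord_space: "subspace (coord_space m)"
  by (auto simp: subspace_def coord_space_def pointwise scaleR_fun_def)

text \<open>The position of the \<open>r\<close>-th coordinate of the \<open>m\<close>-th quaternion.\<close>

definition idx :: "nat \<Rightarrow> nat \<Rightarrow> nat" where "idx m r = 4 * m + r"

text \<open>Left multiplication by the quaternions \<open>i\<close> and \<open>j\<close> on sequences of quaternions.\<close>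

definition left_i :: "(nat \<Rightarrow> real) \<Rightarrow> nat \<Rightarrow> real" where
  "left_i s k = (if even k then - s (k + 1) else s (k - 1))"

definition left_j :: "(nat \<Rightarrow> real) \<Rightarrow> nat \<Rightarrow> real" where
  "left_j s k = (if k mod 4 < 2 then (if even k then - s (k + 2) else s (k + 2))
     else (if even k then s (k - 2) else - s (k - 2)))"

lemma idx_cases: obtains m where "k = idx m 0 \<or> k = idx m (Suc 0) \<or> k = idx m 2 \<or> k = idx m 3"
proof -
  have "k = idx (k div 4) (k mod 4)" by (simp add: idx_def)
  moreover have "k mod 4 = 0 \<or> k mod 4 = 1 \<or> k mod 4 = 2 \<or> k mod 4 = 3" by presburger
  ultimately show ?thesis using that[of "k div 4"] by auto
qed

lemma left_idx:
  "left_i s (idx m 0) = - s (idx m (Suc 0))" "left_i s (idx m (Suc 0)) = s (idx m 0)"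
      "left_i s (idx m 2) = - s (idx m 3)" "left_i s (idx m 3) = s (idx m 2)"
  "left_j s (idx m 0) = - s (idx m 2)" "left_j s (idx m (Suc 0)) = s (idx m 3)"
      "left_j s (idx m 2) = s (idx m 0)" "left_j s (idx m 3) = - s (idx m (Suc 0))"
proof -
  have e: "4 * m + 3 = Suc (Suc (Suc (4 * m)))" by simp
  have m: "(4 * m) mod 4 = 0" "(4 * m + 1) mod 4 = 1" "(4 * m + 2) mod 4 = 2" "(4 * m + 3) mod 4 = 3"
      by presburger+
  show "left_i s (idx m 0) = - s (idx m (Suc 0))" "left_i s (idx m (Suc 0)) = s (idx m 0)"
      "left_i s (idx m 2) = - s (idx m 3)" "left_i s (idx m 3) = s (idx m 2)"
    by (simp_all add: left_i_def idx_def e)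
  show "left_j s (idx m 0) = - s (idx m 2)" "left_j s (idx m 2) = s (idx m 0)"
    using m by (simp_all add: left_j_def idx_def)
  have "left_j s (4 * m + 1) = s (Suc (Suc (Suc (4 * m))))" unfolding left_j_def m by simp
  then show "left_j s (idx m (Suc 0)) = s (idx m 3)" by (simp only: idx_def One_nat_def e)
  have "left_j s (4 * m + 3) = - s (4 * m + 3 - 2)" unfolding left_j_def m by simp
  then show "left_j s (idx m 3) = - s (idx m (Suc 0))" by (simp add: idx_def)
qed

lemma left_linear: "left_i (s + t) = left_i s + left_i t" "left_i (r *\<^sub>R s) = r *\<^sub>R left_i s"
    "left_j (s + t) = left_j s + left_j t" "left_j (r *\<^sub>R s) = r *\<^sub>R left_j s"
  by (auto simp: fun_eq_iff left_i_def left_j_def pointwise scaleR_fun_def)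

lemma left_relations: "left_i (left_i s) = - s" "left_j (left_j s) = - s"
    "left_j (left_i s) = - left_i (left_j s)"
proof -
  show "left_i (left_i s) = - s"
  proof
    fix k show "left_i (left_i s) k = (- s) k" by (rule idx_cases[of k]) (auto simp: left_idx pointwise)
  qed
  show "left_j (left_j s) = - s"
  proof
    fix k show "left_j (left_j s) k = (- s) k" by (rule idx_cases[of k]) (auto simp: left_idx pointwise)
  qed
  show "left_j (left_i s) = - left_i (left_j s)"
  proof
    fix k show "left_j (left_i s) k = (- left_i (left_j s)) k" by (rule idx_cases[of k])
        (auto simp: left_idx pointwise)
  qed
qed

lemma sum_idx: "(\<Sum>k<4*n. h k) = (\<Sum>m<n. h (idx m 0) + h (idx m (Suc 0)) + h (idx m 2) + h (idx m 3))"
    for h :: "nat \<Rightarrow> real"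
proof (induction n)
  case (Suc n)
  have "{..<4 * Suc n} = insert (4*n) (insert (4*n+1) (insert (4*n+2) (insert (4*n+3) {..<4*n})))" by auto
  then have "(\<Sum>k<4*Suc n. h k) = h (4*n) + (h (4*n+1) + (h (4*n+2) + (h (4*n+3) + (\<Sum>k<4*n. h k))))" by simp
  then show ?case using Suc by (simp add: idx_def)
qed simp

lemma left_in:
  assumes "s \<in> coord_space (4 * n)" shows "left_i s \<in> coord_space (4 * n)" "left_j s \<in> coord_space (4 * n)"
proof -
  have s: "s k = 0" if "4 * n \<le> k" for k using assms that by (simp add: coord_space_def)
  have i: "4 * n \<le> idx m r'" if "4 * n \<le> idx m r" "r < 4" for m r r'
  proof -
    have "n \<le> m" using that unfolding idx_def by linarith
    then show ?thesis by (simp add: idx_def)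
  qed
  have "left_i s k = 0 \<and> left_j s k = 0" if "4 * n \<le> k" for k
  proof -
    obtain m where m: "k = idx m 0 \<or> k = idx m (Suc 0) \<or> k = idx m 2 \<or> k = idx m 3" by (rule idx_cases)
    then have "s (idx m r') = 0" for r' using i[of m _ r'] that by (intro s) auto
    then show ?thesis using m by (auto simp: left_idx)
  qed
  then show "left_i s \<in> coord_space (4 * n)" "left_j s \<in> coord_space (4 * n)"
      by (simp_all add: coord_space_def)
qed

definition plane_form :: "(nat \<Rightarrow> real) \<Rightarrow> (nat \<Rightarrow> real) \<Rightarrow> real" where
  "plane_form u v = u 0 * v 0 + u 1 * v 1"

definition quaternion_action :: "(nat \<Rightarrow> real) \<Rightarrow> (nat \<Rightarrow> real) \<Rightarrow> nat \<Rightarrow> real" where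
  "quaternion_action v s = v 0 *\<^sub>R left_i s + v 1 *\<^sub>R left_j s"

definition dot :: "nat \<Rightarrow> (nat \<Rightarrow> real) \<Rightarrow> (nat \<Rightarrow> real) \<Rightarrow> real" where
  "dot n s t = (\<Sum>k<4*n. s k * t k)"

lemma dot_linear: "dot n (s + t) u = dot n s u + dot n t u" "dot n (r *\<^sub>R s) u = r * dot n s u"
  "dot n u (s + t) = dot n u s + dot n u t" "dot n u (r *\<^sub>R s) = r * dot n u s" "dot n s t = dot n t s"
  by (simp_all add: dot_def pointwise scaleR_fun_def algebra_simps sum.distrib sum_distrib_left)

lemma dot_action: "dot n (quaternion_action v s) t = - dot n s (quaternion_action v t)"
proof -
  have "dot n (left_i s) t = - dot n s (left_i t)" "dot n (left_j s) t = - dot n s (left_j t)"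
    unfolding dot_def sum_idx sum_negf[symmetric] by (simp_all add: left_idx algebra_simps)
  then show ?thesis by (simp add: quaternion_action_def dot_linear(1-4) algebra_simps)
qed

text \<open>Left multiplication by an imaginary quaternion is skew for the standard inner product. This
  is the compatibility of the form with vectors for \<open>\<epsilon> = -1\<close>, and it implies invariance because the
  spin representation is given by commutators of vectors.\<close>

lemma quaternionic_data:
  assumes n: "n > 0"
  shows "extended_translation_data (coord_space 2) plane_form (coord_space (4 * n)) quaternion_action
      (dot n)"
proof -
  let ?V = "coord_space 2" and ?W = "coord_space (4 * n)"
  have nz: "coord_space m \<noteq> {0}" if "m > 0" for m
  proof
    assume "coord_space m = {0}"
    then have "coord_space m = span {}" by simp
    then have "dim (coord_space m) = card ({} :: (nat \<Rightarrow> real) set)"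
      using dim_span_eq_card_independent[OF independent_empty] by metis
    then show False using coord_space_dim[of m] that by simp
  qed
  have V0: "v = 0" if "v \<in> ?V" "v 0 = 0" "v 1 = 0" for v
  proof
    fix k show "v k = 0 k"
      using that by (cases "k = 0 \<or> k = 1") (auto simp: coord_space_def pointwise numeral_2_eq_2)
  qed
  have quad: "quadratic_space ?V plane_form"
    unfolding quadratic_space_def
  proof (intro conjI ballI impI)
    show "subspace ?V" "finite_dimensional ?V" "?V \<noteq> {0}" using subspace_coord_space coord_space_dim nz
        by auto
    show "bilinear_on ?V ?V plane_form"
      by (auto simp: bilinear_on_def linear_on_def plane_form_def pointwise scaleR_fun_def algebra_simps)
    show "plane_form v u = plane_form u v" for v u by (simp add: plane_form_def mult.commute)
    show "v = 0" if v: "v \<in> ?V" "\<forall>u\<in>?V. plane_form v u = 0" for v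
    proof -
      have "v 0 * v 0 + v 1 * v 1 = 0" using v by (simp add: plane_form_def)
      then have "v 0 = 0" "v 1 = 0" using sum_squares_eq_zero_iff by auto
      then show ?thesis using V0 v by blast
    qed
  qed
  have act_in: "quaternion_action v s \<in> ?W" if "s \<in> ?W" for v s
    unfolding quaternion_action_def using left_in[OF that] subspace_coord_space
    by (intro subspace_add subspace_scale)
  have cliff: "clifford_module ?V plane_form ?W quaternion_action"
    unfolding clifford_module_def
  proof (intro conjI ballI)
    show "subspace ?W" by (rule subspace_coord_space)
    show "quaternion_action v s \<in> ?W" if "s \<in> ?W" for v s by (rule act_in[OF that])
    show "bilinear_on ?V ?W quaternion_action"
      by (simp add: bilinear_on_def linear_on_def quaternion_action_def left_linear plus_fun_apply[of _
          _ "_ :: nat"]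
          scaleR_fun_apply[of _ _ "_ :: nat"] scaleR_add_left scaleR_add_right add_ac mult.commute)
    show "quaternion_action v (quaternion_action u s) + quaternion_action u (quaternion_action v s) =
        (- 2 * plane_form v u) *\<^sub>R s" for v u s
      by (rule ext) (simp add: quaternion_action_def left_linear left_relations plane_form_def pointwise
          scaleR_fun_apply algebra_simps)
  qed
  have adm: "admissible_form ?V plane_form ?W quaternion_action (dot n)"
    unfolding admissible_form_def
  proof (intro conjI)
    show "bilinear_on ?W ?W (dot n)" by (simp add: bilinear_on_def linear_on_def dot_linear(1-4))
    show "\<forall>s\<in>?W. (\<forall>t\<in>?W. dot n s t = 0) \<longrightarrow> s = 0"
    proof (intro ballI impI)
      fix s assume s: "s \<in> ?W" "\<forall>t\<in>?W. dot n s t = 0"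
      then have "(\<Sum>k<4*n. s k * s k) = 0" by (simp add: dot_def)
      then have z: "s k = 0" if "k < 4 * n" for k using that by (simp add: sum_nonneg_eq_0_iff)
      show "s = 0"
      proof
        fix k show "s k = 0 k" using z[of k] s(1) by (cases "k < 4 * n")
            (auto simp: coord_space_def pointwise)
      qed
    qed
    show "\<forall>(A, T)\<in>spin_representation ?V plane_form quaternion_action. \<forall>s\<in>?W. \<forall>t\<in>?W. dot n (T s) t +
        dot n s (T t) = 0"
    proof -
      let ?I = "{p. \<forall>s\<in>?W. \<forall>t\<in>?W. dot n ((snd p :: (nat \<Rightarrow> real) \<Rightarrow> nat \<Rightarrow> real) s) t + dot n s (snd p t) =
          0} ::
        (((nat \<Rightarrow> real) \<Rightarrow> nat \<Rightarrow> real) \<times> ((nat \<Rightarrow> real) \<Rightarrow> nat \<Rightarrow> real)) set"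
      have "spin_representation ?V plane_form quaternion_action \<subseteq> ?I"
        unfolding spin_representation_def
      proof (rule span_minimal)
        show "subspace ?I"
          unfolding subspace_def
        proof (intro conjI ballI allI)
          have "dot n 0 t = 0" "dot n t 0 = 0" for t by (simp_all add: dot_def pointwise)
          then show "0 \<in> ?I" by (simp add: pointwise)
          fix p q r assume p: "p \<in> ?I"
          then show "r *\<^sub>R p \<in> ?I" for r
            by (simp add: scaleR_fun_def[of r "snd p"] dot_linear(1-4) flip: distrib_left)
          assume q: "q \<in> ?I"
          have "dot n ((snd p + snd q) s) t + dot n s ((snd p + snd q) t) =
              (dot n (snd p s) t + dot n s (snd p t)) + (dot n (snd q s) t + dot n s (snd q t))" for s t
            by (simp add: plus_fun_apply[of "snd p" "snd q"] dot_linear(1-4))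
          then show "p + q \<in> ?I" using p q by simp
        qed
        have d: "dot n (s - t) u = dot n s u - dot n t u" "dot n u (s - t) = dot n u s - dot n u t"
            for s t u
          by (simp_all add: dot_def pointwise algebra_simps sum_subtractf)
        show "{(\<lambda>w. plane_form v w *\<^sub>R u - plane_form u w *\<^sub>R v,
           \<lambda>s. (1 / 4) *\<^sub>R (quaternion_action v (quaternion_action u s) - quaternion_action u
               (quaternion_action v s))) |v u.
           v \<in> ?V \<and> u \<in> ?V} \<subseteq> ?I"
          by (auto simp: dot_linear(1-4) d dot_action diff_divide_distrib)
      qed
      then show ?thesis by (auto simp: subset_iff)
    qed
    show "\<exists>\<epsilon>::real. ((\<forall>s\<in>?W. \<forall>t\<in>?W. dot n s t = dot n t s) \<and> \<epsilon> = -1 \<or> (\<forall>s\<in>?W. \<forall>t\<in>?W. dot n s t =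
        - dot n t s) \<and> \<epsilon> = 1) \<and>
       (\<forall>v\<in>?V. \<forall>s\<in>?W. \<forall>t\<in>?W. dot n (quaternion_action v s) t = \<epsilon> * dot n s (quaternion_action v t))"
      using dot_linear(5)[of n] by (intro exI[of _ "-1"]) (simp add: dot_action)
  qed
  show ?thesis
    unfolding extended_translation_data_def using quad cliff adm coord_space_dim nz n by simp
qed

lemma exists_components:
  assumes n: "n > 0"
  shows "\<exists>(V :: (nat \<Rightarrow> real) set) b (W :: (nat \<Rightarrow> real) set) c \<beta>.
      extended_translation_data V b W c \<beta> \<and> dim V = 2 \<and> has_signature V b 2 0 \<and>
      num_irreducible_components V W c = n"
proof -
  let ?V = "coord_space 2" and ?W = "coord_space (4 * n)"
  note data = quaternionic_data[OF n]
  have quad: "quadratic_space ?V plane_form" using data by (simp add: extended_translation_data_def)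
  have "\<not> has_signature ?V plane_form p q" if "q > 0" for p q
  proof
    assume "has_signature ?V plane_form p q"
    then obtain B where "card {e \<in> B. plane_form e e < 0} = q" unfolding has_signature_def by blast
    moreover have "\<not> plane_form e e < 0" for e
      using sum_squares_ge_zero[of "e 0" "e 1"] by (simp add: plane_form_def not_less)
    then have "{e \<in> B. plane_form e e < 0} = {}" by blast
    ultimately show False using that by simp
  qed
  then have sig: "has_signature ?V plane_form 2 0"
    using quadratic_space_signature[OF quad] coord_space_dim[of 2] by auto
  obtain e1 e2 where e: "e1 \<in> ?V" "e2 \<in> ?V" "\<forall>v\<in>?V. \<exists>x y. v = x *\<^sub>R e1 + y *\<^sub>R e2"
    "plane_form e1 e2 = 0" "plane_form e1 e1 = 1" "plane_form e2 e2 = 1"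
    using has_signature_basis[OF quad sig] by auto
  interpret clifford_plane ?V plane_form ?W quaternion_action "dot n" e1 e2 1 1
    by unfold_locales (use data e in auto)
  have "4 * n = 4 * num_irreducible_components ?V ?W quaternion_action"
    using num_components_quaternionic coord_space_dim[of "4 * n"] by simp
  then show ?thesis using data sig coord_space_dim[of 2] by fastforce
qed

section \<open>Extended translation algebras of the plane\<close>

lemma (in clifford_plane) classification_definite:
  assumes \<kappa>: "\<kappa>1 = \<kappa>2" and max: "maximal_transitive_prolongation m (g :: 'g::real_vector graded_lie)"
  obtains l where "l > 0" "dim W = 4 * l" "m \<cong>\<^sub>g\<^sub>r (heisenberg_algebra l :: complex vfield graded_lie)"
    "g \<cong>\<^sub>g\<^sub>r (contact_algebra l :: complex vfield graded_lie)"
proof -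
  obtain l where l: "dim W = 2 * l * DIM(complex)"
    "heisenberg_model W (\<lambda>s t. Complex (A s t) (\<kappa>1 * B s t)) \<cong>\<^sub>g\<^sub>r (heisenberg_algebra l :: complex
        vfield graded_lie)"
    using heisenberg_model_isomorphic[OF symplectic_definite[OF \<kappa>]] by blast
  have m: "m \<cong>\<^sub>g\<^sub>r (heisenberg_algebra l :: complex vfield graded_lie)"
    by (rule graded_lie_isomorphic_trans[OF m_definite l(2)])
  have l0: "l \<ge> 1" using l(1) dim_W_pos by (cases l) auto
  have "g \<cong>\<^sub>g\<^sub>r (contact_algebra l :: complex vfield graded_lie)"
    by (rule full_prolongation_unique[OF complex_contact_full_prolongation[OF l0] _ max])
      (use m_isomorphic_sym[OF m] in \<open>simp add: heisenberg_algebra_def\<close>)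
  then show ?thesis using that[of l] l(1) l0 m by simp
qed

lemma (in clifford_plane) classification_lorentzian:
  assumes \<kappa>: "\<kappa>1 = 1" "\<kappa>2 = -1" and max: "maximal_transitive_prolongation m (g :: 'g::real_vector
      graded_lie)"
  obtains l where "l > 0" "dim W = 4 * l"
    "m \<cong>\<^sub>g\<^sub>r (heisenberg_algebra l :: real vfield graded_lie) \<oplus>\<^sub>g\<^sub>r (heisenberg_algebra l :: real vfield
        graded_lie)"
    "g \<cong>\<^sub>g\<^sub>r (contact_algebra l :: real vfield graded_lie) \<oplus>\<^sub>g\<^sub>r (contact_algebra l :: real vfield
        graded_lie)"
proof -
  let ?c = "\<lambda>l. contact_algebra l :: real vfield graded_lie"
  obtain l where l: "dim (eigenspace 1) = 2 * l * DIM(real)"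
    "heisenberg_model (eigenspace 1) A \<cong>\<^sub>g\<^sub>r (heisenberg_algebra l :: real vfield graded_lie)"
    using heisenberg_model_isomorphic[OF symplectic_eigenspace[OF \<kappa>, of 1]] by blast
  obtain l' where l': "dim (eigenspace (-1)) = 2 * l' * DIM(real)"
    "heisenberg_model (eigenspace (-1)) A \<cong>\<^sub>g\<^sub>r (heisenberg_algebra l' :: real vfield graded_lie)"
    using heisenberg_model_isomorphic[OF symplectic_eigenspace[OF \<kappa>, of "-1"]] by blast
  have "l' = l" using l(1) l'(1) dim_eigenspace(1)[OF \<kappa>] by simp
  then have m: "m \<cong>\<^sub>g\<^sub>r (heisenberg_algebra l :: real vfield graded_lie) \<oplus>\<^sub>g\<^sub>r (heisenberg_algebra l ::
      real vfield graded_lie)"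
    using graded_lie_isomorphic_trans[OF m_lorentzian[OF \<kappa>] lie_direct_sum_isomorphic[OF l(2) l'(2)]]
        by simp
  have dW: "dim W = 4 * l" using dim_eigenspace[OF \<kappa>] l(1) by simp
  have l0: "l \<ge> 1" using dW dim_W_pos by (cases l) auto
  have full: "full_prolongation (?c l \<oplus>\<^sub>g\<^sub>r ?c l)"
    using real_contact_full_prolongation[OF l0] contact_generated[OF l0]
        by (intro full_prolongation_direct_sum)
  have neg: "negative_part (?c l \<oplus>\<^sub>g\<^sub>r ?c l) = negative_part (?c l) \<oplus>\<^sub>g\<^sub>r negative_part (?c l)"
    by (rule negative_part_direct_sum[OF graded_lie_algebra_contact graded_lie_algebra_contact])
  have "negative_part (?c l \<oplus>\<^sub>g\<^sub>r ?c l) \<cong>\<^sub>g\<^sub>r m"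
    unfolding neg using m_isomorphic_sym[OF m] by (simp only: heisenberg_algebra_def)
  then have "g \<cong>\<^sub>g\<^sub>r ?c l \<oplus>\<^sub>g\<^sub>r ?c l" by (rule full_prolongation_unique[OF full _ max])
  then show ?thesis using that[of l] dW l0 m by simp
qed

theorem proposition4p4:
  shows "(\<forall>(V :: 'v::real_vector set) b (W :: 'w::real_vector set) c \<beta> m (g :: 'g::real_vector graded_lie) N.
      extended_translation_data V b W c \<beta> \<and> dim V = 2 \<and>
      m = extended_translation_algebra V b W c \<beta> \<and>
      N = num_irreducible_components V W c \<and>
      maximal_transitive_prolongation m g \<longrightarrow>
        (has_signature V b 2 0 \<or> has_signature V b 0 2 \<or> has_signature V b 1 1) \<and>
        (has_signature V b 2 0 \<longrightarrow>
           N > 0 \<and>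
           m \<cong>\<^sub>g\<^sub>r (heisenberg_algebra N :: complex vfield graded_lie) \<and>
           g \<cong>\<^sub>g\<^sub>r (contact_algebra N :: complex vfield graded_lie)) \<and>
        (has_signature V b 0 2 \<longrightarrow>
           N > 0 \<and> even N \<and>
           m \<cong>\<^sub>g\<^sub>r (heisenberg_algebra (N div 2) :: complex vfield graded_lie) \<and>
           g \<cong>\<^sub>g\<^sub>r (contact_algebra (N div 2) :: complex vfield graded_lie)) \<and>
        (has_signature V b 1 1 \<longrightarrow>
           N > 0 \<and> even N \<and>
           m \<cong>\<^sub>g\<^sub>r (heisenberg_algebra (N div 2) :: real vfield graded_lie)
                \<oplus>\<^sub>g\<^sub>r (heisenberg_algebra (N div 2) :: real vfield graded_lie) \<and>
           g \<cong>\<^sub>g\<^sub>r (contact_algebra (N div 2) :: real vfield graded_lie)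
                \<oplus>\<^sub>g\<^sub>r (contact_algebra (N div 2) :: real vfield graded_lie)))
    \<and> (\<forall>n>0. \<exists>(V :: (nat \<Rightarrow> real) set) b (W :: (nat \<Rightarrow> real) set) c \<beta>.
      extended_translation_data V b W c \<beta> \<and> dim V = 2 \<and> has_signature V b 2 0 \<and>
      num_irreducible_components V W c = n)"
proof (intro conjI allI impI)
  fix n :: nat assume "n > 0"
  then show "\<exists>(V :: (nat \<Rightarrow> real) set) b (W :: (nat \<Rightarrow> real) set) c \<beta>.
      extended_translation_data V b W c \<beta> \<and> dim V = 2 \<and> has_signature V b 2 0 \<and>
      num_irreducible_components V W c = n" by (rule exists_components)
next
  fix V :: "'v set" and b and W :: "'w set" and c \<beta> m and g :: "'g graded_lie" and N
  assume "extended_translation_data V b W c \<beta> \<and> dim V = 2 \<and>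
      m = extended_translation_algebra V b W c \<beta> \<and>
      N = num_irreducible_components V W c \<and> maximal_transitive_prolongation m g"
  then have data: "extended_translation_data V b W c \<beta>" and dim: "dim V = 2"
    and m: "m = extended_translation_algebra V b W c \<beta>" and N: "N = num_irreducible_components V W c"
    and max: "maximal_transitive_prolongation (extended_translation_algebra V b W c \<beta>) g" by auto
  have quad: "quadratic_space V b" using data by (simp add: extended_translation_data_def)
  show "has_signature V b 2 0 \<or> has_signature V b 0 2 \<or> has_signature V b 1 1"
    by (rule quadratic_space_signature[OF quad dim])
  {
    assume sig: "has_signature V b 2 0"
    obtain e1 e2 where e: "e1 \<in> V" "e2 \<in> V" "\<forall>v\<in>V. \<exists>x y. v = x *\<^sub>R e1 + y *\<^sub>R e2"
      "b e1 e2 = 0" "b e1 e1 = 1" "b e2 e2 = 1"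
      using has_signature_basis[OF quad sig] by auto
    interpret clifford_plane V b W c \<beta> e1 e2 1 1
      by unfold_locales (use data e in auto)
    obtain l where l: "l > 0" "dim W = 4 * l" "m \<cong>\<^sub>g\<^sub>r (heisenberg_algebra l :: complex vfield graded_lie)"
      "g \<cong>\<^sub>g\<^sub>r (contact_algebra l :: complex vfield graded_lie)"
      using classification_definite[OF _ max] m by metis
    have "N = l" using num_components_quaternionic l(2) N by simp
    then show "N > 0" "m \<cong>\<^sub>g\<^sub>r (heisenberg_algebra N :: complex vfield graded_lie)"
      "g \<cong>\<^sub>g\<^sub>r (contact_algebra N :: complex vfield graded_lie)" using l by auto
  }
  {
    assume sig: "has_signature V b 0 2"
    obtain e1 e2 where e: "e1 \<in> V" "e2 \<in> V" "\<forall>v\<in>V. \<exists>x y. v = x *\<^sub>R e1 + y *\<^sub>R e2"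
      "b e1 e2 = 0" "b e1 e1 = -1" "b e2 e2 = -1"
      using has_signature_basis[OF quad sig] by auto
    interpret clifford_plane V b W c \<beta> e1 e2 "-1" "-1"
      by unfold_locales (use data e in auto)
    obtain l where l: "l > 0" "dim W = 4 * l" "m \<cong>\<^sub>g\<^sub>r (heisenberg_algebra l :: complex vfield graded_lie)"
      "g \<cong>\<^sub>g\<^sub>r (contact_algebra l :: complex vfield graded_lie)"
      using classification_definite[OF _ max] m by metis
    \<comment> \<open>here \<open>e1\<close> acts with square \<open>1\<close>\<close>
    have "dim W = 2 * N" unfolding N by (rule num_components_split[of E1 E2]) (auto simp: E11)
    then have "N = 2 * l" using l(2) by simp
    then show "N > 0" "even N" "m \<cong>\<^sub>g\<^sub>r (heisenberg_algebra (N div 2) :: complex vfield graded_lie)"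
      "g \<cong>\<^sub>g\<^sub>r (contact_algebra (N div 2) :: complex vfield graded_lie)" using l by auto
  }
  {
    assume sig: "has_signature V b 1 1"
    obtain e1 e2 where e: "e1 \<in> V" "e2 \<in> V" "\<forall>v\<in>V. \<exists>x y. v = x *\<^sub>R e1 + y *\<^sub>R e2"
      "b e1 e2 = 0" "b e1 e1 = 1" "b e2 e2 = -1"
      using has_signature_basis[OF quad sig] by auto
    interpret clifford_plane V b W c \<beta> e1 e2 1 "-1"
      by unfold_locales (use data e in auto)
    obtain l where l: "l > 0" "dim W = 4 * l"
      "m \<cong>\<^sub>g\<^sub>r (heisenberg_algebra l :: real vfield graded_lie) \<oplus>\<^sub>g\<^sub>r (heisenberg_algebra l :: real
          vfield graded_lie)"
      "g \<cong>\<^sub>g\<^sub>r (contact_algebra l :: real vfield graded_lie) \<oplus>\<^sub>g\<^sub>r (contact_algebra l :: real vfield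
          graded_lie)"
      using classification_lorentzian[OF _ _ max] m by metis
    \<comment> \<open>here \<open>e2\<close> acts with square \<open>1\<close>\<close>
    have "dim W = 2 * N" unfolding N by (rule num_components_split[of E2 E1]) (auto simp: E22)
    then have "N = 2 * l" using l(2) by simp
    then show "N > 0" "even N"
      "m \<cong>\<^sub>g\<^sub>r (heisenberg_algebra (N div 2) :: real vfield graded_lie) \<oplus>\<^sub>g\<^sub>r (heisenberg_algebra
          (N div 2) :: real vfield graded_lie)"
      "g \<cong>\<^sub>g\<^sub>r (contact_algebra (N div 2) :: real vfield graded_lie) \<oplus>\<^sub>g\<^sub>r (contact_algebra (N div 2) ::
          real vfield graded_lie)"
      using l by auto
  }
qed

end
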